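(* Let $\nu$ be Lebesgue measure on $[a,b]$ with $0\le a<b<\infty$ and let $\pi_\theta$ be the Poisson distribution with mean $\theta$, $\pi_\theta(k)=e^{-\theta}\theta^k/k!$. Let $\alpha\ge1$ and $C>1/\sqrt{b-a}$. Then the minimax MISE rate over $\widetilde{\mathcal{C}}(\alpha,C)\cap\mathbb{H}_1$ is $(\log n/\log\log n)^{-2\alpha}$. This rate is achieved by the projection estimator $\widehat f_{m_n,n}$ with $m_n:=[\tau\log n/\log\log n]$ for any positive $\tau\le1$. Moreover, if $\alpha>1$, then for any positive $C$ and any positive integer $r$, the projection estimator $\widehat f_{m_n,n}$ with $m_n:=[\log n/\log\log n]$ (that is, with $\tau=1$) is asymptotically minimax efficient (including the constant) over $\mathcal{C}(\mathbf{u}^\alpha,C,r)$: $$\limsup_{n\to\infty}\left(\frac{\log n}{\log\log n}\right)^{\alpha}\sup_{f\in\mathcal{C}(\mathbf{u}^\alpha,C,r)\cap\mathbb{H}_1}\mathbb{E}_f\|\widehat f_{m_n,n}-f\|_{\mathbb{H}}=\liminf_{n\to\infty}\left(\frac{\log n}{\log\log n}\right)^{\alpha}\inf_{\hat f\in\mathcal{S}_n}\sup_{f\in\mathcal{C}(\mathbf{u}^\alpha,C,r)\cap\mathbb{H}_1}\mathbb{E}_f\|\hat f-f\|_{\mathbb{H}}=C.$$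
   Context: $\mathcal{X}=\mathbb{Z}_+=\{0,1,\dots\}$. $\mathbb{H}=L^2[a,b]$ (real, Lebesgue measure) with scalar product $(\cdot,\cdot)_{\mathbb{H}}$; $\mathbb{H}_1$ is the set of nonnegative $f\in\mathbb{H}$ with $\int_a^bf=1$. For $f\in\mathbb{H}_1$, $\pi_f(k)=\int_a^b\pi_\theta(k)f(\theta)\,d\theta$, and $\mathbb{E}_f$ is expectation when $X_1,\dots,X_n$ are i.i.d. from $\pi_f$. $\mathcal{S}_n$ is the set of measurable functions from $\mathcal{X}^n$ to $\mathbb{H}$ (estimators). $[\cdot]$ is integer part. $\Pi\mathbf{1}_k$ is the function $\theta\mapsto\pi_\theta(k)$ on $[a,b]$; $V_0=\{0\}$, $V_m=\mathrm{Span}(\Pi\mathbf{1}_k,0\le k<m)$. Projection estimator: $\widehat f_{m,n}$ is the unique element of $V_m$ with $(\widehat f_{m,n},\Pi\mathbf{1}_k)_{\mathbb{H}}=P_n\mathbf{1}_k:=\frac1n\#\{i\le n:X_i=k\}$ for $0\le k<m$. For a positive decreasing sequence $u=(u_m)_{m\ge0}$, $\mathcal{C}(u,C,r)=\{f\in\mathbb{H}:\|f-\mathrm{Proj}_{V_m}f\|_{\mathbb{H}}\le Cu_m\ \forall m\ge r\}$, where $\mathrm{Proj}$ is orthogonal projection; $\mathbf{u}^\alpha=((1+m)^{-\alpha})_{m\ge0}$. $\widetilde{\mathcal{C}}(\alpha,C)=\{f\in\mathbb{H}:\|f\|_{\mathbb{H}}\le C,\ \omega^\phi_{[\alpha]+1}(f,t)_2\le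 Ct^\alpha\ \forall t>0\}$, where $\phi(x)=\sqrt{(x-a)(b-x)}$, $\omega_s^\phi(f,t)_2=\sup_{0<h\le t}\|\Delta^s_{h\phi(\cdot)}(f,\cdot)\|_{L^2[a,b]}$, and $\Delta_h^s(f,x)=\sum_{i=0}^s\binom si(-1)^if(x+(i-s/2)h)$, set to $0$ if $x+(i-s/2)h\notin[a,b]$ for $i=0$ or $i=s$. Rates: MISE means $\mathbb{E}_f\|\hat f-f\|_{\mathbb{H}}^2$. "The minimax MISE rate over $\mathcal{C}$ is $v_n$" means $0<\liminf_n v_n^{-1}\inf_{\hat f\in\mathcal{S}_n}\sup_{f\in\mathcal{C}}\mathbb{E}_f\|\hat f-f\|_{\mathbb{H}}^2$ and $\limsup_n v_n^{-1}\inf_{\hat f\in\mathcal{S}_n}\sup_{f\in\mathcal{C}}\mathbb{E}_f\|\hat f-f\|_{\mathbb{H}}^2<\infty$; it is achieved by $\hat f_n$ if $\limsup_nv_n^{-1}\sup_{f\in\mathcal{C}}\mathbb{E}_f\|\hat f_n-f\|^2_{\mathbb{H}}<\infty$. *)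

theory Defs
  imports "HOL-Probability.Probability"
begin

text \<open>
  Elements of \<open>L\<^sup>2[a,b]\<close> are represented by functions on the real line of which only the
  restriction to \<open>[a,b]\<close> matters. Every class contains a Borel representative, and all
  notions below are invariant under changes on a null set, so restricting to Borel
  functions loses no class.
\<close>

abbreviation interval_measure :: "real \<Rightarrow> real \<Rightarrow> real measure" where
  "interval_measure a b \<equiv> restrict_space lborel {a..b}"

text \<open>Extended-valued, so that it is infinite (and not a default value) when the integral diverges.\<close>

definition L2norm :: "real \<Rightarrow> real \<Rightarrow> (real \<Rightarrow> real) \<Rightarrow> ennreal" where
  "L2norm a b g =
     (let I = (\<integral>\<^sup>+ \<theta>. ennreal ((g \<theta>)\<^sup>2) \<partial>interval_measure a b)
      in if I = \<infinity> then \<infinity> else ennreal (sqrt (enn2real I)))"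

definition L2 :: "real \<Rightarrow> real \<Rightarrow> (real \<Rightarrow> real) set" where
  "L2 a b = {g \<in> borel_measurable (interval_measure a b). L2norm a b g < \<infinity>}"

definition L2inner :: "real \<Rightarrow> real \<Rightarrow> (real \<Rightarrow> real) \<Rightarrow> (real \<Rightarrow> real) \<Rightarrow> real" where
  "L2inner a b g h = (\<integral>\<theta>. g \<theta> * h \<theta> \<partial>interval_measure a b)"

definition L2_densities :: "real \<Rightarrow> real \<Rightarrow> (real \<Rightarrow> real) set" where
  "L2_densities a b =
     {f \<in> L2 a b. (AE \<theta> in interval_measure a b. 0 \<le> f \<theta>)
                \<and> (\<integral>\<theta>. f \<theta> \<partial>interval_measure a b) = 1}"

text \<open>
  The formula is used instead of \<^const>\<open>poisson_pmf\<close>, which is specified only for positive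
  means, because the mean 0 is allowed here.
\<close>

definition poisson_mass :: "nat \<Rightarrow> real \<Rightarrow> real" where
  "poisson_mass k \<theta> = exp (- \<theta>) * \<theta> ^ k / fact k"

lemma poisson_mass_eq_pmf: "0 < \<theta> \<Longrightarrow> poisson_mass k \<theta> = pmf (poisson_pmf \<theta>) k"
  by (simp add: poisson_mass_def)

definition mixture_mass :: "real \<Rightarrow> real \<Rightarrow> (real \<Rightarrow> real) \<Rightarrow> nat \<Rightarrow> real" where
  "mixture_mass a b f k = (\<integral>\<theta>. poisson_mass k \<theta> * f \<theta> \<partial>interval_measure a b)"

definition mixture :: "real \<Rightarrow> real \<Rightarrow> (real \<Rightarrow> real) \<Rightarrow> nat measure" where
  "mixture a b f = density (count_space UNIV) (\<lambda>k. ennreal (mixture_mass a b f k))"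

definition sample_law :: "real \<Rightarrow> real \<Rightarrow> (real \<Rightarrow> real) \<Rightarrow> nat \<Rightarrow> (nat \<Rightarrow> nat) measure" where
  "sample_law a b f n = (\<Pi>\<^sub>M i\<in>{..<n}. mixture a b f)"

text \<open>
  All sets of samples are measurable, so every map from samples into
  \<open>L\<^sup>2[a,b]\<close> is an estimator.
\<close>

lemma sets_sample_law: "sets (sample_law a b f n) = Pow ({..<n} \<rightarrow>\<^sub>E UNIV)"
proof -
  have "sets (sample_law a b f n) = sets (\<Pi>\<^sub>M i\<in>{..<n}. count_space (UNIV :: nat set))"
    unfolding sample_law_def by (intro sets_PiM_cong) (auto simp: mixture_def)
  also have "\<dots> = sets (count_space ({..<n} \<rightarrow>\<^sub>E (UNIV :: nat set)))"
    by (subst count_space_PiM_finite) auto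
  finally show ?thesis by simp
qed

definition estimators :: "real \<Rightarrow> real \<Rightarrow> nat \<Rightarrow> ((nat \<Rightarrow> nat) \<Rightarrow> real \<Rightarrow> real) set" where
  "estimators a b n = {g. \<forall>x \<in> {..<n} \<rightarrow>\<^sub>E UNIV. g x \<in> L2 a b}"

definition mean_error ::
  "real \<Rightarrow> real \<Rightarrow> nat \<Rightarrow> ((nat \<Rightarrow> nat) \<Rightarrow> real \<Rightarrow> real) \<Rightarrow> (real \<Rightarrow> real) \<Rightarrow> ennreal" where
  "mean_error a b n g f = (\<integral>\<^sup>+ x. L2norm a b (\<lambda>\<theta>. g x \<theta> - f \<theta>) \<partial>sample_law a b f n)"

definition MISE ::
  "real \<Rightarrow> real \<Rightarrow> nat \<Rightarrow> ((nat \<Rightarrow> nat) \<Rightarrow> real \<Rightarrow> real) \<Rightarrow> (real \<Rightarrow> real) \<Rightarrow> ennreal" where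
  "MISE a b n g f = (\<integral>\<^sup>+ x. (L2norm a b (\<lambda>\<theta>. g x \<theta> - f \<theta>))\<^sup>2 \<partial>sample_law a b f n)"

definition is_minimax_MISE_rate ::
  "real \<Rightarrow> real \<Rightarrow> (real \<Rightarrow> real) set \<Rightarrow> (nat \<Rightarrow> real) \<Rightarrow> bool" where
  "is_minimax_MISE_rate a b F v \<longleftrightarrow>
     0 < liminf (\<lambda>n. ennreal (inverse (v n)) *
                     (INF g\<in>estimators a b n. SUP f\<in>F. MISE a b n g f))
   \<and> limsup (\<lambda>n. ennreal (inverse (v n)) *
                 (INF g\<in>estimators a b n. SUP f\<in>F. MISE a b n g f)) < \<infinity>"

definition achieves_MISE_rate ::
  "real \<Rightarrow> real \<Rightarrow> (real \<Rightarrow> real) set \<Rightarrow> (nat \<Rightarrow> real)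
     \<Rightarrow> (nat \<Rightarrow> (nat \<Rightarrow> nat) \<Rightarrow> real \<Rightarrow> real) \<Rightarrow> bool" where
  "achieves_MISE_rate a b F v est \<longleftrightarrow>
     limsup (\<lambda>n. ennreal (inverse (v n)) * (SUP f\<in>F. MISE a b n (est n) f)) < \<infinity>"

definition poisson_span :: "nat \<Rightarrow> (real \<Rightarrow> real) set" where
  "poisson_span m = {(\<lambda>\<theta>. \<Sum>k<m. c k * poisson_mass k \<theta>) |c. True}"

definition empirical_mass :: "nat \<Rightarrow> (nat \<Rightarrow> nat) \<Rightarrow> nat \<Rightarrow> real" where
  "empirical_mass n x k = real (card {i \<in> {..<n}. x i = k}) / real n"

text \<open>
  For \<open>a < b\<close>, linear combinations of Poisson masses that agree almost everywhere on \<open>[a,b]\<close>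
  agree everywhere, so the two definite descriptions below determine functions and not
  merely classes.
\<close>

definition projection_estimator ::
  "real \<Rightarrow> real \<Rightarrow> nat \<Rightarrow> nat \<Rightarrow> (nat \<Rightarrow> nat) \<Rightarrow> real \<Rightarrow> real" where
  "projection_estimator a b m n x =
     (THE g. g \<in> poisson_span m \<and> (\<forall>k<m. L2inner a b g (poisson_mass k) = empirical_mass n x k))"

definition span_projection :: "real \<Rightarrow> real \<Rightarrow> nat \<Rightarrow> (real \<Rightarrow> real) \<Rightarrow> real \<Rightarrow> real" where
  "span_projection a b m f =
     (THE p. p \<in> poisson_span m \<and> (\<forall>g \<in> poisson_span m. L2inner a b (\<lambda>\<theta>. f \<theta> - p \<theta>) g = 0))"

definition approx_class ::
  "real \<Rightarrow> real \<Rightarrow> (nat \<Rightarrow> real) \<Rightarrow> real \<Rightarrow> nat \<Rightarrow> (real \<Rightarrow> real) set" where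
  "approx_class a b u C r =
     {f \<in> L2 a b. \<forall>m\<ge>r. L2norm a b (\<lambda>\<theta>. f \<theta> - span_projection a b m f \<theta>) \<le> ennreal (C * u m)}"

definition power_seq :: "real \<Rightarrow> nat \<Rightarrow> real" where
  "power_seq \<alpha> m = (1 + real m) powr (- \<alpha>)"

definition step_weight :: "real \<Rightarrow> real \<Rightarrow> real \<Rightarrow> real" where
  "step_weight a b x = sqrt ((x - a) * (b - x))"

definition sym_difference ::
  "real \<Rightarrow> real \<Rightarrow> nat \<Rightarrow> real \<Rightarrow> (real \<Rightarrow> real) \<Rightarrow> real \<Rightarrow> real" where
  "sym_difference a b s h f x =
     (if x - real s / 2 * h \<in> {a..b} \<and> x + real s / 2 * h \<in> {a..b}
      then \<Sum>i\<le>s. real (s choose i) * (-1) ^ i * f (x + (real i - real s / 2) * h)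
      else 0)"

definition modulus :: "real \<Rightarrow> real \<Rightarrow> nat \<Rightarrow> (real \<Rightarrow> real) \<Rightarrow> real \<Rightarrow> ennreal" where
  "modulus a b s f t =
     (SUP h\<in>{0<..t}. L2norm a b (\<lambda>x. sym_difference a b s (h * step_weight a b x) f x))"

definition smooth_class :: "real \<Rightarrow> real \<Rightarrow> real \<Rightarrow> real \<Rightarrow> (real \<Rightarrow> real) set" where
  "smooth_class a b \<alpha> C =
     {f \<in> L2 a b. L2norm a b f \<le> ennreal C
        \<and> (\<forall>t>0. modulus a b (nat \<lfloor>\<alpha>\<rfloor> + 1) f t \<le> ennreal (C * t powr \<alpha>))}"

definition log_ratio :: "nat \<Rightarrow> real" where
  "log_ratio n = ln (real n) / ln (ln (real n))"

definition cutoff :: "real \<Rightarrow> nat \<Rightarrow> nat" where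
  "cutoff \<tau> n = nat \<lfloor>\<tau> * log_ratio n\<rfloor>"

end

theory Submission
  imports Defs "HOL-Real_Asymp.Real_Asymp" "HOL-Computational_Algebra.Polynomial"
begin

text \<open>
  Lower bounds: two densities with the same first \<open>m\<close> mixture masses cannot be told apart as long as
  all observations are below \<open>m\<close>, which holds with probability close to one once \<open>m\<close> slightly
  exceeds \<open>log n / log log n\<close>. Perturbing the uniform density by a multiple of a function orthogonal
  to \<open>V\<^sub>m\<close> gives such pairs: for the approximation classes the perturbation is the normalised residual
  of a Poisson mass, for the smoothness classes a combination of bumps of width \<open>1 / m\<close>.

  Upper bounds: the elements of \<open>V\<^sub>m\<close> are \<open>exp (- \<theta>)\<close> times polynomials of degree below \<open>m\<close>, and
  coefficient bounds for polynomials make the variance at most \<open>K\<^sup>m m! / n\<close>, which is negligible for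
  \<open>m \<le> log n / log log n\<close>. The bias is controlled by Jackson's inequality for the modulus with step
  weight \<open>\<phi>\<close>: averaging \<open>g (x + i (- \<delta> x + c \<phi>(x)))\<close> over small \<open>\<delta>\<close> and \<open>c\<close>, the latter with an even
  kernel, maps polynomials to polynomials of the same degree, controls \<open>\<phi> g'\<close>, and is
  close to the identity on functions with a small modulus; the Legendre operator turns the control
  of \<open>\<phi> g'\<close> into an approximation rate. Multiplying by \<open>exp (- \<theta>)\<close> times a Taylor polynomial of
  \<open>exp \<theta>\<close> moves the approximating polynomials into \<open>V\<^sub>m\<close>.
\<close>

section \<open>The space of square integrable functions\<close>

text \<open>Everything hinges on the equation \<open>m! = n\<close>, solved asymptotically by
  \<open>m = log n / log log n\<close>. Recovering a density from its first \<open>m\<close> masses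
  costs a factor \<open>K^m m!\<close>, while a sample of size \<open>n\<close> shows a value beyond
  \<open>m\<close> with probability at most \<open>n b^m / m!\<close>. The variance is therefore
  still negligible at \<open>\<tau> = 1\<close>, and a factor \<open>1 + \<epsilon>\<close> more
  already hides the perturbation. The two indices differ only by this factor, with
  \<open>\<epsilon>\<close> arbitrary, and the bias is a power of \<open>m\<close>; so even the
  constant can be matched. The obstacle in Jackson's inequality is that steps along \<phi> leave the
  interval near its ends and do not average there, because \<phi> is too small. The inward shift by
  \<delta> cures both defects. The rate then follows by absorption: a polynomial of uncontrolled
  degree near the function has a distance to degree below \<open>m\<close> that is at most its
  smoothing error plus half of that distance, so neither its degree nor a derivative of the function
  enters.\<close>

lemma finite_interval_measure: "finite_measure (interval_measure a b)"
proof (rule finite_measureI)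
  have "emeasure (interval_measure a b) (space (interval_measure a b)) = emeasure lborel {a..b}"
    by (simp add: emeasure_restrict_space space_restrict_space)
  also have "\<dots> \<noteq> \<infinity>" by (cases "a \<le> b") auto
  finally show "emeasure (interval_measure a b) (space (interval_measure a b)) \<noteq> \<infinity>" .
qed

lemma L2_iff:
  "g \<in> L2 a b \<longleftrightarrow>
     g \<in> borel_measurable (interval_measure a b) \<and> integrable (interval_measure a b) (\<lambda>x. (g x)\<^sup>2)"
proof -
  have "L2norm a b g < \<infinity> \<longleftrightarrow> (\<integral>\<^sup>+ x. ennreal ((g x)\<^sup>2) \<partial>interval_measure a b) < \<infinity>"
    by (simp add: L2norm_def Let_def less_top)
  then show ?thesis
    by (auto simp: L2_def integrable_iff_bounded)
qed

text \<open>A real companion of \<open>L2norm\<close>, so that Hilbert space algebra need not be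
  done in extended reals. The two agree on \<open>L2\<close>; outside it the default value of a
  divergent integral makes \<open>l2n\<close> meaningless.\<close>

definition l2n :: "real \<Rightarrow> real \<Rightarrow> (real \<Rightarrow> real) \<Rightarrow> real" where
  "l2n a b f = sqrt (L2inner a b f f)"

lemma l2n_nonneg [simp]: "0 \<le> l2n a b f"
  unfolding l2n_def L2inner_def by (simp add: integral_nonneg)

lemma L2inner_self: "L2inner a b f f = (l2n a b f)\<^sup>2"
  unfolding l2n_def L2inner_def by (simp add: integral_nonneg)

lemma nn_integral_L2:
  assumes "f \<in> L2 a b"
  shows "(\<integral>\<^sup>+ x. ennreal ((f x)\<^sup>2) \<partial>interval_measure a b) = ennreal ((l2n a b f)\<^sup>2)"
  using assms unfolding L2inner_self[symmetric] L2inner_def L2_iff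
  by (simp add: nn_integral_eq_integral power2_eq_square[symmetric])

lemma L2norm_eq: "f \<in> L2 a b \<Longrightarrow> L2norm a b f = ennreal (l2n a b f)"
  by (simp add: L2norm_def Let_def nn_integral_L2)

lemma L2norm_sq: "f \<in> L2 a b \<Longrightarrow> (L2norm a b f)\<^sup>2 = ennreal ((l2n a b f)\<^sup>2)"
  by (simp add: L2norm_eq ennreal_power)

lemma L2_measurable: "f \<in> L2 a b \<Longrightarrow> f \<in> borel_measurable (interval_measure a b)"
  by (simp add: L2_iff)

lemma L2_integrable_mult:
  assumes "f \<in> L2 a b" "g \<in> L2 a b"
  shows "integrable (interval_measure a b) (\<lambda>x. f x * g x)"
proof (rule Bochner_Integration.integrable_bound)
  show "integrable (interval_measure a b) (\<lambda>x. (f x)\<^sup>2 + (g x)\<^sup>2)"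
    using assms by (simp add: L2_iff)
  show "(\<lambda>x. f x * g x) \<in> borel_measurable (interval_measure a b)"
    using assms by (intro borel_measurable_times L2_measurable)
  have "\<bar>u * v\<bar> \<le> u\<^sup>2 + v\<^sup>2" for u v :: real
  proof -
    have "2 * (\<bar>u\<bar> * \<bar>v\<bar>) \<le> \<bar>u\<bar>\<^sup>2 + \<bar>v\<bar>\<^sup>2"
      using sum_squares_bound[of "\<bar>u\<bar>" "\<bar>v\<bar>"] by simp
    moreover have "0 \<le> \<bar>u\<bar> * \<bar>v\<bar>" by simp
    ultimately show ?thesis unfolding abs_mult power2_abs by linarith
  qed
  then show "AE x in interval_measure a b. norm (f x * g x) \<le> norm ((f x)\<^sup>2 + (g x)\<^sup>2)"
    by simp
qed

lemma L2_cmult: "f \<in> L2 a b \<Longrightarrow> (\<lambda>x. c * f x) \<in> L2 a b"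
  by (auto simp: L2_iff power_mult_distrib)

lemma L2_add:
  assumes "f \<in> L2 a b" "g \<in> L2 a b"
  shows "(\<lambda>x. f x + g x) \<in> L2 a b"
  using assms L2_integrable_mult[OF assms] by (auto simp: L2_iff power2_sum mult.assoc)

lemma L2_diff:
  assumes "f \<in> L2 a b" "g \<in> L2 a b"
  shows "(\<lambda>x. f x - g x) \<in> L2 a b"
  using L2_add[OF assms(1) L2_cmult[OF assms(2), of "-1"]] by simp

lemma L2_zero [simp]: "(\<lambda>x. 0) \<in> L2 a b"
  by (simp add: L2_iff)

lemma L2_bounded:
  assumes "f \<in> borel_measurable (interval_measure a b)" "\<And>x. x \<in> {a..b} \<Longrightarrow> \<bar>f x\<bar> \<le> B"
  shows "f \<in> L2 a b"
proof -
  interpret finite_measure "interval_measure a b" by (rule finite_interval_measure)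
  have "AE x in interval_measure a b. norm ((f x)\<^sup>2) \<le> B\<^sup>2"
  proof (rule AE_I2)
    fix x assume "x \<in> space (interval_measure a b)"
    then have "\<bar>f x\<bar> \<le> B" using assms(2) by (simp add: space_restrict_space)
    then show "norm ((f x)\<^sup>2) \<le> B\<^sup>2" by (simp add: abs_le_square_iff[symmetric])
  qed
  then show ?thesis
    unfolding L2_iff using assms(1) by (auto intro!: integrable_const_bound[where B="B\<^sup>2"])
qed

lemma L2_continuous:
  assumes "continuous_on {a..b} f"
  shows "f \<in> L2 a b"
proof -
  have "f \<in> borel_measurable (interval_measure a b)"
    using borel_measurable_continuous_on_restrict[OF assms]
    by (simp add: measurable_cong_sets[OF sets_restrict_space_cong[OF sets_lborel] refl])
  moreover obtain B where "\<And>x. x \<in> {a..b} \<Longrightarrow> \<bar>f x\<bar> \<le> B"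
    using compact_continuous_image[OF assms compact_Icc, THEN compact_imp_bounded]
    unfolding bounded_iff by fastforce
  ultimately show ?thesis by (rule L2_bounded)
qed

section \<open>Algebra of the inner product and its norm\<close>

lemma L2inner_commute: "L2inner a b f g = L2inner a b g f"
  by (simp add: L2inner_def mult.commute)

lemma L2inner_add_left:
  "f \<in> L2 a b \<Longrightarrow> g \<in> L2 a b \<Longrightarrow> h \<in> L2 a b \<Longrightarrow>
   L2inner a b (\<lambda>x. f x + g x) h = L2inner a b f h + L2inner a b g h"
  by (simp add: L2inner_def distrib_right L2_integrable_mult)

lemma L2inner_diff_left:
  "f \<in> L2 a b \<Longrightarrow> g \<in> L2 a b \<Longrightarrow> h \<in> L2 a b \<Longrightarrow>
   L2inner a b (\<lambda>x. f x - g x) h = L2inner a b f h - L2inner a b g h"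
  by (simp add: L2inner_def left_diff_distrib L2_integrable_mult)

lemma L2inner_cmult_left: "L2inner a b (\<lambda>x. c * f x) h = c * L2inner a b f h"
  by (simp add: L2inner_def mult.assoc)

lemma L2inner_cmult_right: "L2inner a b h (\<lambda>x. c * f x) = c * L2inner a b h f"
  by (metis L2inner_cmult_left L2inner_commute)

lemma L2inner_add_right:
  "f \<in> L2 a b \<Longrightarrow> g \<in> L2 a b \<Longrightarrow> h \<in> L2 a b \<Longrightarrow>
   L2inner a b h (\<lambda>x. f x + g x) = L2inner a b h f + L2inner a b h g"
  by (simp add: L2inner_def distrib_left L2_integrable_mult)

lemma L2inner_diff_right:
  "f \<in> L2 a b \<Longrightarrow> g \<in> L2 a b \<Longrightarrow> h \<in> L2 a b \<Longrightarrow>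
   L2inner a b h (\<lambda>x. f x - g x) = L2inner a b h f - L2inner a b h g"
  by (simp add: L2inner_def right_diff_distrib L2_integrable_mult)

lemma L2inner_sum_left:
  assumes "\<And>i. i \<in> I \<Longrightarrow> f i \<in> L2 a b" "h \<in> L2 a b"
  shows "L2inner a b (\<lambda>x. \<Sum>i\<in>I. f i x) h = (\<Sum>i\<in>I. L2inner a b (f i) h)"
  using assms by (simp add: L2inner_def sum_distrib_right L2_integrable_mult)

lemma L2inner_sum_right:
  assumes "\<And>i. i \<in> I \<Longrightarrow> f i \<in> L2 a b" "h \<in> L2 a b"
  shows "L2inner a b h (\<lambda>x. \<Sum>i\<in>I. f i x) = (\<Sum>i\<in>I. L2inner a b h (f i))"
  using L2inner_sum_left[OF assms] by (simp add: L2inner_commute)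

lemma l2n_add_sq:
  assumes "f \<in> L2 a b" "g \<in> L2 a b"
  shows "(l2n a b (\<lambda>x. f x + g x))\<^sup>2 = (l2n a b f)\<^sup>2 + 2 * L2inner a b f g + (l2n a b g)\<^sup>2"
proof -
  have "L2inner a b (\<lambda>x. f x + g x) (\<lambda>x. f x + g x)
      = L2inner a b f f + L2inner a b g f + (L2inner a b f g + L2inner a b g g)"
    using assms by (simp add: L2inner_add_left L2_add L2inner_add_right)
  then show ?thesis by (simp add: L2inner_self L2inner_commute[of a b g f])
qed

lemma l2n_cmult: "l2n a b (\<lambda>x. c * f x) = \<bar>c\<bar> * l2n a b f"
  unfolding l2n_def by (simp add: L2inner_cmult_left L2inner_cmult_right real_sqrt_mult)

text \<open>The quadratic form \<open>quad\<close> is nonnegative; at the coefficients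
  \<open>(v, - u)\<close> it is \<open>2 u v\<close> times the gap in the inequality. If
  \<open>u\<close> or \<open>v\<close> vanishes there is nothing to divide by, and a coefficient
  that turns the mixed term into \<open>- 2 (v^2 + 1)\<close> or \<open>- 2 (u^2 + 1)\<close> would
  make the form negative. The absolute value comes from replacing \<open>f\<close> by its
  negative.\<close>

lemma L2_cauchy_schwarz:
  assumes "f \<in> L2 a b" "g \<in> L2 a b"
  shows "\<bar>L2inner a b f g\<bar> \<le> l2n a b f * l2n a b g"
proof -
  have main: "L2inner a b f g \<le> l2n a b f * l2n a b g" if fg: "f \<in> L2 a b" "g \<in> L2 a b" for f g
  proof -
    define u where "u = l2n a b f"
    define v where "v = l2n a b g"
    have quad: "0 \<le> r\<^sup>2 * u\<^sup>2 + 2 * r * s * L2inner a b f g + s\<^sup>2 * v\<^sup>2" for r s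
    proof -
      have "(l2n a b (\<lambda>x. r * f x + s * g x))\<^sup>2
          = r\<^sup>2 * u\<^sup>2 + 2 * r * s * L2inner a b f g + s\<^sup>2 * v\<^sup>2"
        using l2n_add_sq[OF L2_cmult[OF fg(1)] L2_cmult[OF fg(2)], of r s]
        by (simp add: l2n_cmult L2inner_cmult_left L2inner_cmult_right power_mult_distrib u_def v_def)
      then show ?thesis by (metis zero_le_power2)
    qed
    have uv: "0 \<le> u" "0 \<le> v" by (simp_all add: u_def v_def)
    show ?thesis
    proof (cases "u = 0 \<or> v = 0")
      case False
      then have "u * v > 0" using uv by (auto intro: mult_pos_pos order_le_neq_trans)
      have "0 \<le> (u * v) * (2 * (u * v - L2inner a b f g))"
        using quad[of v "-u"] by (simp add: power2_eq_square algebra_simps)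
      then have "0 \<le> 2 * (u * v - L2inner a b f g)"
        using \<open>u * v > 0\<close> by (simp add: zero_le_mult_iff[of "u * v"])
      then show ?thesis by (simp add: u_def v_def)
    next
      case True
      have "L2inner a b f g \<le> 0"
      proof (rule ccontr)
        assume "\<not> L2inner a b f g \<le> 0"
        then have p: "L2inner a b f g > 0" by simp
        show False
        proof (cases "u = 0")
          case True
          have "0 \<le> 2 * (-(v\<^sup>2 + 1) / L2inner a b f g) * L2inner a b f g + v\<^sup>2"
            using quad[of "-(v\<^sup>2 + 1) / L2inner a b f g" 1] True by simp
          then have "0 \<le> - v\<^sup>2 - 2" using p by simp
          then show False by (smt (verit) zero_le_power2)
        next
          case False
          then have "v = 0" using \<open>u = 0 \<or> v = 0\<close> by simp
          then have "0 \<le> 2 * (-(u\<^sup>2 + 1) / L2inner a b f g) * L2inner a b f g + u\<^sup>2"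
            using quad[of 1 "-(u\<^sup>2 + 1) / L2inner a b f g"] by simp
          then have "0 \<le> - u\<^sup>2 - 2" using p by simp
          then show False by (smt (verit) zero_le_power2)
        qed
      qed
      then show ?thesis using True by (auto simp: u_def v_def intro: order_trans)
    qed
  qed
  have "L2inner a b (\<lambda>x. - 1 * f x) g \<le> l2n a b (\<lambda>x. -1 * f x) * l2n a b g"
    by (rule main[OF L2_cmult[OF assms(1)] assms(2)])
  then have "- L2inner a b f g \<le> l2n a b f * l2n a b g"
    unfolding L2inner_cmult_left l2n_cmult by simp
  with main[OF assms] show ?thesis by linarith
qed

lemma l2n_triangle:
  assumes "f \<in> L2 a b" "g \<in> L2 a b"
  shows "l2n a b (\<lambda>x. f x + g x) \<le> l2n a b f + l2n a b g"
proof (rule power2_le_imp_le)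
  show "(l2n a b (\<lambda>x. f x + g x))\<^sup>2 \<le> (l2n a b f + l2n a b g)\<^sup>2"
    using L2_cauchy_schwarz[OF assms] by (simp add: l2n_add_sq[OF assms] power2_sum)
qed simp

lemma l2n_minus_commute: "l2n a b (\<lambda>x. f x - g x) = l2n a b (\<lambda>x. g x - f x)"
  using l2n_cmult[of a b "-1" "\<lambda>x. g x - f x"] by simp

lemma l2n_triangle_diff:
  assumes "f \<in> L2 a b" "g \<in> L2 a b" "h \<in> L2 a b"
  shows "l2n a b (\<lambda>x. f x - h x) \<le> l2n a b (\<lambda>x. f x - g x) + l2n a b (\<lambda>x. g x - h x)"
  using l2n_triangle[OF L2_diff[OF assms(1,2)] L2_diff[OF assms(2,3)]] by simp

lemma l2n_pythagoras:
  assumes "f \<in> L2 a b" "g \<in> L2 a b" "L2inner a b f g = 0"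
  shows "(l2n a b (\<lambda>x. f x + g x))\<^sup>2 = (l2n a b f)\<^sup>2 + (l2n a b g)\<^sup>2"
  using l2n_add_sq[OF assms(1,2)] assms(3) by simp

lemma l2n_mono:
  assumes "f \<in> L2 a b" "g \<in> L2 a b" "\<And>x. x \<in> {a..b} \<Longrightarrow> \<bar>f x\<bar> \<le> \<bar>g x\<bar>"
  shows "l2n a b f \<le> l2n a b g"
proof -
  have "L2inner a b f f \<le> L2inner a b g g"
    unfolding L2inner_def
    using assms L2_integrable_mult[OF assms(1,1)] L2_integrable_mult[OF assms(2,2)]
    by (intro integral_mono)
       (auto simp: space_restrict_space power2_eq_square[symmetric] abs_le_square_iff)
  then show ?thesis by (simp add: l2n_def)
qed

text \<open>Bridge from the Bochner integral of the definitions to the gauge integral, in which the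
  fundamental theorem and affine substitutions are applied.\<close>

lemma L2inner_eq_integral:
  assumes "continuous_on {a..b} f" "continuous_on {a..b} g"
  shows "L2inner a b f g = integral {a..b} (\<lambda>x. f x * g x)"
proof -
  have c: "continuous_on {a..b} (\<lambda>x. f x * g x)" by (intro continuous_intros assms)
  have "L2inner a b f g = (LINT x:{a..b}|lborel. f x * g x)"
    unfolding L2inner_def set_lebesgue_integral_def by (subst integral_restrict_space) auto
  also have "\<dots> = integral {a..b} (\<lambda>x. f x * g x)"
    by (rule set_borel_integral_eq_integral) (rule borel_integrable_atLeastAtMost'[OF c])
  finally show ?thesis .
qed

section \<open>Legendre polynomials\<close>

definition deg_less :: "nat \<Rightarrow> real poly \<Rightarrow> bool" where
  "deg_less m p \<longleftrightarrow> p = 0 \<or> degree p < m"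

lemma deg_less_iff: "deg_less m p \<longleftrightarrow> (\<forall>i\<ge>m. coeff p i = 0)"
proof
  assume "deg_less m p"
  then show "\<forall>i\<ge>m. coeff p i = 0" by (auto simp: deg_less_def coeff_eq_0)
next
  assume *: "\<forall>i\<ge>m. coeff p i = 0"
  show "deg_less m p"
    using * leading_coeff_0_iff[of p] unfolding deg_less_def by (metis not_le)
qed

lemma deg_less_add: "deg_less m p \<Longrightarrow> deg_less m q \<Longrightarrow> deg_less m (p + q)"
  and deg_less_diff: "deg_less m p \<Longrightarrow> deg_less m q \<Longrightarrow> deg_less m (p - q)"
  and deg_less_smult: "deg_less m p \<Longrightarrow> deg_less m (smult c p)"
  and deg_less_0 [simp]: "deg_less m 0"
  and deg_less_mono: "deg_less m p \<Longrightarrow> m \<le> n \<Longrightarrow> deg_less n p"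
  by (auto simp: deg_less_iff)

lemma deg_less_sum: "(\<And>i. i \<in> I \<Longrightarrow> deg_less m (f i)) \<Longrightarrow> deg_less m (\<Sum>i\<in>I. f i)"
  by (auto simp: deg_less_iff coeff_sum)

lemma deg_less_mult:
  assumes "deg_less m p" "deg_less n q"
  shows "deg_less (m + n) (p * q)"
  using assms degree_mult_le[of p q] by (auto simp: deg_less_def)

lemma deg_less_pcompose_linear:
  assumes "deg_less m p"
  shows "deg_less m (p \<circ>\<^sub>p [:u, v:])"
  using assms degree_pcompose_le[of p "[:u, v:]"] by (auto simp: deg_less_def split: if_splits)

section \<open>Integrals of polynomials over [0, 1]\<close>

definition pint :: "real poly \<Rightarrow> real" where
  "pint p = integral {0..1} (poly p)"

lemma poly_integrable [simp]: "poly (p :: real poly) integrable_on {u..v}"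
  by (intro integrable_continuous_real continuous_intros)

lemma pint_add: "pint (p + q) = pint p + pint q"
  and pint_diff: "pint (p - q) = pint p - pint q"
  and pint_smult: "pint (smult c p) = c * pint p"
  and pint_minus: "pint (- p) = - pint p"
  and pint_0 [simp]: "pint 0 = 0"
proof -
  have "poly (p + q) = (\<lambda>x. poly p x + poly q x)" "poly (p - q) = (\<lambda>x. poly p x - poly q x)"
    "poly (smult c p) = (\<lambda>x. c * poly p x)" "poly (- p) = (\<lambda>x. - poly p x)"
    "poly (0 :: real poly) = (\<lambda>x. 0)"
    by auto
  then show "pint (p + q) = pint p + pint q" "pint (p - q) = pint p - pint q"
    "pint (smult c p) = c * pint p" "pint (- p) = - pint p" "pint 0 = 0"
    unfolding pint_def
    by (simp_all add: Henstock_Kurzweil_Integration.integral_add Henstock_Kurzweil_Integration.integral_diff)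
qed

lemma pint_sum: "pint (\<Sum>i\<in>I. f i) = (\<Sum>i\<in>I. pint (f i))"
  by (induction I rule: infinite_finite_induct) (auto simp: pint_add)

lemma pint_pderiv: "pint (pderiv p) = poly p 1 - poly p 0"
proof -
  have "(poly (pderiv p) has_integral (poly p 1 - poly p 0)) {0..1}"
    by (intro fundamental_theorem_of_calculus)
       (auto intro!: derivative_eq_intros poly_DERIV
             simp: has_real_derivative_iff_has_vector_derivative[symmetric])
  then show ?thesis unfolding pint_def by (rule integral_unique)
qed

text \<open>The Sturm-Liouville operator \<open>- (x (1 - x) q')'\<close> whose eigenfunctions are
  the Legendre polynomials shifted to [0, 1].\<close>

definition legendre_op :: "real poly \<Rightarrow> real poly" where
  "legendre_op q = - pderiv ([:0, 1, -1:] * pderiv q)"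

text \<open>Integration by parts; the weight \<open>x (1 - x)\<close> vanishes at both ends, so no
  boundary term survives.\<close>

lemma legendre_op_integral:
  "pint (legendre_op p * q) = pint ([:0, 1, -1:] * pderiv p * pderiv q)"
proof -
  define w :: "real poly" where "w = [:0, 1, -1:]"
  have "pint (pderiv (w * pderiv p * q)) = 0"
    unfolding pint_pderiv by (simp add: w_def)
  moreover have "pderiv (w * pderiv p * q) = - legendre_op p * q + w * pderiv p * pderiv q"
    unfolding legendre_op_def w_def[symmetric] by (simp only: pderiv_mult[of "w * pderiv p"]) (simp add: algebra_simps)
  ultimately show ?thesis
    by (simp add: pint_add pint_diff pint_minus w_def[symmetric])
qed

lemma legendre_op_symmetric: "pint (legendre_op p * q) = pint (legendre_op q * p)"
  unfolding legendre_op_integral by (simp only: mult.assoc mult.commute[of "pderiv p"])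

text \<open>In the monomial basis the operator is bidiagonal. Hence an eigenpolynomial can be
  written down from a two-term recursion for its coefficients.\<close>

lemma coeff_legendre_op:
  "coeff (legendre_op q) j = real j * (real j + 1) * coeff q j - (real j + 1)\<^sup>2 * coeff q (Suc j)"
proof -
  have "coeff ([:0, 1, -1:] * r) (Suc n) = coeff r n - (case n of 0 \<Rightarrow> 0 | Suc i \<Rightarrow> coeff r i)"
    for r :: "real poly" and n
    by (cases n) (simp_all add: mult_pCons_left coeff_pCons)
  note w = this
  show ?thesis
    unfolding legendre_op_def coeff_minus coeff_pderiv w
    by (cases j) (simp_all add: coeff_pderiv power2_eq_square algebra_simps)
qed

text \<open>The eigenvalue equation for \<open>k (k + 1)\<close> solved coefficient by coefficient.
  The factor \<open>k - j\<close> stops the recursion after degree \<open>k\<close>.\<close>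

primrec legendre_coeff :: "nat \<Rightarrow> nat \<Rightarrow> real" where
  "legendre_coeff k 0 = 1"
| "legendre_coeff k (Suc j) =
     - legendre_coeff k j * ((real k - real j) * (real k + real j + 1)) / (real j + 1)\<^sup>2"

text \<open>The recursion is the product of the absorption identities for the two binomials. The
  closed form gives the exponential size bound and a nonzero leading coefficient.\<close>

lemma legendre_coeff_eq:
  assumes "j \<le> k"
  shows "legendre_coeff k j = (-1) ^ j * real (k choose j) * real ((k + j) choose j)"
  using assms
proof (induction j)
  case (Suc j)
  have 1: "real (k choose Suc j) * (real j + 1) = real (k choose j) * (real k - real j)"
  proof -
    have "(k choose Suc j) * Suc j = (k choose j) * (k - j)"
      using binomial_absorb_comp[of k j] Suc.prems
      by (metis binomial_absorption mult.commute)
    then have "real ((k choose Suc j) * Suc j) = real ((k choose j) * (k - j))" by presburger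
    then show ?thesis using Suc.prems by (simp add: of_nat_diff algebra_simps)
  qed
  have 2: "real ((k + Suc j) choose Suc j) * (real j + 1) = (real k + real j + 1) * real ((k + j) choose j)"
  proof -
    have "Suc j * (Suc (k + j) choose Suc j) = Suc (k + j) * ((k + j) choose j)"
      by (rule Suc_times_binomial_eq[symmetric, THEN trans[OF mult.commute]])
    then have "real (Suc j * (Suc (k + j) choose Suc j)) = real (Suc (k + j) * ((k + j) choose j))"
      by presburger
    then show ?thesis by (simp add: algebra_simps del: binomial_Suc_Suc)
  qed
  have "legendre_coeff k (Suc j) * (real j + 1)\<^sup>2
     = (-1) ^ Suc j * (real (k choose j) * (real k - real j)) * ((real k + real j + 1) * real ((k + j) choose j))"
    using Suc by (simp add: field_simps)
  also have "\<dots> = ((-1) ^ Suc j * real (k choose Suc j) * real ((k + Suc j) choose Suc j)) * (real j + 1)\<^sup>2"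
    unfolding 1[symmetric] 2[symmetric] by (simp add: power2_eq_square del: binomial_Suc_Suc)
  finally show ?case
    by (metis mult_right_cancel of_nat_Suc of_nat_neq_0 power_not_zero add.commute)
qed simp

lemma legendre_coeff_bound:
  assumes "j \<le> k"
  shows "\<bar>legendre_coeff k j\<bar> \<le> 8 ^ k"
proof -
  have 1: "real (n choose i) \<le> 2 ^ n" for n i
    using binomial_le_pow2[of n i] by (metis of_nat_le_iff of_nat_numeral of_nat_power)
  have "real ((k + j) choose j) \<le> 2 ^ (k + j)" by (rule 1)
  also have "(2::real) ^ (k + j) \<le> 2 ^ (k + k)" using assms by (intro power_increasing) auto
  finally have "real (k choose j) * real ((k + j) choose j) \<le> 2 ^ k * 2 ^ (k + k)"
    using 1 by (intro mult_mono) auto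
  also have "\<dots> = (8::real) ^ k" by (simp add: power_add power_mult_distrib[symmetric])
  finally show ?thesis using assms by (simp add: legendre_coeff_eq abs_mult)
qed

text \<open>The classical Legendre polynomial evaluated at \<open>1 - 2 x\<close>, hence normalised
  to the value 1 at 0.\<close>

definition legendre :: "nat \<Rightarrow> real poly" where
  "legendre k = (\<Sum>j\<le>k. monom (legendre_coeff k j) j)"

lemma legendre_coeff_gt: "k < j \<Longrightarrow> legendre_coeff k j = 0"
  by (induction j) (auto simp: less_Suc_eq)

lemma coeff_legendre: "coeff (legendre k) j = legendre_coeff k j"
  by (auto simp: legendre_def coeff_sum if_distrib legendre_coeff_gt cong: if_cong)

lemma legendre_op_legendre: "legendre_op (legendre k) = smult (real k * (real k + 1)) (legendre k)"
proof (rule poly_eqI)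
  fix j
  have "(real j + 1)\<^sup>2 * legendre_coeff k (Suc j)
      = - legendre_coeff k j * ((real k - real j) * (real k + real j + 1))"
    by (simp add: field_simps)
  then show "coeff (legendre_op (legendre k)) j = coeff (smult (real k * (real k + 1)) (legendre k)) j"
    by (simp add: coeff_legendre_op coeff_legendre algebra_simps del: legendre_coeff.simps)
qed

text \<open>Eigenvectors of a symmetric operator for the distinct eigenvalues
  \<open>i (i + 1)\<close> and \<open>k (k + 1)\<close>.\<close>

lemma legendre_orthogonal:
  assumes "i \<noteq> k"
  shows "pint (legendre i * legendre k) = 0"
proof -
  have "(real i * (real i + 1)) * pint (legendre i * legendre k)
      = (real k * (real k + 1)) * pint (legendre i * legendre k)"
    using legendre_op_symmetric[of "legendre i" "legendre k"]
    by (simp add: legendre_op_legendre pint_smult mult.commute)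
  moreover have "real i * (real i + 1) \<noteq> real k * (real k + 1)"
  proof
    assume "real i * (real i + 1) = real k * (real k + 1)"
    then have "(real i - real k) * (real i + real k + 1) = 0" by (simp add: algebra_simps)
    then show False using assms by (auto simp: add_eq_0_iff)
  qed
  ultimately show ?thesis by auto
qed

lemma legendre_expansion:
  assumes "deg_less m p"
  shows "\<exists>c. p = (\<Sum>k<m. smult (c k) (legendre k))"
  using assms
proof (induction m arbitrary: p)
  case 0
  then show ?case by (simp add: deg_less_def)
next
  case (Suc m)
  have nz: "legendre_coeff m m \<noteq> 0" by (simp add: legendre_coeff_eq)
  define d where "d = coeff p m / legendre_coeff m m"
  have "deg_less m (p - smult d (legendre m))"
    unfolding deg_less_iff
  proof (intro allI impI)
    fix i assume "i \<ge> m"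
    show "coeff (p - smult d (legendre m)) i = 0"
    proof (cases "i = m")
      case True
      then show ?thesis using nz by (simp add: d_def coeff_legendre)
    next
      case False
      then show ?thesis using \<open>i \<ge> m\<close> Suc.prems by (simp add: deg_less_iff coeff_legendre legendre_coeff_gt)
    qed
  qed
  from Suc.IH[OF this] obtain c where c: "p - smult d (legendre m) = (\<Sum>k<m. smult (c k) (legendre k))"
    by blast
  have "p = (\<Sum>k<m. smult (c k) (legendre k)) + smult d (legendre m)"
    using c by (simp add: diff_eq_eq)
  also have "\<dots> = (\<Sum>k<Suc m. smult ((c(m := d)) k) (legendre k))" by simp
  finally show ?case by blast
qed

lemma legendre_orthogonal_lower:
  assumes "deg_less k p"
  shows "pint (p * legendre k) = 0"
proof -
  obtain c where c: "p = (\<Sum>i<k. smult (c i) (legendre i))" using legendre_expansion[OF assms] by blast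
  show ?thesis unfolding c sum_distrib_right pint_sum by (simp add: pint_smult legendre_orthogonal)
qed

lemma legendre_at_0: "poly (legendre k) 0 = 1"
  by (simp add: poly_0_coeff_0 coeff_legendre)

text \<open>The norm is read off the boundary term of \<open>\<integral> ((1 - x) P\<^sup>2)'\<close>, because \<open>(1 - x) P'\<close> equals
  \<open>- k P\<close> up to lower order terms.\<close>

lemma legendre_norm: "pint (legendre k * legendre k) = 1 / (2 * real k + 1)"
proof -
  define P where "P = legendre k"
  define w :: "real poly" where "w = [:1, -1:]"
  define r where "r = w * pderiv P + smult (real k) P"
  have cw: "coeff (w * s) i = coeff s i - (case i of 0 \<Rightarrow> 0 | Suc j \<Rightarrow> coeff s j)" for s :: "real poly" and i
    by (simp add: w_def mult_pCons_left coeff_pCons split: nat.split)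
  have "deg_less k r"
    unfolding deg_less_iff r_def P_def
    by (auto simp: cw coeff_pderiv coeff_legendre legendre_coeff_gt le_less split: nat.split
             simp del: legendre_coeff.simps)
  then have r0: "pint (r * P) = 0" unfolding P_def by (rule legendre_orthogonal_lower)
  have "pint (pderiv (w * (P * P))) = -1"
    unfolding pint_pderiv by (simp add: w_def P_def legendre_at_0)
  moreover have "pderiv (w * (P * P)) = - (P * P) + smult 2 (w * pderiv P * P)"
  proof -
    have "pderiv w = -1" by (simp add: w_def pderiv_pCons one_pCons)
    moreover have "smult 2 r = r + r" for r :: "real poly"
      using smult_add_left[of 1 1 r] by simp
    ultimately show ?thesis by (simp add: pderiv_mult algebra_simps)
  qed
  moreover have "w * pderiv P * P = r * P - smult (real k) (P * P)"
    by (simp add: r_def algebra_simps)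
  ultimately have "- pint (P * P) + 2 * (- real k * pint (P * P)) = -1"
    by (simp add: pint_add pint_diff pint_minus pint_smult r0)
  then have "(2 * real k + 1) * pint (P * P) = 1" by (simp add: algebra_simps)
  then show ?thesis by (simp add: P_def field_simps)
qed

lemma pint_legendre_sums:
  "pint ((\<Sum>k<m. smult (c k) (legendre k)) * (\<Sum>k<m. smult (d k) (legendre k)))
     = (\<Sum>k<m. c k * d k / (2 * real k + 1))"
proof -
  have "pint ((\<Sum>k<m. smult (c k) (legendre k)) * (\<Sum>k<m. smult (d k) (legendre k)))
     = (\<Sum>k<m. \<Sum>j<m. c k * d j * pint (legendre k * legendre j))"
    by (simp add: sum_product pint_sum pint_smult mult_ac)
  also have "\<dots> = (\<Sum>k<m. \<Sum>j<m. if j = k then c k * d k / (2 * real k + 1) else 0)"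
    by (intro sum.cong refl) (auto simp: legendre_orthogonal legendre_norm)
  also have "\<dots> = (\<Sum>k<m. c k * d k / (2 * real k + 1))" by simp
  finally show ?thesis .
qed

text \<open>Every Legendre polynomial is 1 at 0, so the value there is the sum of the coefficients.
  Cauchy-Schwarz with the weights \<open>2 k + 1\<close>, the inverse squared norms, gives their sum
  \<open>m^2\<close>.\<close>

lemma nikolskii_endpoint:
  assumes "deg_less m p"
  shows "(poly p 0)\<^sup>2 \<le> (real m)\<^sup>2 * pint (p * p)"
proof -
  obtain c where c: "p = (\<Sum>k<m. smult (c k) (legendre k))" using legendre_expansion[OF assms] by blast
  have "poly p 0 = (\<Sum>k<m. c k)" unfolding c by (simp add: poly_sum legendre_at_0)
  also have "\<dots> = (\<Sum>k<m. (c k / sqrt (2 * real k + 1)) * sqrt (2 * real k + 1))"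
    by (intro sum.cong) (auto simp: add_nonneg_eq_0_iff)
  finally have "(poly p 0)\<^sup>2 = (\<Sum>k<m. (c k / sqrt (2 * real k + 1)) * sqrt (2 * real k + 1))\<^sup>2" by simp
  also have "\<dots> \<le> (\<Sum>k<m. (c k / sqrt (2 * real k + 1))\<^sup>2) * (\<Sum>k<m. (sqrt (2 * real k + 1))\<^sup>2)"
    by (rule Cauchy_Schwarz_ineq_sum)
  also have "(\<Sum>k<m. (c k / sqrt (2 * real k + 1))\<^sup>2) = pint (p * p)"
    unfolding c pint_legendre_sums by (simp add: power_divide power2_eq_square)
  also have "(\<Sum>k<m. (sqrt (2 * real k + 1))\<^sup>2) = (real m)\<^sup>2"
    by (induction m) (simp_all add: power2_eq_square algebra_simps)
  finally show ?thesis by (simp add: mult.commute)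
qed

text \<open>The segment may run from \<open>x\<close> in either direction; \<open>nikolskii\<close>
  needs both signs of \<open>s\<close>.\<close>

lemma integral_poly_affine:
  assumes "s \<noteq> 0"
  shows "pint (p \<circ>\<^sub>p [:x, s:]) = integral {min x (x + s)..max x (x + s)} (poly p) / \<bar>s\<bar>"
proof -
  define u where "u = min x (x + s)"
  define v where "v = max x (x + s)"
  have uv: "u \<le> v" by (simp add: u_def v_def)
  have "(poly p has_integral integral {u..v} (poly p)) (cbox u v)"
    by (simp add: integrable_integral)
  from has_integral_affinity[OF this assms, of x]
  have "((\<lambda>y. poly p (s *\<^sub>R y + x)) has_integral (1 / \<bar>s\<bar>) *\<^sub>R integral {u..v} (poly p))
          ((\<lambda>y. (1 / s) *\<^sub>R y + - ((1 / s) *\<^sub>R x)) ` cbox u v)" by simp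
  moreover have "(\<lambda>y. (1 / s) *\<^sub>R y + - ((1 / s) *\<^sub>R x)) ` cbox u v = {0..1}"
    unfolding image_affinity_cbox using uv assms by (auto simp: u_def v_def min_def max_def field_simps)
  ultimately have "((\<lambda>y. poly p (s *\<^sub>R y + x)) has_integral (1 / \<bar>s\<bar>) *\<^sub>R integral {u..v} (poly p)) {0..1}"
    by simp
  moreover have "poly (p \<circ>\<^sub>p [:x, s:]) = (\<lambda>y. poly p (s *\<^sub>R y + x))"
    by (auto simp: poly_pcompose algebra_simps)
  ultimately show ?thesis unfolding pint_def u_def[symmetric] v_def[symmetric]
    by (simp add: integral_unique)
qed

lemma l2n_poly: "(l2n u v (poly p))\<^sup>2 = integral {u..v} (poly (p * p))"
  by (subst L2inner_self[symmetric], subst L2inner_eq_integral)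
     (auto intro!: continuous_intros Henstock_Kurzweil_Integration.integral_cong)

lemma poly_L2 [simp]: "poly p \<in> L2 u v"
  by (intro L2_continuous continuous_intros)

lemma pcompose_linear_sq: "(p \<circ>\<^sub>p q) * (p \<circ>\<^sub>p q) = (p * p) \<circ>\<^sub>p (q :: real poly)"
  by (simp add: pcompose_mult)

lemma pint_sq_compose:
  assumes "u < v"
  shows "pint ((p \<circ>\<^sub>p [:u, v - u:]) * (p \<circ>\<^sub>p [:u, v - u:])) = (l2n u v (poly p))\<^sup>2 / (v - u)"
  unfolding pcompose_linear_sq l2n_poly using integral_poly_affine[of "v - u" "p * p" u] assms
  by (simp add: min_def max_def)

text \<open>An interior point is an end of two subintervals. The endpoint bound is applied to the
  longer one, whose length is at least half of \<open>v - u\<close>; this is the source of the 2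
  under the root.\<close>

lemma nikolskii:
  assumes "deg_less m p" "u < v" "x \<in> {u..v}"
  shows "\<bar>poly p x\<bar> \<le> sqrt (2 / (v - u)) * real m * l2n u v (poly p)"
proof -
  define s where "s = (if x \<le> (u + v) / 2 then v - x else u - x)"
  have s: "\<bar>s\<bar> \<ge> (v - u) / 2" "s \<noteq> 0" "{min x (x + s)..max x (x + s)} \<subseteq> {u..v}"
    using assms(2,3) by (auto simp: s_def min_def max_def)
  have "(poly (p \<circ>\<^sub>p [:x, s:]) 0)\<^sup>2 \<le> (real m)\<^sup>2 * pint ((p \<circ>\<^sub>p [:x, s:]) * (p \<circ>\<^sub>p [:x, s:]))"
    by (rule nikolskii_endpoint[OF deg_less_pcompose_linear[OF assms(1)]])
  also have "pint ((p \<circ>\<^sub>p [:x, s:]) * (p \<circ>\<^sub>p [:x, s:]))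
      = integral {min x (x + s)..max x (x + s)} (poly (p * p)) / \<bar>s\<bar>"
    unfolding pcompose_linear_sq using integral_poly_affine[OF s(2)] .
  also have "\<dots> \<le> (l2n u v (poly p))\<^sup>2 / ((v - u) / 2)"
    unfolding l2n_poly using s assms(2)
    by (intro frac_le integral_subset_le integral_nonneg) auto
  finally have "(poly p x)\<^sup>2 \<le> (real m)\<^sup>2 * ((l2n u v (poly p))\<^sup>2 / ((v - u) / 2))"
    by (simp add: poly_pcompose mult_left_mono)
  also have "\<dots> = (sqrt (2 / (v - u)) * real m * l2n u v (poly p))\<^sup>2"
    using assms(2) by (simp add: power_mult_distrib field_simps)
  finally show ?thesis
    using assms(2) by (intro power2_le_imp_le[of "\<bar>poly p x\<bar>", simplified]) (auto intro!: mult_nonneg_nonneg)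
qed

lemma coeff_linear_power:
  "\<bar>coeff ([:u, v:] ^ j) i\<bar> \<le> (\<bar>u\<bar> + \<bar>v\<bar> :: real) ^ j"
proof (induction j arbitrary: i)
  case (Suc j)
  have "\<bar>coeff ([:u, v:] ^ Suc j) i\<bar> \<le> \<bar>u\<bar> * (\<bar>u\<bar> + \<bar>v\<bar>) ^ j + \<bar>v\<bar> * (\<bar>u\<bar> + \<bar>v\<bar>) ^ j"
  proof (cases i)
    case 0
    then show ?thesis using Suc[of 0]
      by (simp add: abs_mult mult_pCons_left add_increasing2 mult_left_mono)
  next
    case (Suc l)
    have "\<bar>coeff ([:u, v:] ^ Suc j) i\<bar> = \<bar>u * coeff ([:u, v:] ^ j) i + v * coeff ([:u, v:] ^ j) l\<bar>"
      by (simp add: Suc mult_pCons_left)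
    also have "\<dots> \<le> \<bar>u\<bar> * \<bar>coeff ([:u, v:] ^ j) i\<bar> + \<bar>v\<bar> * \<bar>coeff ([:u, v:] ^ j) l\<bar>"
      by (metis abs_mult abs_triangle_ineq)
    also have "\<dots> \<le> \<bar>u\<bar> * (\<bar>u\<bar> + \<bar>v\<bar>) ^ j + \<bar>v\<bar> * (\<bar>u\<bar> + \<bar>v\<bar>) ^ j"
      using Suc.IH by (intro add_mono mult_left_mono) auto
    finally show ?thesis .
  qed
  then show ?case by (simp add: algebra_simps)
qed auto

text \<open>In the Legendre expansion the coefficients are controlled by the norm, the coefficients
  of each Legendre polynomial by \<open>8^k\<close>, and the substitution back to [a, b] by another
  exponential. A bound exponential in \<open>m\<close> is all that is needed, since it will be
  compared with \<open>m!\<close>.\<close>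

lemma coeff_bound_L2:
  assumes "a < b"
  shows "\<exists>K\<ge>1. \<forall>m p k. deg_less m p \<longrightarrow> \<bar>coeff p k\<bar> \<le> K ^ m * l2n a b (poly p)"
proof -
  define u where "u = - a / (b - a)"
  define v where "v = 1 / (b - a)"
  define \<kappa> where "\<kappa> = 1 + \<bar>u\<bar> + \<bar>v\<bar>"
  define \<mu> where "\<mu> = 1 + 1 / sqrt (b - a)"
  have \<kappa>: "\<kappa> \<ge> 1" and \<mu>: "\<mu> \<ge> 1" using assms by (auto simp: \<kappa>_def \<mu>_def)
  have main: "\<bar>coeff p i\<bar> \<le> (64 * \<kappa> * \<mu>) ^ m * l2n a b (poly p)" if p: "deg_less m p" for m p i
  proof (cases "m = 0")
    case True
    then show ?thesis using p by (simp add: deg_less_def)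
  next
    case False
    define q where "q = p \<circ>\<^sub>p [:a, b - a:]"
    define N where "N = l2n a b (poly p) / sqrt (b - a)"
    have N: "N \<ge> 0" unfolding N_def using assms by simp
    have pq: "p = q \<circ>\<^sub>p [:u, v:]"
      using assms by (simp add: q_def pcompose_assoc[symmetric] pcompose_pCons u_def v_def field_simps)
    have "deg_less m q" unfolding q_def by (rule deg_less_pcompose_linear[OF p])
    then obtain c where c: "q = (\<Sum>k<m. smult (c k) (legendre k))" using legendre_expansion by blast
    have qq: "pint (q * q) = N\<^sup>2"
      unfolding q_def N_def using pint_sq_compose[OF assms] assms by (simp add: power_divide)
    have ck: "\<bar>c k\<bar> \<le> 2 * real m * N" if "k < m" for k
    proof -
      have "(c k)\<^sup>2 / (2 * real k + 1) \<le> (\<Sum>k<m. c k * c k / (2 * real k + 1))"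
        unfolding power2_eq_square
        using that by (intro member_le_sum[of k "{..<m}" "\<lambda>k. c k * c k / (2 * real k + 1)"]) auto
      also have "\<dots> = N\<^sup>2" unfolding qq[symmetric] c pint_legendre_sums ..
      finally have "(c k)\<^sup>2 \<le> (2 * real k + 1) * N\<^sup>2" by (simp add: field_simps)
      also have "\<dots> \<le> (2 * real m)\<^sup>2 * N\<^sup>2"
      proof (intro mult_right_mono)
        have "2 * real k + 1 \<le> 2 * real m" using that by linarith
        also have "\<dots> \<le> (2 * real m)\<^sup>2" using that by (intro self_le_power) auto
        finally show "2 * real k + 1 \<le> (2 * real m)\<^sup>2" .
      qed simp
      finally have "(c k)\<^sup>2 \<le> (2 * real m * N)\<^sup>2" by (simp add: power_mult_distrib)
      then show ?thesis using N by (intro power2_le_imp_le[of "\<bar>c k\<bar>", simplified]) auto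
    qed
    have leg: "\<bar>coeff (legendre k \<circ>\<^sub>p [:u, v:]) i\<bar> \<le> real m * (8 * \<kappa>) ^ m" if "k < m" for k
    proof -
      have "legendre k \<circ>\<^sub>p [:u, v:] = (\<Sum>j\<le>k. smult (legendre_coeff k j) ([:u, v:] ^ j))"
        by (intro poly_eq_poly_eq_iff[THEN iffD1] ext)
           (simp add: legendre_def poly_sum poly_pcompose poly_monom)
      then have "\<bar>coeff (legendre k \<circ>\<^sub>p [:u, v:]) i\<bar> \<le> (\<Sum>j\<le>k. \<bar>legendre_coeff k j * coeff ([:u, v:] ^ j) i\<bar>)"
        by (simp add: coeff_sum)
      also have "\<dots> \<le> (\<Sum>j\<le>k. 8 ^ k * \<kappa> ^ k)"
      proof (intro sum_mono)
        fix j assume j: "j \<in> {..k}"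
        have "\<bar>coeff ([:u, v:] ^ j) i\<bar> \<le> (\<bar>u\<bar> + \<bar>v\<bar>) ^ j" by (rule coeff_linear_power)
        also have "\<dots> \<le> \<kappa> ^ j" by (intro power_mono) (auto simp: \<kappa>_def)
        also have "\<dots> \<le> \<kappa> ^ k" using j \<kappa> by (intro power_increasing) auto
        finally have "\<bar>coeff ([:u, v:] ^ j) i\<bar> \<le> \<kappa> ^ k" .
        then show "\<bar>legendre_coeff k j * coeff ([:u, v:] ^ j) i\<bar> \<le> 8 ^ k * \<kappa> ^ k"
          unfolding abs_mult using legendre_coeff_bound[of j k] j by (intro mult_mono) auto
      qed
      also have "\<dots> = real (k + 1) * (8 * \<kappa>) ^ k" by (simp add: power_mult_distrib)
      also have "\<dots> \<le> real m * (8 * \<kappa>) ^ m"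
        using that \<kappa> by (intro mult_mono power_increasing) auto
      finally show ?thesis .
    qed
    have "coeff p i = (\<Sum>k<m. c k * coeff (legendre k \<circ>\<^sub>p [:u, v:]) i)"
      unfolding pq c by (simp add: pcompose_sum pcompose_smult coeff_sum)
    then have "\<bar>coeff p i\<bar> \<le> (\<Sum>k<m. \<bar>c k\<bar> * \<bar>coeff (legendre k \<circ>\<^sub>p [:u, v:]) i\<bar>)"
      by (metis (no_types, lifting) abs_mult sum.cong sum_abs)
    also have "\<dots> \<le> (\<Sum>k<m. (2 * real m * N) * (real m * (8 * \<kappa>) ^ m))"
      using ck leg N by (intro sum_mono mult_mono) auto
    also have "\<dots> = 2 * (real m * real m * real m) * ((8 * \<kappa>) ^ m * N)" by simp
    \<comment> \<open>The power of 64 is one factor 8 from the Legendre coefficients and one that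
      swallows the polynomial factor \<open>2 m^3\<close>.\<close>
    also have "\<dots> \<le> 8 ^ m * ((8 * \<kappa>) ^ m * (\<mu> ^ m * l2n a b (poly p)))"
    proof (intro mult_mono)
      have "2 * (m * m * m) \<le> 8 ^ m"
      proof -
        have "m \<le> 2 ^ (m - 1)"
        proof (induction m)
          case (Suc n)
          show ?case
          proof (cases n)
            case (Suc k)
            have "k < 2 ^ k" by (rule less_exp)
            moreover have "(1::nat) \<le> 2 ^ k" by simp
            ultimately have "Suc (Suc k) \<le> 2 * 2 ^ k" by linarith
            then show ?thesis using Suc by simp
          qed simp
        qed simp
        then have "m * m * m \<le> 2 ^ (m - 1) * 2 ^ (m - 1) * 2 ^ (m - 1)" by (intro mult_mono) auto
        also have "\<dots> = (8::nat) ^ (m - 1)" by (simp add: power_mult_distrib[symmetric])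
        finally have "2 * (m * m * m) \<le> 2 * 8 ^ (m - 1)" by simp
        also have "\<dots> \<le> (8::nat) * 8 ^ (m - 1)" by simp
        also have "\<dots> = 8 ^ m" using False by (simp add: power_Suc[symmetric] del: power_Suc)
        finally show ?thesis .
      qed
      then have "real (2 * (m * m * m)) \<le> real (8 ^ m)" by (simp only: of_nat_le_iff)
      then show "2 * (real m * real m * real m) \<le> 8 ^ m" by simp
      have "1 / sqrt (b - a) \<le> \<mu>" by (simp add: \<mu>_def)
      also have "\<dots> \<le> \<mu> ^ m" using \<mu> False by (intro self_le_power) auto
      finally show "N \<le> \<mu> ^ m * l2n a b (poly p)"
        unfolding N_def using mult_right_mono[of "1 / sqrt (b - a)" "\<mu> ^ m" "l2n a b (poly p)"] by simp
    qed (use \<kappa> N in auto)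
    also have "\<dots> = (64 * \<kappa> * \<mu>) ^ m * l2n a b (poly p)"
    proof -
      have "(64::real) ^ m = 8 ^ m * 8 ^ m" by (simp add: power_mult_distrib[symmetric])
      then show ?thesis by (simp add: power_mult_distrib)
    qed
    finally show ?thesis .
  qed
  have "1 * 1 * 1 \<le> 64 * \<kappa> * \<mu>" using \<kappa> \<mu> by (intro mult_mono) auto
  then show ?thesis using main by (intro exI[of _ "64 * \<kappa> * \<mu>"]) auto
qed

text \<open>In the eigenbasis of the Legendre operator the squared norm of \<open>\<phi> q'\<close> has the weights
  \<open>k (k + 1)\<close>.\<close>

lemma legendre_projection:
  "\<exists>p. deg_less m p \<and> (\<forall>r. deg_less m r \<longrightarrow> pint ((q - p) * r) = 0) \<and>
       (real m)\<^sup>2 * pint ((q - p) * (q - p)) \<le> pint ([:0, 1, -1:] * pderiv q * pderiv q)"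
proof -
  \<comment> \<open>\<open>q\<close> has no degree restriction, so it is expanded far enough;
    \<open>p\<close> keeps the first \<open>m\<close> terms and \<open>d\<close> holds the
    coefficients of the remainder.\<close>
  define M where "M = max m (Suc (degree q))"
  have "deg_less M q" by (auto simp: deg_less_def M_def)
  then obtain c where c: "q = (\<Sum>k<M. smult (c k) (legendre k))" using legendre_expansion by blast
  define p where "p = (\<Sum>k<m. smult (c k) (legendre k))"
  have degl: "deg_less (Suc k) (legendre k)" for k
    by (auto simp: deg_less_iff coeff_legendre legendre_coeff_gt)
  have degp: "deg_less m p"
    unfolding p_def by (intro deg_less_sum deg_less_smult deg_less_mono[OF degl]) auto
  define d where "d k = (if k < m then 0 else c k)" for k
  have "p = (\<Sum>k<M. smult (if k < m then c k else 0) (legendre k))"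
    unfolding p_def by (rule sum.mono_neutral_cong_left) (auto simp: M_def)
  then have qp: "q - p = (\<Sum>k<M. smult (d k) (legendre k))"
    unfolding c by (auto simp: sum_subtractf[symmetric] d_def intro!: sum.cong)
  have orth: "pint ((q - p) * r) = 0" if "deg_less m r" for r
  proof -
    obtain e where e: "r = (\<Sum>k<m. smult (e k) (legendre k))"
      using legendre_expansion \<open>deg_less m r\<close> by blast
    have "r = (\<Sum>k<M. smult (if k < m then e k else 0) (legendre k))"
      unfolding e by (rule sum.mono_neutral_cong_left) (auto simp: M_def)
    then have "pint ((q - p) * r) = (\<Sum>k<M. d k * (if k < m then e k else 0) / (2 * real k + 1))"
      unfolding qp by (simp only: pint_legendre_sums)
    also have "\<dots> = 0" by (intro sum.neutral) (auto simp: d_def)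
    finally show ?thesis .
  qed
  have lop: "legendre_op q = (\<Sum>k<M. smult (real k * (real k + 1) * c k) (legendre k))"
  proof (rule poly_eqI)
    fix j
    have "coeff (legendre_op q) j = (\<Sum>k<M. c k * coeff (legendre_op (legendre k)) j)"
      by (simp add: coeff_legendre_op c coeff_sum sum_distrib_left sum_subtractf[symmetric] algebra_simps)
    also have "\<dots> = (\<Sum>k<M. c k * coeff (smult (real k * (real k + 1)) (legendre k)) j)"
      by (simp only: legendre_op_legendre)
    finally show "coeff (legendre_op q) j = coeff (\<Sum>k<M. smult (real k * (real k + 1) * c k) (legendre k)) j"
      by (simp add: coeff_sum mult_ac)
  qed
  have "(real m)\<^sup>2 * pint ((q - p) * (q - p)) = (\<Sum>k<M. (real m)\<^sup>2 * (d k * d k / (2 * real k + 1)))"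
    unfolding qp pint_legendre_sums by (simp add: sum_distrib_left)
  also have "\<dots> \<le> (\<Sum>k<M. real k * (real k + 1) * c k * c k / (2 * real k + 1))"
  proof (intro sum_mono)
    fix k
    show "(real m)\<^sup>2 * (d k * d k / (2 * real k + 1)) \<le> real k * (real k + 1) * c k * c k / (2 * real k + 1)"
    proof (cases "k < m")
      \<comment> \<open>Only indices \<open>k \<ge> m\<close> remain in \<open>q - p\<close>, and
        their eigenvalue \<open>k (k + 1)\<close> is at least \<open>m^2\<close>.\<close>
      case False
      have "(real m)\<^sup>2 \<le> real k * (real k + 1)"
        unfolding power2_eq_square using False by (intro mult_mono) auto
      then have "(real m)\<^sup>2 * (c k * c k) \<le> real k * (real k + 1) * (c k * c k)"
        by (intro mult_right_mono) auto
      then show ?thesis using False by (simp add: d_def divide_right_mono mult.assoc)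
    qed (simp add: d_def mult.assoc)
  qed
  also have "\<dots> = pint (legendre_op q * q)" unfolding lop unfolding c pint_legendre_sums ..
  also have "\<dots> = pint ([:0, 1, -1:] * pderiv q * pderiv q)" by (rule legendre_op_integral)
  finally show ?thesis using degp orth by blast
qed

section \<open>Spans of Poisson masses\<close>

lemma continuous_poisson_mass [continuous_intros]: "continuous_on S (poisson_mass k)"
  unfolding poisson_mass_def by (intro continuous_intros) auto

lemma poisson_mass_L2 [simp]: "poisson_mass k \<in> L2 a b"
  by (intro L2_continuous continuous_intros)

lemma poisson_mass_nonneg: "0 \<le> \<theta> \<Longrightarrow> 0 \<le> poisson_mass k \<theta>"
  by (simp add: poisson_mass_def)

lemma poisson_span_iff_poly:
  "g \<in> poisson_span m \<longleftrightarrow> (\<exists>p. deg_less m p \<and> g = (\<lambda>\<theta>. exp (- \<theta>) * poly p \<theta>))"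
proof
  assume "g \<in> poisson_span m"
  then obtain c where g: "g = (\<lambda>\<theta>. \<Sum>k<m. c k * poisson_mass k \<theta>)" by (auto simp: poisson_span_def)
  define p where "p = (\<Sum>k<m. monom (c k / fact k) k)"
  have "deg_less m p" by (auto simp: p_def deg_less_iff coeff_sum)
  moreover have "g = (\<lambda>\<theta>. exp (- \<theta>) * poly p \<theta>)"
    by (auto simp: g p_def poly_sum poly_monom sum_distrib_left poisson_mass_def intro!: sum.cong)
  ultimately show "\<exists>p. deg_less m p \<and> g = (\<lambda>\<theta>. exp (- \<theta>) * poly p \<theta>)" by blast
next
  assume "\<exists>p. deg_less m p \<and> g = (\<lambda>\<theta>. exp (- \<theta>) * poly p \<theta>)"
  then obtain p where p: "deg_less m p" and g: "g = (\<lambda>\<theta>. exp (- \<theta>) * poly p \<theta>)" by blast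
  have "p = (\<Sum>k<m. monom (coeff p k) k)"
  proof (rule poly_eqI)
    fix i show "coeff p i = coeff (\<Sum>k<m. monom (coeff p k) k) i"
      using p by (cases "i < m") (auto simp: coeff_sum deg_less_iff)
  qed
  then have "poly p \<theta> = (\<Sum>k<m. coeff p k * \<theta> ^ k)" for \<theta>
    by (metis (no_types, lifting) poly_monom poly_sum sum.cong)
  then have "g = (\<lambda>\<theta>. \<Sum>k<m. (fact k * coeff p k) * poisson_mass k \<theta>)"
    by (auto simp: g sum_distrib_left poisson_mass_def intro!: sum.cong)
  then show "g \<in> poisson_span m" by (auto simp: poisson_span_def)
qed

lemma poisson_span_continuous: "g \<in> poisson_span m \<Longrightarrow> continuous_on S g"
  by (auto simp: poisson_span_iff_poly intro!: continuous_intros)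

lemma poisson_span_L2: "g \<in> poisson_span m \<Longrightarrow> g \<in> L2 a b"
  by (intro L2_continuous poisson_span_continuous)

lemma poisson_span_zero: "(\<lambda>\<theta>. 0) \<in> poisson_span m"
  unfolding poisson_span_iff_poly by (rule exI[of _ 0]) simp

lemma poisson_span_add:
  assumes "g \<in> poisson_span m" "h \<in> poisson_span m"
  shows "(\<lambda>\<theta>. g \<theta> + h \<theta>) \<in> poisson_span m"
proof -
  obtain p q where "deg_less m p" "g = (\<lambda>\<theta>. exp (- \<theta>) * poly p \<theta>)"
    "deg_less m q" "h = (\<lambda>\<theta>. exp (- \<theta>) * poly q \<theta>)"
    using assms unfolding poisson_span_iff_poly by blast
  then show ?thesis
    unfolding poisson_span_iff_poly by (intro exI[of _ "p + q"]) (auto simp: deg_less_add algebra_simps)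
qed

lemma poisson_span_cmult:
  assumes "g \<in> poisson_span m"
  shows "(\<lambda>\<theta>. c * g \<theta>) \<in> poisson_span m"
proof -
  obtain p where "deg_less m p" "g = (\<lambda>\<theta>. exp (- \<theta>) * poly p \<theta>)"
    using assms unfolding poisson_span_iff_poly by blast
  then show ?thesis
    unfolding poisson_span_iff_poly by (intro exI[of _ "smult c p"]) (auto simp: deg_less_smult)
qed

lemma poisson_span_diff:
  assumes "g \<in> poisson_span m" "h \<in> poisson_span m"
  shows "(\<lambda>\<theta>. g \<theta> - h \<theta>) \<in> poisson_span m"
  using poisson_span_add[OF assms(1) poisson_span_cmult[OF assms(2), of "-1"]] by simp

lemma poisson_span_mono: "g \<in> poisson_span m \<Longrightarrow> m \<le> n \<Longrightarrow> g \<in> poisson_span n"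
  unfolding poisson_span_iff_poly using deg_less_mono by blast

lemma poisson_mass_in_span: "k < m \<Longrightarrow> poisson_mass k \<in> poisson_span m"
  unfolding poisson_span_iff_poly
  by (intro exI[of _ "monom (1 / fact k) k"]) (auto simp: deg_less_iff poly_monom poisson_mass_def)

lemma poisson_span_Suc:
  assumes "g \<in> poisson_span (Suc m)"
  obtains h c where "h \<in> poisson_span m" "g = (\<lambda>\<theta>. h \<theta> + c * poisson_mass m \<theta>)"
  using assms by (auto simp: poisson_span_def)

lemma poisson_mass_not_in_span: "poisson_mass m \<notin> poisson_span m"
proof
  assume "poisson_mass m \<in> poisson_span m"
  then obtain p where p: "deg_less m p" "poisson_mass m = (\<lambda>\<theta>. exp (- \<theta>) * poly p \<theta>)"
    unfolding poisson_span_iff_poly by blast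
  have "poly (monom (1 / fact m) m) = poly p"
  proof
    fix x :: real
    have "poisson_mass m x = exp (- x) * poly p x" using p(2) by simp
    then show "poly (monom (1 / fact m) m) x = poly p x" by (simp add: poisson_mass_def poly_monom field_simps)
  qed
  then have "monom (1 / fact m) m = p" by (simp add: poly_eq_poly_eq_iff)
  moreover have "coeff (monom (1 / fact m) m) m \<noteq> (0::real)" by simp
  ultimately show False using p(1) by (auto simp: deg_less_iff)
qed

text \<open>On [a, b] the factor \<open>exp (b - x)\<close> is at least one. Removing the weight
  \<open>exp (- \<theta>)\<close> thus costs only a constant, and polynomial inequalities carry over
  to Poisson spans.\<close>

lemma l2n_poly_le_exp:
  fixes p :: "real poly"
  shows "l2n a b (poly p) \<le> exp b * l2n a b (\<lambda>\<theta>. exp (- \<theta>) * poly p \<theta>)"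
proof -
  have "l2n a b (poly p) \<le> l2n a b (\<lambda>\<theta>. exp b * (exp (- \<theta>) * poly p \<theta>))"
  proof (rule l2n_mono)
    show "(\<lambda>\<theta>. exp b * (exp (- \<theta>) * poly p \<theta>)) \<in> L2 a b" by (intro L2_continuous continuous_intros)
    fix x assume "x \<in> {a..b}"
    then have "1 \<le> exp (b - x)" by simp
    then have "1 * \<bar>poly p x\<bar> \<le> exp (b - x) * \<bar>poly p x\<bar>" by (intro mult_right_mono) auto
    then show "\<bar>poly p x\<bar> \<le> \<bar>exp b * (exp (- x) * poly p x)\<bar>"
      by (simp add: abs_mult exp_diff exp_minus field_simps)
  qed simp
  then show ?thesis by (simp add: l2n_cmult)
qed

text \<open>Lets a perturbation that is small in norm be added to a density without losing
  positivity. The factor \<open>m\<close> is why the efficiency statement has to assume that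
  \<alpha> exceeds 1.\<close>

lemma poisson_span_sup_bound:
  assumes "0 \<le> a" "a < b" "g \<in> poisson_span m" "x \<in> {a..b}"
  shows "\<bar>g x\<bar> \<le> sqrt (2 / (b - a)) * exp b * real m * l2n a b g"
proof -
  obtain p where p: "deg_less m p" "g = (\<lambda>\<theta>. exp (- \<theta>) * poly p \<theta>)"
    using assms(3) unfolding poisson_span_iff_poly by blast
  have "\<bar>g x\<bar> \<le> 1 * \<bar>poly p x\<bar>"
    unfolding p(2) abs_mult using assms by (intro mult_right_mono) auto
  also have "\<dots> \<le> 1 * (sqrt (2 / (b - a)) * real m * l2n a b (poly p))"
    using nikolskii[OF p(1) assms(2,4)] by simp
  also have "\<dots> \<le> 1 * (sqrt (2 / (b - a)) * real m * (exp b * l2n a b g))"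
    unfolding p(2) using assms by (intro mult_left_mono l2n_poly_le_exp) auto
  finally show ?thesis by (simp add: mult_ac)
qed

text \<open>Nikolskii's inequality makes the polynomial vanish on a whole interval, so it has
  infinitely many roots. This upgrades uniqueness almost everywhere to equality of functions, which
  the definite descriptions require.\<close>

lemma poisson_span_eq_0:
  assumes "a < b" "g \<in> poisson_span m" "l2n a b g = 0"
  shows "g = (\<lambda>\<theta>. 0)"
proof -
  obtain p where p: "deg_less m p" "g = (\<lambda>\<theta>. exp (- \<theta>) * poly p \<theta>)"
    using assms(2) unfolding poisson_span_iff_poly by blast
  have "l2n a b (poly p) \<le> 0" using l2n_poly_le_exp[of a b p] assms(3) p(2) by simp
  then have "l2n a b (poly p) = 0" by (simp add: order_antisym)
  then have "poly p x = 0" if "x \<in> {a..b}" for x using nikolskii[OF p(1) assms(1) that] by simp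
  then have "{a..b} \<subseteq> {x. poly p x = 0}" by auto
  moreover have "infinite {a..b}" using assms(1) by simp
  ultimately have "p = 0" using poly_roots_finite[of p] infinite_super by blast
  then show ?thesis using p by simp
qed

text \<open>One Gram-Schmidt step per index: \<open>e\<close> is the part of the new mass orthogonal
  to the smaller span, and the projection grows by the component of \<open>f\<close> along
  \<open>e\<close>.\<close>

lemma span_projection_exists:
  assumes "f \<in> L2 a b"
  shows "\<exists>p \<in> poisson_span m. \<forall>g \<in> poisson_span m. L2inner a b (\<lambda>\<theta>. f \<theta> - p \<theta>) g = 0"
  using assms
proof (induction m arbitrary: f)
  case 0
  have "poisson_span 0 = {\<lambda>\<theta>. 0}" by (auto simp: poisson_span_def)
  then show ?case by (simp add: L2inner_def)
next
  case (Suc m)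
  obtain p where p: "p \<in> poisson_span m" "\<And>g. g \<in> poisson_span m \<Longrightarrow> L2inner a b (\<lambda>\<theta>. f \<theta> - p \<theta>) g = 0"
    using Suc.IH[OF Suc.prems] by blast
  obtain q where q: "q \<in> poisson_span m"
    "\<And>g. g \<in> poisson_span m \<Longrightarrow> L2inner a b (\<lambda>\<theta>. poisson_mass m \<theta> - q \<theta>) g = 0"
    using Suc.IH[of "poisson_mass m"] by auto
  define e where "e = (\<lambda>\<theta>. poisson_mass m \<theta> - q \<theta>)"
  define l where "l = L2inner a b f e / L2inner a b e e"
  have pL: "p \<in> L2 a b" by (rule poisson_span_L2[OF p(1)])
  have eL: "e \<in> L2 a b" unfolding e_def by (intro L2_diff poisson_span_L2[OF q(1)]) simp
  \<comment> \<open>If \<open>e\<close> is null, division by zero sets \<open>l\<close> to 0. The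
    equation still holds, because Cauchy-Schwarz makes its right-hand side vanish too.\<close>
  have le: "l * L2inner a b e e = L2inner a b f e"
  proof (cases "L2inner a b e e = 0")
    case True
    then have "l2n a b e = 0" by (simp add: L2inner_self)
    then show ?thesis using L2_cauchy_schwarz[OF Suc.prems eL] True by simp
  qed (simp add: l_def)
  have eS: "e \<in> poisson_span (Suc m)"
    unfolding e_def by (intro poisson_span_diff poisson_mass_in_span poisson_span_mono[OF q(1)]) auto
  have fp: "(\<lambda>\<theta>. f \<theta> - p \<theta>) \<in> L2 a b" by (intro L2_diff Suc.prems pL)
  show ?case
  proof (intro bexI ballI)
    show "(\<lambda>\<theta>. p \<theta> + l * e \<theta>) \<in> poisson_span (Suc m)"
      by (intro poisson_span_add poisson_span_cmult eS poisson_span_mono[OF p(1)]) auto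
    fix g assume "g \<in> poisson_span (Suc m)"
    then obtain h c where h: "h \<in> poisson_span m" and g: "g = (\<lambda>\<theta>. h \<theta> + c * poisson_mass m \<theta>)"
      by (rule poisson_span_Suc)
    define h' where "h' = (\<lambda>\<theta>. h \<theta> + c * q \<theta>)"
    have h': "h' \<in> poisson_span m" unfolding h'_def by (intro poisson_span_add poisson_span_cmult h q(1))
    have h'L: "h' \<in> L2 a b" by (rule poisson_span_L2[OF h'])
    have g: "g = (\<lambda>\<theta>. h' \<theta> + c * e \<theta>)" unfolding g h'_def e_def by (auto simp: algebra_simps)
    have eh: "L2inner a b e h' = 0" using q(2)[OF h'] by (simp add: e_def)
    have pe: "L2inner a b p e = 0" using q(2)[OF p(1)] by (simp add: e_def L2inner_commute)
    have "L2inner a b (\<lambda>\<theta>. (f \<theta> - p \<theta>) - l * e \<theta>) g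
        = L2inner a b (\<lambda>\<theta>. f \<theta> - p \<theta>) g - l * L2inner a b e g"
      unfolding g using fp eL h'L
      by (subst L2inner_diff_left) (auto simp: L2inner_cmult_left intro!: L2_add L2_cmult)
    also have "L2inner a b (\<lambda>\<theta>. f \<theta> - p \<theta>) g = c * L2inner a b f e"
      unfolding g using fp eL h'L pL Suc.prems
      by (simp add: L2inner_add_right L2_cmult L2inner_cmult_right p(2)[OF h'] L2inner_diff_left pe)
    also have "L2inner a b e g = c * L2inner a b e e"
      unfolding g using eL h'L by (simp add: L2inner_add_right L2_cmult L2inner_cmult_right eh)
    finally show "L2inner a b (\<lambda>\<theta>. f \<theta> - (p \<theta> + l * e \<theta>)) g = 0"
      using le by (simp add: algebra_simps)
  qed
qed

lemma span_projection_unique: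
  assumes "a < b" "f \<in> L2 a b"
    and p: "p \<in> poisson_span m" "\<forall>g \<in> poisson_span m. L2inner a b (\<lambda>\<theta>. f \<theta> - p \<theta>) g = 0"
    and q: "q \<in> poisson_span m" "\<forall>g \<in> poisson_span m. L2inner a b (\<lambda>\<theta>. f \<theta> - q \<theta>) g = 0"
  shows "p = q"
proof -
  define d where "d = (\<lambda>\<theta>. p \<theta> - q \<theta>)"
  have d: "d \<in> poisson_span m" unfolding d_def by (intro poisson_span_diff p q)
  have L: "p \<in> L2 a b" "q \<in> L2 a b" "d \<in> L2 a b" using p q d by (auto intro: poisson_span_L2)
  have "L2inner a b f d = L2inner a b p d" "L2inner a b f d = L2inner a b q d"
    using p(2)[rule_format, OF d] q(2)[rule_format, OF d] L assms(2) by (simp_all add: L2inner_diff_left)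
  then have "L2inner a b (\<lambda>\<theta>. p \<theta> - q \<theta>) d = 0" using L by (simp add: L2inner_diff_left)
  then have "l2n a b d = 0" unfolding d_def[symmetric] by (simp add: L2inner_self)
  then have "d = (\<lambda>\<theta>. 0)" by (rule poisson_span_eq_0[OF assms(1) d])
  then show ?thesis by (auto simp: d_def fun_eq_iff)
qed

lemma span_projection_props:
  assumes "a < b" "f \<in> L2 a b"
  shows span_projection_in: "span_projection a b m f \<in> poisson_span m"
    and span_projection_orthogonal:
      "g \<in> poisson_span m \<Longrightarrow> L2inner a b (\<lambda>\<theta>. f \<theta> - span_projection a b m f \<theta>) g = 0"
proof -
  have "\<exists>!p. p \<in> poisson_span m \<and> (\<forall>g \<in> poisson_span m. L2inner a b (\<lambda>\<theta>. f \<theta> - p \<theta>) g = 0)"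
    using span_projection_exists[OF assms(2), of m] span_projection_unique[OF assms] by blast
  from theI'[OF this] show "span_projection a b m f \<in> poisson_span m"
    "g \<in> poisson_span m \<Longrightarrow> L2inner a b (\<lambda>\<theta>. f \<theta> - span_projection a b m f \<theta>) g = 0"
    unfolding span_projection_def by blast+
qed

lemma span_projection_best:
  assumes "a < b" "f \<in> L2 a b" "g \<in> poisson_span m"
  shows "l2n a b (\<lambda>\<theta>. f \<theta> - span_projection a b m f \<theta>) \<le> l2n a b (\<lambda>\<theta>. f \<theta> - g \<theta>)"
proof -
  define p where "p = span_projection a b m f"
  have p: "p \<in> poisson_span m" unfolding p_def by (rule span_projection_in[OF assms(1,2)])
  have d: "(\<lambda>\<theta>. p \<theta> - g \<theta>) \<in> poisson_span m" by (intro poisson_span_diff p assms)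
  have "L2inner a b (\<lambda>\<theta>. f \<theta> - p \<theta>) (\<lambda>\<theta>. p \<theta> - g \<theta>) = 0"
    unfolding p_def by (rule span_projection_orthogonal[OF assms(1,2) d[unfolded p_def]])
  then have "(l2n a b (\<lambda>\<theta>. (f \<theta> - p \<theta>) + (p \<theta> - g \<theta>)))\<^sup>2
      = (l2n a b (\<lambda>\<theta>. f \<theta> - p \<theta>))\<^sup>2 + (l2n a b (\<lambda>\<theta>. p \<theta> - g \<theta>))\<^sup>2"
    by (intro l2n_pythagoras L2_diff assms poisson_span_L2[OF p] poisson_span_L2[OF d]) auto
  then have "(l2n a b (\<lambda>\<theta>. f \<theta> - p \<theta>))\<^sup>2 \<le> (l2n a b (\<lambda>\<theta>. f \<theta> - g \<theta>))\<^sup>2" by simp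
  then show ?thesis unfolding p_def by (rule power2_le_imp_le) simp
qed

text \<open>The residual of a Poisson mass after projection. Its inner product with that mass is its
  own squared norm, which is positive since the mass lies outside the smaller span.\<close>

lemma poisson_residual:
  assumes "a < b"
  obtains e where "e \<in> poisson_span (Suc m)" "\<And>g. g \<in> poisson_span m \<Longrightarrow> L2inner a b e g = 0"
    "L2inner a b e (poisson_mass m) \<noteq> 0"
proof -
  define q where "q = span_projection a b m (poisson_mass m)"
  define e where "e = (\<lambda>\<theta>. poisson_mass m \<theta> - q \<theta>)"
  have q: "q \<in> poisson_span m" unfolding q_def by (rule span_projection_in[OF assms]) simp
  have e: "e \<in> poisson_span (Suc m)"
    unfolding e_def by (intro poisson_span_diff poisson_mass_in_span poisson_span_mono[OF q]) auto
  have orth: "L2inner a b e g = 0" if "g \<in> poisson_span m" for g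
    unfolding e_def q_def by (rule span_projection_orthogonal[OF assms _ that]) simp
  have "e \<noteq> (\<lambda>\<theta>. 0)"
  proof
    assume "e = (\<lambda>\<theta>. 0)"
    then have "poisson_mass m = q" by (auto simp: e_def fun_eq_iff)
    then show False using poisson_mass_not_in_span q by metis
  qed
  then have "l2n a b e \<noteq> 0" using poisson_span_eq_0[OF assms e] by blast
  then have "L2inner a b e e \<noteq> 0" by (simp add: L2inner_self)
  moreover have "L2inner a b e e = L2inner a b e (poisson_mass m) - L2inner a b e q"
    by (subst (2) e_def) (intro L2inner_diff_right poisson_span_L2[OF e] poisson_span_L2[OF q] poisson_mass_L2)
  ultimately show ?thesis using that[OF e orth] orth[OF q] by simp
qed

text \<open>As in Newton interpolation, the correction for the last condition is a multiple of the
  residual, which is orthogonal to all earlier masses and so leaves their conditions intact.\<close>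

lemma span_interpolation:
  assumes "a < b"
  shows "\<exists>g \<in> poisson_span m. \<forall>k<m. L2inner a b g (poisson_mass k) = d k"
proof (induction m)
  case 0
  then show ?case using poisson_span_zero by auto
next
  case (Suc m)
  then obtain g where g: "g \<in> poisson_span m" "\<And>k. k < m \<Longrightarrow> L2inner a b g (poisson_mass k) = d k" by blast
  obtain e where e: "e \<in> poisson_span (Suc m)" "\<And>g. g \<in> poisson_span m \<Longrightarrow> L2inner a b e g = 0"
    "L2inner a b e (poisson_mass m) \<noteq> 0" using poisson_residual[OF assms] by metis
  define l where "l = (d m - L2inner a b g (poisson_mass m)) / L2inner a b e (poisson_mass m)"
  have eq: "L2inner a b (\<lambda>\<theta>. g \<theta> + l * e \<theta>) (poisson_mass k)
      = L2inner a b g (poisson_mass k) + l * L2inner a b e (poisson_mass k)" for k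
    using poisson_span_L2[OF g(1)] poisson_span_L2[OF e(1)]
    by (simp add: L2inner_add_left L2_cmult L2inner_cmult_left)
  show ?case
  proof (intro bexI allI impI)
    show "(\<lambda>\<theta>. g \<theta> + l * e \<theta>) \<in> poisson_span (Suc m)"
      by (intro poisson_span_add poisson_span_cmult e(1) poisson_span_mono[OF g(1)]) auto
    fix k assume "k < Suc m"
    then consider "k < m" | "k = m" by linarith
    then show "L2inner a b (\<lambda>\<theta>. g \<theta> + l * e \<theta>) (poisson_mass k) = d k"
    proof cases
      case 1
      then show ?thesis using g(2) e(2)[OF poisson_mass_in_span[OF 1]] by (simp add: eq)
    next
      case 2
      then show ?thesis using e(3) unfolding 2 eq by (simp add: l_def)
    qed
  qed
qed

text \<open>Measures how ill-posed the recovery of an element from its masses is. Write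
  \<open>v\<close> as a combination of masses with coefficients \<open>fact k * coeff p k\<close>
  and test it against itself: the polynomial coefficients are at most \<open>(K * E)^m\<close> times
  the norm of \<open>v\<close>, and one factor of that norm cancels.\<close>

lemma poisson_span_norm_bound:
  assumes "a < b"
  shows "\<exists>K\<ge>1. \<forall>m. \<forall>v \<in> poisson_span m.
           l2n a b v \<le> K ^ m * (\<Sum>k<m. fact k * \<bar>L2inner a b v (poisson_mass k)\<bar>)"
proof -
  obtain K where K: "K \<ge> 1" "\<And>m p k. deg_less m p \<Longrightarrow> \<bar>coeff p k\<bar> \<le> K ^ m * l2n a b (poly p)"
    using coeff_bound_L2[OF assms] by blast
  define E where "E = exp \<bar>b\<bar>"
  have E: "E \<ge> 1" by (simp add: E_def)
  have "l2n a b v \<le> (K * E) ^ m * (\<Sum>k<m. fact k * \<bar>L2inner a b v (poisson_mass k)\<bar>)"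
    if v: "v \<in> poisson_span m" for m v
  proof (cases "m = 0")
    case True
    then have "v = (\<lambda>\<theta>. 0)" using v by (auto simp: poisson_span_def)
    then show ?thesis using True by (simp add: l2n_def L2inner_def)
  next
    case False
    obtain p where p: "deg_less m p" "v = (\<lambda>\<theta>. exp (- \<theta>) * poly p \<theta>)"
      using v unfolding poisson_span_iff_poly by blast
    have vL: "v \<in> L2 a b" by (rule poisson_span_L2[OF v])
    have c: "\<bar>coeff p k\<bar> \<le> (K * E) ^ m * l2n a b v" for k
    proof -
      have "\<bar>coeff p k\<bar> \<le> K ^ m * l2n a b (poly p)" by (rule K(2)[OF p(1)])
      also have "\<dots> \<le> K ^ m * (E ^ m * l2n a b v)"
      proof (intro mult_left_mono)
        have "l2n a b (poly p) \<le> exp b * l2n a b v" unfolding p(2) by (rule l2n_poly_le_exp)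
        also have "\<dots> \<le> E ^ m * l2n a b v"
        proof (intro mult_right_mono)
          have "exp b \<le> E" by (simp add: E_def)
          also have "\<dots> \<le> E ^ m" using E False by (intro self_le_power) auto
          finally show "exp b \<le> E ^ m" .
        qed simp
        finally show "l2n a b (poly p) \<le> E ^ m * l2n a b v" .
      qed (use K in auto)
      finally show ?thesis by (simp add: power_mult_distrib mult_ac)
    qed
    have "p = (\<Sum>k<m. monom (coeff p k) k)"
    proof (rule poly_eqI)
      fix i show "coeff p i = coeff (\<Sum>k<m. monom (coeff p k) k) i"
        using p(1) by (cases "i < m") (auto simp: coeff_sum deg_less_iff)
    qed
    then have "poly p \<theta> = (\<Sum>k<m. coeff p k * \<theta> ^ k)" for \<theta>
      by (metis (no_types, lifting) poly_monom poly_sum sum.cong)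
    then have "v = (\<lambda>\<theta>. \<Sum>k<m. (fact k * coeff p k) * poisson_mass k \<theta>)"
      by (auto simp: p(2) sum_distrib_left poisson_mass_def intro!: sum.cong)
    then have "L2inner a b v v = L2inner a b v (\<lambda>\<theta>. \<Sum>k<m. (fact k * coeff p k) * poisson_mass k \<theta>)"
      by simp
    also have "\<dots> = (\<Sum>k<m. (fact k * coeff p k) * L2inner a b v (poisson_mass k))"
      using vL by (subst L2inner_sum_right) (auto simp: L2inner_cmult_right intro!: L2_cmult)
    also have "\<dots> \<le> (\<Sum>k<m. fact k * ((K * E) ^ m * l2n a b v) * \<bar>L2inner a b v (poisson_mass k)\<bar>)"
    proof (intro sum_mono)
      fix k
      have "(fact k * coeff p k) * L2inner a b v (poisson_mass k)
          \<le> \<bar>(fact k * coeff p k) * L2inner a b v (poisson_mass k)\<bar>" by simp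
      also have "\<dots> = fact k * \<bar>coeff p k\<bar> * \<bar>L2inner a b v (poisson_mass k)\<bar>" by (simp add: abs_mult)
      also have "\<dots> \<le> fact k * ((K * E) ^ m * l2n a b v) * \<bar>L2inner a b v (poisson_mass k)\<bar>"
        by (intro mult_right_mono mult_left_mono c) auto
      finally show "(fact k * coeff p k) * L2inner a b v (poisson_mass k)
          \<le> fact k * ((K * E) ^ m * l2n a b v) * \<bar>L2inner a b v (poisson_mass k)\<bar>" .
    qed
    also have "\<dots> = l2n a b v * ((K * E) ^ m * (\<Sum>k<m. fact k * \<bar>L2inner a b v (poisson_mass k)\<bar>))"
      by (simp add: sum_distrib_left mult_ac)
    finally have *: "l2n a b v * l2n a b v
        \<le> l2n a b v * ((K * E) ^ m * (\<Sum>k<m. fact k * \<bar>L2inner a b v (poisson_mass k)\<bar>))"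
      by (simp add: L2inner_self power2_eq_square)
    show ?thesis
    proof (cases "l2n a b v = 0")
      case True
      then show ?thesis using K E by (simp add: sum_nonneg)
    next
      case False
      then have "0 < l2n a b v" using l2n_nonneg[of a b v] by linarith
      then show ?thesis using * by (simp only: mult_le_cancel_left_pos)
    qed
  qed
  moreover have "1 \<le> K * E" using K E by (metis mult_mono' mult_1 zero_le_one)
  ultimately show ?thesis by blast
qed

section \<open>The projection estimator is well defined\<close>

lemma projection_estimator_props:
  assumes "a < b"
  shows projection_estimator_in: "projection_estimator a b m n x \<in> poisson_span m"
    and projection_estimator_inner:
      "k < m \<Longrightarrow> L2inner a b (projection_estimator a b m n x) (poisson_mass k) = empirical_mass n x k"
proof -
  have "\<exists>!g. g \<in> poisson_span m \<and> (\<forall>k<m. L2inner a b g (poisson_mass k) = empirical_mass n x k)"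
  proof (rule ex_ex1I)
    show "\<exists>g. g \<in> poisson_span m \<and> (\<forall>k<m. L2inner a b g (poisson_mass k) = empirical_mass n x k)"
      using span_interpolation[OF assms] by blast
  next
    fix g h
    assume g: "g \<in> poisson_span m \<and> (\<forall>k<m. L2inner a b g (poisson_mass k) = empirical_mass n x k)"
      and h: "h \<in> poisson_span m \<and> (\<forall>k<m. L2inner a b h (poisson_mass k) = empirical_mass n x k)"
    define d where "d = (\<lambda>\<theta>. g \<theta> - h \<theta>)"
    have d: "d \<in> poisson_span m" using g h unfolding d_def by (intro poisson_span_diff) auto
    have "L2inner a b d (poisson_mass k) = 0" if "k < m" for k
      unfolding d_def using g h that poisson_span_L2 by (subst L2inner_diff_left) auto
    moreover obtain K where "l2n a b d \<le> K ^ m * (\<Sum>k<m. fact k * \<bar>L2inner a b d (poisson_mass k)\<bar>)"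
      using poisson_span_norm_bound[OF assms] d by blast
    ultimately have "l2n a b d = 0" by (simp add: order_antisym)
    then have "d = (\<lambda>\<theta>. 0)" by (rule poisson_span_eq_0[OF assms d])
    then show "g = h" by (auto simp: d_def fun_eq_iff)
  qed
  from theI'[OF this] show "projection_estimator a b m n x \<in> poisson_span m"
    "k < m \<Longrightarrow> L2inner a b (projection_estimator a b m n x) (poisson_mass k) = empirical_mass n x k"
    unfolding projection_estimator_def by blast+
qed

lemma projection_estimator_estimator: "a < b \<Longrightarrow> projection_estimator a b m n \<in> estimators a b n"
  by (auto simp: estimators_def intro!: poisson_span_L2 projection_estimator_in)

section \<open>Mixtures and samples\<close>

lemma mixture_mass_eq_L2inner: "mixture_mass a b f k = L2inner a b f (poisson_mass k)"
  by (simp add: mixture_mass_def L2inner_def mult.commute)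

lemma L2_densities_L2: "f \<in> L2_densities a b \<Longrightarrow> f \<in> L2 a b"
  by (simp add: L2_densities_def)

lemma L2_integrable: "f \<in> L2 a b \<Longrightarrow> integrable (interval_measure a b) f"
  using L2_integrable_mult[of f a b "\<lambda>_. 1"] L2_continuous[of a b "\<lambda>_. 1"] by simp

text \<open>The tail is \<open>exp (t - \<theta>) \<theta>^m / m!\<close> for an intermediate point
  \<open>t\<close> of the Lagrange remainder, and \<open>t\<close> does not exceed \<theta>, so the
  exponential is at most one.\<close>

lemma poisson_partial_sum_ge:
  assumes "0 \<le> (\<theta>::real)"
  shows "1 - \<theta> ^ m / fact m \<le> (\<Sum>k<m. poisson_mass k \<theta>)"
proof -
  obtain t where t: "\<bar>t\<bar> \<le> \<bar>\<theta>\<bar>" "exp \<theta> = (\<Sum>k<m. \<theta> ^ k / fact k) + exp t / fact m * \<theta> ^ m"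
    using Maclaurin_exp_le[of \<theta> m] by blast
  have "exp (- \<theta>) * (exp t * (\<theta> ^ m / fact m)) = exp (t - \<theta>) * (\<theta> ^ m / fact m)"
    by (simp add: exp_add[symmetric] mult.assoc[symmetric])
  also have "\<dots> \<le> 1 * (\<theta> ^ m / fact m)"
    using t(1) assms by (intro mult_right_mono) auto
  finally have "exp (- \<theta>) * (exp t / fact m * \<theta> ^ m) \<le> \<theta> ^ m / fact m" by simp
  moreover have "1 = exp (- \<theta>) * exp \<theta>" by (simp add: exp_add[symmetric])
  then have "1 = (\<Sum>k<m. poisson_mass k \<theta>) + exp (- \<theta>) * (exp t / fact m * \<theta> ^ m)"
    unfolding t(2) by (simp add: distrib_left sum_distrib_left poisson_mass_def)
  ultimately show ?thesis by linarith
qed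

lemma poisson_mass_sums: "(\<lambda>k. poisson_mass k \<theta>) sums 1"
proof -
  have "(\<lambda>k. exp (- \<theta>) * (\<theta> ^ k /\<^sub>R fact k)) sums (exp (- \<theta>) * exp \<theta>)"
    by (intro sums_mult exp_converges)
  then show ?thesis by (simp add: poisson_mass_def exp_add[symmetric] field_simps scaleR_conv_of_real)
qed

lemma poisson_mass_le: "0 \<le> \<theta> \<Longrightarrow> \<theta> \<le> b \<Longrightarrow> poisson_mass k \<theta> \<le> b ^ k / fact k"
proof -
  assume "0 \<le> \<theta>" "\<theta> \<le> b"
  then have "exp (- \<theta>) * \<theta> ^ k \<le> 1 * b ^ k" by (intro mult_mono power_mono) auto
  then show ?thesis by (simp add: poisson_mass_def divide_right_mono)
qed

context
  fixes a b :: real and f :: "real \<Rightarrow> real"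
  assumes a: "0 \<le> a" and f: "f \<in> L2_densities a b"
begin

lemma density_AE: "AE \<theta> in interval_measure a b. 0 \<le> \<theta> \<and> \<theta> \<in> {a..b} \<and> 0 \<le> f \<theta>"
  using f a by (auto simp: L2_densities_def space_restrict_space intro: AE_mp[OF _ AE_I2])

lemma mixture_integrable: "integrable (interval_measure a b) (\<lambda>\<theta>. poisson_mass k \<theta> * f \<theta>)"
  using L2_integrable_mult[OF poisson_mass_L2 L2_densities_L2[OF f]] .

lemma mixture_mass_nonneg: "0 \<le> mixture_mass a b f k"
  unfolding mixture_mass_def
  by (rule integral_nonneg_AE) (use density_AE in \<open>auto intro: poisson_mass_nonneg mult_nonneg_nonneg\<close>)

text \<open>The decay \<open>1 / k!\<close> of the masses later cancels one of the two factorials in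
  the variance of the estimator.\<close>

lemma mixture_mass_le: "mixture_mass a b f k \<le> b ^ k / fact k"
proof -
  have "mixture_mass a b f k \<le> (\<integral>\<theta>. b ^ k / fact k * f \<theta> \<partial>interval_measure a b)"
    unfolding mixture_mass_def
  proof (rule integral_mono_AE)
    show "integrable (interval_measure a b) (\<lambda>\<theta>. b ^ k / fact k * f \<theta>)"
      using L2_integrable[OF L2_densities_L2[OF f]] by simp
    show "AE \<theta> in interval_measure a b. poisson_mass k \<theta> * f \<theta> \<le> b ^ k / fact k * f \<theta>"
      using density_AE by eventually_elim (rule mult_right_mono[OF poisson_mass_le], auto)
  qed (rule mixture_integrable)
  then show ?thesis using f by (simp add: L2_densities_def)
qed

lemma mixture_partial_sum_ge: "1 - b ^ m / fact m \<le> (\<Sum>k<m. mixture_mass a b f k)"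
proof -
  have "1 - b ^ m / fact m = (\<integral>\<theta>. (1 - b ^ m / fact m) * f \<theta> \<partial>interval_measure a b)"
    using f by (simp add: L2_densities_def)
  also have "\<dots> \<le> (\<integral>\<theta>. (\<Sum>k<m. poisson_mass k \<theta> * f \<theta>) \<partial>interval_measure a b)"
  proof (rule integral_mono_AE)
    show "integrable (interval_measure a b) (\<lambda>\<theta>. (1 - b ^ m / fact m) * f \<theta>)"
      using L2_integrable[OF L2_densities_L2[OF f]] by simp
    show "integrable (interval_measure a b) (\<lambda>\<theta>. \<Sum>k<m. poisson_mass k \<theta> * f \<theta>)"
      by (intro Bochner_Integration.integrable_sum mixture_integrable)
    show "AE \<theta> in interval_measure a b. (1 - b ^ m / fact m) * f \<theta> \<le> (\<Sum>k<m. poisson_mass k \<theta> * f \<theta>)"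
      using density_AE
    proof eventually_elim
      case (elim \<theta>)
      then have "\<theta> ^ m / fact m \<le> b ^ m / fact m" by (intro divide_right_mono power_mono) auto
      then have "1 - b ^ m / fact m \<le> (\<Sum>k<m. poisson_mass k \<theta>)"
        using poisson_partial_sum_ge[of \<theta> m] elim by linarith
      then show ?case unfolding sum_distrib_right[symmetric] using elim by (intro mult_right_mono) auto
    qed
  qed
  also have "\<dots> = (\<Sum>k<m. mixture_mass a b f k)"
    unfolding mixture_mass_def by (intro Bochner_Integration.integral_sum mixture_integrable)
  finally show ?thesis .
qed

text \<open>In this form the sum over \<open>k\<close> can be exchanged with the integral by
  monotone convergence, which yields total mass one.\<close>

lemma ennreal_mixture_mass:
  "ennreal (mixture_mass a b f k) = (\<integral>\<^sup>+ \<theta>. ennreal (poisson_mass k \<theta>) * ennreal (f \<theta>) \<partial>interval_measure a b)"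
proof -
  have "ennreal (mixture_mass a b f k) = (\<integral>\<^sup>+ \<theta>. ennreal (poisson_mass k \<theta> * f \<theta>) \<partial>interval_measure a b)"
    unfolding mixture_mass_def
    by (rule nn_integral_eq_integral[OF mixture_integrable, symmetric])
       (use density_AE in \<open>auto intro: poisson_mass_nonneg mult_nonneg_nonneg\<close>)
  also have "\<dots> = (\<integral>\<^sup>+ \<theta>. ennreal (poisson_mass k \<theta>) * ennreal (f \<theta>) \<partial>interval_measure a b)"
  proof (rule nn_integral_cong_AE)
    show "AE \<theta> in interval_measure a b.
        ennreal (poisson_mass k \<theta> * f \<theta>) = ennreal (poisson_mass k \<theta>) * ennreal (f \<theta>)"
      using density_AE by eventually_elim (simp add: ennreal_mult poisson_mass_nonneg)
  qed
  finally show ?thesis .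
qed

lemma prob_space_mixture: "prob_space (mixture a b f)"
proof
  have m: "f \<in> borel_measurable (interval_measure a b)" by (rule L2_measurable[OF L2_densities_L2[OF f]])
  have pm: "poisson_mass k \<in> borel_measurable (interval_measure a b)" for k
    by (rule L2_measurable[OF poisson_mass_L2])
  have "emeasure (mixture a b f) (space (mixture a b f)) = (\<integral>\<^sup>+ k. ennreal (mixture_mass a b f k) \<partial>count_space UNIV)"
    by (simp add: mixture_def emeasure_density)
  also have "\<dots> = (\<Sum>k. ennreal (mixture_mass a b f k))" by (rule nn_integral_count_space_nat)
  also have "\<dots> = (\<integral>\<^sup>+ \<theta>. (\<Sum>k. ennreal (poisson_mass k \<theta>) * ennreal (f \<theta>)) \<partial>interval_measure a b)"
    unfolding ennreal_mixture_mass
    by (rule nn_integral_suminf[symmetric]) (intro borel_measurable_times_ennreal measurable_compose[OF pm measurable_ennreal] measurable_compose[OF m measurable_ennreal])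
  also have "\<dots> = (\<integral>\<^sup>+ \<theta>. ennreal (f \<theta>) \<partial>interval_measure a b)"
  proof (rule nn_integral_cong_AE)
    show "AE \<theta> in interval_measure a b. (\<Sum>k. ennreal (poisson_mass k \<theta>) * ennreal (f \<theta>)) = ennreal (f \<theta>)"
      using density_AE
    proof eventually_elim
      case (elim \<theta>)
      have "(\<Sum>k. ennreal (poisson_mass k \<theta>)) = ennreal (\<Sum>k. poisson_mass k \<theta>)"
        using elim sums_summable[OF poisson_mass_sums]
        by (intro suminf_ennreal2) (auto simp: poisson_mass_nonneg)
      also have "(\<Sum>k. poisson_mass k \<theta>) = 1" by (rule sums_unique[OF poisson_mass_sums, symmetric])
      finally show ?case by (simp only: ennreal_suminf_multc ennreal_1 mult_1)
    qed
  qed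
  also have "\<dots> = 1"
  proof -
    have "(\<integral>\<^sup>+ \<theta>. ennreal (f \<theta>) \<partial>interval_measure a b) = ennreal (\<integral>\<theta>. f \<theta> \<partial>interval_measure a b)"
      by (rule nn_integral_eq_integral[OF L2_integrable[OF L2_densities_L2[OF f]]])
         (use f in \<open>simp add: L2_densities_def\<close>)
    then show ?thesis using f by (simp add: L2_densities_def)
  qed
  finally show "emeasure (mixture a b f) (space (mixture a b f)) = 1" .
qed

lemma emeasure_mixture:
  assumes "finite A"
  shows "emeasure (mixture a b f) A = ennreal (\<Sum>k\<in>A. mixture_mass a b f k)"
proof -
  have "emeasure (mixture a b f) A = (\<integral>\<^sup>+ k. ennreal (mixture_mass a b f k) * indicator A k \<partial>count_space UNIV)"
    by (simp add: mixture_def emeasure_density)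
  also have "\<dots> = (\<Sum>k\<in>A. ennreal (mixture_mass a b f k))"
    using nn_integral_indicator_finite[OF assms, of "count_space UNIV" "\<lambda>k. ennreal (mixture_mass a b f k)"]
    by simp
  also have "\<dots> = ennreal (\<Sum>k\<in>A. mixture_mass a b f k)"
    by (rule sum_ennreal) (rule mixture_mass_nonneg)
  finally show ?thesis .
qed

lemma sets_mixture: "sets (mixture a b f) = UNIV" and space_mixture: "space (mixture a b f) = UNIV"
  by (simp_all add: mixture_def)

section \<open>Product law of the sample and variance of the empirical masses\<close>

lemma emeasure_sample_PiE:
  assumes "\<And>i. i < n \<Longrightarrow> finite (A i)"
  shows "emeasure (sample_law a b f n) (PiE {..<n} A) = (\<Prod>i<n. ennreal (\<Sum>k\<in>A i. mixture_mass a b f k))"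
proof -
  interpret product_prob_space "\<lambda>_. mixture a b f" "{..<n}"
    by (intro product_prob_spaceI prob_space_mixture)
  show ?thesis unfolding sample_law_def
    by (subst emeasure_PiM) (auto simp: sets_mixture emeasure_mixture assms intro!: prod.cong)
qed

lemma prob_space_sample: "prob_space (sample_law a b f n)"
  unfolding sample_law_def by (rule prob_space_PiM) (rule prob_space_mixture)

lemma space_sample: "space (sample_law a b f n) = {..<n} \<rightarrow>\<^sub>E UNIV"
  by (simp add: sample_law_def space_PiM space_mixture)

lemma measurable_sample: "g \<in> measurable (sample_law a b f n) M" if "\<And>x. x \<in> {..<n} \<rightarrow>\<^sub>E UNIV \<Longrightarrow> g x \<in> space M"
  using that by (auto simp: measurable_def sets_sample_law space_sample)

lemma borel_measurable_sample: "g \<in> borel_measurable (sample_law a b f n)"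
  by (rule measurable_sample) simp

lemma mixture_integral_indicator: "(\<integral>y. indicator {k} y \<partial>mixture a b f) = mixture_mass a b f k"
  by (simp add: sets_mixture space_mixture measure_def emeasure_mixture mixture_mass_nonneg)

lemma sample_covariance:
  assumes ij: "i < n" "j < n" and p_def: "p = mixture_mass a b f k"
  shows "(\<integral>x. (indicator {k} (x i) - p) * (indicator {k} (x j) - p) \<partial>sample_law a b f n)
           = (if i = j then p - p\<^sup>2 else 0)"
proof -
  note assms = ij
  interpret Q: prob_space "mixture a b f" by (rule prob_space_mixture)
  have int: "integrable (mixture a b f) g" if "\<And>y. \<bar>g y\<bar> \<le> B" for g :: "nat \<Rightarrow> real" and B
    by (rule Q.integrable_const_bound[where B=B]) (use that in \<open>auto simp: measurable_def sets_mixture space_mixture\<close>)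
  interpret product_prob_space "\<lambda>_. mixture a b f" "{..<n}"
    by (intro product_prob_spaceI prob_space_mixture)
  define Y where "Y = (\<lambda>y. indicator {k} y - p)"
  have Yb: "\<bar>Y y\<bar> \<le> 1 + \<bar>p\<bar>" for y by (auto simp: Y_def indicator_def)
  have indint: "integrable (mixture a b f) (indicator {k} :: nat \<Rightarrow> real)"
    by (rule int[of _ 1]) (auto simp: indicator_def)
  have EY: "(\<integral>y. Y y \<partial>mixture a b f) = 0"
    unfolding Y_def using indint mixture_integral_indicator[of k] by (simp add: Q.prob_space p_def)
  have "(\<lambda>y. Y y * Y y) = (\<lambda>y. (1 - 2 * p) * indicator {k} y + p\<^sup>2)"
    by (auto simp: Y_def indicator_def power2_eq_square algebra_simps)
  then have EYY: "(\<integral>y. Y y * Y y \<partial>mixture a b f) = p - p\<^sup>2"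
    using indint mixture_integral_indicator[of k]
    by (simp add: Q.prob_space p_def power2_eq_square algebra_simps del: integral_indicator)
  \<comment> \<open>Factors equal to 1 except at positions \<open>i\<close> and \<open>j\<close>, so
    that the product over all positions is the wanted product. Writing it this way covers
    \<open>i = j\<close> and \<open>i \<noteq> j\<close> by the same product formula.\<close>
  define h where "h l = (\<lambda>y. (if l = i then Y y else 1) * (if l = j then Y y else 1))" for l
  have hint: "integrable (mixture a b f) (h l)" for l
  proof (rule int)
    fix y
    have "\<bar>if l = i then Y y else 1\<bar> \<le> 1 + \<bar>p\<bar>" "\<bar>if l = j then Y y else 1\<bar> \<le> 1 + \<bar>p\<bar>" using Yb[of y] by auto
    then show "\<bar>h l y\<bar> \<le> (1 + \<bar>p\<bar>) * (1 + \<bar>p\<bar>)" unfolding h_def abs_mult by (intro mult_mono) auto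
  qed
  have "(\<integral>x. Y (x i) * Y (x j) \<partial>sample_law a b f n) = (\<integral>x. (\<Prod>l<n. h l (x l)) \<partial>sample_law a b f n)"
  proof (rule Bochner_Integration.integral_cong[OF refl])
    fix x :: "nat \<Rightarrow> nat"
    have "(\<Prod>l<n. h l (x l)) = (\<Prod>l<n. if l = i then Y (x l) else 1) * (\<Prod>l<n. if l = j then Y (x l) else 1)"
      unfolding h_def by (rule prod.distrib)
    also have "\<dots> = Y (x i) * Y (x j)" using assms by simp
    finally show "Y (x i) * Y (x j) = (\<Prod>l<n. h l (x l))" ..
  qed
  also have "\<dots> = (\<Prod>l<n. \<integral>y. h l y \<partial>mixture a b f)"
    unfolding sample_law_def by (rule product_integral_prod) (auto intro: hint)
  also have "\<dots> = (if i = j then p - p\<^sup>2 else 0)"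
  proof (cases "i = j")
    case True
    have "(\<integral>y. h l y \<partial>mixture a b f) = (if l = i then p - p\<^sup>2 else 1)" for l
      using EYY True by (auto simp: h_def Q.prob_space)
    then show ?thesis using True assms by simp
  next
    case False
    have "(\<integral>y. h i y \<partial>mixture a b f) = 0" using EY False by (simp add: h_def)
    then show ?thesis using False assms by (auto intro!: prod_zero bexI[of _ i])
  qed
  finally show ?thesis by (simp add: Y_def)
qed

text \<open>Off-diagonal covariances vanish by independence, leaving \<open>(p - p^2) / n\<close>.
  It is bounded by \<open>p / n\<close> and not by a constant over \<open>n\<close>, because
  \<open>p\<close> is as small as \<open>b^k / k!\<close>.\<close>

lemma empirical_variance:
  assumes "0 < n"
  shows "(\<integral>\<^sup>+ x. ennreal ((empirical_mass n x k - mixture_mass a b f k)\<^sup>2) \<partial>sample_law a b f n)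
           \<le> ennreal (mixture_mass a b f k / real n)"
proof -
  interpret S: prob_space "sample_law a b f n" by (rule prob_space_sample)
  define p where "p = mixture_mass a b f k"
  define Y where "Y i x = indicator {k} (x i) - p" for i :: nat and x :: "nat \<Rightarrow> nat"
  have int: "integrable (sample_law a b f n) (\<lambda>x. Y i x * Y j x)" for i j
  proof (rule S.integrable_const_bound[where B="(1 + \<bar>p\<bar>) * (1 + \<bar>p\<bar>)"])
    have "\<bar>Y i x\<bar> \<le> 1 + \<bar>p\<bar>" for i x by (auto simp: Y_def indicator_def)
    then have "\<bar>Y i x * Y j x\<bar> \<le> (1 + \<bar>p\<bar>) * (1 + \<bar>p\<bar>)" for x unfolding abs_mult by (intro mult_mono) auto
    then show "AE x in sample_law a b f n. norm (Y i x * Y j x) \<le> (1 + \<bar>p\<bar>) * (1 + \<bar>p\<bar>)" by simp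
  qed (rule borel_measurable_sample)
  have emp: "(empirical_mass n x k - p)\<^sup>2 = (\<Sum>i<n. \<Sum>j<n. Y i x * Y j x) / (real n)\<^sup>2" for x
  proof -
    have "real (card {i \<in> {..<n}. x i = k}) = (\<Sum>i<n. indicator {k} (x i))"
      by (simp add: indicator_def sum.If_cases Int_def conj_commute)
    then have "empirical_mass n x k - p = (\<Sum>i<n. Y i x) / real n"
      using assms by (simp add: empirical_mass_def Y_def sum_subtractf field_simps)
    then show ?thesis by (simp add: power_divide power2_eq_square sum_product)
  qed
  have eq: "(\<integral>x. (\<Sum>i<n. \<Sum>j<n. Y i x * Y j x) \<partial>sample_law a b f n) = real n * (p - p\<^sup>2)"
  proof -
    have "(\<integral>x. (\<Sum>i<n. \<Sum>j<n. Y i x * Y j x) \<partial>sample_law a b f n)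
        = (\<Sum>i<n. \<Sum>j<n. if i = j then p - p\<^sup>2 else 0)"
      using int sample_covariance[OF _ _ p_def] by (simp add: Y_def)
    then show ?thesis by simp
  qed
  have "(\<integral>\<^sup>+ x. ennreal ((empirical_mass n x k - p)\<^sup>2) \<partial>sample_law a b f n)
      = ennreal (\<integral>x. (empirical_mass n x k - p)\<^sup>2 \<partial>sample_law a b f n)"
  proof (rule nn_integral_eq_integral)
    show "integrable (sample_law a b f n) (\<lambda>x. (empirical_mass n x k - p)\<^sup>2)"
      unfolding emp by (intro integrable_divide Bochner_Integration.integrable_sum int)
  qed simp
  also have "(\<integral>x. (empirical_mass n x k - p)\<^sup>2 \<partial>sample_law a b f n) = (p - p\<^sup>2) / real n"
    unfolding emp using eq assms by (simp add: power2_eq_square)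
  also have "\<dots> \<le> p / real n" by (intro divide_right_mono) auto
  finally show ?thesis by (simp add: p_def ennreal_leI)
qed

end

text \<open>If the first \<open>m\<close> masses of two mixtures agree, then samples whose entries are all below \<open>m\<close>
  have the same probability under both laws, so no estimator can be close to both densities on them.\<close>

lemma two_point_bound:
  assumes a: "0 \<le> a" and f: "f \<in> L2_densities a b" "f' \<in> L2_densities a b"
    and eq: "\<And>k. k < m \<Longrightarrow> mixture_mass a b f k = mixture_mass a b f' k"
    and D: "\<And>x. x \<in> {..<n} \<rightarrow>\<^sub>E UNIV \<Longrightarrow> D \<le> Z x + Z' x"
  shows "D * ennreal (1 - real n * (b ^ m / fact m))
           \<le> (\<integral>\<^sup>+ x. Z x \<partial>sample_law a b f n) + (\<integral>\<^sup>+ x. Z' x \<partial>sample_law a b f' n)"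
proof -
  define S where "S = {..<n} \<rightarrow>\<^sub>E {..<m}"
  have fin: "finite S" unfolding S_def by (intro finite_PiE) auto
  have single: "emeasure (sample_law a b h n) {x} = (\<Prod>i<n. ennreal (mixture_mass a b h (x i)))"
    if "x \<in> S" "h \<in> L2_densities a b" for x h
  proof -
    have "{x} = PiE {..<n} (\<lambda>i. {x i})"
      using that(1) by (subst PiE_singleton) (auto simp: S_def PiE_iff)
    then show ?thesis using emeasure_sample_PiE[OF a that(2), of n "\<lambda>i. {x i}"] by simp
  qed
  have same: "emeasure (sample_law a b f n) {x} = emeasure (sample_law a b f' n) {x}" if "x \<in> S" for x
    unfolding single[OF that f(1)] single[OF that f(2)] using that eq
    by (intro prod.cong) (auto simp: S_def PiE_iff)
  have sets: "{x} \<in> sets (sample_law a b h n)" if "x \<in> S" for x h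
    using that by (auto simp: sets_sample_law S_def PiE_iff)
  have restr: "(\<Sum>x\<in>S. Y x * emeasure (sample_law a b h n) {x}) \<le> (\<integral>\<^sup>+ x. Y x \<partial>sample_law a b h n)" for Y h
  proof -
    have "(\<Sum>x\<in>S. Y x * emeasure (sample_law a b h n) {x}) = (\<integral>\<^sup>+ x. Y x * indicator S x \<partial>sample_law a b h n)"
      by (rule nn_integral_indicator_finite[OF fin sets, symmetric])
    also have "\<dots> \<le> (\<integral>\<^sup>+ x. Y x \<partial>sample_law a b h n)"
      by (intro nn_integral_mono) (auto simp: indicator_def)
    finally show ?thesis .
  qed
  have sum1: "(\<Sum>x\<in>S. emeasure (sample_law a b f n) {x}) = emeasure (sample_law a b f n) S"
    using fin sets by (rule emeasure_eq_sum_singleton[symmetric])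
  define q where "q = (\<Sum>k<m. mixture_mass a b f k)"
  have q0: "q \<ge> 0" unfolding q_def by (intro sum_nonneg mixture_mass_nonneg[OF a f(1)])
  have "emeasure (sample_law a b f n) S = ennreal q ^ n"
    unfolding S_def q_def by (subst emeasure_sample_PiE[OF a f(1)]) simp_all
  also have "\<dots> = ennreal (q ^ n)" by (rule ennreal_power[OF q0])
  \<comment> \<open>One observation is below \<open>m\<close> with probability at least
    \<open>1 - b^m / m!\<close>, and Bernoulli's inequality bounds the n-th power. If the left side
    is negative, \<open>ennreal\<close> truncates it to 0.\<close>
  also have "ennreal (1 - real n * (b ^ m / fact m)) \<le> ennreal (q ^ n)"
  proof (cases "0 < 1 - real n * (b ^ m / fact m)")
    case True
    show ?thesis
    proof (cases "n = 0")
      case False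
      have r1: "b ^ m / fact m \<le> 1"
      proof (rule ccontr)
        assume "\<not> b ^ m / fact m \<le> 1"
        then have "1 * 1 \<le> real n * (b ^ m / fact m)" using False by (intro mult_mono) auto
        then show False using True by simp
      qed
      have "1 - real n * (b ^ m / fact m) \<le> (1 - b ^ m / fact m) ^ n"
        using Bernoulli_inequality[of "- (b ^ m / fact m)" n] r1 by simp
      also have "\<dots> \<le> q ^ n"
        unfolding q_def using mixture_partial_sum_ge[OF a f(1)] r1 by (intro power_mono) auto
      finally show ?thesis by (rule ennreal_leI)
    qed simp
  qed (simp add: ennreal_neg)
  finally have "D * ennreal (1 - real n * (b ^ m / fact m)) \<le> D * (\<Sum>x\<in>S. emeasure (sample_law a b f n) {x})"
    unfolding sum1 by (intro mult_left_mono) auto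
  also have "\<dots> \<le> (\<Sum>x\<in>S. (Z x + Z' x) * emeasure (sample_law a b f n) {x})"
    unfolding sum_distrib_left by (intro sum_mono mult_right_mono D) (auto simp: S_def PiE_iff)
  also have "\<dots> = (\<Sum>x\<in>S. Z x * emeasure (sample_law a b f n) {x})
      + (\<Sum>x\<in>S. Z' x * emeasure (sample_law a b f' n) {x})"
    unfolding distrib_right sum.distrib by (simp add: same cong: sum.cong)
  also have "\<dots> \<le> (\<integral>\<^sup>+ x. Z x \<partial>sample_law a b f n) + (\<integral>\<^sup>+ x. Z' x \<partial>sample_law a b f' n)"
    by (intro add_mono restr)
  finally show ?thesis .
qed

section \<open>Risk of the projection estimator\<close>

text \<open>The masses of the difference between the estimator and the projection are exactly the
  errors of the empirical masses. The inverse bound \<open>poisson_span_norm_bound\<close> weights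
  them with \<open>(k!)^2\<close>, their variance is of order \<open>1 / k!\<close>, and a single
  factorial remains.\<close>

lemma projection_variance:
  assumes "0 \<le> a" "a < b"
  shows "\<exists>K\<ge>1. \<forall>m n. \<forall>f \<in> L2_densities a b. 0 < n \<longrightarrow>
    (\<integral>\<^sup>+ x. ennreal ((l2n a b (\<lambda>\<theta>. projection_estimator a b m n x \<theta> - span_projection a b m f \<theta>))\<^sup>2)
       \<partial>sample_law a b f n) \<le> ennreal (K ^ m * fact m / real n)"
proof -
  obtain K where K: "K \<ge> 1" "\<And>m v. v \<in> poisson_span m \<Longrightarrow>
      l2n a b v \<le> K ^ m * (\<Sum>k<m. fact k * \<bar>L2inner a b v (poisson_mass k)\<bar>)"
    using poisson_span_norm_bound[OF assms(2)] by blast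
  define K' where "K' = 4 * K\<^sup>2 * (1 + b)"
  have b: "0 < b" using assms by simp
  have "(\<integral>\<^sup>+ x. ennreal ((l2n a b (\<lambda>\<theta>. projection_estimator a b m n x \<theta> - span_projection a b m f \<theta>))\<^sup>2)
       \<partial>sample_law a b f n) \<le> ennreal (K' ^ m * fact m / real n)"
    if f: "f \<in> L2_densities a b" and n: "0 < n" for m n f
  proof -
    define d where "d k x = empirical_mass n x k - mixture_mass a b f k" for k x
    define v where "v x = (\<lambda>\<theta>. projection_estimator a b m n x \<theta> - span_projection a b m f \<theta>)" for x
    \<comment> \<open>The factor \<open>m\<close> is the price of Cauchy-Schwarz for a sum of
      \<open>m\<close> terms.\<close>
    define C where "C = K ^ (2 * m) * real m"
    have C: "C \<ge> 0" using K by (simp add: C_def)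
    have fL: "f \<in> L2 a b" by (rule L2_densities_L2[OF f])
    have inner: "L2inner a b (v x) (poisson_mass k) = d k x" if "k < m" for k x
    proof -
      have "L2inner a b (span_projection a b m f) (poisson_mass k) = L2inner a b f (poisson_mass k)"
        using span_projection_orthogonal[OF assms(2) fL poisson_mass_in_span[OF that]] fL
          poisson_span_L2[OF span_projection_in[OF assms(2) fL]] by (simp add: L2inner_diff_left)
      then show ?thesis
        unfolding v_def d_def mixture_mass_eq_L2inner
        using projection_estimator_inner[OF assms(2) that, of n x]
          poisson_span_L2[OF span_projection_in[OF assms(2) fL]]
          poisson_span_L2[OF projection_estimator_in[OF assms(2)]]
        by (simp add: L2inner_diff_left)
    qed
    have bound: "(l2n a b (v x))\<^sup>2 \<le> (\<Sum>k<m. C * (fact k)\<^sup>2 * (d k x)\<^sup>2)" for x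
    proof -
      have "v x \<in> poisson_span m"
        unfolding v_def by (intro poisson_span_diff projection_estimator_in[OF assms(2)] span_projection_in[OF assms(2) fL])
      then have "l2n a b (v x) \<le> K ^ m * (\<Sum>k<m. fact k * \<bar>L2inner a b (v x) (poisson_mass k)\<bar>)" by (rule K(2))
      also have "(\<Sum>k<m. fact k * \<bar>L2inner a b (v x) (poisson_mass k)\<bar>) = (\<Sum>k<m. fact k * \<bar>d k x\<bar>)"
        using inner by simp
      finally have "(l2n a b (v x))\<^sup>2 \<le> (K ^ m * (\<Sum>k<m. fact k * \<bar>d k x\<bar>))\<^sup>2" by (intro power_mono) auto
      also have "\<dots> = K ^ (2 * m) * (\<Sum>k<m. 1 * (fact k * \<bar>d k x\<bar>))\<^sup>2"
        by (simp add: power_mult_distrib power_even_eq)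
      also have "\<dots> \<le> K ^ (2 * m) * ((\<Sum>k<m. 1\<^sup>2) * (\<Sum>k<m. (fact k * \<bar>d k x\<bar>)\<^sup>2))"
        using K by (intro mult_left_mono Cauchy_Schwarz_ineq_sum) auto
      also have "\<dots> = (\<Sum>k<m. C * (fact k)\<^sup>2 * (d k x)\<^sup>2)"
        by (simp add: C_def sum_distrib_left power_mult_distrib mult_ac)
      finally show ?thesis .
    qed
    have "(\<integral>\<^sup>+ x. ennreal ((l2n a b (v x))\<^sup>2) \<partial>sample_law a b f n)
        \<le> (\<integral>\<^sup>+ x. (\<Sum>k<m. ennreal (C * (fact k)\<^sup>2) * ennreal ((d k x)\<^sup>2)) \<partial>sample_law a b f n)"
    proof (rule nn_integral_mono)
      fix x
      have "ennreal ((l2n a b (v x))\<^sup>2) \<le> ennreal (\<Sum>k<m. C * (fact k)\<^sup>2 * (d k x)\<^sup>2)"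
        by (rule ennreal_leI[OF bound])
      also have "\<dots> = (\<Sum>k<m. ennreal (C * (fact k)\<^sup>2) * ennreal ((d k x)\<^sup>2))"
        using C by (subst sum_ennreal[symmetric]) (auto simp: ennreal_mult)
      finally show "ennreal ((l2n a b (v x))\<^sup>2) \<le> (\<Sum>k<m. ennreal (C * (fact k)\<^sup>2) * ennreal ((d k x)\<^sup>2))" .
    qed
    also have "\<dots> = (\<Sum>k<m. ennreal (C * (fact k)\<^sup>2) * (\<integral>\<^sup>+ x. ennreal ((d k x)\<^sup>2) \<partial>sample_law a b f n))"
      by (subst nn_integral_sum) (auto intro!: borel_measurable_sample[OF assms(1) f] nn_integral_cmult sum.cong)
    also have "\<dots> \<le> (\<Sum>k<m. ennreal (C * (fact k)\<^sup>2) * ennreal (mixture_mass a b f k / real n))"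
      unfolding d_def by (intro sum_mono mult_left_mono empirical_variance[OF assms(1) f n]) auto
    also have "\<dots> = ennreal (\<Sum>k<m. C * (fact k)\<^sup>2 * (mixture_mass a b f k / real n))"
      using C mixture_mass_nonneg[OF assms(1) f]
    proof (subst sum_ennreal[symmetric])
      show "(\<Sum>k<m. ennreal (C * (fact k)\<^sup>2) * ennreal (mixture_mass a b f k / real n))
          = (\<Sum>k<m. ennreal (C * (fact k)\<^sup>2 * (mixture_mass a b f k / real n)))"
        by (intro sum.cong refl ennreal_mult[symmetric]) (simp_all add: C mixture_mass_nonneg[OF assms(1) f])
    qed (simp add: C mixture_mass_nonneg[OF assms(1) f])
    also have "\<dots> \<le> ennreal (K' ^ m * fact m / real n)"
    proof (rule ennreal_leI)
      have "(\<Sum>k<m. C * (fact k)\<^sup>2 * (mixture_mass a b f k / real n)) \<le> (\<Sum>k<m. C * (fact m * (1 + b) ^ m / real n))"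
      proof (intro sum_mono)
        \<comment> \<open>One factorial of \<open>(fact k)^2\<close> cancels against the bound
          \<open>b^k / k!\<close> of the mass.\<close>
        fix k assume k: "k \<in> {..<m}"
        have "(fact k)\<^sup>2 * mixture_mass a b f k \<le> (fact k)\<^sup>2 * (b ^ k / fact k)"
          by (intro mult_left_mono mixture_mass_le[OF assms(1) f]) auto
        also have "\<dots> = fact k * b ^ k" by (simp add: power2_eq_square)
        also have "\<dots> \<le> fact m * (1 + b) ^ m"
        proof (intro mult_mono)
          show "(fact k :: real) \<le> fact m" using k by (intro fact_mono) auto
          have "b ^ k \<le> (1 + b) ^ k" using b by (intro power_mono) auto
          also have "\<dots> \<le> (1 + b) ^ m" using k b by (intro power_increasing) auto
          finally show "b ^ k \<le> (1 + b) ^ m" .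
        qed (use b in auto)
        finally have "(fact k)\<^sup>2 * mixture_mass a b f k / real n \<le> fact m * (1 + b) ^ m / real n"
          by (rule divide_right_mono) simp
        then show "C * (fact k)\<^sup>2 * (mixture_mass a b f k / real n) \<le> C * (fact m * (1 + b) ^ m / real n)"
          using mult_left_mono[OF _ C] by (fastforce simp: mult.assoc)
      qed
      also have "\<dots> = (real m * real m) * (K ^ (2 * m) * (1 + b) ^ m * fact m / real n)"
        by (simp add: C_def)
      also have "\<dots> \<le> 4 ^ m * (K ^ (2 * m) * (1 + b) ^ m * fact m / real n)"
      proof (rule mult_right_mono)
        have "real m \<le> 2 ^ m" using less_exp[of m] by (metis less_imp_le of_nat_le_iff of_nat_numeral of_nat_power)
        then have "real m * real m \<le> 2 ^ m * 2 ^ m" by (intro mult_mono) auto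
        then show "real m * real m \<le> 4 ^ m" by (simp add: power_mult_distrib[symmetric])
      qed (use K b in auto)
      also have "\<dots> = K' ^ m * fact m / real n"
        by (simp add: K'_def power_mult_distrib power_mult)
      finally show "(\<Sum>k<m. C * (fact k)\<^sup>2 * (mixture_mass a b f k / real n)) \<le> K' ^ m * fact m / real n" .
    qed
    finally show ?thesis by (simp add: v_def)
  qed
  moreover have "1 \<le> K'"
  proof -
    have "1 * 1 * 1 \<le> 4 * K\<^sup>2 * (1 + b)" using K b by (intro mult_mono) auto
    then show ?thesis by (simp add: K'_def)
  qed
  ultimately show ?thesis by blast
qed

text \<open>For the squared risk a factor 2 in front of the bias is harmless. In the mean error the
  bias must enter with factor exactly one, because the constant of the second statement is read off
  from it.\<close>

lemma projection_risk:
  assumes "0 \<le> a" "a < b"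
  obtains K where "K \<ge> 1"
    "\<And>m n f. f \<in> L2_densities a b \<Longrightarrow> 0 < n \<Longrightarrow>
       MISE a b n (projection_estimator a b m n) f
         \<le> ennreal (2 * (l2n a b (\<lambda>\<theta>. f \<theta> - span_projection a b m f \<theta>))\<^sup>2 + 2 * (K ^ m * fact m / real n))"
    "\<And>m n f. f \<in> L2_densities a b \<Longrightarrow> 0 < n \<Longrightarrow>
       mean_error a b n (projection_estimator a b m n) f
         \<le> ennreal (l2n a b (\<lambda>\<theta>. f \<theta> - span_projection a b m f \<theta>) + sqrt (K ^ m * fact m / real n))"
proof -
  obtain K where K: "K \<ge> 1" and var: "\<And>m n f. f \<in> L2_densities a b \<Longrightarrow> 0 < n \<Longrightarrow>
    (\<integral>\<^sup>+ x. ennreal ((l2n a b (\<lambda>\<theta>. projection_estimator a b m n x \<theta> - span_projection a b m f \<theta>))\<^sup>2)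
       \<partial>sample_law a b f n) \<le> ennreal (K ^ m * fact m / real n)"
    using projection_variance[OF assms] by blast
  show ?thesis
  proof (rule that[OF K])
    fix m n :: nat and f
    assume f: "f \<in> L2_densities a b" and n: "0 < n"
    define V where "V = K ^ m * fact m / real n"
    define B where "B = l2n a b (\<lambda>\<theta>. f \<theta> - span_projection a b m f \<theta>)"
    define v where "v x = l2n a b (\<lambda>\<theta>. projection_estimator a b m n x \<theta> - span_projection a b m f \<theta>)" for x
    have V: "V > 0" using K n by (simp add: V_def)
    have B: "0 \<le> B" and v: "0 \<le> v x" for x by (simp_all add: B_def v_def)
    have fL: "f \<in> L2 a b" by (rule L2_densities_L2[OF f])
    have pL: "span_projection a b m f \<in> L2 a b" "projection_estimator a b m n x \<in> L2 a b" for x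
      by (rule poisson_span_L2[OF span_projection_in[OF assms(2) fL]]
            poisson_span_L2[OF projection_estimator_in[OF assms(2)]])+
    interpret S: prob_space "sample_law a b f n" by (rule prob_space_sample[OF assms(1) f])
    have tri: "l2n a b (\<lambda>\<theta>. projection_estimator a b m n x \<theta> - f \<theta>) \<le> v x + B" for x
      using l2n_triangle_diff[OF pL(2) pL(1) fL] unfolding v_def B_def
      by (subst (2) l2n_minus_commute) simp
    have vV: "(\<integral>\<^sup>+ x. ennreal ((v x)\<^sup>2) \<partial>sample_law a b f n) \<le> ennreal V"
      unfolding v_def V_def by (rule var[OF f n])
    have N: "L2norm a b (\<lambda>\<theta>. projection_estimator a b m n x \<theta> - f \<theta>)
        = ennreal (l2n a b (\<lambda>\<theta>. projection_estimator a b m n x \<theta> - f \<theta>))" for x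
      by (rule L2norm_eq[OF L2_diff[OF pL(2) fL]])
    have "MISE a b n (projection_estimator a b m n) f
        \<le> (\<integral>\<^sup>+ x. ennreal (2 * B\<^sup>2) + ennreal 2 * ennreal ((v x)\<^sup>2) \<partial>sample_law a b f n)"
      unfolding MISE_def
    proof (rule nn_integral_mono)
      fix x
      have "(l2n a b (\<lambda>\<theta>. projection_estimator a b m n x \<theta> - f \<theta>))\<^sup>2 \<le> (v x + B)\<^sup>2"
        by (intro power_mono tri) simp
      also have "\<dots> \<le> 2 * B\<^sup>2 + 2 * (v x)\<^sup>2" using sum_squares_bound[of "v x" B] by (simp add: power2_sum)
      finally have "ennreal ((l2n a b (\<lambda>\<theta>. projection_estimator a b m n x \<theta> - f \<theta>))\<^sup>2)
          \<le> ennreal (2 * B\<^sup>2 + 2 * (v x)\<^sup>2)" by (rule ennreal_leI)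
      also have "\<dots> = ennreal (2 * B\<^sup>2) + ennreal 2 * ennreal ((v x)\<^sup>2)"
        by (simp add: ennreal_mult)
      finally show "(L2norm a b (\<lambda>\<theta>. projection_estimator a b m n x \<theta> - f \<theta>))\<^sup>2
          \<le> ennreal (2 * B\<^sup>2) + ennreal 2 * ennreal ((v x)\<^sup>2)"
        unfolding N by (simp add: ennreal_power)
    qed
    also have "\<dots> = ennreal (2 * B\<^sup>2) + ennreal 2 * (\<integral>\<^sup>+ x. ennreal ((v x)\<^sup>2) \<partial>sample_law a b f n)"
      by (subst nn_integral_add) (auto simp: S.emeasure_space_1 nn_integral_cmult borel_measurable_sample[OF assms(1) f])
    also have "\<dots> \<le> ennreal (2 * B\<^sup>2) + ennreal 2 * ennreal V"
      by (intro add_left_mono mult_left_mono vV) auto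
    also have "\<dots> = ennreal (2 * B\<^sup>2 + 2 * V)" using V by (simp add: ennreal_mult)
    finally show "MISE a b n (projection_estimator a b m n) f
         \<le> ennreal (2 * (l2n a b (\<lambda>\<theta>. f \<theta> - span_projection a b m f \<theta>))\<^sup>2 + 2 * (K ^ m * fact m / real n))"
      by (simp add: B_def V_def)
    define s where "s = sqrt V"
    have s: "s > 0" "s * s = V" using V by (simp_all add: s_def)
    have "mean_error a b n (projection_estimator a b m n) f
        \<le> (\<integral>\<^sup>+ x. ennreal (B + s / 2) + ennreal (1 / (2 * s)) * ennreal ((v x)\<^sup>2) \<partial>sample_law a b f n)"
      unfolding mean_error_def
    proof (rule nn_integral_mono)
      fix x
      \<comment> \<open>Linearised form of \<open>E v \<le> sqrt (E (v^2))\<close>: the tangent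
        bound \<open>v \<le> s / 2 + v^2 / (2 s)\<close> is integrated at the optimal
        \<open>s = sqrt V\<close>, which gives a total of \<open>s\<close>.\<close>
      have "2 * v x * s \<le> s * s + (v x)\<^sup>2" using sum_squares_bound[of "v x" s] by (simp add: power2_eq_square)
      then have "v x \<le> s / 2 + 1 / (2 * s) * (v x)\<^sup>2" using s by (simp add: field_simps)
      then have "l2n a b (\<lambda>\<theta>. projection_estimator a b m n x \<theta> - f \<theta>) \<le> (B + s / 2) + 1 / (2 * s) * (v x)\<^sup>2"
        using tri[of x] by linarith
      then have "ennreal (l2n a b (\<lambda>\<theta>. projection_estimator a b m n x \<theta> - f \<theta>))
          \<le> ennreal ((B + s / 2) + 1 / (2 * s) * (v x)\<^sup>2)" by (rule ennreal_leI)
      also have "\<dots> = ennreal (B + s / 2) + ennreal (1 / (2 * s)) * ennreal ((v x)\<^sup>2)"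
        using s B by (subst ennreal_plus) (auto simp: ennreal_mult[symmetric])
      finally show "L2norm a b (\<lambda>\<theta>. projection_estimator a b m n x \<theta> - f \<theta>)
          \<le> ennreal (B + s / 2) + ennreal (1 / (2 * s)) * ennreal ((v x)\<^sup>2)"
        unfolding N .
    qed
    also have "\<dots> = ennreal (B + s / 2) + ennreal (1 / (2 * s)) * (\<integral>\<^sup>+ x. ennreal ((v x)\<^sup>2) \<partial>sample_law a b f n)"
      by (subst nn_integral_add) (auto simp: S.emeasure_space_1 nn_integral_cmult borel_measurable_sample[OF assms(1) f])
    also have "\<dots> \<le> ennreal (B + s / 2) + ennreal (1 / (2 * s)) * ennreal V"
      by (intro add_left_mono mult_left_mono vV) auto
    also have "\<dots> = ennreal (B + s / 2 + 1 / (2 * s) * V)"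
      using s B V by (subst ennreal_mult[symmetric]) (auto simp: ennreal_plus[symmetric] simp del: ennreal_plus)
    also have "B + s / 2 + 1 / (2 * s) * V = B + s" using s(1) by (simp add: s(2)[symmetric])
    finally show "mean_error a b n (projection_estimator a b m n) f
         \<le> ennreal (l2n a b (\<lambda>\<theta>. f \<theta> - span_projection a b m f \<theta>) + sqrt (K ^ m * fact m / real n))"
      by (simp add: B_def V_def s_def)
  qed
qed

section \<open>Growth of the cutoff\<close>

lemma log_ratio_at_top: "filterlim log_ratio at_top sequentially"
proof -
  have "filterlim (\<lambda>x::real. ln x / ln (ln x)) at_top at_top" by real_asymp
  from filterlim_compose[OF this filterlim_real_sequentially]
  show ?thesis by (simp add: log_ratio_def[abs_def])
qed

lemma cutoff_le: "0 \<le> log_ratio n \<Longrightarrow> 0 \<le> \<tau> \<Longrightarrow> real (cutoff \<tau> n) \<le> \<tau> * log_ratio n"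
  by (simp add: cutoff_def)

lemma cutoff_ge: "\<tau> * log_ratio n \<le> 1 + real (cutoff \<tau> n)"
  unfolding cutoff_def by linarith

text \<open>With \<open>L = log_ratio n\<close> one has \<open>L ln L = ln n - L ln ln ln n\<close>.
  The deficit \<open>L ln ln ln n\<close> beats both \<open>L ln K\<close> and
  \<open>\<beta> ln L\<close>, so the variance survives any power of \<open>L\<close> even for
  \<open>\<tau> = 1\<close>.\<close>

lemma cutoff_variance_vanishes:
  assumes K: "1 \<le> K" and tau: "0 < \<tau>" "\<tau> \<le> 1"
  shows "(\<lambda>n. log_ratio n powr \<beta> * (K ^ cutoff \<tau> n * fact (cutoff \<tau> n) / real n)) \<longlonglongrightarrow> 0"
proof -
  define H where "H x = exp (\<beta> * ln (ln x / ln (ln x)) + (ln x / ln (ln x)) * ln K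
      + (ln x / ln (ln x)) * ln (ln x / ln (ln x)) - ln x)" for x :: real
  have "filterlim (\<lambda>x::real. \<beta> * ln (ln x / ln (ln x)) + (ln x / ln (ln x)) * ln K
      + (ln x / ln (ln x)) * ln (ln x / ln (ln x)) - ln x) at_bot at_top"
    by real_asymp
  then have "(H \<longlongrightarrow> 0) at_top"
    unfolding H_def by (rule filterlim_compose[OF exp_at_bot])
  from filterlim_compose[OF this filterlim_real_sequentially]
  have lim: "(\<lambda>n. H (real n)) \<longlonglongrightarrow> 0" .
  have up: "eventually (\<lambda>n. log_ratio n powr \<beta> * (K ^ cutoff \<tau> n * fact (cutoff \<tau> n) / real n) \<le> H (real n)) sequentially"
    using filterlim_at_top[THEN iffD1, OF log_ratio_at_top, rule_format, of 1] eventually_gt_at_top[of 0]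
  proof eventually_elim
    case (elim n)
    define L where "L = log_ratio n"
    define m where "m = cutoff \<tau> n"
    have L: "1 \<le> L" using elim by (simp add: L_def)
    have "real m \<le> \<tau> * L" using cutoff_le[of n \<tau>] L tau by (simp add: m_def L_def)
    also have "\<dots> \<le> 1 * L" using L tau by (intro mult_right_mono) auto
    finally have m: "real m \<le> L" by simp
    have "K ^ m = K powr real m" using K by (simp add: powr_realpow)
    also have "\<dots> \<le> K powr L" using K m by (intro powr_mono) auto
    finally have 1: "K ^ m \<le> K powr L" .
    have "(fact m :: real) \<le> real m ^ m" using fact_le_power[of m] by simp
    also have "\<dots> \<le> L ^ m" using m by (intro power_mono) auto
    also have "\<dots> = L powr real m" using L by (simp add: powr_realpow)
    also have "\<dots> \<le> L powr L" using L m by (intro powr_mono) auto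
    finally have 2: "fact m \<le> L powr L" .
    have "log_ratio n powr \<beta> * (K ^ m * fact m / real n) \<le> L powr \<beta> * (K powr L * L powr L / real n)"
      unfolding L_def[symmetric] using 1 2 K by (intro mult_left_mono divide_right_mono mult_mono) auto
    also have "\<dots> = exp (\<beta> * ln L + L * ln K + L * ln L - ln (real n))"
      using L K elim by (simp add: powr_def exp_add exp_diff)
    also have "\<dots> = H (real n)" by (simp add: H_def L_def log_ratio_def)
    finally show ?case by (simp add: m_def)
  qed
  have lo: "eventually (\<lambda>n. 0 \<le> log_ratio n powr \<beta> * (K ^ cutoff \<tau> n * fact (cutoff \<tau> n) / real n)) sequentially"
    using K by (intro always_eventually allI) auto
  show ?thesis by (rule tendsto_sandwich[OF lo up tendsto_const lim])
qed

text \<open>A single term of the exponential series; it serves as the lower half of Stirling's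
  formula.\<close>

lemma power_div_fact_le_exp: "real m ^ m / fact m \<le> exp (real m)"
proof -
  have "(\<lambda>n. real m ^ n /\<^sub>R fact n) sums exp (real m)" by (rule exp_converges)
  then have "(\<Sum>n\<in>{m}. real m ^ n /\<^sub>R fact n) \<le> exp (real m)"
    using sum_le_suminf[of "\<lambda>n. real m ^ n /\<^sub>R fact n" "{m}"] by (simp add: sums_iff)
  then show ?thesis by (simp add: divide_inverse mult.commute)
qed

text \<open>An index slightly above the largest cutoff. Samples stay below it with probability
  tending to one, so differences between densities that only show in later masses are
  invisible.\<close>

definition blind_index :: "real \<Rightarrow> nat \<Rightarrow> nat" where
  "blind_index \<epsilon> n = nat \<lceil>(1 + \<epsilon>) * log_ratio n\<rceil>"

text \<open>By the Stirling bound the quantity is at most \<open>exp (ln n - m (ln m - c))\<close>,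
  and \<open>m ln m\<close> is asymptotically at least \<open>(1 + \<epsilon>) ln n\<close>.\<close>

lemma blind_tail_vanishes:
  assumes b: "0 < b" and eps: "0 < \<epsilon>"
  shows "(\<lambda>n. real n * (b ^ blind_index \<epsilon> n / fact (blind_index \<epsilon> n))) \<longlonglongrightarrow> 0"
proof -
  define c where "c = ln b + 1"
  define M where "M x = (1 + \<epsilon>) * (ln x / ln (ln x))" for x :: real
  have "filterlim (\<lambda>x::real. ln x - (1 + \<epsilon>) * (ln x / ln (ln x)) * (ln ((1 + \<epsilon>) * (ln x / ln (ln x))) - c)) at_bot at_top"
    using eps by real_asymp
  then have "((\<lambda>x. exp (ln x - M x * (ln (M x) - c))) \<longlongrightarrow> 0) at_top"
    unfolding M_def by (rule filterlim_compose[OF exp_at_bot])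
  from filterlim_compose[OF this filterlim_real_sequentially]
  have lim: "(\<lambda>n. exp (ln (real n) - M (real n) * (ln (M (real n)) - c))) \<longlonglongrightarrow> 0" .
  have up: "eventually (\<lambda>n. real n * (b ^ blind_index \<epsilon> n / fact (blind_index \<epsilon> n))
      \<le> exp (ln (real n) - M (real n) * (ln (M (real n)) - c))) sequentially"
    using filterlim_at_top[THEN iffD1, OF log_ratio_at_top, rule_format, of "max 1 (exp c)"] eventually_gt_at_top[of 0]
  proof eventually_elim
    case (elim n)
    define m where "m = blind_index \<epsilon> n"
    define N where "N = M (real n)"
    have N: "N = (1 + \<epsilon>) * log_ratio n" by (simp add: N_def M_def log_ratio_def)
    have "1 * max 1 (exp c) \<le> N" unfolding N using elim eps by (intro mult_mono) auto
    then have N1: "1 \<le> N" "exp c \<le> N" by auto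
    have mN: "N \<le> real m" unfolding m_def blind_index_def N by linarith
    then have m1: "1 \<le> real m" "exp c \<le> real m" using N1 by auto
    have lnN: "c \<le> ln N" "c \<le> ln (real m)" using N1 m1 by (simp_all add: ln_ge_iff)
    have "b ^ m / fact m = (b ^ m / real m ^ m) * (real m ^ m / fact m)" using m1 by simp
    also have "\<dots> \<le> (b ^ m / real m ^ m) * exp (real m)"
      using b by (intro mult_left_mono power_div_fact_le_exp) auto
    also have "\<dots> = exp (real m * (c - ln (real m)))"
    proof -
      have "b ^ m = exp (real m * ln b)" "real m ^ m = exp (real m * ln (real m))"
        using b m1 by (simp_all add: exp_of_nat_mult)
      then show ?thesis by (simp add: c_def exp_add[symmetric] exp_diff[symmetric] algebra_simps)
    qed
    finally have "real n * (b ^ m / fact m) \<le> real n * exp (real m * (c - ln (real m)))"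
      by (intro mult_left_mono) auto
    also have "real n = exp (ln (real n))" using elim by simp
    also have "exp (ln (real n)) * exp (real m * (c - ln (real m))) \<le> exp (ln (real n) - N * (ln N - c))"
    proof -
      \<comment> \<open>Beyond \<open>exp c\<close> both factors are nonnegative and increasing, so
        the integer \<open>m\<close> may be replaced by the smaller real \<open>N\<close> for which
        the limit is known.\<close>
      have "N * (ln N - c) \<le> real m * (ln (real m) - c)"
        using mN N1 lnN m1 by (intro mult_mono) (auto intro!: ln_mono)
      then show ?thesis by (simp add: exp_add[symmetric] algebra_simps)
    qed
    finally show ?case using elim by (simp add: m_def N_def)
  qed
  have lo: "eventually (\<lambda>n. 0 \<le> real n * (b ^ blind_index \<epsilon> n / fact (blind_index \<epsilon> n))) sequentially"
    using b by (intro always_eventually allI) auto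
  show ?thesis by (rule tendsto_sandwich[OF lo up tendsto_const lim])
qed

lemma blind_index_le: "real (blind_index \<epsilon> n) \<le> (1 + \<epsilon>) * log_ratio n + 1" if "0 \<le> (1 + \<epsilon>) * log_ratio n"
  unfolding blind_index_def using that by linarith

lemma blind_index_at_top:
  assumes "0 < \<epsilon>"
  shows "filterlim (blind_index \<epsilon>) at_top sequentially"
proof -
  have "filterlim (\<lambda>n. (1 + \<epsilon>) * log_ratio n) at_top sequentially"
    using assms by (intro filterlim_tendsto_pos_mult_at_top[OF tendsto_const _ log_ratio_at_top]) auto
  then have "filterlim (\<lambda>n. real (blind_index \<epsilon> n)) at_top sequentially"
    by (rule filterlim_at_top_mono) (auto simp: blind_index_def real_nat_ceiling_ge)
  then show ?thesis by (simp add: filterlim_sequentially_iff_filterlim_real)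
qed

section \<open>Minimax lower bounds from two densities\<close>

lemma ennreal_half_sum_le:
  assumes "ennreal D * p \<le> X + Y" "X \<le> S" "Y \<le> S" "0 \<le> D"
  shows "ennreal (D / 2) * p \<le> S"
proof -
  have "ennreal D = 2 * ennreal (D / 2)"
    using assms(4) by (metis ennreal_mult ennreal_numeral field_sum_of_halves mult_2 nonzero_eq_divide_eq
      times_divide_eq_right divide_nonneg_pos zero_le_numeral zero_less_numeral)
  then have "2 * (ennreal (D / 2) * p) \<le> 2 * S"
    using order_trans[OF assms(1) add_mono[OF assms(2,3)]] by (simp add: mult.assoc mult_2[of S])
  then show ?thesis
    by (subst (asm) ennreal_mult_le_mult_iff) auto
qed

context
  fixes a b :: real and m n :: nat and f f' :: "real \<Rightarrow> real" and F :: "(real \<Rightarrow> real) set"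
  assumes a: "0 \<le> a" and dens: "f \<in> L2_densities a b" "f' \<in> L2_densities a b"
    and F: "f \<in> F" "f' \<in> F"
    and eq: "\<And>k. k < m \<Longrightarrow> mixture_mass a b f k = mixture_mass a b f' k"
begin

lemma two_point_mean_error:
  "ennreal (l2n a b (\<lambda>\<theta>. f \<theta> - f' \<theta>) / 2) * ennreal (1 - real n * (b ^ m / fact m))
     \<le> (INF g\<in>estimators a b n. SUP f\<in>F. mean_error a b n g f)"
proof (rule INF_greatest)
  fix g assume g: "g \<in> estimators a b n"
  have L: "f \<in> L2 a b" "f' \<in> L2 a b" using dens by (auto intro: L2_densities_L2)
  show "ennreal (l2n a b (\<lambda>\<theta>. f \<theta> - f' \<theta>) / 2) * ennreal (1 - real n * (b ^ m / fact m))
      \<le> (SUP f\<in>F. mean_error a b n g f)"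
  proof (rule ennreal_half_sum_le)
    show "ennreal (l2n a b (\<lambda>\<theta>. f \<theta> - f' \<theta>)) * ennreal (1 - real n * (b ^ m / fact m))
        \<le> mean_error a b n g f + mean_error a b n g f'"
      unfolding mean_error_def
    proof (rule two_point_bound[OF a dens eq])
      fix x :: "nat \<Rightarrow> nat" assume "x \<in> {..<n} \<rightarrow>\<^sub>E UNIV"
      then have gx: "g x \<in> L2 a b" using g by (simp add: estimators_def)
      have "l2n a b (\<lambda>\<theta>. f \<theta> - f' \<theta>) \<le> l2n a b (\<lambda>\<theta>. g x \<theta> - f \<theta>) + l2n a b (\<lambda>\<theta>. g x \<theta> - f' \<theta>)"
        using l2n_triangle_diff[OF L(1) gx L(2)] l2n_minus_commute[of a b f "g x"] by simp
      then show "ennreal (l2n a b (\<lambda>\<theta>. f \<theta> - f' \<theta>))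
          \<le> L2norm a b (\<lambda>\<theta>. g x \<theta> - f \<theta>) + L2norm a b (\<lambda>\<theta>. g x \<theta> - f' \<theta>)"
        using L gx by (simp add: L2norm_eq L2_diff ennreal_plus[symmetric] del: ennreal_plus)
    qed
  qed (use F in \<open>auto intro: SUP_upper\<close>)
qed

text \<open>Of the factor 1/4, one half comes from \<open>(u + v)^2 \<le> 2 (u^2 + v^2)\<close> and
  the other from passing from the sum of two risks to their supremum.\<close>

lemma two_point_MISE:
  "ennreal ((l2n a b (\<lambda>\<theta>. f \<theta> - f' \<theta>))\<^sup>2 / 4) * ennreal (1 - real n * (b ^ m / fact m))
     \<le> (INF g\<in>estimators a b n. SUP f\<in>F. MISE a b n g f)"
proof (rule INF_greatest)
  fix g assume g: "g \<in> estimators a b n"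
  have L: "f \<in> L2 a b" "f' \<in> L2 a b" using dens by (auto intro: L2_densities_L2)
  have "ennreal ((l2n a b (\<lambda>\<theta>. f \<theta> - f' \<theta>))\<^sup>2 / 2 / 2) * ennreal (1 - real n * (b ^ m / fact m))
      \<le> (SUP f\<in>F. MISE a b n g f)"
  proof (rule ennreal_half_sum_le)
    show "ennreal ((l2n a b (\<lambda>\<theta>. f \<theta> - f' \<theta>))\<^sup>2 / 2) * ennreal (1 - real n * (b ^ m / fact m))
        \<le> MISE a b n g f + MISE a b n g f'"
      unfolding MISE_def
    proof (rule two_point_bound[OF a dens eq])
      fix x :: "nat \<Rightarrow> nat" assume "x \<in> {..<n} \<rightarrow>\<^sub>E UNIV"
      then have gx: "g x \<in> L2 a b" using g by (simp add: estimators_def)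
      define u where "u = l2n a b (\<lambda>\<theta>. g x \<theta> - f \<theta>)"
      define v where "v = l2n a b (\<lambda>\<theta>. g x \<theta> - f' \<theta>)"
      have "l2n a b (\<lambda>\<theta>. f \<theta> - f' \<theta>) \<le> u + v"
        using l2n_triangle_diff[OF L(1) gx L(2)] l2n_minus_commute[of a b f "g x"] by (simp add: u_def v_def)
      then have "(l2n a b (\<lambda>\<theta>. f \<theta> - f' \<theta>))\<^sup>2 \<le> (u + v)\<^sup>2" by (intro power_mono) auto
      also have "\<dots> \<le> 2 * (u\<^sup>2 + v\<^sup>2)" using sum_squares_bound[of u v] by (simp add: power2_sum)
      finally have "(l2n a b (\<lambda>\<theta>. f \<theta> - f' \<theta>))\<^sup>2 / 2 \<le> u\<^sup>2 + v\<^sup>2" by simp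
      then show "ennreal ((l2n a b (\<lambda>\<theta>. f \<theta> - f' \<theta>))\<^sup>2 / 2)
          \<le> (L2norm a b (\<lambda>\<theta>. g x \<theta> - f \<theta>))\<^sup>2 + (L2norm a b (\<lambda>\<theta>. g x \<theta> - f' \<theta>))\<^sup>2"
        using L gx by (simp add: L2norm_sq L2_diff ennreal_plus[symmetric] u_def v_def del: ennreal_plus)
    qed
  qed (use F in \<open>auto intro: SUP_upper\<close>)
  then show "ennreal ((l2n a b (\<lambda>\<theta>. f \<theta> - f' \<theta>))\<^sup>2 / 4) * ennreal (1 - real n * (b ^ m / fact m))
      \<le> (SUP f\<in>F. MISE a b n g f)" by simp
qed

end

section \<open>Asymptotic efficiency over the approximation classes\<close>

text \<open>Orthogonality to \<open>V_m\<close> keeps the first \<open>m\<close> masses, zero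
  integral keeps the total mass. The residuals of two successive masses span a plane of candidates
  for the one extra condition, hence the index \<open>m + 2\<close>.\<close>

lemma blind_direction:
  assumes "a < b"
  obtains g where "g \<in> poisson_span (m + 2)" "\<And>h. h \<in> poisson_span m \<Longrightarrow> L2inner a b g h = 0"
    "(\<integral>\<theta>. g \<theta> \<partial>interval_measure a b) = 0" "l2n a b g = 1"
proof -
  obtain u where u: "u \<in> poisson_span (Suc m)" "\<And>h. h \<in> poisson_span m \<Longrightarrow> L2inner a b u h = 0"
    "L2inner a b u (poisson_mass m) \<noteq> 0" using poisson_residual[OF assms] by metis
  obtain v where v: "v \<in> poisson_span (Suc (Suc m))" "\<And>h. h \<in> poisson_span (Suc m) \<Longrightarrow> L2inner a b v h = 0"
    "L2inner a b v (poisson_mass (Suc m)) \<noteq> 0" using poisson_residual[OF assms] by metis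
  have L: "u \<in> L2 a b" "v \<in> L2 a b" by (rule poisson_span_L2[OF u(1)] poisson_span_L2[OF v(1)])+
  define I where "I f = (\<integral>\<theta>. f \<theta> \<partial>interval_measure a b)" for f :: "real \<Rightarrow> real"
  \<comment> \<open>The coefficients \<open>(I v, - I u)\<close> solve the integral condition; if
    both integrals vanish every combination does, and \<open>u\<close> alone is taken to avoid the
    zero vector.\<close>
  define s where "s = (if I u = 0 \<and> I v = 0 then 1 else I v)"
  define t where "t = - I u"
  have st: "s \<noteq> 0 \<or> t \<noteq> 0" "s * I u + t * I v = 0" by (auto simp: s_def t_def)
  define g where "g = (\<lambda>\<theta>. s * u \<theta> + t * v \<theta>)"
  have gS: "g \<in> poisson_span (m + 2)"
    unfolding g_def using u(1) v(1)
    by (intro poisson_span_add poisson_span_cmult) (auto intro: poisson_span_mono)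
  have gL: "g \<in> L2 a b" by (rule poisson_span_L2[OF gS])
  have orth: "L2inner a b g h = 0" if "h \<in> poisson_span m" for h
    unfolding g_def using L poisson_span_L2[OF that] u(2)[OF that] v(2)[OF poisson_span_mono[OF that]]
    by (simp add: L2inner_add_left L2_cmult L2inner_cmult_left)
  have Ig: "I g = 0"
    using st(2) L unfolding I_def g_def by (simp add: L2_integrable)
  have nz: "l2n a b g \<noteq> 0"
  proof
    assume "l2n a b g = 0"
    have uv: "L2inner a b v u = 0" by (rule v(2)[OF u(1)])
    have "(l2n a b g)\<^sup>2 = s\<^sup>2 * (l2n a b u)\<^sup>2 + t\<^sup>2 * (l2n a b v)\<^sup>2"
      unfolding g_def using L uv
      by (subst l2n_pythagoras) (auto simp: L2_cmult L2inner_cmult_left L2inner_cmult_right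
          L2inner_commute[of a b u v] l2n_cmult power_mult_distrib)
    then have "s\<^sup>2 * (l2n a b u)\<^sup>2 = 0" "t\<^sup>2 * (l2n a b v)\<^sup>2 = 0"
      using \<open>l2n a b g = 0\<close> by (auto simp: add_nonneg_eq_0_iff)
    moreover have "l2n a b u \<noteq> 0" using u(3) L2_cauchy_schwarz[OF L(1) poisson_mass_L2[of m]] by auto
    moreover have "l2n a b v \<noteq> 0" using v(3) L2_cauchy_schwarz[OF L(2) poisson_mass_L2[of "Suc m"]] by auto
    ultimately show False using st(1) by auto
  qed
  show ?thesis
  proof (rule that)
    show "(\<lambda>\<theta>. (1 / l2n a b g) * g \<theta>) \<in> poisson_span (m + 2)" by (intro poisson_span_cmult gS)
    show "L2inner a b (\<lambda>\<theta>. (1 / l2n a b g) * g \<theta>) h = 0" if "h \<in> poisson_span m" for h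
      unfolding L2inner_cmult_left using orth[OF that] by simp
    show "(\<integral>\<theta>. (1 / l2n a b g) * g \<theta> \<partial>interval_measure a b) = 0"
      using Ig by (simp add: I_def)
    show "l2n a b (\<lambda>\<theta>. (1 / l2n a b g) * g \<theta>) = 1" unfolding l2n_cmult using nz by simp
  qed
qed

text \<open>The centre of the perturbation is proportional to \<open>exp (- \<theta>)\<close> and
  not uniform: it lies in \<open>V_1\<close>, so it adds nothing to the approximation error from
  index 1 on. The condition \<open>0 < r\<close> is tied to this.\<close>

lemma exp_density:
  assumes "a < b"
  obtains c where "c > 0" "(\<integral>\<theta>. c * exp (- \<theta>) \<partial>interval_measure a b) = 1"
    "(\<lambda>\<theta>. c * exp (- \<theta>)) \<in> poisson_span 1"
proof -
  define J where "J = (\<integral>\<theta>. exp (- \<theta>) \<partial>interval_measure a b)"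
  have "J = L2inner a b (\<lambda>\<theta>. exp (- \<theta>)) (\<lambda>_. 1)" by (simp add: J_def L2inner_def)
  also have "\<dots> = integral {a..b} (\<lambda>\<theta>. exp (- \<theta>) * 1)" by (intro L2inner_eq_integral continuous_intros)
  also have "\<dots> = integral {a..b} (\<lambda>\<theta>. exp (- \<theta>))" by simp
  also have "\<dots> = exp (- a) - exp (- b)"
  proof (rule integral_unique)
    have "((\<lambda>\<theta>. exp (- \<theta>)) has_integral (- exp (- b) - - exp (- a))) {a..b}"
      using assms by (intro fundamental_theorem_of_calculus)
        (auto intro!: derivative_eq_intros simp: has_real_derivative_iff_has_vector_derivative[symmetric])
    then show "((\<lambda>\<theta>. exp (- \<theta>)) has_integral (exp (- a) - exp (- b))) {a..b}" by simp
  qed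
  finally have J: "J > 0" using assms by simp
  show ?thesis
  proof (rule that[of "1 / J"])
    show "(\<lambda>\<theta>. 1 / J * exp (- \<theta>)) \<in> poisson_span 1"
      unfolding poisson_span_iff_poly by (rule exI[of _ "[:1 / J:]"]) (auto simp: deg_less_def)
  qed (use J in \<open>auto simp: J_def\<close>)
qed

text \<open>For \<open>k \<le> m + 1\<close> the centre is already a competitor in
  \<open>V_k\<close> at distance \<open>C (m + 2)^(- \<alpha>)\<close>, the smallest of the
  tolerances involved; for larger \<open>k\<close> the density itself lies in \<open>V_k\<close>.
  The hypothesis \<open>small\<close> makes the perturbation pointwise smaller than the
  centre.\<close>

lemma approx_class_two_points:
  assumes a: "0 \<le> a" "a < b" and C: "0 < C" and r: "0 < r"
    and g: "g \<in> poisson_span (m + 2)" "l2n a b g = 1" "(\<integral>\<theta>. g \<theta> \<partial>interval_measure a b) = 0"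
    and c: "(\<integral>\<theta>. c * exp (- \<theta>) \<partial>interval_measure a b) = 1" "(\<lambda>\<theta>. c * exp (- \<theta>)) \<in> poisson_span 1"
    and s: "\<bar>s\<bar> = C * power_seq \<alpha> (m + 1)" and alpha: "0 \<le> \<alpha>"
    and small: "sqrt (2 / (b - a)) * exp b * real (m + 2) * (C * power_seq \<alpha> (m + 1)) \<le> c * exp (- b)"
  shows "(\<lambda>\<theta>. c * exp (- \<theta>) + s * g \<theta>) \<in> approx_class a b (power_seq \<alpha>) C r \<inter> L2_densities a b"
proof
  define f0 where "f0 = (\<lambda>\<theta>. c * exp (- \<theta>))"
  define f where "f = (\<lambda>\<theta>. f0 \<theta> + s * g \<theta>)"
  have f0: "f0 \<in> poisson_span k" if "0 < k" for k
    unfolding f0_def using poisson_span_mono[OF c(2), of k] that by simp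
  have fS: "f \<in> poisson_span (m + 2)" unfolding f_def by (intro poisson_span_add poisson_span_cmult f0 g) auto
  have fL: "f \<in> L2 a b" and gL: "g \<in> L2 a b" and f0L: "f0 \<in> L2 a b"
    by (rule poisson_span_L2[OF fS] poisson_span_L2[OF g(1)] poisson_span_L2[OF f0[of 1]])+ simp
  have c0: "0 < c"
  proof (rule ccontr)
    assume "\<not> 0 < c"
    then have "0 \<le> (\<integral>\<theta>. - (c * exp (- \<theta>)) \<partial>interval_measure a b)"
      by (intro Bochner_Integration.integral_nonneg) (auto simp: mult_nonpos_nonneg)
    then show False using c(1) by simp
  qed
  have sup: "\<bar>s * g \<theta>\<bar> \<le> f0 \<theta>" if "\<theta> \<in> {a..b}" for \<theta>
  proof -
    have "\<bar>s * g \<theta>\<bar> \<le> (C * power_seq \<alpha> (m + 1)) * (sqrt (2 / (b - a)) * exp b * real (m + 2) * 1)"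
      unfolding abs_mult s using poisson_span_sup_bound[OF a g(1) that] g(2) C
      by (intro mult_left_mono) (auto simp: power_seq_def)
    also have "\<dots> \<le> c * exp (- b)" using small by (simp add: mult_ac)
    also have "\<dots> \<le> f0 \<theta>" unfolding f0_def using that c0 by simp
    finally show ?thesis .
  qed
  have "(\<integral>\<theta>. f \<theta> \<partial>interval_measure a b) = 1"
    unfolding f_def using g(3) c(1) L2_integrable[OF gL] L2_integrable[OF f0L] by (simp add: f0_def)
  moreover have "0 \<le> f \<theta>" if "\<theta> \<in> {a..b}" for \<theta> using sup[OF that] by (simp add: f_def abs_le_iff)
  ultimately show "(\<lambda>\<theta>. c * exp (- \<theta>) + s * g \<theta>) \<in> L2_densities a b"
    using fL by (auto simp: L2_densities_def f_def f0_def space_restrict_space intro!: AE_I2)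
  have "l2n a b (\<lambda>\<theta>. f \<theta> - span_projection a b k f \<theta>) \<le> C * power_seq \<alpha> k" if "k \<ge> r" for k
  proof (cases "k \<le> m + 1")
    case True
    have "l2n a b (\<lambda>\<theta>. f \<theta> - span_projection a b k f \<theta>) \<le> l2n a b (\<lambda>\<theta>. f \<theta> - f0 \<theta>)"
      using r that by (intro span_projection_best a fL f0) auto
    also have "\<dots> = C * power_seq \<alpha> (m + 1)" by (simp add: f_def l2n_cmult g(2) s)
    also have "\<dots> \<le> C * power_seq \<alpha> k"
      unfolding power_seq_def using True C alpha by (intro mult_left_mono powr_mono2') auto
    finally show ?thesis .
  next
    case False
    have "l2n a b (\<lambda>\<theta>. f \<theta> - span_projection a b k f \<theta>) \<le> l2n a b (\<lambda>\<theta>. f \<theta> - f \<theta>)"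
      using False by (intro span_projection_best a fL poisson_span_mono[OF fS]) auto
    also have "\<dots> = 0" by (simp add: l2n_def L2inner_def)
    also have "\<dots> \<le> C * power_seq \<alpha> k" using C by (simp add: power_seq_def)
    finally show ?thesis .
  qed
  then have "L2norm a b (\<lambda>\<theta>. f \<theta> - span_projection a b k f \<theta>) \<le> ennreal (C * power_seq \<alpha> k)" if "k \<ge> r" for k
    using that fL poisson_span_L2[OF span_projection_in[OF a(2) fL]]
    by (subst L2norm_eq) (auto intro!: L2_diff ennreal_leI)
  then show "(\<lambda>\<theta>. c * exp (- \<theta>) + s * g \<theta>) \<in> approx_class a b (power_seq \<alpha>) C r"
    using fL by (auto simp: approx_class_def f_def f0_def)
qed

text \<open>The perturbation uses the full tolerance of the class at index \<open>m + 1\<close>, so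
  the only loss is the factor \<open>(1 + \<epsilon>)^(- \<alpha>)\<close> between blind index and
  cutoff, and it disappears as \<epsilon> tends to 0.\<close>

lemma approx_class_lower:
  assumes a: "0 \<le> a" "a < b" and alpha: "1 < \<alpha>" and C: "0 < C" and r: "0 < r"
  shows "ennreal C \<le> liminf (\<lambda>n. ennreal (log_ratio n powr \<alpha>) *
             (INF g \<in> estimators a b n.
                SUP f \<in> approx_class a b (power_seq \<alpha>) C r \<inter> L2_densities a b. mean_error a b n g f))"
    (is "_ \<le> liminf (\<lambda>n. ennreal (log_ratio n powr \<alpha>) * ?R n)")
proof -
  have b: "0 < b" using a by simp
  obtain c where c: "c > 0" "(\<integral>\<theta>. c * exp (- \<theta>) \<partial>interval_measure a b) = 1"
    "(\<lambda>\<theta>. c * exp (- \<theta>)) \<in> poisson_span 1" using exp_density[OF a(2)] by metis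
  have main: "ennreal (C * (1 + \<epsilon>) powr (- \<alpha>)) \<le> liminf (\<lambda>n. ennreal (log_ratio n powr \<alpha>) * ?R n)"
    if eps: "0 < \<epsilon>" for \<epsilon>
  proof -
    define t where "t n = real n * (b ^ blind_index \<epsilon> n / fact (blind_index \<epsilon> n))" for n
    \<comment> \<open>The 3 collects the rounding of the blind index, the index \<open>m + 1\<close>
      in the tolerance, and the shift inside \<open>power_seq\<close>.\<close>
    define w where "w L = L powr \<alpha> * (C * ((1 + \<epsilon>) * L + 3) powr (- \<alpha>))" for L
    have "(w \<longlongrightarrow> C * (1 + \<epsilon>) powr (- \<alpha>)) at_top"
      unfolding w_def using eps alpha C by real_asymp
    then have "(\<lambda>n. w (log_ratio n)) \<longlonglongrightarrow> C * (1 + \<epsilon>) powr (- \<alpha>)"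
      by (rule filterlim_compose[OF _ log_ratio_at_top])
    moreover have "t \<longlonglongrightarrow> 0" unfolding t_def by (rule blind_tail_vanishes[OF b eps])
    ultimately have "(\<lambda>n. w (log_ratio n) * (1 - t n)) \<longlonglongrightarrow> C * (1 + \<epsilon>) powr (- \<alpha>) * (1 - 0)"
      by (intro tendsto_intros)
    then have lim: "(\<lambda>n. ennreal (w (log_ratio n) * (1 - t n))) \<longlonglongrightarrow> ennreal (C * (1 + \<epsilon>) powr (- \<alpha>))"
      by (intro tendsto_ennrealI) simp
    \<comment> \<open>Here \<open>\<alpha> > 1\<close> is decisive: the linear factor from the sup
      bound has to lose against the power.\<close>
    have "((\<lambda>x::real. sqrt (2 / (b - a)) * exp b * (x + 2) * (C * (1 + (x + 1)) powr (- \<alpha>))) \<longlongrightarrow> 0) at_top"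
      using alpha a C by real_asymp
    then have "eventually (\<lambda>x::real. sqrt (2 / (b - a)) * exp b * (x + 2) * (C * (1 + (x + 1)) powr (- \<alpha>)) < c * exp (- b)) at_top"
      using c(1) by (intro order_tendstoD(2)[of _ 0]) auto
    then have ev: "eventually (\<lambda>n. sqrt (2 / (b - a)) * exp b * (real (blind_index \<epsilon> n) + 2)
        * (C * (1 + (real (blind_index \<epsilon> n) + 1)) powr (- \<alpha>)) < c * exp (- b)) sequentially"
      by (rule eventually_compose_filterlim)
         (rule filterlim_compose[OF filterlim_real_sequentially blind_index_at_top[OF eps]])
    have "eventually (\<lambda>n. ennreal (w (log_ratio n) * (1 - t n)) \<le> ennreal (log_ratio n powr \<alpha>) * ?R n) sequentially"
      using ev filterlim_at_top[THEN iffD1, OF log_ratio_at_top, rule_format, of 1]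
    proof eventually_elim
      case (elim n)
      define m where "m = blind_index \<epsilon> n"
      define s where "s = C * power_seq \<alpha> (m + 1)"
      have s0: "0 \<le> s" using C by (simp add: s_def power_seq_def)
      obtain g where g: "g \<in> poisson_span (m + 2)" "\<And>h. h \<in> poisson_span m \<Longrightarrow> L2inner a b g h = 0"
        "(\<integral>\<theta>. g \<theta> \<partial>interval_measure a b) = 0" "l2n a b g = 1"
        using blind_direction[OF a(2), of m] by metis
      have small: "sqrt (2 / (b - a)) * exp b * real (m + 2) * (C * power_seq \<alpha> (m + 1)) \<le> c * exp (- b)"
        using elim(1) by (simp add: power_seq_def m_def algebra_simps)
      let ?F = "approx_class a b (power_seq \<alpha>) C r \<inter> L2_densities a b"
      define f where "f \<sigma> = (\<lambda>\<theta>. c * exp (- \<theta>) + \<sigma> * g \<theta>)" for \<sigma>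
      have mem: "f \<sigma> \<in> ?F" if "\<bar>\<sigma>\<bar> = s" for \<sigma>
        unfolding f_def using that alpha
        by (intro approx_class_two_points[OF a C r g(1,4,3) c(2,3) _ _ small]) (auto simp: s_def)
      have cL: "(\<lambda>\<theta>. c * exp (- \<theta>)) \<in> L2 a b" and gL: "g \<in> L2 a b"
        by (intro poisson_span_L2[OF c(3)] poisson_span_L2[OF g(1)])+
      have mass: "mixture_mass a b (f \<sigma>) k = L2inner a b (\<lambda>\<theta>. c * exp (- \<theta>)) (poisson_mass k)" if "k < m" for k \<sigma>
        unfolding mixture_mass_eq_L2inner f_def using g(2)[OF poisson_mass_in_span[OF that]] cL gL
        by (simp add: L2inner_add_left L2_cmult L2inner_cmult_left)
      have mem2: "f s \<in> ?F" "f (- s) \<in> ?F" using mem[of s] mem[of "- s"] s0 by auto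
      \<comment> \<open>The two densities lie symmetrically around the centre at distance
        \<open>2 s\<close>. Half of it is \<open>s\<close>, so the two-point method keeps the exact
        constant.\<close>
      have "l2n a b (\<lambda>\<theta>. f s \<theta> - f (- s) \<theta>) = l2n a b (\<lambda>\<theta>. (2 * s) * g \<theta>)"
        by (simp add: f_def algebra_simps)
      also have "\<dots> = 2 * s" unfolding l2n_cmult g(4) using s0 by simp
      finally have D: "l2n a b (\<lambda>\<theta>. f s \<theta> - f (- s) \<theta>) / 2 = s" by simp
      have low: "ennreal s * ennreal (1 - t n) \<le> ?R n"
      proof -
        have "f s \<in> L2_densities a b" "f (- s) \<in> L2_densities a b" using mem2 by auto
        from two_point_mean_error[OF a(1) this mem2, of m n]
        show ?thesis unfolding D t_def m_def[symmetric] by (simp add: mass)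
      qed
      have L1: "1 \<le> log_ratio n" by (rule elim(2))
      have "ennreal (w (log_ratio n) * (1 - t n)) \<le> ennreal (log_ratio n powr \<alpha> * s) * ennreal (1 - t n)"
      proof -
        have "((1 + \<epsilon>) * log_ratio n + 3) powr (- \<alpha>) \<le> power_seq \<alpha> (m + 1)"
          unfolding power_seq_def using blind_index_le[of \<epsilon> n] L1 eps alpha
          by (intro powr_mono2') (auto simp: m_def)
        then have "w (log_ratio n) \<le> log_ratio n powr \<alpha> * s"
          unfolding w_def s_def using C by (intro mult_left_mono) auto
        moreover have "0 \<le> w (log_ratio n)" using C by (simp add: w_def)
        ultimately show ?thesis by (subst ennreal_mult') (auto intro!: mult_right_mono ennreal_leI)
      qed
      also have "\<dots> = ennreal (log_ratio n powr \<alpha>) * (ennreal s * ennreal (1 - t n))"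
        using s0 by (simp add: ennreal_mult mult.assoc)
      also have "\<dots> \<le> ennreal (log_ratio n powr \<alpha>) * ?R n" by (intro mult_left_mono low) simp
      finally show ?case .
    qed
    then have "liminf (\<lambda>n. ennreal (w (log_ratio n) * (1 - t n))) \<le> liminf (\<lambda>n. ennreal (log_ratio n powr \<alpha>) * ?R n)"
      by (rule Liminf_mono)
    then show ?thesis using lim_imp_Liminf[OF _ lim] by simp
  qed
  \<comment> \<open>The bound holds for each fixed \<epsilon>; it is taken along
    \<open>1 / (k + 1)\<close>.\<close>
  have "((\<lambda>x::real. C * (1 + 1 / x) powr (- \<alpha>)) \<longlongrightarrow> C) at_top" by real_asymp
  then have "(\<lambda>k. C * (1 + 1 / real (Suc k)) powr (- \<alpha>)) \<longlonglongrightarrow> C"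
    by (rule filterlim_compose) (rule filterlim_compose[OF filterlim_real_sequentially filterlim_Suc])
  then have "(\<lambda>k. ennreal (C * (1 + 1 / real (Suc k)) powr (- \<alpha>))) \<longlonglongrightarrow> ennreal C" by (rule tendsto_ennrealI)
  then show ?thesis
    by (rule LIMSEQ_le_const2) (use main[of "1 / real (Suc _)"] in auto)
qed

text \<open>The integer part and the shift in \<open>(1 + m)^(- \<alpha>)\<close> fit together:
  \<open>log_ratio n \<le> 1 + m\<close>, so the scaled bias is at most \<open>C\<close> for every
  large \<open>n\<close>, without any asymptotic loss.\<close>

lemma approx_class_upper:
  assumes a: "0 \<le> a" "a < b" and alpha: "1 < \<alpha>" and C: "0 < C"
  shows "limsup (\<lambda>n. ennreal (log_ratio n powr \<alpha>) *
             (SUP f \<in> approx_class a b (power_seq \<alpha>) C r \<inter> L2_densities a b.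
                mean_error a b n (projection_estimator a b (cutoff 1 n) n) f)) \<le> ennreal C"
    (is "limsup ?U \<le> _")
proof -
  obtain K where K: "K \<ge> 1" and risk: "\<And>m n f. f \<in> L2_densities a b \<Longrightarrow> 0 < n \<Longrightarrow>
       mean_error a b n (projection_estimator a b m n) f
         \<le> ennreal (l2n a b (\<lambda>\<theta>. f \<theta> - span_projection a b m f \<theta>) + sqrt (K ^ m * fact m / real n))"
    using projection_risk[OF a] by metis
  define V where "V n = K ^ cutoff 1 n * fact (cutoff 1 n) / real n" for n
  have V0: "0 \<le> V n" for n using K by (simp add: V_def)
  have "(\<lambda>n. log_ratio n powr (2 * \<alpha>) * V n) \<longlonglongrightarrow> 0"
    unfolding V_def by (rule cutoff_variance_vanishes[OF K]) auto
  then have "(\<lambda>n. C + sqrt (log_ratio n powr (2 * \<alpha>) * V n)) \<longlonglongrightarrow> C + sqrt 0" by (intro tendsto_intros)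
  then have lim: "(\<lambda>n. ennreal (C + sqrt (log_ratio n powr (2 * \<alpha>) * V n))) \<longlonglongrightarrow> ennreal C"
    by (intro tendsto_ennrealI) simp
  have "eventually (\<lambda>n. ?U n \<le> ennreal (C + sqrt (log_ratio n powr (2 * \<alpha>) * V n))) sequentially"
    using filterlim_at_top[THEN iffD1, OF log_ratio_at_top, rule_format, of "max 1 (real r + 1)"] eventually_gt_at_top[of 0]
  proof eventually_elim
    case (elim n)
    define m where "m = cutoff 1 n"
    define L where "L = log_ratio n"
    have L: "1 \<le> L" "real r + 1 \<le> L" using elim by (auto simp: L_def)
    have Lm: "L \<le> 1 + real m" using cutoff_ge[of 1 n] by (simp add: m_def L_def)
    then have rm: "r \<le> m" using L by linarith
    have "ennreal (L powr \<alpha>) * mean_error a b n (projection_estimator a b m n) f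
        \<le> ennreal (C + sqrt (L powr (2 * \<alpha>) * V n))"
      if f: "f \<in> approx_class a b (power_seq \<alpha>) C r \<inter> L2_densities a b" for f
    proof -
      have fL: "f \<in> L2 a b" using f by (auto intro: L2_densities_L2)
      have "L2norm a b (\<lambda>\<theta>. f \<theta> - span_projection a b m f \<theta>) \<le> ennreal (C * power_seq \<alpha> m)"
        using f rm by (auto simp: approx_class_def)
      then have "l2n a b (\<lambda>\<theta>. f \<theta> - span_projection a b m f \<theta>) \<le> C * power_seq \<alpha> m"
        using fL poisson_span_L2[OF span_projection_in[OF a(2) fL]] C
        by (subst (asm) L2norm_eq) (auto intro!: L2_diff simp: power_seq_def)
      then have "mean_error a b n (projection_estimator a b m n) f \<le> ennreal (C * power_seq \<alpha> m + sqrt (V n))"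
        using order_trans[OF risk[of f n m] ennreal_leI[OF add_right_mono]] f elim(2)
        unfolding V_def m_def[symmetric] by simp
      then have "ennreal (L powr \<alpha>) * mean_error a b n (projection_estimator a b m n) f
          \<le> ennreal (L powr \<alpha>) * ennreal (C * power_seq \<alpha> m + sqrt (V n))" by (intro mult_left_mono) auto
      also have "\<dots> = ennreal (L powr \<alpha> * (C * power_seq \<alpha> m + sqrt (V n)))"
        using C V0 by (intro ennreal_mult[symmetric]) (auto simp: power_seq_def)
      also have "\<dots> \<le> ennreal (C + sqrt (L powr (2 * \<alpha>) * V n))"
      proof (rule ennreal_leI)
        have "L powr \<alpha> * power_seq \<alpha> m \<le> (1 + real m) powr \<alpha> * power_seq \<alpha> m"
          using Lm L alpha by (intro mult_right_mono powr_mono2) (auto simp: power_seq_def)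
        also have "\<dots> = 1" by (simp add: power_seq_def powr_minus field_simps)
        finally have "C * (L powr \<alpha> * power_seq \<alpha> m) \<le> C * 1" using C by (intro mult_left_mono) auto
        moreover have "sqrt (L powr (2 * \<alpha>) * V n) = L powr \<alpha> * sqrt (V n)"
        proof -
          have "L powr (2 * \<alpha>) = (L powr \<alpha>)\<^sup>2" using L by (simp add: power2_eq_square powr_add[symmetric])
          then show ?thesis by (simp add: real_sqrt_mult)
        qed
        ultimately show "L powr \<alpha> * (C * power_seq \<alpha> m + sqrt (V n)) \<le> C + sqrt (L powr (2 * \<alpha>) * V n)"
          by (simp add: algebra_simps)
      qed
      finally show ?thesis .
    qed
    then show ?case
      unfolding L_def[symmetric] m_def[symmetric] by (simp add: SUP_mult_left_ennreal SUP_le_iff)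
  qed
  then have "limsup ?U \<le> limsup (\<lambda>n. ennreal (C + sqrt (log_ratio n powr (2 * \<alpha>) * V n)))"
    by (rule Limsup_mono)
  then show ?thesis using lim_imp_Limsup[OF _ lim] by simp
qed

lemma approx_class_efficient:
  assumes a: "0 \<le> a" "a < b" and alpha: "1 < \<alpha>" and C: "0 < C" and r: "0 < r"
  shows "limsup (\<lambda>n. ennreal (log_ratio n powr \<alpha>) *
             (SUP f \<in> approx_class a b (power_seq \<alpha>) C r \<inter> L2_densities a b.
                mean_error a b n (projection_estimator a b (cutoff 1 n) n) f)) = ennreal C"
      (is "limsup ?U = _")
    and "liminf (\<lambda>n. ennreal (log_ratio n powr \<alpha>) *
             (INF g \<in> estimators a b n.
                SUP f \<in> approx_class a b (power_seq \<alpha>) C r \<inter> L2_densities a b.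
                  mean_error a b n g f)) = ennreal C"
      (is "liminf ?R = _")
proof -
  have low: "ennreal C \<le> liminf ?R" by (rule approx_class_lower[OF a alpha C r])
  have "liminf ?R \<le> liminf ?U"
    by (intro Liminf_mono always_eventually allI mult_left_mono INF_lower projection_estimator_estimator a) auto
  moreover have "liminf ?U \<le> limsup ?U" by (rule Liminf_le_Limsup) simp
  moreover have "limsup ?U \<le> ennreal C" by (rule approx_class_upper[OF a alpha C])
  ultimately show "limsup ?U = ennreal C" "liminf ?R = ennreal C" using low by auto
qed

section \<open>Central differences\<close>

text \<open>The difference without the convention for points near the boundary, so that it is linear
  and has a clean recursion in the order.\<close>

definition central_diff :: "nat \<Rightarrow> real \<Rightarrow> (real \<Rightarrow> real) \<Rightarrow> real \<Rightarrow> real" where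
  "central_diff n h f x = (\<Sum>i\<le>n. real (n choose i) * (-1) ^ i * f (x + (real i - real n / 2) * h))"

text \<open>Pascal's rule: the two summands of \<open>Suc n choose Suc i\<close> regroup into a
  difference of consecutive values.\<close>

lemma central_diff_Suc:
  "central_diff (Suc n) h f x = central_diff n h (\<lambda>y. f (y - h / 2) - f (y + h / 2)) x"
proof -
  define F where "F i = f (x + (real i - real (Suc n) / 2) * h)" for i
  have "central_diff (Suc n) h f x = (\<Sum>i\<le>Suc n. real (Suc n choose i) * (-1) ^ i * F i)"
    by (simp add: central_diff_def F_def)
  also have "\<dots> = F 0 + (\<Sum>i\<le>n. real (Suc n choose Suc i) * (-1) ^ Suc i * F (Suc i))"
    by (subst sum.atMost_Suc_shift) simp
  also have "\<dots> = F 0 + (\<Sum>i\<le>n. real (n choose Suc i) * (-1) ^ Suc i * F (Suc i))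
      + (\<Sum>i\<le>n. real (n choose i) * (-1) ^ Suc i * F (Suc i))"
    by (simp add: algebra_simps sum.distrib[symmetric])
  also have "F 0 + (\<Sum>i\<le>n. real (n choose Suc i) * (-1) ^ Suc i * F (Suc i))
      = (\<Sum>i\<le>Suc n. real (n choose i) * (-1) ^ i * F i)"
    by (subst sum.atMost_Suc_shift) simp
  also have "\<dots> = (\<Sum>i\<le>n. real (n choose i) * (-1) ^ i * F i)" by (simp add: binomial_eq_0)
  finally have "central_diff (Suc n) h f x
      = (\<Sum>i\<le>n. real (n choose i) * (-1) ^ i * (F i - F (Suc i)))"
    by (simp add: algebra_simps sum.distrib[symmetric] sum_subtractf[symmetric])
  also have "\<dots> = central_diff n h (\<lambda>y. f (y - h / 2) - f (y + h / 2)) x"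
  proof -
    have "x + (real i - real (Suc n) / 2) * h = x + (real i - real n / 2) * h - h / 2"
      "x + (real (Suc i) - real (Suc n) / 2) * h = x + (real i - real n / 2) * h + h / 2" for i
      by (simp_all add: field_simps)
    then show ?thesis unfolding central_diff_def F_def by (simp only:)
  qed
  finally show ?thesis .
qed

text \<open>Each induction step trades a first difference for a derivative by the mean value
  theorem, and uses up \<open>h / 2\<close> of the neighbourhood on which the last derivative is
  bounded.\<close>

lemma central_diff_bound:
  assumes "0 \<le> h" "\<And>k y. k < n \<Longrightarrow> (G k has_real_derivative G (Suc k) y) (at y)"
    "\<And>y. \<bar>y - x\<bar> \<le> real n / 2 * h \<Longrightarrow> \<bar>G n y\<bar> \<le> M"
  shows "\<bar>central_diff n h (G 0) x\<bar> \<le> h ^ n * M"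
  using assms(2,3)
proof (induction n arbitrary: G M)
  case 0
  then show ?case by (simp add: central_diff_def)
next
  case (Suc n)
  define H where "H k y = G k (y - h / 2) - G k (y + h / 2)" for k y
  have "\<bar>central_diff n h (H 0) x\<bar> \<le> h ^ n * (h * M)"
  proof (rule Suc.IH)
    fix k y assume "k < n"
    then show "(H k has_real_derivative H (Suc k) y) (at y)"
      unfolding H_def by (auto intro!: derivative_eq_intros DERIV_chain2[OF Suc.prems(1)])
  next
    fix y assume y: "\<bar>y - x\<bar> \<le> real n / 2 * h"
    show "\<bar>H n y\<bar> \<le> h * M"
    proof (cases "h = 0")
      case False
      then have h: "0 < h" using assms(1) by simp
      have "\<exists>z. y - h / 2 < z \<and> z < y + h / 2 \<and> G n (y + h / 2) - G n (y - h / 2) = (y + h / 2 - (y - h / 2)) * G (Suc n) z"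
        using h Suc.prems(1)[of n] by (intro MVT2) auto
      then obtain z where z: "y - h / 2 < z" "z < y + h / 2" "G n (y + h / 2) - G n (y - h / 2) = h * G (Suc n) z"
        by auto
      have "\<bar>G (Suc n) z\<bar> \<le> M"
      proof (rule Suc.prems(2))
        have "real (Suc n) / 2 * h = real n / 2 * h + h / 2" by (simp add: field_simps)
        moreover have "\<bar>z - y\<bar> \<le> h / 2" unfolding abs_le_iff using z(1,2) by linarith
        ultimately show "\<bar>z - x\<bar> \<le> real (Suc n) / 2 * h" using y by linarith
      qed
      moreover have "\<bar>H n y\<bar> = h * \<bar>G (Suc n) z\<bar>"
        using z(3) h by (simp add: H_def abs_minus_commute[of "G n (y - h / 2)"] abs_mult)
      ultimately show ?thesis using h by simp
    qed (simp add: H_def)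
  qed
  then show ?case by (simp add: central_diff_Suc H_def[abs_def] mult_ac)
qed

lemma central_diff_const: "0 < n \<Longrightarrow> central_diff n h (\<lambda>_. c) x = 0"
proof -
  assume "0 < n"
  then have "(\<Sum>i\<le>n. real (n choose i) * (-1) ^ i) = 0"
    using choose_alternating_sum[of n, where ?'a=real] by (simp add: mult.commute)
  then show ?thesis unfolding central_diff_def sum_distrib_right[symmetric] by simp
qed

lemma central_diff_add: "central_diff n h (\<lambda>x. f x + g x) x = central_diff n h f x + central_diff n h g x"
  by (simp add: central_diff_def algebra_simps sum.distrib)

lemma central_diff_cmult: "central_diff n h (\<lambda>x. c * f x) x = c * central_diff n h f x"
  by (simp add: central_diff_def sum_distrib_left mult_ac)

lemma central_diff_sq_le:
  "(central_diff n h f x)\<^sup>2 \<le> real (n + 1) * 4 ^ n * (\<Sum>i\<le>n. (f (x + (real i - real n / 2) * h))\<^sup>2)"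
proof -
  have "(central_diff n h f x)\<^sup>2 \<le> (\<Sum>i\<le>n. (real (n choose i) * (-1) ^ i)\<^sup>2) * (\<Sum>i\<le>n. (f (x + (real i - real n / 2) * h))\<^sup>2)"
    unfolding central_diff_def by (rule Cauchy_Schwarz_ineq_sum)
  also have "\<dots> \<le> (\<Sum>i\<le>n. 4 ^ n) * (\<Sum>i\<le>n. (f (x + (real i - real n / 2) * h))\<^sup>2)"
  proof (intro mult_right_mono sum_mono sum_nonneg)
    fix i
    have "real (n choose i) \<le> 2 ^ n"
      using binomial_le_pow2[of n i] by (metis of_nat_le_iff of_nat_numeral of_nat_power)
    then have "(real (n choose i))\<^sup>2 \<le> (2 ^ n)\<^sup>2" by (intro power_mono) auto
    also have "(2 ^ n)\<^sup>2 = (4::real) ^ n" by (simp add: power2_eq_square power_mult_distrib[symmetric])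
    finally show "(real (n choose i) * (-1) ^ i)\<^sup>2 \<le> 4 ^ n"
      by (simp add: power_mult_distrib power_even_eq[symmetric] flip: power_mult)
  qed auto
  finally show ?thesis by simp
qed

lemma sym_difference_eq:
  "sym_difference a b n h f x =
     (if x - real n / 2 * h \<in> {a..b} \<and> x + real n / 2 * h \<in> {a..b} then central_diff n h f x else 0)"
  by (simp add: sym_difference_def central_diff_def)

lemma L2norm_leI:
  assumes "(\<integral>\<^sup>+ x. ennreal ((g x)\<^sup>2) \<partial>interval_measure a b) \<le> ennreal (R\<^sup>2)" "0 \<le> R"
  shows "L2norm a b g \<le> ennreal R"
proof -
  define I where "I = (\<integral>\<^sup>+ x. ennreal ((g x)\<^sup>2) \<partial>interval_measure a b)"
  have "I < \<infinity>" using assms(1) unfolding I_def[symmetric] by (metis ennreal_less_top infinity_ennreal_def le_less_trans)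
  then have "enn2real I \<le> R\<^sup>2" using assms(1) unfolding I_def[symmetric]
    by (metis enn2real_leI zero_le_power2)
  then have "sqrt (enn2real I) \<le> R" using assms(2) by (simp add: real_le_lsqrt)
  moreover have "I \<noteq> \<infinity>" using \<open>I < \<infinity>\<close> by auto
  ultimately show ?thesis unfolding L2norm_def Let_def I_def[symmetric] by (simp only: if_False) (rule ennreal_leI)
qed

section \<open>Geometry of the step weight\<close>

lemma step_weight_sq:
  assumes "x \<in> {a..b}"
  shows "(step_weight a b x)\<^sup>2 = ((b - a) / 2)\<^sup>2 - (x - (a + b) / 2)\<^sup>2"
proof -
  have "(step_weight a b x)\<^sup>2 = (x - a) * (b - x)"
    unfolding step_weight_def using assms by (intro real_sqrt_pow2) auto
  then show ?thesis by (simp add: power2_eq_square field_simps)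
qed

lemma step_weight_nonneg: "x \<in> {a..b} \<Longrightarrow> 0 \<le> step_weight a b x"
  by (simp add: step_weight_def)

lemma step_weight_le:
  assumes "x \<in> {a..b}"
  shows "step_weight a b x \<le> (b - a) / 2"
proof (rule power2_le_imp_le)
  show "(step_weight a b x)\<^sup>2 \<le> ((b - a) / 2)\<^sup>2" unfolding step_weight_sq[OF assms] by simp
qed (use assms in auto)

text \<open>Where the stencil stays inside the interval, \<open>\<phi>\<close> dominates the step enough to make
  \<open>x \<mapsto> x + \<kappa> \<phi>(x)\<close> expand distances by at least one half.\<close>

lemma stencil_expansion:
  assumes x: "x \<in> {a<..<b}" "x - \<Lambda> * step_weight a b x \<in> {a..b}" "x + \<Lambda> * step_weight a b x \<in> {a..b}"
    and y: "y \<in> {a<..<b}" "y - \<Lambda> * step_weight a b y \<in> {a..b}" "y + \<Lambda> * step_weight a b y \<in> {a..b}"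
    and k: "\<bar>\<kappa>\<bar> \<le> \<Lambda>"
  shows "\<bar>x - y\<bar> \<le> 2 * \<bar>(x + \<kappa> * step_weight a b x) - (y + \<kappa> * step_weight a b y)\<bar>"
proof -
  define c where "c = (a + b) / 2"
  define \<rho> where "\<rho> = (b - a) / 2"
  define \<phi> where "\<phi> = step_weight a b"
  have L: "0 \<le> \<Lambda>" using k by simp
  \<comment> \<open>Since \<phi> has derivative \<open>- (z - c) / \<phi>\<close>, this says that
    \<Lambda> times that derivative is at most 1/2 in absolute value. It follows by inserting
    \<open>\<Lambda> * \<phi> z \<le> \<rho> - \<bar>z - c\<bar>\<close> into the factorisation of
    the squared weight.\<close>
  have key: "0 < \<phi> z \<and> 2 * \<Lambda> * \<bar>z - c\<bar> \<le> \<phi> z"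
    if z: "z \<in> {a<..<b}" "z - \<Lambda> * \<phi> z \<in> {a..b}" "z + \<Lambda> * \<phi> z \<in> {a..b}" for z
  proof -
    have pos: "0 < \<phi> z" using z(1) by (simp add: \<phi>_def step_weight_def)
    have le: "\<Lambda> * \<phi> z \<le> \<rho> - \<bar>z - c\<bar>" using z(2,3) by (auto simp: \<rho>_def c_def field_simps abs_if)
    have rz: "\<bar>z - c\<bar> \<le> \<rho>" using z(1) by (auto simp: \<rho>_def c_def field_simps abs_if)
    have "(\<phi> z)\<^sup>2 = (\<rho> - \<bar>z - c\<bar>) * (\<rho> + \<bar>z - c\<bar>)"
      using step_weight_sq[of z a b] z(1) by (simp add: \<phi>_def \<rho>_def c_def power2_eq_square algebra_simps)
    also have "\<dots> \<ge> \<Lambda> * \<phi> z * (\<rho> + \<bar>z - c\<bar>)" using le rz by (intro mult_right_mono) auto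
    finally have "\<phi> z * (\<Lambda> * (\<rho> + \<bar>z - c\<bar>)) \<le> \<phi> z * \<phi> z" by (simp add: power2_eq_square mult_ac)
    then have "\<Lambda> * (\<rho> + \<bar>z - c\<bar>) \<le> \<phi> z" using pos by simp
    moreover have "\<Lambda> * (2 * \<bar>z - c\<bar>) \<le> \<Lambda> * (\<rho> + \<bar>z - c\<bar>)" using rz L by (intro mult_left_mono) auto
    ultimately show ?thesis using pos by (simp add: mult_ac)
  qed
  have kx: "0 < \<phi> x" "2 * \<Lambda> * \<bar>x - c\<bar> \<le> \<phi> x" using key[of x] x by (auto simp: \<phi>_def)
  have ky: "0 < \<phi> y" "2 * \<Lambda> * \<bar>y - c\<bar> \<le> \<phi> y" using key[of y] y by (auto simp: \<phi>_def)
  \<comment> \<open>The difference of squares replaces the derivative of \<phi>, so that the bounds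
    at \<open>x\<close> and \<open>y\<close> alone suffice.\<close>
  have sq: "(\<phi> x - \<phi> y) * (\<phi> x + \<phi> y) = - (x - y) * ((x - c) + (y - c))"
  proof -
    have "(\<phi> x)\<^sup>2 = \<rho>\<^sup>2 - (x - c)\<^sup>2" "(\<phi> y)\<^sup>2 = \<rho>\<^sup>2 - (y - c)\<^sup>2"
      using step_weight_sq[of _ a b] x(1) y(1) by (auto simp: \<phi>_def \<rho>_def c_def)
    then show ?thesis by (simp add: power2_eq_square algebra_simps)
  qed
  have "\<bar>\<kappa> * (\<phi> x - \<phi> y)\<bar> * (2 * (\<phi> x + \<phi> y)) = \<bar>\<kappa>\<bar> * (2 * \<bar>(\<phi> x - \<phi> y) * (\<phi> x + \<phi> y)\<bar>)"
    using kx ky by (simp add: abs_mult)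
  also have "\<dots> = \<bar>x - y\<bar> * (2 * \<bar>\<kappa>\<bar> * \<bar>(x - c) + (y - c)\<bar>)"
    unfolding sq abs_mult abs_minus_cancel by (simp add: mult_ac)
  also have "\<dots> \<le> \<bar>x - y\<bar> * (\<phi> x + \<phi> y)"
  proof (rule mult_left_mono)
    have "2 * \<bar>\<kappa>\<bar> * \<bar>(x - c) + (y - c)\<bar> \<le> 2 * \<Lambda> * (\<bar>x - c\<bar> + \<bar>y - c\<bar>)"
      using k by (intro mult_mono) auto
    then show "2 * \<bar>\<kappa>\<bar> * \<bar>(x - c) + (y - c)\<bar> \<le> \<phi> x + \<phi> y" using kx ky by (simp add: algebra_simps)
  qed simp
  finally have "(2 * \<bar>\<kappa> * (\<phi> x - \<phi> y)\<bar>) * (\<phi> x + \<phi> y) \<le> \<bar>x - y\<bar> * (\<phi> x + \<phi> y)" by (simp add: algebra_simps)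
  then have "2 * \<bar>\<kappa> * (\<phi> x - \<phi> y)\<bar> \<le> \<bar>x - y\<bar>" using kx ky by simp
  moreover have eq: "(x + \<kappa> * \<phi> x) - (y + \<kappa> * \<phi> y) = (x - y) + \<kappa> * (\<phi> x - \<phi> y)" by (simp add: algebra_simps)
  moreover have "\<bar>d\<bar> \<le> 2 * \<bar>d + e\<bar>" if "2 * \<bar>e\<bar> \<le> \<bar>d\<bar>" for d e :: real
    using that by (smt (verit))
  ultimately show ?thesis unfolding \<phi>_def[symmetric] eq by blast
qed

text \<open>The set lies in an interval of radius \<open>d\<close> about any of its points. Used for
  preimages, of which only the diameter is known.\<close>

lemma emeasure_diameter_le:
  fixes S :: "real set"
  assumes "\<And>x y. x \<in> S \<Longrightarrow> y \<in> S \<Longrightarrow> \<bar>x - y\<bar> \<le> d" "0 \<le> d"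
  shows "(\<integral>\<^sup>+ x. indicator S x \<partial>lborel) \<le> ennreal (2 * d)"
proof (cases "S = {}")
  case False
  then obtain z where z: "z \<in> S" by blast
  have "(\<integral>\<^sup>+ x. indicator S x \<partial>lborel) \<le> (\<integral>\<^sup>+ x. indicator {z - d..z + d} x \<partial>lborel)"
    using assms(1)[OF _ z] by (intro nn_integral_mono) (auto simp: indicator_def abs_le_iff algebra_simps)
  also have "\<dots> = ennreal (2 * d)" using assms(2) by simp
  finally show ?thesis .
qed simp

section \<open>Bump functions\<close>

definition bump_base :: "real \<Rightarrow> real" where
  "bump_base x = max 0 (x * (1 - x))"

text \<open>The polynomial cofactor of the derivatives: with \<open>w = x (1 - x)\<close>,
  differentiating \<open>w^n p\<close> gives \<open>w^(n-1) (n w' p + w p')\<close>.\<close>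

primrec bump_factor :: "nat \<Rightarrow> nat \<Rightarrow> real poly" where
  "bump_factor s 0 = 1"
| "bump_factor s (Suc k) = smult (real (s + 1 - k)) ([:1, -2:] * bump_factor s k)
     + [:0, 1, -1:] * pderiv (bump_factor s k)"

text \<open>For \<open>k \<le> s\<close> this is the k-th derivative of the truncated power
  \<open>max 0 (x (1 - x))^(s + 1)\<close>. That function is just smooth enough for differences of
  order \<open>s\<close>, and all its derivatives are explicit with the same support.\<close>

definition bump :: "nat \<Rightarrow> nat \<Rightarrow> real \<Rightarrow> real" where
  "bump s k x = bump_base x ^ (s + 1 - k) * poly (bump_factor s k) x"

text \<open>Away from 0 the function is locally a power or zero. At 0 the difference quotient is at
  most \<open>\<bar>h\<bar> ^ (n - 1)\<close>, which tends to 0 because the exponent is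
  positive.\<close>

lemma max_0_power_deriv:
  assumes "2 \<le> n"
  shows "((\<lambda>u::real. max 0 u ^ n) has_real_derivative real n * max 0 u ^ (n - 1)) (at u)"
proof -
  consider "u > 0" | "u < 0" | "u = 0" by linarith
  then show ?thesis
  proof cases
    case 1
    have "((\<lambda>u::real. u ^ n) has_real_derivative real n * u ^ (n - 1)) (at u)"
      by (auto intro!: derivative_eq_intros)
    moreover have "eventually (\<lambda>v. max 0 v ^ n = v ^ n) (nhds u)"
      using eventually_nhds_in_open[of "{0<..}" u] 1 by (auto elim!: eventually_mono)
    ultimately show ?thesis using 1 by (subst DERIV_cong_ev[OF refl _ refl]) auto
  next
    case 2
    have "eventually (\<lambda>v. max 0 v ^ n = 0) (nhds u)"
      using eventually_nhds_in_open[of "{..<0}" u] 2 assms by (auto elim!: eventually_mono)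
    then have "((\<lambda>u::real. max 0 u ^ n) has_real_derivative 0) (at u)"
      by (subst DERIV_cong_ev[OF refl _ refl, where g="\<lambda>_. 0"]) auto
    moreover have "real n * max 0 u ^ (n - 1) = 0" using 2 assms by simp
    ultimately show ?thesis by metis
  next
    case 3
    have "((\<lambda>h. max 0 h ^ n / h) \<longlongrightarrow> 0) (at (0::real))"
    proof (rule Lim_null_comparison)
      show "eventually (\<lambda>h. norm (max 0 h ^ n / h) \<le> \<bar>h\<bar> ^ (n - 1)) (at 0)"
      proof (rule always_eventually, rule allI)
        fix h :: real
        have "max 0 h ^ n \<le> \<bar>h\<bar> ^ n" by (intro power_mono) auto
        also have "\<dots> = \<bar>h\<bar> ^ (n - 1) * \<bar>h\<bar>" using assms by (metis One_nat_def Suc_pred gr0I not_numeral_le_zero power_Suc2)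
        finally show "norm (max 0 h ^ n / h) \<le> \<bar>h\<bar> ^ (n - 1)"
          by (cases "h = 0") (auto simp: field_simps power_abs[symmetric])
      qed
      have "((\<lambda>h::real. \<bar>h\<bar> ^ (n - 1)) \<longlongrightarrow> \<bar>0\<bar> ^ (n - 1)) (at 0)" by (intro tendsto_intros)
      moreover have "\<bar>0::real\<bar> ^ (n - 1) = 0" using assms by simp
      ultimately show "((\<lambda>h::real. \<bar>h\<bar> ^ (n - 1)) \<longlongrightarrow> 0) (at 0)" by (simp only:)
    qed
    then show ?thesis using 3 assms by (simp add: DERIV_def power_0_left)
  qed
qed

lemma bump_deriv:
  assumes "k < s"
  shows "(bump s k has_real_derivative bump s (Suc k) x) (at x)"
proof -
  define n where "n = s + 1 - k"
  have n: "2 \<le> n" "s + 1 - Suc k = n - 1" using assms by (auto simp: n_def)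
  define p where "p = bump_factor s k"
  have base: "((\<lambda>x. bump_base x ^ n) has_real_derivative real n * bump_base x ^ (n - 1) * (1 - 2 * x)) (at x)"
    unfolding bump_base_def
    by (rule DERIV_chain2[OF max_0_power_deriv[OF n(1)]]) (auto intro!: derivative_eq_intros)
  have "(bump s k has_real_derivative
      real n * bump_base x ^ (n - 1) * (1 - 2 * x) * poly p x + poly (pderiv p) x * bump_base x ^ n) (at x)"
    unfolding bump_def[abs_def] n_def[symmetric] p_def[symmetric]
    by (rule DERIV_mult[OF base poly_DERIV])
  moreover have e1: "bump_base x ^ n = bump_base x ^ (n - 1) * (x * (1 - x))"
  proof -
    have "bump_base x ^ n = bump_base x ^ (n - 1) * bump_base x"
      using n by (metis One_nat_def Suc_pred gr0I not_numeral_le_zero power_Suc2)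
    then show ?thesis using n by (auto simp: bump_base_def max_def)
  qed
  moreover have e2: "bump s (Suc k) x = bump_base x ^ (n - 1) * (real n * (1 - 2 * x) * poly p x + x * (1 - x) * poly (pderiv p) x)"
    unfolding bump_def n(2) by (simp add: p_def n_def algebra_simps)
  ultimately show ?thesis
    by (elim DERIV_cong) (simp only: e1 e2, simp only: algebra_simps)
qed

lemma bump_outside:
  assumes "k \<le> s" "x \<notin> {0<..<1}"
  shows "bump s k x = 0"
proof -
  have "x * (1 - x) \<le> 0" using assms(2) by (auto simp: mult_le_0_iff)
  then show ?thesis using assms(1) by (simp add: bump_def bump_base_def)
qed

lemma bump_continuous: "continuous_on S (bump s k)"
  unfolding bump_def[abs_def] bump_base_def by (intro continuous_intros)

lemma bump_bounded:
  obtains B where "B \<ge> 1" "\<And>k x. k \<le> s \<Longrightarrow> \<bar>bump s k x\<bar> \<le> B"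
proof -
  have "\<exists>B. \<forall>x\<in>{0..1}. \<bar>bump s k x\<bar> \<le> B" for k
    using compact_continuous_image[OF bump_continuous compact_Icc, THEN compact_imp_bounded]
    unfolding bounded_iff by fastforce
  then obtain B where B: "\<And>k x. x \<in> {0..1} \<Longrightarrow> \<bar>bump s k x\<bar> \<le> B k" by metis
  define M where "M = 1 + (\<Sum>k\<le>s. \<bar>B k\<bar>)"
  show ?thesis
  proof (rule that)
    show "1 \<le> M" by (simp add: M_def sum_nonneg)
    fix k x assume k: "k \<le> s"
    have "\<bar>B k\<bar> \<le> (\<Sum>k\<le>s. \<bar>B k\<bar>)" using k by (intro member_le_sum) auto
    then have BM: "B k \<le> M" "0 \<le> M" by (auto simp: M_def intro: sum_nonneg)
    show "\<bar>bump s k x\<bar> \<le> M"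
    proof (cases "x \<in> {0<..<1}")
      case True
      then show ?thesis using B[of x k] BM by auto
    qed (use bump_outside[OF k] BM in auto)
  qed
qed

lemma bump_disjoint:
  assumes "k \<le> s" "i \<noteq> j"
  shows "bump s k (x - real i) * bump s k (x - real j) = 0"
proof (cases "x - real i \<in> {0<..<1} \<and> x - real j \<in> {0<..<1}")
  case True
  then have "\<bar>real i - real j\<bar> < 1" by auto
  then show ?thesis using assms(2) by linarith
qed (use bump_outside[OF assms(1)] in auto)

text \<open>Gaussian elimination with one pivot per induction step. It supplies the bump
  coefficients that annihilate all the linear conditions of the lower bound.\<close>

lemma underdetermined_system:
  fixes A :: "'k \<Rightarrow> 'j \<Rightarrow> real"
  assumes "finite K" "finite J" "card K < card J"
  shows "\<exists>c. (\<exists>j\<in>J. c j \<noteq> 0) \<and> (\<forall>k\<in>K. (\<Sum>j\<in>J. A k j * c j) = 0)"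
  using assms
proof (induction K arbitrary: J A rule: finite_induct)
  case empty
  then have "J \<noteq> {}" by auto
  then show ?case by (intro exI[of _ "\<lambda>_. 1"]) auto
next
  case (insert k K)
  show ?case
  proof (cases "\<forall>j\<in>J. A k j = 0")
    case True
    obtain c where "\<exists>j\<in>J. c j \<noteq> 0" "\<forall>k\<in>K. (\<Sum>j\<in>J. A k j * c j) = 0"
      using insert.IH[of J A] insert.prems insert.hyps by auto
    then show ?thesis using True by (intro exI[of _ c]) auto
  next
    case False
    then obtain l where l: "l \<in> J" "A k l \<noteq> 0" by blast
    define J' where "J' = J - {l}"
    have J: "J = insert l J'" "l \<notin> J'" "finite J'" using l insert.prems by (auto simp: J'_def)
    have "card K < card J'" using insert.prems insert.hyps J by simp
    then obtain c where c: "\<exists>j\<in>J'. c j \<noteq> 0"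
      "\<forall>i\<in>K. (\<Sum>j\<in>J'. (A i j - A i l * A k j / A k l) * c j) = 0"
      using insert.IH[OF J(3), of "\<lambda>i j. A i j - A i l * A k j / A k l"] by blast
    \<comment> \<open>Back substitution: the pivot variable is chosen to satisfy the eliminated
      equation.\<close>
    define d where "d = c(l := - (\<Sum>j\<in>J'. A k j * c j) / A k l)"
    have dJ': "(\<Sum>j\<in>J'. A i j * d j) = (\<Sum>j\<in>J'. A i j * c j)" for i
      using J(2) by (intro sum.cong) (auto simp: d_def)
    have sum: "(\<Sum>j\<in>J. A i j * d j) = A i l * d l + (\<Sum>j\<in>J'. A i j * c j)" for i
      using J by (simp add: dJ')
    have "(\<Sum>j\<in>J. A k j * d j) = 0" unfolding sum using l by (simp add: d_def)
    moreover have "(\<Sum>j\<in>J. A i j * d j) = 0" if "i \<in> K" for i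
    proof -
      have "(\<Sum>j\<in>J'. (A i j - A i l * A k j / A k l) * c j)
          = (\<Sum>j\<in>J'. A i j * c j) - A i l / A k l * (\<Sum>j\<in>J'. A k j * c j)"
        unfolding sum_distrib_left sum_subtractf[symmetric]
        by (intro sum.cong refl) (simp add: left_diff_distrib)
      then show ?thesis unfolding sum using c(2) that by (simp add: d_def)
    qed
    moreover have "\<exists>j\<in>J. d j \<noteq> 0" using c(1) J by (auto simp: d_def)
    ultimately show ?thesis by (intro exI[of _ d]) auto
  qed
qed

section \<open>Oscillating perturbations of the uniform density\<close>

definition bump_scale :: "real \<Rightarrow> real \<Rightarrow> nat \<Rightarrow> real" where
  "bump_scale a b N = real N / (b - a)"

text \<open>The k-th derivative of a sum of \<open>N\<close> bumps with coefficients
  \<open>c j\<close>, one in each of \<open>N\<close> equal cells of [a, b]; the power of the scale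
  is the chain rule.\<close>

definition bump_sum :: "real \<Rightarrow> real \<Rightarrow> nat \<Rightarrow> nat \<Rightarrow> (nat \<Rightarrow> real) \<Rightarrow> nat \<Rightarrow> real \<Rightarrow> real" where
  "bump_sum a b s N c k y =
     (\<Sum>j<N. c j * bump_scale a b N ^ k * bump s k (bump_scale a b N * (y - a) - real j))"

text \<open>Comparable, up to constants independent of \<open>N\<close>, with the squared norm of
  the bump sum; all estimates below are expressed in it.\<close>

definition bump_energy :: "nat \<Rightarrow> (nat \<Rightarrow> real) \<Rightarrow> real" where
  "bump_energy N c = (\<Sum>j<N. (c j)\<^sup>2) / real N"

definition bump_cell :: "real \<Rightarrow> real \<Rightarrow> nat \<Rightarrow> nat \<Rightarrow> real set" where
  "bump_cell a b N j = {y. bump_scale a b N * (y - a) - real j \<in> {0..1}}"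

section \<open>Norm and differences of a sum of bumps\<close>

context
  fixes a b :: real and s N :: nat and c :: "nat \<Rightarrow> real" and B :: real
  assumes ab: "a < b" and s: "0 < s" and N: "0 < N"
    and B: "1 \<le> B" "\<And>k x. k \<le> s \<Longrightarrow> \<bar>bump s k x\<bar> \<le> B"
begin

lemma bump_scale_pos: "0 < (bump_scale a b N)" using ab N by (simp add: bump_scale_def)

lemma bump_energy_nonneg: "0 \<le> (bump_energy N c)" by (simp add: bump_energy_def sum_nonneg)

lemma bump_sum_deriv:
  assumes "k < s"
  shows "(bump_sum a b s N c k has_real_derivative (bump_sum a b s N c) (Suc k) y) (at y)"
proof -
  have "((\<lambda>y. bump s k ((bump_scale a b N) * (y - a) - real j)) has_real_derivative
      bump s (Suc k) ((bump_scale a b N) * (y - a) - real j) * (bump_scale a b N)) (at y)" for j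
    by (rule DERIV_chain2[OF bump_deriv[OF assms]]) (auto intro!: derivative_eq_intros)
  then have "((\<lambda>y. c j * (bump_scale a b N) ^ k * bump s k ((bump_scale a b N) * (y - a) - real j)) has_real_derivative
      c j * (bump_scale a b N) ^ k * (bump s (Suc k) ((bump_scale a b N) * (y - a) - real j) * (bump_scale a b N))) (at y)" for j
    by (rule DERIV_cmult)
  then have "(bump_sum a b s N c k has_real_derivative
      (\<Sum>j<N. c j * (bump_scale a b N) ^ k * (bump s (Suc k) ((bump_scale a b N) * (y - a) - real j) * (bump_scale a b N)))) (at y)"
    unfolding bump_sum_def[abs_def] by (rule DERIV_sum)
  then show ?thesis
    by (rule DERIV_cong) (simp add: bump_sum_def mult_ac)
qed

lemma bump_sum_continuous: "continuous_on S (bump_sum a b s N c k)"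
  unfolding bump_sum_def[abs_def]
  by (intro continuous_intros continuous_on_compose2[OF bump_continuous[of UNIV]]) auto

lemma bump_sum_L2: "bump_sum a b s N c k \<in> L2 a b"
  by (rule L2_continuous[OF bump_sum_continuous])

lemma bump_cell_eq: "bump_cell a b N j = {a + real j / (bump_scale a b N)..a + (real j + 1) / (bump_scale a b N)}"
  using bump_scale_pos by (auto simp: bump_cell_def field_simps)

text \<open>The supports are disjoint, so all mixed products vanish.\<close>

lemma bump_sum_sq:
  assumes "k \<le> s"
  shows "(bump_sum a b s N c k y)\<^sup>2 = (\<Sum>j<N. (c j)\<^sup>2 * (bump_scale a b N) ^ (2 * k) * (bump s k ((bump_scale a b N) * (y - a) - real j))\<^sup>2)"
proof -
  define F where "F j = c j * (bump_scale a b N) ^ k * bump s k ((bump_scale a b N) * (y - a) - real j)" for j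
  have zero: "F i * F j = 0" if "i \<noteq> j" for i j
    using bump_disjoint[OF assms that, of "(bump_scale a b N) * (y - a)"] by (auto simp: F_def)
  have "(bump_sum a b s N c k y)\<^sup>2 = (\<Sum>i<N. \<Sum>j<N. F i * F j)"
    by (simp add: bump_sum_def F_def power2_eq_square sum_product)
  also have "\<dots> = (\<Sum>i<N. \<Sum>j<N. if j = i then (F i)\<^sup>2 else 0)"
    using zero by (intro sum.cong refl) (auto simp: power2_eq_square)
  also have "\<dots> = (\<Sum>i<N. (F i)\<^sup>2)" by simp
  also have "\<dots> = (\<Sum>j<N. (c j)\<^sup>2 * (bump_scale a b N) ^ (2 * k) * (bump s k ((bump_scale a b N) * (y - a) - real j))\<^sup>2)"
    unfolding F_def power_mult_distrib by (simp add: power_even_eq)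
  finally show ?thesis .
qed

lemma bump_sum_sq_le:
  assumes "k \<le> s"
  shows "(bump_sum a b s N c k y)\<^sup>2 \<le> (\<Sum>j<N. (c j)\<^sup>2 * (bump_scale a b N) ^ (2 * k) * B\<^sup>2 * indicator (bump_cell a b N j) y)"
  unfolding bump_sum_sq[OF assms]
proof (intro sum_mono)
  fix j
  have "(bump s k ((bump_scale a b N) * (y - a) - real j))\<^sup>2 \<le> B\<^sup>2 * indicator (bump_cell a b N j) y"
  proof (cases "y \<in> bump_cell a b N j")
    case True
    then show ?thesis using B(2)[OF assms] B(1) by (simp add: abs_le_square_iff[symmetric])
  next
    case False
    then show ?thesis using bump_outside[OF assms] by (auto simp: bump_cell_def)
  qed
  then show "(c j)\<^sup>2 * (bump_scale a b N) ^ (2 * k) * (bump s k ((bump_scale a b N) * (y - a) - real j))\<^sup>2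
      \<le> (c j)\<^sup>2 * (bump_scale a b N) ^ (2 * k) * B\<^sup>2 * indicator (bump_cell a b N j) y"
    using bump_scale_pos unfolding mult.assoc by (intro mult_left_mono) auto
qed

lemma bump_sum_abs_le: "\<bar>bump_sum a b s N c 0 y\<bar> \<le> B * sqrt (real N * (bump_energy N c))"
proof (rule power2_le_imp_le)
  have "(bump_sum a b s N c 0 y)\<^sup>2 \<le> (\<Sum>j<N. (c j)\<^sup>2 * (bump_scale a b N) ^ (2 * 0) * B\<^sup>2 * indicator (bump_cell a b N j) y)"
    by (rule bump_sum_sq_le) simp
  also have "\<dots> \<le> (\<Sum>j<N. (c j)\<^sup>2 * B\<^sup>2)" by (intro sum_mono) (auto simp: indicator_def)
  also have "\<dots> = (B * sqrt (real N * (bump_energy N c)))\<^sup>2"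
    using N bump_energy_nonneg by (simp add: power_mult_distrib bump_energy_def sum_distrib_right[symmetric] sum_nonneg)
  finally show "\<bar>bump_sum a b s N c 0 y\<bar>\<^sup>2 \<le> (B * sqrt (real N * (bump_energy N c)))\<^sup>2" by simp
  show "0 \<le> B * sqrt (real N * (bump_energy N c))" using B by (simp add: bump_energy_nonneg)
qed

text \<open>Common bookkeeping for the cells themselves, for cells enlarged by a stencil width, and
  for preimages of cells: whenever the sets have measure of order \<open>1 / N\<close>, the integral
  is of the order of the energy.\<close>

lemma nn_integral_cells:
  assumes w: "\<And>j. w j = C * (c j)\<^sup>2" and C: "0 \<le> C" and S: "\<And>j. j < N \<Longrightarrow> S j \<in> sets borel"
    and le: "AE y in interval_measure a b. ennreal (F y) \<le> ennreal (\<Sum>j<N. w j * indicator (S j) y)"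
    and size: "\<And>j. j < N \<Longrightarrow> (\<integral>\<^sup>+ y. indicator (S j) y \<partial>lborel) \<le> ennreal (d / real N)" and d: "0 \<le> d"
  shows "(\<integral>\<^sup>+ y. ennreal (F y) \<partial>interval_measure a b) \<le> ennreal (C * d * (bump_energy N c))"
proof -
  have "(\<integral>\<^sup>+ y. ennreal (F y) \<partial>interval_measure a b)
      \<le> (\<integral>\<^sup>+ y. ennreal (\<Sum>j<N. w j * indicator (S j) y) \<partial>interval_measure a b)"
    by (rule nn_integral_mono_AE[OF le])
  also have "\<dots> = (\<integral>\<^sup>+ y. ennreal (\<Sum>j<N. w j * indicator (S j) y) * indicator {a..b} y \<partial>lborel)"
    by (rule nn_integral_restrict_space) simp
  also have "\<dots> \<le> (\<integral>\<^sup>+ y. (\<Sum>j<N. ennreal (w j) * indicator (S j) y) \<partial>lborel)"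
  proof (rule nn_integral_mono)
    fix y
    have "ennreal (\<Sum>j<N. w j * indicator (S j) y) = (\<Sum>j<N. ennreal (w j * indicator (S j) y))"
      using w C by (intro sum_ennreal[symmetric]) simp
    also have "\<dots> = (\<Sum>j<N. ennreal (w j) * indicator (S j) y)"
      by (intro sum.cong refl) (auto simp: indicator_def)
    finally show "ennreal (\<Sum>j<N. w j * indicator (S j) y) * indicator {a..b} y
        \<le> (\<Sum>j<N. ennreal (w j) * indicator (S j) y)" by (auto simp: indicator_def)
  qed
  also have "\<dots> = (\<Sum>j<N. ennreal (w j) * (\<integral>\<^sup>+ y. indicator (S j) y \<partial>lborel))"
  proof (subst nn_integral_sum)
    show "(\<Sum>j<N. \<integral>\<^sup>+ y. ennreal (w j) * indicator (S j) y \<partial>lborel)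
        = (\<Sum>j<N. ennreal (w j) * (\<integral>\<^sup>+ y. indicator (S j) y \<partial>lborel))"
      using S by (intro sum.cong refl nn_integral_cmult) auto
  qed (use S in auto)
  also have "\<dots> \<le> (\<Sum>j<N. ennreal (w j) * ennreal (d / real N))"
    using size by (intro sum_mono mult_left_mono) auto
  also have "\<dots> = (\<Sum>j<N. ennreal (w j * (d / real N)))"
    using w C d by (intro sum.cong refl ennreal_mult[symmetric]) auto
  also have "\<dots> = ennreal (\<Sum>j<N. w j * (d / real N))"
    using w C d by (intro sum_ennreal) auto
  also have "(\<Sum>j<N. w j * (d / real N)) = C * d * (bump_energy N c)"
    by (simp add: w bump_energy_def sum_distrib_left sum_divide_distrib mult_ac)
  finally show ?thesis .
qed

lemma bump_sum_norm_le: "(l2n a b (bump_sum a b s N c 0))\<^sup>2 \<le> B\<^sup>2 * (b - a) * (bump_energy N c)"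
proof -
  have "(\<integral>\<^sup>+ y. ennreal ((bump_sum a b s N c 0 y)\<^sup>2) \<partial>interval_measure a b) \<le> ennreal (B\<^sup>2 * (b - a) * (bump_energy N c))"
  proof (rule nn_integral_cells[where w = "\<lambda>j. B\<^sup>2 * (c j)\<^sup>2" and S = "bump_cell a b N"])
    show "AE y in interval_measure a b. ennreal ((bump_sum a b s N c 0 y)\<^sup>2) \<le> ennreal (\<Sum>j<N. B\<^sup>2 * (c j)\<^sup>2 * indicator (bump_cell a b N j) y)"
      using bump_sum_sq_le[of 0] by (intro AE_I2 ennreal_leI) (simp add: mult_ac)
    fix j
    show "(\<integral>\<^sup>+ y. indicator (bump_cell a b N j) y \<partial>lborel) \<le> ennreal ((b - a) / real N)"
      using bump_scale_pos by (simp add: bump_cell_eq diff_divide_distrib[symmetric] divide_right_mono)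
         (simp add: bump_scale_def)
  qed (use ab in \<open>auto simp: bump_cell_eq\<close>)
  then show ?thesis
    unfolding nn_integral_L2[OF bump_sum_L2] using ab by (simp add: bump_energy_nonneg)
qed

text \<open>On the middle half of its cell \<open>u (1 - u)\<close> is at least 3/16. The power is
  \<open>s + 1\<close>, squared, and the middle halves fill half of the interval.\<close>

lemma bump_sum_norm_ge: "(3 / 16) ^ (2 * s + 2) * ((b - a) / 2) * (bump_energy N c) \<le> (l2n a b (bump_sum a b s N c 0))\<^sup>2"
proof -
  define \<delta> :: real where "\<delta> = (3 / 16) ^ (2 * s + 2)"
  define I where "I j = {a + (real j + 1/4) / (bump_scale a b N)..a + (real j + 3/4) / (bump_scale a b N)}" for j
  have sub: "I j \<subseteq> {a..b}" if "j < N" for j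
  proof -
    have "(real j + 3/4) / (bump_scale a b N) \<le> real N / (bump_scale a b N)"
      using that bump_scale_pos by (intro divide_right_mono) auto
    also have "\<dots> = b - a" using N ab by (simp add: bump_scale_def)
    finally have "a + (real j + 3/4) / (bump_scale a b N) \<le> b" by simp
    moreover have "0 \<le> (real j + 1/4) / (bump_scale a b N)" using bump_scale_pos by simp
    ultimately show ?thesis by (auto simp: I_def)
  qed
  have low: "(\<Sum>j<N. (c j)\<^sup>2 * \<delta> * indicator (I j) y) \<le> (bump_sum a b s N c 0 y)\<^sup>2" for y
    unfolding bump_sum_sq[of 0, simplified]
  proof (intro sum_mono)
    fix j
    show "(c j)\<^sup>2 * \<delta> * indicator (I j) y \<le> (c j)\<^sup>2 * (bump s 0 ((bump_scale a b N) * (y - a) - real j))\<^sup>2"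
    proof (cases "y \<in> I j")
      case True
      define u where "u = (bump_scale a b N) * (y - a) - real j"
      have u: "1/4 \<le> u" "u \<le> 3/4" using True bump_scale_pos by (auto simp: I_def u_def field_simps)
      have "0 \<le> (u - 1/4) * (3/4 - u)" using u by (intro mult_nonneg_nonneg) auto
      moreover have "(u - 1/4) * (3/4 - u) = u * (1 - u) - 3/16" by (simp add: field_simps)
      ultimately have "3/16 \<le> u * (1 - u)" by linarith
      then have "3/16 \<le> bump_base u" by (simp add: bump_base_def)
      then have "(3/16) ^ (s + 1) \<le> bump_base u ^ (s + 1)" by (intro power_mono) auto
      then have "((3/16) ^ (s + 1))\<^sup>2 \<le> (bump s 0 u)\<^sup>2" by (intro power_mono) (auto simp: bump_def)
      moreover have "((3/16) ^ (s + 1))\<^sup>2 = \<delta>" unfolding \<delta>_def power_mult[symmetric] by (rule arg_cong) simp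
      ultimately show ?thesis using True by (simp add: u_def mult_left_mono)
    qed simp
  qed
  have d0: "0 \<le> \<delta>" by (simp add: \<delta>_def)
  have "ennreal (\<delta> * ((b - a) / 2) * (bump_energy N c)) = ennreal (\<Sum>j<N. (c j)\<^sup>2 * \<delta> * (1 / (2 * (bump_scale a b N))))"
    using ab by (simp add: bump_energy_def bump_scale_def sum_distrib_left sum_divide_distrib sum_distrib_right mult_ac)
  also have "\<dots> = (\<Sum>j<N. ennreal ((c j)\<^sup>2 * \<delta>) * ennreal (1 / (2 * (bump_scale a b N))))"
  proof (subst sum_ennreal[symmetric])
    show "(\<Sum>j<N. ennreal ((c j)\<^sup>2 * \<delta> * (1 / (2 * (bump_scale a b N)))))
        = (\<Sum>j<N. ennreal ((c j)\<^sup>2 * \<delta>) * ennreal (1 / (2 * (bump_scale a b N))))"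
      using d0 bump_scale_pos by (intro sum.cong refl ennreal_mult) auto
  qed (use d0 bump_scale_pos in auto)
  also have "\<dots> = (\<Sum>j<N. ennreal ((c j)\<^sup>2 * \<delta>) * (\<integral>\<^sup>+ y. indicator (I j) y \<partial>lborel))"
  proof (intro sum.cong refl)
    fix j
    have "(real j + 3/4) / (bump_scale a b N) - (real j + 1/4) / (bump_scale a b N) = 1 / (2 * (bump_scale a b N))"
      by (simp add: diff_divide_distrib[symmetric])
    moreover have "(real j + 1/4) / (bump_scale a b N) \<le> (real j + 3/4) / (bump_scale a b N)"
      using bump_scale_pos by (intro divide_right_mono) auto
    ultimately have "(\<integral>\<^sup>+ y. indicator (I j) y \<partial>lborel) = ennreal (1 / (2 * (bump_scale a b N)))"
      by (simp add: I_def)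
    then show "ennreal ((c j)\<^sup>2 * \<delta>) * ennreal (1 / (2 * (bump_scale a b N)))
        = ennreal ((c j)\<^sup>2 * \<delta>) * (\<integral>\<^sup>+ y. indicator (I j) y \<partial>lborel)" by simp
  qed
  also have "\<dots> = (\<integral>\<^sup>+ y. (\<Sum>j<N. ennreal ((c j)\<^sup>2 * \<delta>) * indicator (I j) y) \<partial>lborel)"
  proof (subst nn_integral_sum)
    show "(\<Sum>j<N. ennreal ((c j)\<^sup>2 * \<delta>) * (\<integral>\<^sup>+ y. indicator (I j) y \<partial>lborel))
        = (\<Sum>j<N. \<integral>\<^sup>+ y. ennreal ((c j)\<^sup>2 * \<delta>) * indicator (I j) y \<partial>lborel)"
      by (intro sum.cong refl nn_integral_cmult[symmetric]) (auto simp: I_def)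
  qed (auto simp: I_def)
  also have "\<dots> \<le> (\<integral>\<^sup>+ y. ennreal ((bump_sum a b s N c 0 y)\<^sup>2) * indicator {a..b} y \<partial>lborel)"
  proof (rule nn_integral_mono)
    fix y
    show "(\<Sum>j<N. ennreal ((c j)\<^sup>2 * \<delta>) * indicator (I j) y) \<le> ennreal ((bump_sum a b s N c 0 y)\<^sup>2) * indicator {a..b} y"
    proof (cases "y \<in> {a..b}")
      case True
      have "(\<Sum>j<N. ennreal ((c j)\<^sup>2 * \<delta>) * indicator (I j) y) = (\<Sum>j<N. ennreal ((c j)\<^sup>2 * \<delta> * indicator (I j) y))"
        by (intro sum.cong refl) (auto simp: indicator_def)
      also have "\<dots> = ennreal (\<Sum>j<N. (c j)\<^sup>2 * \<delta> * indicator (I j) y)" using d0 by (intro sum_ennreal) simp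
      also have "\<dots> \<le> ennreal ((bump_sum a b s N c 0 y)\<^sup>2)" by (rule ennreal_leI[OF low])
      finally show ?thesis using True by simp
    next
      case False
      then have "y \<notin> I j" if "j < N" for j using sub[OF that] by blast
      then show ?thesis by simp
    qed
  qed
  also have "\<dots> = (\<integral>\<^sup>+ y. ennreal ((bump_sum a b s N c 0 y)\<^sup>2) \<partial>interval_measure a b)"
    by (rule nn_integral_restrict_space[symmetric]) simp
  also have "\<dots> = ennreal ((l2n a b (bump_sum a b s N c 0))\<^sup>2)" by (rule nn_integral_L2[OF bump_sum_L2])
  finally show ?thesis by (simp add: \<delta>_def)
qed

lemma AE_open_interval: "AE x in interval_measure a b. x \<in> {a<..<b}"
proof -
  have "AE x in lborel. x \<noteq> a \<and> x \<noteq> b" using AE_lborel_singleton[of a] AE_lborel_singleton[of b] by auto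
  then have "AE x in lborel. x \<in> {a..b} \<longrightarrow> x \<in> {a<..<b}" by eventually_elim auto
  then show ?thesis by (subst AE_restrict_space_iff) auto
qed

text \<open>For steps below the cell width the difference is governed by the s-th derivative. Cells
  are enlarged by \<open>w\<close> because the stencil around \<open>x\<close> may reach into
  neighbouring ones.\<close>

lemma bump_difference_smooth:
  assumes h: "0 < h" "h * real N \<le> 1"
  shows "(\<integral>\<^sup>+ x. ennreal ((sym_difference a b s (h * step_weight a b x) (bump_sum a b s N c 0) x)\<^sup>2) \<partial>interval_measure a b)
    \<le> ennreal ((h * real N) ^ (2 * s) * B\<^sup>2 * ((1 + 2 * real s) * (b - a)) * (bump_energy N c))"
proof -
  define w where "w = real s * (b - a) / real N"
  define S where "S j = {a + real j / (bump_scale a b N) - w..a + (real j + 1) / (bump_scale a b N) + w}" for j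
  have w: "0 \<le> w" using ab by (simp add: w_def)
  define C where "C = (h * real N) ^ (2 * s) * B\<^sup>2"
  show ?thesis unfolding C_def[symmetric]
  proof (rule nn_integral_cells[where w = "\<lambda>j. C * (c j)\<^sup>2" and S = S])
    show "AE x in interval_measure a b. ennreal ((sym_difference a b s (h * step_weight a b x) (bump_sum a b s N c 0) x)\<^sup>2)
        \<le> ennreal (\<Sum>j<N. C * (c j)\<^sup>2 * indicator (S j) x)"
    proof (rule AE_I2, rule ennreal_leI)
      fix x assume "x \<in> space (interval_measure a b)"
      then have x: "x \<in> {a..b}" by (simp add: space_restrict_space)
      define \<eta> where "\<eta> = h * step_weight a b x"
      have eta0: "0 \<le> \<eta>" using h step_weight_nonneg[OF x] by (simp add: \<eta>_def)
      have eta: "\<eta> \<le> h * ((b - a) / 2)" unfolding \<eta>_def using h step_weight_le[OF x] by (intro mult_left_mono) auto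
      have etaN: "\<eta> * (bump_scale a b N) \<le> h * real N"
      proof -
        have "\<eta> * (bump_scale a b N) \<le> h * ((b - a) / 2) * (bump_scale a b N)" using eta bump_scale_pos by (intro mult_right_mono) auto
        also have "\<dots> = h * ((b - a) * (bump_scale a b N)) / 2" by simp
        also have "\<dots> = h * real N / 2" using ab by (simp add: bump_scale_def)
        also have "\<dots> \<le> h * real N" using h by simp
        finally show ?thesis .
      qed
      have etaw: "real s / 2 * \<eta> \<le> w"
      proof -
        have "\<eta> * (bump_scale a b N) \<le> 1" using etaN h by linarith
        then have "\<eta> \<le> (b - a) / real N" using ab N by (simp add: bump_scale_def field_simps)
        then have "real s * \<eta> \<le> real s * ((b - a) / real N)" by (intro mult_left_mono) auto
        then have "real s * \<eta> \<le> w" by (simp add: w_def)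
        then show ?thesis using w by linarith
      qed
      define M2 where "M2 = (\<Sum>j<N. (c j)\<^sup>2 * (bump_scale a b N) ^ (2 * s) * B\<^sup>2 * indicator (S j) x)"
      have M2: "0 \<le> M2" unfolding M2_def using bump_scale_pos by (intro sum_nonneg) auto
      have "\<bar>central_diff s \<eta> (bump_sum a b s N c 0) x\<bar> \<le> \<eta> ^ s * sqrt M2"
      proof (rule central_diff_bound[where G = "bump_sum a b s N c" and n = s, OF eta0 bump_sum_deriv])
        fix y assume y: "\<bar>y - x\<bar> \<le> real s / 2 * \<eta>"
        have "(bump_sum a b s N c s y)\<^sup>2 \<le> (\<Sum>j<N. (c j)\<^sup>2 * (bump_scale a b N) ^ (2 * s) * B\<^sup>2 * indicator (bump_cell a b N j) y)"
          by (rule bump_sum_sq_le) simp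
        also have "\<dots> \<le> M2"
        proof -
          have "\<bar>y - x\<bar> \<le> w" using y etaw by (rule order_trans)
          then have "y \<le> x + w" "x \<le> y + w" by (auto simp: abs_le_iff)
          then have "indicator (bump_cell a b N j) y \<le> (indicator (S j) x :: real)" for j
            by (auto simp: indicator_def bump_cell_eq S_def)
          then show ?thesis unfolding M2_def using bump_scale_pos by (intro sum_mono mult_left_mono) auto
        qed
        finally show "\<bar>bump_sum a b s N c s y\<bar> \<le> sqrt M2" by (simp add: real_le_rsqrt)
      qed
      then have "(central_diff s \<eta> (bump_sum a b s N c 0) x)\<^sup>2 \<le> (\<eta> ^ s * sqrt M2)\<^sup>2"
        using eta0 M2 by (subst abs_le_square_iff[symmetric]) (simp add: abs_mult)
      also have "\<dots> = \<eta> ^ (2 * s) * M2" using M2 by (simp add: power_mult_distrib power_even_eq)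
      also have "\<dots> = (\<eta> * (bump_scale a b N)) ^ (2 * s) * (\<Sum>j<N. (c j)\<^sup>2 * B\<^sup>2 * indicator (S j) x)"
        by (simp add: M2_def power_mult_distrib sum_distrib_left mult_ac)
      also have "\<dots> \<le> (h * real N) ^ (2 * s) * (\<Sum>j<N. (c j)\<^sup>2 * B\<^sup>2 * indicator (S j) x)"
        using etaN eta0 bump_scale_pos by (intro mult_right_mono power_mono sum_nonneg) auto
      also have "\<dots> = (\<Sum>j<N. C * (c j)\<^sup>2 * indicator (S j) x)"
        by (simp add: C_def sum_distrib_left mult_ac)
      finally have "(central_diff s \<eta> (bump_sum a b s N c 0) x)\<^sup>2 \<le> (\<Sum>j<N. C * (c j)\<^sup>2 * indicator (S j) x)" .
      moreover have "0 \<le> (\<Sum>j<N. C * (c j)\<^sup>2 * indicator (S j) x)"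
        using h by (intro sum_nonneg) (auto simp: C_def)
      ultimately show "(sym_difference a b s (h * step_weight a b x) (bump_sum a b s N c 0) x)\<^sup>2
          \<le> (\<Sum>j<N. C * (c j)\<^sup>2 * indicator (S j) x)"
        by (simp add: sym_difference_eq \<eta>_def)
    qed
    fix j
    have "(a + (real j + 1) / (bump_scale a b N) + w) - (a + real j / (bump_scale a b N) - w) = ((1 + 2 * real s) * (b - a)) / real N"
      by (simp add: w_def bump_scale_def diff_divide_distrib[symmetric] add_divide_distrib[symmetric])
         (simp add: field_simps)
    moreover have "a + real j / (bump_scale a b N) - w \<le> a + (real j + 1) / (bump_scale a b N) + w"
      using w bump_scale_pos divide_right_mono[of "real j" "real j + 1" "bump_scale a b N"] by simp
    ultimately show "(\<integral>\<^sup>+ y. indicator (S j) y \<partial>lborel) \<le> ennreal ((1 + 2 * real s) * (b - a) / real N)"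
      by (simp add: S_def)
  qed (use h ab in \<open>auto simp: C_def S_def\<close>)
qed

text \<open>For large steps nothing is gained from smoothness, and the values at the nodes are
  estimated one by one. By \<open>stencil_expansion\<close> a node map at most doubles distances
  backwards, so the preimage of a cell has diameter at most two cell widths and measure at most
  four.\<close>

lemma bump_difference_rough:
  assumes h: "0 < h"
  shows "(\<integral>\<^sup>+ x. ennreal ((sym_difference a b s (h * step_weight a b x) (bump_sum a b s N c 0) x)\<^sup>2) \<partial>interval_measure a b)
    \<le> ennreal ((real s + 1)\<^sup>2 * 4 ^ s * B\<^sup>2 * (4 * (b - a)) * (bump_energy N c))"
proof -
  define \<phi> where "\<phi> = step_weight a b"
  define D where "D = {x \<in> {a<..<b}. x - real s / 2 * (h * \<phi> x) \<in> {a..b} \<and> x + real s / 2 * (h * \<phi> x) \<in> {a..b}}"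
  define z where "z i x = x + (real i - real s / 2) * (h * \<phi> x)" for i x
  define S where "S i j = {x \<in> D. z i x \<in> bump_cell a b N j}" for i j
  have phim: "\<phi> \<in> borel_measurable borel" unfolding \<phi>_def step_weight_def[abs_def] by measurable
  have Dm: "D \<in> sets borel" unfolding D_def using phim by measurable
  have zm: "z i \<in> borel_measurable borel" for i unfolding z_def using phim by measurable
  have Sm: "S i j \<in> sets borel" for i j
    unfolding S_def bump_cell_eq using Dm zm[of i] by measurable
  have size: "(\<integral>\<^sup>+ x. indicator (S i j) x \<partial>lborel) \<le> ennreal (4 * (b - a) / real N)" if "i \<le> s" for i j
  proof -
    have "(\<integral>\<^sup>+ x. indicator (S i j) x \<partial>lborel) \<le> ennreal (2 * (2 * ((b - a) / real N)))"
    proof (rule emeasure_diameter_le)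
      fix x y assume x: "x \<in> S i j" and y: "y \<in> S i j"
      have "\<bar>(real i - real s / 2) * h\<bar> \<le> real s / 2 * h"
        unfolding abs_mult using that h by (intro mult_mono) (auto simp: abs_if)
      then have "\<bar>x - y\<bar> \<le> 2 * \<bar>(x + ((real i - real s / 2) * h) * \<phi> x) - (y + ((real i - real s / 2) * h) * \<phi> y)\<bar>"
        using x y unfolding \<phi>_def
        by (intro stencil_expansion[where \<Lambda> = "real s / 2 * h"]) (auto simp: S_def D_def \<phi>_def mult.assoc)
      also have "\<dots> = 2 * \<bar>z i x - z i y\<bar>" by (simp add: z_def mult.assoc)
      also have "\<bar>z i x - z i y\<bar> \<le> 1 / (bump_scale a b N)"
      proof -
        have "(a + (real j + 1) / (bump_scale a b N)) - (a + real j / (bump_scale a b N)) = 1 / (bump_scale a b N)"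
          by (simp add: diff_divide_distrib[symmetric])
        then show ?thesis using x y by (auto simp: S_def bump_cell_eq abs_le_iff)
      qed
      finally show "\<bar>x - y\<bar> \<le> 2 * ((b - a) / real N)" by (simp add: bump_scale_def)
    qed (use ab in auto)
    then show ?thesis by (simp add: mult.assoc)
  qed
  define C where "C = (real s + 1) * 4 ^ s * B\<^sup>2"
  have C: "0 \<le> C" by (simp add: C_def)
  have point: "ennreal ((sym_difference a b s (h * step_weight a b x) (bump_sum a b s N c 0) x)\<^sup>2)
      \<le> (\<Sum>i\<le>s. ennreal (\<Sum>j<N. C * (c j)\<^sup>2 * indicator (S i j) x))" if x: "x \<in> {a<..<b}" for x
  proof -
    have "(sym_difference a b s (h * step_weight a b x) (bump_sum a b s N c 0) x)\<^sup>2
        \<le> (\<Sum>i\<le>s. \<Sum>j<N. C * (c j)\<^sup>2 * indicator (S i j) x)"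
    proof (cases "x \<in> D")
      case True
      have "(sym_difference a b s (h * step_weight a b x) (bump_sum a b s N c 0) x)\<^sup>2 = (central_diff s (h * \<phi> x) (bump_sum a b s N c 0) x)\<^sup>2"
        using True by (auto simp: sym_difference_eq D_def \<phi>_def)
      also have "\<dots> \<le> real (s + 1) * 4 ^ s * (\<Sum>i\<le>s. (bump_sum a b s N c 0 (z i x))\<^sup>2)"
        unfolding z_def by (rule central_diff_sq_le)
      also have "\<dots> \<le> real (s + 1) * 4 ^ s * (\<Sum>i\<le>s. \<Sum>j<N. (c j)\<^sup>2 * B\<^sup>2 * indicator (S i j) x)"
      proof (intro mult_left_mono sum_mono)
        fix i
        have "(bump_sum a b s N c 0 (z i x))\<^sup>2 \<le> (\<Sum>j<N. (c j)\<^sup>2 * (bump_scale a b N) ^ (2 * 0) * B\<^sup>2 * indicator (bump_cell a b N j) (z i x))"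
          by (rule bump_sum_sq_le) simp
        also have "\<dots> = (\<Sum>j<N. (c j)\<^sup>2 * B\<^sup>2 * indicator (S i j) x)"
          using True by (simp add: S_def indicator_def)
        finally show "(bump_sum a b s N c 0 (z i x))\<^sup>2 \<le> (\<Sum>j<N. (c j)\<^sup>2 * B\<^sup>2 * indicator (S i j) x)" .
      qed auto
      also have "\<dots> = (\<Sum>i\<le>s. \<Sum>j<N. C * (c j)\<^sup>2 * indicator (S i j) x)"
        unfolding C_def sum_distrib_left by (intro sum.cong refl) (simp add: algebra_simps)
      finally show ?thesis .
    next
      case False
      then have "sym_difference a b s (h * step_weight a b x) (bump_sum a b s N c 0) x = 0"
        using x by (auto simp: sym_difference_eq D_def \<phi>_def)
      then show ?thesis using C by (auto intro!: sum_nonneg)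
    qed
    then have "ennreal ((sym_difference a b s (h * step_weight a b x) (bump_sum a b s N c 0) x)\<^sup>2)
        \<le> ennreal (\<Sum>i\<le>s. \<Sum>j<N. C * (c j)\<^sup>2 * indicator (S i j) x)" by (rule ennreal_leI)
    also have "\<dots> = (\<Sum>i\<le>s. ennreal (\<Sum>j<N. C * (c j)\<^sup>2 * indicator (S i j) x))"
      using C by (intro sum_ennreal[symmetric] sum_nonneg) auto
    finally show ?thesis .
  qed
  have "(\<integral>\<^sup>+ x. ennreal ((sym_difference a b s (h * step_weight a b x) (bump_sum a b s N c 0) x)\<^sup>2) \<partial>interval_measure a b)
      \<le> (\<integral>\<^sup>+ x. (\<Sum>i\<le>s. ennreal (\<Sum>j<N. C * (c j)\<^sup>2 * indicator (S i j) x)) \<partial>interval_measure a b)"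
    by (rule nn_integral_mono_AE, rule eventually_mono[OF AE_open_interval], rule point)
  also have "\<dots> = (\<Sum>i\<le>s. \<integral>\<^sup>+ x. ennreal (\<Sum>j<N. C * (c j)\<^sup>2 * indicator (S i j) x) \<partial>interval_measure a b)"
  proof (rule nn_integral_sum)
    fix i
    have "(\<lambda>x. ennreal (\<Sum>j<N. C * (c j)\<^sup>2 * indicator (S i j) x)) \<in> borel_measurable lborel"
      using Sm by measurable
    then show "(\<lambda>x. ennreal (\<Sum>j<N. C * (c j)\<^sup>2 * indicator (S i j) x)) \<in> borel_measurable (interval_measure a b)"
      by (rule measurable_restrict_space1)
  qed
  also have "\<dots> \<le> (\<Sum>i\<le>s. ennreal (C * (4 * (b - a)) * (bump_energy N c)))"
  proof (intro sum_mono)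
    fix i assume i: "i \<in> {..s}"
    show "(\<integral>\<^sup>+ x. ennreal (\<Sum>j<N. C * (c j)\<^sup>2 * indicator (S i j) x) \<partial>interval_measure a b)
        \<le> ennreal (C * (4 * (b - a)) * (bump_energy N c))"
      by (rule nn_integral_cells[where w = "\<lambda>j. C * (c j)\<^sup>2" and S = "S i", OF refl C Sm AE_I2[OF order_refl]])
         (use size i ab in auto)
  qed
  also have "\<dots> = ennreal (\<Sum>i\<le>s. C * (4 * (b - a)) * (bump_energy N c))"
    using C ab bump_energy_nonneg by (intro sum_ennreal) auto
  also have "(\<Sum>i\<le>s. C * (4 * (b - a)) * (bump_energy N c)) = (real s + 1)\<^sup>2 * 4 ^ s * B\<^sup>2 * (4 * (b - a)) * (bump_energy N c)"
    by (simp add: C_def power2_eq_square algebra_simps)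
  finally show ?thesis .
qed

text \<open>Interpolates between the two regimes: \<open>(h N)^s \<le> (h N)^\<alpha>\<close> as
  long as \<open>h N \<le> 1\<close>, and \<open>1 \<le> (h N)^\<alpha>\<close> afterwards.\<close>

lemma bump_sum_difference:
  assumes h: "0 < h" and alpha: "0 \<le> \<alpha>" "\<alpha> \<le> real s"
  shows "L2norm a b (\<lambda>x. sym_difference a b s (h * step_weight a b x) (bump_sum a b s N c 0) x)
    \<le> ennreal (sqrt ((real s + 1)\<^sup>2 * 4 ^ s * B\<^sup>2 * (4 * (b - a)) * (bump_energy N c)) * (h * real N) powr \<alpha>)"
proof (rule L2norm_leI)
  define K where "K = (real s + 1)\<^sup>2 * 4 ^ s * B\<^sup>2 * (4 * (b - a)) * (bump_energy N c)"
  have K: "0 \<le> K" using ab bump_energy_nonneg by (simp add: K_def)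
  have hN: "0 < h * real N" using h N by simp
  have "(\<integral>\<^sup>+ x. ennreal ((sym_difference a b s (h * step_weight a b x) (bump_sum a b s N c 0) x)\<^sup>2) \<partial>interval_measure a b)
      \<le> ennreal (K * ((h * real N) powr \<alpha>)\<^sup>2)"
  proof (cases "h * real N \<le> 1")
    case True
    have "(\<integral>\<^sup>+ x. ennreal ((sym_difference a b s (h * step_weight a b x) (bump_sum a b s N c 0) x)\<^sup>2) \<partial>interval_measure a b)
        \<le> ennreal ((h * real N) ^ (2 * s) * B\<^sup>2 * ((1 + 2 * real s) * (b - a)) * (bump_energy N c))"
      by (rule bump_difference_smooth[OF h True])
    also have "\<dots> \<le> ennreal (K * ((h * real N) powr \<alpha>)\<^sup>2)"
    proof (rule ennreal_leI)
      have "(h * real N) ^ s = (h * real N) powr real s" using hN by (simp add: powr_realpow)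
      also have "\<dots> \<le> (h * real N) powr \<alpha>" using hN True alpha by (intro powr_mono') auto
      finally have "((h * real N) ^ s)\<^sup>2 \<le> ((h * real N) powr \<alpha>)\<^sup>2" using hN by (intro power_mono) auto
      then have p: "(h * real N) ^ (2 * s) \<le> ((h * real N) powr \<alpha>)\<^sup>2" by (simp add: power_even_eq)
      have "(1 + 2 * real s) * 1 \<le> (real s + 1)\<^sup>2 * 4 ^ s"
        by (intro mult_mono) (auto simp: power2_eq_square algebra_simps)
      then have "(1 + 2 * real s) * (B\<^sup>2 * (b - a) * (bump_energy N c)) \<le> ((real s + 1)\<^sup>2 * 4 ^ s * 4) * (B\<^sup>2 * (b - a) * (bump_energy N c))"
        using ab bump_energy_nonneg by (intro mult_right_mono) auto
      also have "\<dots> = K" by (simp add: K_def)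
      finally have q: "B\<^sup>2 * ((1 + 2 * real s) * (b - a)) * (bump_energy N c) \<le> K" by (simp add: mult_ac)
      have "(h * real N) ^ (2 * s) * (B\<^sup>2 * ((1 + 2 * real s) * (b - a)) * (bump_energy N c)) \<le> ((h * real N) powr \<alpha>)\<^sup>2 * K"
        using p q ab bump_energy_nonneg by (intro mult_mono) auto
      then show "(h * real N) ^ (2 * s) * B\<^sup>2 * ((1 + 2 * real s) * (b - a)) * (bump_energy N c) \<le> K * ((h * real N) powr \<alpha>)\<^sup>2"
        by (simp add: mult_ac)
    qed
    finally show ?thesis .
  next
    case False
    have "(\<integral>\<^sup>+ x. ennreal ((sym_difference a b s (h * step_weight a b x) (bump_sum a b s N c 0) x)\<^sup>2) \<partial>interval_measure a b)
        \<le> ennreal K" unfolding K_def by (rule bump_difference_rough[OF h])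
    also have "\<dots> \<le> ennreal (K * ((h * real N) powr \<alpha>)\<^sup>2)"
    proof (rule ennreal_leI)
      have "1 \<le> (h * real N) powr \<alpha>" using False alpha by (intro ge_one_powr_ge_zero) auto
      then have "1 \<le> ((h * real N) powr \<alpha>)\<^sup>2" by simp
      then show "K \<le> K * ((h * real N) powr \<alpha>)\<^sup>2" using mult_left_mono[OF _ K] by fastforce
    qed
    finally show ?thesis .
  qed
  then show "(\<integral>\<^sup>+ x. ennreal ((sym_difference a b s (h * step_weight a b x) (bump_sum a b s N c 0) x)\<^sup>2) \<partial>interval_measure a b)
      \<le> ennreal ((sqrt ((real s + 1)\<^sup>2 * 4 ^ s * B\<^sup>2 * (4 * (b - a)) * (bump_energy N c)) * (h * real N) powr \<alpha>)\<^sup>2)"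
    unfolding K_def[symmetric] power_mult_distrib using K by simp
qed (use ab bump_energy_nonneg in auto)

end

section \<open>The lower bound over the smoothness class\<close>

lemma L2_one: "l2n a b (\<lambda>_. k) = \<bar>k\<bar> * sqrt (b - a)" if "a < b"
proof -
  have "L2inner a b (\<lambda>_. 1) (\<lambda>_. 1) = integral {a..b} (\<lambda>_. 1 * 1)"
    by (rule L2inner_eq_integral) auto
  then have "l2n a b (\<lambda>_. 1) = sqrt (b - a)" using that by (simp add: l2n_def)
  then show ?thesis using l2n_cmult[of a b k "\<lambda>_. 1"] by simp
qed

text \<open>The centre is the uniform density: differences annihilate constants, so it costs nothing
  in the modulus. Its norm is \<open>1 / sqrt (b - a)\<close>, and the strict inequality for
  \<open>C\<close> leaves room for a perturbation.\<close>

lemma smooth_class_perturbation: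
  assumes ab: "a < b" and alpha: "1 \<le> \<alpha>" and C: "1 / sqrt (b - a) < C"
  shows "\<exists>d>0. \<forall>m. \<exists>g. g \<in> L2 a b \<and> (\<forall>k<m. L2inner a b g (poisson_mass k) = 0) \<and>
     d * real (m + 2) powr (- 2 * \<alpha>) \<le> (l2n a b g)\<^sup>2 \<and>
     (\<forall>\<sigma>\<in>{1, -1}. (\<lambda>\<theta>. 1 / (b - a) + \<sigma> * g \<theta>) \<in> smooth_class a b \<alpha> C \<inter> L2_densities a b)"
proof -
  define s where "s = nat \<lfloor>\<alpha>\<rfloor> + 1"
  have s: "0 < s" "\<alpha> \<le> real s" unfolding s_def using alpha by linarith+
  obtain B where B: "1 \<le> B" "\<And>k x. k \<le> s \<Longrightarrow> \<bar>bump s k x\<bar> \<le> B" using bump_bounded[of s] by metis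
  define K where "K = sqrt ((real s + 1)\<^sup>2 * 4 ^ s * B\<^sup>2 * (4 * (b - a)))"
  have K: "0 < K" unfolding K_def using ab B by simp
  have C0: "0 < C" using C ab by (meson less_trans divide_pos_pos real_sqrt_gt_zero zero_less_one diff_gt_0_iff_gt)
  define gap where "gap = C - 1 / sqrt (b - a)"
  have gap: "0 < gap" using C by (simp add: gap_def)
  \<comment> \<open>The three bounds serve, in this order, the modulus, the norm and the positivity
    of the density.\<close>
  define \<kappa> where "\<kappa> = Min {C / K, gap / (B * sqrt (b - a)), 1 / (B * (b - a))}"
  have kappa: "0 < \<kappa>" "\<kappa> \<le> C / K" "\<kappa> \<le> gap / (B * sqrt (b - a))" "\<kappa> \<le> 1 / (B * (b - a))"
    unfolding \<kappa>_def using C0 K gap B ab by auto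
  define d where "d = (3 / 16) ^ (2 * s + 2) * ((b - a) / 2) * \<kappa>\<^sup>2"
  have d: "0 < d" using kappa ab by (simp add: d_def)
  have "\<exists>g. g \<in> L2 a b \<and> (\<forall>k<m. L2inner a b g (poisson_mass k) = 0) \<and>
     d * real (m + 2) powr (- 2 * \<alpha>) \<le> (l2n a b g)\<^sup>2 \<and>
     (\<forall>\<sigma>\<in>{1, -1}. (\<lambda>\<theta>. 1 / (b - a) + \<sigma> * g \<theta>) \<in> smooth_class a b \<alpha> C \<inter> L2_densities a b)" for m
  proof -
    \<comment> \<open>There are \<open>m + 1\<close> linear conditions, namely \<open>m\<close>
      masses and the integral, so \<open>m + 2\<close> bumps leave a nontrivial combination.\<close>
    define N where "N = m + 2"
    have N: "0 < N" by (simp add: N_def)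
    note ctx = ab s(1) N B
    define e where "e j y = bump s 0 (bump_scale a b N * (y - a) - real j)" for j y
    have econt: "continuous_on S (e j)" for j S
      unfolding e_def[abs_def] by (intro continuous_intros continuous_on_compose2[OF bump_continuous[of UNIV]]) auto
    have eL: "e j \<in> L2 a b" for j by (rule L2_continuous[OF econt])
    define A where "A k j = (if k < m then L2inner a b (e j) (poisson_mass k) else L2inner a b (e j) (\<lambda>_. 1))" for k j :: nat
    obtain c0 where c0: "\<exists>j\<in>{..<N}. c0 j \<noteq> 0" "\<forall>k\<in>{..m}. (\<Sum>j\<in>{..<N}. A k j * c0 j) = 0"
      using underdetermined_system[of "{..m}" "{..<N}" A] by (auto simp: N_def)
    define E where "E = (\<Sum>j<N. (c0 j)\<^sup>2)"
    have E: "0 < E"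
    proof -
      obtain l where l: "l < N" "c0 l \<noteq> 0" using c0(1) by auto
      have "0 < (c0 l)\<^sup>2" using l by simp
      also have "\<dots> \<le> E" unfolding E_def using l by (intro member_le_sum) auto
      finally show ?thesis .
    qed
    \<comment> \<open>Normalises the solution of the linear system to energy
      \<open>\<kappa>^2 N^(- 2 \<alpha>)\<close>.\<close>
    define r where "r = \<kappa> * real N powr (- \<alpha>) * sqrt (real N / E)"
    define c where "c j = r * c0 j" for j
    define Q where "Q = bump_energy N c"
    have rsq: "r\<^sup>2 = \<kappa>\<^sup>2 * real N powr (- 2 * \<alpha>) * (real N / E)"
      unfolding r_def power_mult_distrib using E N by (simp add: powr_power)
    have Q: "Q = \<kappa>\<^sup>2 * real N powr (- 2 * \<alpha>)"
    proof -
      have "Q = r\<^sup>2 * E / real N"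
        unfolding Q_def bump_energy_def unfolding c_def E_def power_mult_distrib sum_distrib_left ..
      then show ?thesis unfolding rsq using E N by simp
    qed
    define g where "g = bump_sum a b s N c 0"
    have geq: "g y = (\<Sum>j<N. c j * e j y)" for y
      by (simp add: g_def bump_sum_def e_def)
    have gL: "g \<in> L2 a b" unfolding g_def by (rule bump_sum_L2[OF ctx])
    have inner: "L2inner a b g h = r * (\<Sum>j<N. L2inner a b (e j) h * c0 j)" if "h \<in> L2 a b" for h
      unfolding geq[abs_def] using eL that
      by (subst L2inner_sum_left) (auto simp: L2inner_cmult_left c_def sum_distrib_left mult_ac intro!: L2_cmult)
    have orth: "L2inner a b g (poisson_mass k) = 0" if "k < m" for k
      using c0(2)[rule_format, of k] that by (simp add: inner A_def)
    have one: "(\<lambda>_. 1) \<in> L2 a b" by (intro L2_continuous continuous_intros)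
    have Ig: "(\<integral>\<theta>. g \<theta> \<partial>interval_measure a b) = 0"
    proof -
      have "L2inner a b g (\<lambda>_. 1) = 0"
        using c0(2)[rule_format, of m] by (simp add: inner[OF one] A_def)
      then show ?thesis by (simp add: L2inner_def)
    qed
    \<comment> \<open>Here \<open>1 \<le> \<alpha>\<close> enters: the bumps can be as high as
      \<open>sqrt N\<close> times \<open>N^(- \<alpha>)\<close>, and must stay below the uniform
      density for every \<open>N\<close>.\<close>
    have Nalpha: "real N powr (- \<alpha>) \<le> 1 / real N"
    proof -
      have "real N powr (- \<alpha>) \<le> real N powr (- 1)" using N alpha by (intro powr_mono) auto
      then show ?thesis using N by (simp add: powr_minus_divide)
    qed
    have sqrtQ: "sqrt Q = \<kappa> * real N powr (- \<alpha>)"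
    proof -
      have "Q = (\<kappa> * real N powr (- \<alpha>))\<^sup>2" unfolding Q power_mult_distrib using N by (simp add: powr_power)
      then show ?thesis using kappa by simp
    qed
    have Q1: "sqrt Q \<le> \<kappa>"
    proof -
      have "1 / real N \<le> 1" using N by simp
      then have "real N powr (- \<alpha>) \<le> 1" using Nalpha by linarith
      then show ?thesis unfolding sqrtQ using kappa(1) mult_left_mono[of "real N powr (- \<alpha>)" 1 \<kappa>] by simp
    qed
    have sup: "\<bar>g y\<bar> \<le> 1 / (b - a)" for y
    proof -
      have "\<bar>g y\<bar> \<le> B * sqrt (real N * Q)" unfolding g_def Q_def by (rule bump_sum_abs_le[OF ctx])
      also have "\<dots> \<le> B * \<kappa>"
      proof (intro mult_left_mono)
        have "sqrt (real N * Q) = sqrt (real N) * (\<kappa> * real N powr (- \<alpha>))" by (simp add: real_sqrt_mult sqrtQ)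
        also have "\<dots> \<le> real N * (\<kappa> * (1 / real N))"
          using Nalpha N kappa(1) by (intro mult_mono) (auto intro!: real_le_lsqrt self_le_power simp: power2_eq_square)
        finally show "sqrt (real N * Q) \<le> \<kappa>" using N by simp
      qed (use B in auto)
      also have "\<dots> \<le> B * (1 / (B * (b - a)))" using kappa(4) B by (intro mult_left_mono) auto
      also have "\<dots> = 1 / (b - a)" using B by simp
      finally show ?thesis .
    qed
    have norm: "l2n a b g \<le> gap"
    proof -
      have "(l2n a b g)\<^sup>2 \<le> B\<^sup>2 * (b - a) * Q" unfolding g_def Q_def by (rule bump_sum_norm_le[OF ctx])
      also have "\<dots> = (B * sqrt (b - a) * sqrt Q)\<^sup>2"
        using ab by (simp add: power_mult_distrib Q)
      finally have "l2n a b g \<le> B * sqrt (b - a) * sqrt Q"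
        by (rule power2_le_imp_le) (use B ab Q in auto)
      also have "\<dots> \<le> B * sqrt (b - a) * (gap / (B * sqrt (b - a)))"
        using Q1 kappa(3) B ab by (intro mult_left_mono) auto
      also have "\<dots> = gap" using B ab by simp
      finally show ?thesis .
    qed
    have low: "d * real (m + 2) powr (- 2 * \<alpha>) \<le> (l2n a b g)\<^sup>2"
      using bump_sum_norm_ge[OF ctx, of c] unfolding g_def[symmetric] Q_def[symmetric] Q N_def[symmetric]
      by (simp add: d_def mult.assoc)
    have mem: "(\<lambda>\<theta>. 1 / (b - a) + \<sigma> * g \<theta>) \<in> smooth_class a b \<alpha> C \<inter> L2_densities a b"
      if sigma: "\<sigma> = 1 \<or> \<sigma> = -1" for \<sigma>
    proof
      define f where "f = (\<lambda>\<theta>. 1 / (b - a) + \<sigma> * g \<theta>)"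
      have kL: "(\<lambda>_. 1 / (b - a)) \<in> L2 a b" by (intro L2_continuous continuous_intros)
      have fL: "f \<in> L2 a b" unfolding f_def by (intro L2_add L2_cmult gL kL)
      have "(\<integral>\<theta>. f \<theta> \<partial>interval_measure a b) = 1"
      proof -
        have "(\<integral>\<theta>. f \<theta> \<partial>interval_measure a b) = (\<integral>\<theta>. 1 / (b - a) \<partial>interval_measure a b)"
          unfolding f_def using Ig L2_integrable[OF gL] L2_integrable[OF kL] by simp
        also have "\<dots> = L2inner a b (\<lambda>_. 1 / (b - a)) (\<lambda>_. 1)" by (simp add: L2inner_def)
        also have "\<dots> = integral {a..b} (\<lambda>_. 1 / (b - a) * 1)" by (intro L2inner_eq_integral continuous_intros)
        also have "\<dots> = 1" using ab by simp
        finally show ?thesis .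
      qed
      moreover have "0 \<le> f \<theta>" for \<theta> using sup[of \<theta>] sigma by (auto simp: f_def abs_le_iff)
      ultimately show "(\<lambda>\<theta>. 1 / (b - a) + \<sigma> * g \<theta>) \<in> L2_densities a b"
        using fL by (auto simp: L2_densities_def f_def)
      have "l2n a b f \<le> l2n a b (\<lambda>_. 1 / (b - a)) + l2n a b (\<lambda>\<theta>. \<sigma> * g \<theta>)"
        unfolding f_def by (intro l2n_triangle kL L2_cmult gL)
      also have "\<dots> = 1 / sqrt (b - a) + l2n a b g"
        unfolding L2_one[OF ab] l2n_cmult using ab sigma by (auto simp: real_div_sqrt field_simps)
      also have "\<dots> \<le> C" using norm by (simp add: gap_def)
      finally have "L2norm a b f \<le> ennreal C" using fL by (simp add: L2norm_eq ennreal_leI)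
      moreover have "modulus a b s f t \<le> ennreal (C * t powr \<alpha>)" if t: "0 < t" for t
        unfolding modulus_def
      proof (rule SUP_least)
        fix h assume h: "h \<in> {0<..t}"
        \<comment> \<open>The constant drops out because the order \<open>s\<close> is positive; the
          sign disappears under the square.\<close>
        have diff: "(sym_difference a b s (h * step_weight a b x) f x)\<^sup>2
            = (sym_difference a b s (h * step_weight a b x) g x)\<^sup>2" for x
          using sigma s(1) unfolding f_def sym_difference_eq
          by (auto simp: central_diff_add central_diff_const central_diff_cmult
                central_diff_cmult[where c="-1", simplified])
        have "L2norm a b (\<lambda>x. sym_difference a b s (h * step_weight a b x) f x)
            = L2norm a b (\<lambda>x. sym_difference a b s (h * step_weight a b x) g x)"
          by (simp add: L2norm_def diff)
        also have "\<dots> \<le> ennreal (sqrt ((real s + 1)\<^sup>2 * 4 ^ s * B\<^sup>2 * (4 * (b - a)) * Q) * (h * real N) powr \<alpha>)"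
          unfolding g_def Q_def using h alpha s(2) by (intro bump_sum_difference[OF ctx]) auto
        also have "\<dots> \<le> ennreal (C * t powr \<alpha>)"
        proof (rule ennreal_leI)
          have "sqrt ((real s + 1)\<^sup>2 * 4 ^ s * B\<^sup>2 * (4 * (b - a)) * Q) * (h * real N) powr \<alpha>
              = K * sqrt Q * (h * real N) powr \<alpha>" unfolding K_def by (simp add: real_sqrt_mult)
          also have "\<dots> = K * \<kappa> * h powr \<alpha>"
            unfolding sqrtQ using h N by (simp add: powr_mult powr_minus field_simps)
          also have "\<dots> \<le> C * t powr \<alpha>"
          proof (rule mult_mono)
            show "K * \<kappa> \<le> C" using kappa(2) K by (simp add: field_simps)
            show "h powr \<alpha> \<le> t powr \<alpha>" using h alpha by (intro powr_mono2) auto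
          qed (use C0 in auto)
          finally show "sqrt ((real s + 1)\<^sup>2 * 4 ^ s * B\<^sup>2 * (4 * (b - a)) * Q) * (h * real N) powr \<alpha> \<le> C * t powr \<alpha>" .
        qed
        finally show "L2norm a b (\<lambda>x. sym_difference a b s (h * step_weight a b x) f x) \<le> ennreal (C * t powr \<alpha>)" .
      qed
      ultimately show "(\<lambda>\<theta>. 1 / (b - a) + \<sigma> * g \<theta>) \<in> smooth_class a b \<alpha> C"
        using fL unfolding smooth_class_def s_def[symmetric] f_def by simp
    qed
    show ?thesis using gL orth low mem by (intro exI[of _ g]) auto
  qed
  then show ?thesis using d by blast
qed

text \<open>Only the order is claimed, so the blind index with \<open>\<epsilon> = 1\<close> is
  enough.\<close>

lemma smooth_class_lower:
  assumes a: "0 \<le> a" "a < b" and alpha: "1 \<le> \<alpha>" and C: "1 / sqrt (b - a) < C"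
  shows "0 < liminf (\<lambda>n. ennreal (inverse (log_ratio n powr (- 2 * \<alpha>))) *
           (INF g\<in>estimators a b n. SUP f\<in>smooth_class a b \<alpha> C \<inter> L2_densities a b. MISE a b n g f))"
    (is "0 < liminf (\<lambda>n. _ * ?R n)")
proof -
  have b: "0 < b" using a by simp
  obtain d where d: "d > 0" and pert: "\<And>m. \<exists>g. g \<in> L2 a b \<and> (\<forall>k<m. L2inner a b g (poisson_mass k) = 0) \<and>
     d * real (m + 2) powr (- 2 * \<alpha>) \<le> (l2n a b g)\<^sup>2 \<and>
     (\<forall>\<sigma>\<in>{1, -1}. (\<lambda>\<theta>. 1 / (b - a) + \<sigma> * g \<theta>) \<in> smooth_class a b \<alpha> C \<inter> L2_densities a b)"
    using smooth_class_perturbation[OF a(2) alpha C] by metis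
  define t where "t n = real n * (b ^ blind_index 1 n / fact (blind_index 1 n))" for n
  have "t \<longlonglongrightarrow> 0" unfolding t_def by (rule blind_tail_vanishes[OF b]) simp
  then have "eventually (\<lambda>n. t n < 1 / 2) sequentially" by (rule order_tendstoD) simp
  then have "eventually (\<lambda>n. ennreal (d * 5 powr (- 2 * \<alpha>) / 2)
      \<le> ennreal (inverse (log_ratio n powr (- 2 * \<alpha>))) * ?R n) sequentially"
    using filterlim_at_top[THEN iffD1, OF log_ratio_at_top, rule_format, of 1]
  proof eventually_elim
    case (elim n)
    define m where "m = blind_index 1 n"
    define L where "L = log_ratio n"
    have L: "1 \<le> L" using elim by (simp add: L_def)
    obtain g where g: "g \<in> L2 a b" "\<And>k. k < m \<Longrightarrow> L2inner a b g (poisson_mass k) = 0"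
      "d * real (m + 2) powr (- 2 * \<alpha>) \<le> (l2n a b g)\<^sup>2"
      "\<And>\<sigma>. \<sigma> \<in> {1, -1} \<Longrightarrow> (\<lambda>\<theta>. 1 / (b - a) + \<sigma> * g \<theta>) \<in> smooth_class a b \<alpha> C \<inter> L2_densities a b"
      using pert[of m] by blast
    define f where "f \<sigma> = (\<lambda>\<theta>. 1 / (b - a) + \<sigma> * g \<theta>)" for \<sigma> :: real
    have mem: "f 1 \<in> smooth_class a b \<alpha> C \<inter> L2_densities a b" "f (-1) \<in> smooth_class a b \<alpha> C \<inter> L2_densities a b"
      using g(4)[of 1] g(4)[of "-1"] by (simp_all add: f_def)
    have kL: "(\<lambda>_. 1 / (b - a)) \<in> L2 a b" by (intro L2_continuous continuous_intros)
    have mass: "mixture_mass a b (f \<sigma>) k = L2inner a b (\<lambda>_. 1 / (b - a)) (poisson_mass k)" if "k < m" for k \<sigma>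
      unfolding mixture_mass_eq_L2inner f_def L2inner_add_left[OF kL L2_cmult[OF g(1)] poisson_mass_L2]
        L2inner_cmult_left g(2)[OF that] by simp
    have "l2n a b (\<lambda>\<theta>. f 1 \<theta> - f (-1) \<theta>) = l2n a b (\<lambda>\<theta>. 2 * g \<theta>)" by (simp add: f_def)
    then have D: "(l2n a b (\<lambda>\<theta>. f 1 \<theta> - f (-1) \<theta>))\<^sup>2 / 4 = (l2n a b g)\<^sup>2"
      unfolding l2n_cmult by (simp add: power_mult_distrib)
    have low: "ennreal ((l2n a b g)\<^sup>2) * ennreal (1 - t n) \<le> ?R n"
    proof -
      have "f 1 \<in> L2_densities a b" "f (-1) \<in> L2_densities a b" using mem by auto
      from two_point_MISE[OF a(1) this mem, of m n]
      show ?thesis unfolding D t_def m_def[symmetric] by (simp add: mass)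
    qed
    \<comment> \<open>The blind index is at most \<open>2 L + 1\<close>, so
      \<open>m + 2 \<le> 5 L\<close> once \<open>L\<close> is at least 1.\<close>
    have "(5 * L) powr (- 2 * \<alpha>) \<le> real (m + 2) powr (- 2 * \<alpha>)"
      using blind_index_le[of 1 n] L alpha by (intro powr_mono2') (auto simp: m_def L_def)
    then have "d * (5 powr (- 2 * \<alpha>) * L powr (- 2 * \<alpha>)) \<le> (l2n a b g)\<^sup>2"
      using g(3) d L by (intro order_trans[OF _ g(3)] mult_left_mono) (auto simp: powr_mult)
    then have "d * (5 powr (- 2 * \<alpha>) * L powr (- 2 * \<alpha>)) * (1 / 2) \<le> (l2n a b g)\<^sup>2 * (1 - t n)"
      using elim(1) by (intro mult_mono) auto
    then have "ennreal (d * (5 powr (- 2 * \<alpha>) * L powr (- 2 * \<alpha>)) * (1 / 2)) \<le> ennreal ((l2n a b g)\<^sup>2 * (1 - t n))"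
      by (rule ennreal_leI)
    also have "\<dots> = ennreal ((l2n a b g)\<^sup>2) * ennreal (1 - t n)"
      using elim(1) by (intro ennreal_mult) auto
    finally have low2: "ennreal (d * (5 powr (- 2 * \<alpha>) * L powr (- 2 * \<alpha>)) * (1 / 2)) \<le> ?R n"
      using low by (rule order_trans)
    have "ennreal (d * 5 powr (- 2 * \<alpha>) / 2)
        = ennreal (inverse (L powr (- 2 * \<alpha>))) * ennreal (d * (5 powr (- 2 * \<alpha>) * L powr (- 2 * \<alpha>)) * (1 / 2))"
      using L d by (simp only: ennreal_mult[symmetric] powr_ge_zero inverse_nonnegative_iff_nonnegative
          mult_nonneg_nonneg less_imp_le zero_le_divide_1_iff zero_le_numeral) (simp add: field_simps)
    also have "\<dots> \<le> ennreal (inverse (L powr (- 2 * \<alpha>))) * ?R n" by (intro mult_left_mono low2) simp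
    finally show ?case by (simp add: L_def)
  qed
  then have "ennreal (d * 5 powr (- 2 * \<alpha>) / 2) \<le> liminf (\<lambda>n. ennreal (inverse (log_ratio n powr (- 2 * \<alpha>))) * ?R n)"
    by (rule Liminf_bounded)
  moreover have "0 < ennreal (d * 5 powr (- 2 * \<alpha>) / 2)" using d by simp
  ultimately show ?thesis by (rule less_le_trans[rotated])
qed

section \<open>Averaged differences on \<open>[-1, 1]\<close>\<close>

abbreviation circle_weight :: "real \<Rightarrow> real" where
  "circle_weight \<equiv> step_weight (-1) 1"

lemma circle_weight_eq: "circle_weight x = sqrt (1 - x\<^sup>2)"
  by (simp add: step_weight_def power2_eq_square algebra_simps)

lemma circle_weight_sq: "\<bar>x\<bar> \<le> 1 \<Longrightarrow> (circle_weight x)\<^sup>2 = 1 - x\<^sup>2"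
  by (simp add: circle_weight_eq abs_square_le_1)

lemma circle_weight_nonneg: "\<bar>x\<bar> \<le> 1 \<Longrightarrow> 0 \<le> circle_weight x"
  by (simp add: circle_weight_eq abs_square_le_1)

lemma circle_weight_measurable [measurable]: "circle_weight \<in> borel_measurable borel"
  unfolding step_weight_def[abs_def] by measurable

lemma nn_integral_affine:
  fixes f :: "real \<Rightarrow> ennreal"
  assumes "f \<in> borel_measurable borel" "k \<noteq> 0"
  shows "(\<integral>\<^sup>+ c. f (u + k * c) \<partial>lborel) = ennreal (1 / \<bar>k\<bar>) * (\<integral>\<^sup>+ z. f z \<partial>lborel)"
proof -
  have "(\<integral>\<^sup>+ z. f z \<partial>lborel) = ennreal \<bar>k\<bar> * (\<integral>\<^sup>+ c. f (u + k * c) \<partial>lborel)"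
    by (rule nn_integral_real_affine[OF assms])
  then have "ennreal (1 / \<bar>k\<bar>) * (\<integral>\<^sup>+ z. f z \<partial>lborel)
      = ennreal (1 / \<bar>k\<bar>) * ennreal \<bar>k\<bar> * (\<integral>\<^sup>+ c. f (u + k * c) \<partial>lborel)"
    by (simp only: mult.assoc)
  also have "ennreal (1 / \<bar>k\<bar>) * ennreal \<bar>k\<bar> = 1"
    using assms(2) by (subst ennreal_mult[symmetric]) auto
  finally show ?thesis by simp
qed

lemma nn_integral_swap:
  fixes f :: "real \<Rightarrow> real \<Rightarrow> ennreal"
  assumes "(\<lambda>(x, y). f x y) \<in> borel_measurable (borel \<Otimes>\<^sub>M borel)"
  shows "(\<integral>\<^sup>+ y. \<integral>\<^sup>+ x. f x y \<partial>lborel \<partial>lborel) = (\<integral>\<^sup>+ x. \<integral>\<^sup>+ y. f x y \<partial>lborel \<partial>lborel)"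
proof (rule lborel_pair.Fubini')
  have "sets (lborel \<Otimes>\<^sub>M lborel :: (real \<times> real) measure) = sets (borel \<Otimes>\<^sub>M borel)"
    by (intro sets_pair_measure_cong) auto
  then show "(\<lambda>(x, y). f x y) \<in> borel_measurable (lborel \<Otimes>\<^sub>M lborel)"
    using assms by (simp cong: measurable_cong_sets)
qed

text \<open>With mean \<open>m\<close> and half difference \<open>d\<close> of the angles,
  \<open>\<bar>sin u - sin v\<bar> = 2 cos m sin d\<close> and
  \<open>cos u + cos v = 2 cos m cos d\<close>. The common factor cancels, leaving a bound on the
  tangent of \<open>d\<close>, which dominates \<open>d\<close>.\<close>

lemma angle_window:
  assumes u: "\<bar>u\<bar> < pi / 2" "\<bar>z - a * sin u\<bar> \<le> \<epsilon> * cos u"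
    and v: "\<bar>v\<bar> < pi / 2" "\<bar>z - a * sin v\<bar> \<le> \<epsilon> * cos v"
    and a: "1 / 2 \<le> a"
  shows "\<bar>u - v\<bar> \<le> 4 * \<epsilon>"
proof -
  define m where "m = (u + v) / 2"
  define d where "d = \<bar>u - v\<bar> / 2"
  have cm: "0 < cos m" using u v by (intro cos_gt_zero_pi) (auto simp: m_def)
  have cd: "0 < cos d" using u v by (intro cos_gt_zero_pi) (auto simp: d_def)
  have sd: "0 \<le> sin d" using u v by (intro sin_ge_zero) (auto simp: d_def)
  have s: "\<bar>sin u - sin v\<bar> = 2 * cos m * sin d"
  proof -
    have "\<bar>sin u - sin v\<bar> = 2 * \<bar>sin ((u - v) / 2)\<bar> * \<bar>cos m\<bar>"
      by (simp add: sin_diff_sin abs_mult m_def)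
    also have "\<bar>sin ((u - v) / 2)\<bar> = sin d"
    proof -
      have "d = (u - v) / 2 \<or> d = - ((u - v) / 2)" unfolding d_def by arith
      then show ?thesis using sd by (metis abs_minus_cancel abs_of_nonneg sin_minus)
    qed
    finally show ?thesis using cm by simp
  qed
  have c: "cos u + cos v = 2 * cos m * cos d"
    by (cases "u \<ge> v") (auto simp: cos_plus_cos m_def d_def abs_if cos_diff cos_add add_divide_distrib diff_divide_distrib)
  have "a * (2 * cos m * sin d) = \<bar>a * sin u - a * sin v\<bar>"
    using a by (simp add: s[symmetric] abs_mult right_diff_distrib[symmetric])
  also have "\<dots> \<le> \<epsilon> * (cos u + cos v)" using u(2) v(2) by (simp add: distrib_left abs_le_iff)
  also have "\<dots> = \<epsilon> * (2 * cos m * cos d)" by (simp only: c)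
  finally have "(2 * cos m) * (a * sin d) \<le> (2 * cos m) * (\<epsilon> * cos d)" by (simp add: mult_ac)
  then have 1: "a * sin d \<le> \<epsilon> * cos d" using cm by simp
  have "1 / 2 * (d * cos d) \<le> a * sin d"
  proof (intro mult_mono a)
    have "0 \<le> d" "d < pi / 2" using u v by (auto simp: d_def)
    then have "d \<le> \<bar>tan d\<bar>" using abs_tan_ge[of d] by simp
    then show "d * cos d \<le> sin d" using cd sd by (simp add: tan_def field_simps)
  qed (use a cd in \<open>auto simp: d_def\<close>)
  then have "cos d * d \<le> cos d * (2 * \<epsilon>)" using 1 by (simp add: algebra_simps)
  then have "d \<le> 2 * \<epsilon>" using cd by simp
  then show ?thesis by (simp add: d_def)
qed

text \<open>Substituting \<open>x = sin u\<close> turns the density \<open>1 / \<phi>\<close> into the length of a set of angles.\<close>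

lemma angle_measure:
  assumes a: "1 / 2 \<le> a" and k: "0 < \<kappa>" and t: "0 < t"
  shows "(\<integral>\<^sup>+ x. ennreal (1 / (\<kappa> * circle_weight x)) * indicator {x. \<bar>z - a * x\<bar> \<le> \<kappa> * t * circle_weight x} x
            * indicator {-1<..<1} x \<partial>lborel) \<le> ennreal (8 * t)"
proof -
  define P where "P x = (1 / (\<kappa> * circle_weight x)) * indicator {x. \<bar>z - a * x\<bar> \<le> \<kappa> * t * circle_weight x} x
      * indicator {-1<..<1} x" for x :: real
  have Pm: "P \<in> borel_measurable borel" unfolding P_def by measurable
  define S where "S = {u. \<bar>u\<bar> < pi / 2 \<and> \<bar>z - a * sin u\<bar> \<le> \<kappa> * t * cos u}"
  have "(\<integral>\<^sup>+ x. ennreal (1 / (\<kappa> * circle_weight x)) * indicator {x. \<bar>z - a * x\<bar> \<le> \<kappa> * t * circle_weight x} x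
            * indicator {-1<..<1} x \<partial>lborel)
      = (\<integral>\<^sup>+ x. ennreal (P x) * indicator {sin (- (pi / 2))..sin (pi / 2)} x \<partial>lborel)"
    by (intro nn_integral_cong) (auto simp: P_def indicator_def)
  also have "\<dots> = (\<integral>\<^sup>+ x. ennreal (P x * indicator {sin (- (pi / 2))..sin (pi / 2)} x) \<partial>lborel)"
    by (intro nn_integral_cong) (auto simp: indicator_def)
  also have "\<dots> = (\<integral>\<^sup>+ u. ennreal (P (sin u) * cos u * indicator {- (pi / 2)..pi / 2} u) \<partial>lborel)"
    using Pm by (intro nn_integral_substitution)
      (auto intro!: continuous_intros derivative_eq_intros cos_ge_zero simp: set_borel_measurable_def)
  also have "\<dots> \<le> (\<integral>\<^sup>+ u. ennreal (1 / \<kappa>) * indicator S u \<partial>lborel)"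
  proof (rule nn_integral_mono)
    fix u :: real
    show "ennreal (P (sin u) * cos u * indicator {- (pi / 2)..pi / 2} u) \<le> ennreal (1 / \<kappa>) * indicator S u"
    proof (cases "P (sin u) * cos u * indicator {- (pi / 2)..pi / 2} u = 0")
      case False
      then have u: "- (pi / 2) \<le> u" "u \<le> pi / 2" "cos u \<noteq> 0" "P (sin u) \<noteq> 0" by (auto simp: indicator_def split: if_splits)
      have "u \<noteq> pi / 2" "u \<noteq> - (pi / 2)" using u(3) by (metis cos_pi_half cos_minus)+
      then have u': "\<bar>u\<bar> < pi / 2" using u by auto
      then have cu: "0 < cos u" by (intro cos_gt_zero_pi) auto
      have w: "circle_weight (sin u) = cos u"
        using cu by (simp add: circle_weight_eq cos_squared_eq[symmetric])
      have "u \<in> S" using u(4) u' by (auto simp: P_def S_def w indicator_def split: if_splits)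
      moreover have "P (sin u) * cos u * indicator {- (pi / 2)..pi / 2} u \<le> 1 / \<kappa>"
        using u cu k by (auto simp: P_def w indicator_def)
      ultimately show ?thesis by (simp add: ennreal_leI)
    next
      case True
      show ?thesis unfolding True by simp
    qed
  qed
  also have "\<dots> = ennreal (1 / \<kappa>) * (\<integral>\<^sup>+ u. indicator S u \<partial>lborel)"
    by (rule nn_integral_cmult) (simp add: S_def)
  also have "\<dots> \<le> ennreal (1 / \<kappa>) * ennreal (2 * (4 * (\<kappa> * t)))"
  proof (intro mult_left_mono emeasure_diameter_le)
    fix u v assume "u \<in> S" "v \<in> S"
    then show "\<bar>u - v\<bar> \<le> 4 * (\<kappa> * t)" using angle_window[OF _ _ _ _ a] by (auto simp: S_def)
  qed (use k t in auto)
  also have "\<dots> = ennreal (8 * t)" using k t by (subst ennreal_mult[symmetric]) auto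
  finally show ?thesis .
qed

text \<open>A single map \<open>x \<mapsto> a x + \<kappa> c \<phi>(x)\<close> with
  \<open>c \<noteq> 0\<close> has a critical point, so composition with it cannot be bounded on its
  own. Averaged over \<open>c\<close> it is: taking the image \<open>z\<close> as variable instead
  of \<open>c\<close> produces the density \<open>1 / (\<kappa> \<phi>(x))\<close> on a window,
  whose integral in \<open>x\<close> is the one of \<open>angle_measure\<close>.\<close>

lemma composition_bound:
  fixes G :: "real \<Rightarrow> ennreal"
  assumes G [measurable]: "G \<in> borel_measurable borel" and a: "1 / 2 \<le> a" and k: "0 < \<kappa>" and t: "0 < t"
  shows "(\<integral>\<^sup>+ c. (\<integral>\<^sup>+ x. G (a * x + \<kappa> * c * circle_weight x) * indicator {-1<..<1} x \<partial>lborel) * indicator {-t..t} c \<partial>lborel)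
      \<le> ennreal (8 * t) * (\<integral>\<^sup>+ z. G z \<partial>lborel)"
proof -
  have "(\<integral>\<^sup>+ c. (\<integral>\<^sup>+ x. G (a * x + \<kappa> * c * circle_weight x) * indicator {-1<..<1} x \<partial>lborel) * indicator {-t..t} c \<partial>lborel)
      = (\<integral>\<^sup>+ c. \<integral>\<^sup>+ x. G (a * x + \<kappa> * c * circle_weight x) * indicator {-t..t} c * indicator {-1<..<1} x \<partial>lborel \<partial>lborel)"
    by (intro nn_integral_cong, subst nn_integral_multc[symmetric]) (auto simp: mult_ac)
  also have "\<dots> = (\<integral>\<^sup>+ x. \<integral>\<^sup>+ c. G (a * x + \<kappa> * c * circle_weight x) * indicator {-t..t} c * indicator {-1<..<1} x \<partial>lborel \<partial>lborel)"
    by (rule nn_integral_swap) measurable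
  also have "\<dots> \<le> (\<integral>\<^sup>+ x. \<integral>\<^sup>+ z. G z * (ennreal (1 / (\<kappa> * circle_weight x))
      * indicator {x. \<bar>z - a * x\<bar> \<le> \<kappa> * t * circle_weight x} x * indicator {-1<..<1} x) \<partial>lborel \<partial>lborel)"
  proof (rule nn_integral_mono)
    fix x :: real
    show "(\<integral>\<^sup>+ c. G (a * x + \<kappa> * c * circle_weight x) * indicator {-t..t} c * indicator {-1<..<1} x \<partial>lborel)
      \<le> (\<integral>\<^sup>+ z. G z * (ennreal (1 / (\<kappa> * circle_weight x))
      * indicator {x. \<bar>z - a * x\<bar> \<le> \<kappa> * t * circle_weight x} x * indicator {-1<..<1} x) \<partial>lborel)"
    proof (cases "x \<in> {-1<..<1}")
      case True
      have w: "0 < circle_weight x" using True by (simp add: step_weight_def)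
      define F where "F z = G z * indicator {z. \<bar>z - a * x\<bar> \<le> \<kappa> * t * circle_weight x} z" for z
      have [measurable]: "F \<in> borel_measurable borel" unfolding F_def by measurable
      have kw: "\<kappa> * circle_weight x \<noteq> 0" using k w by simp
      have "(\<integral>\<^sup>+ c. G (a * x + \<kappa> * c * circle_weight x) * indicator {-t..t} c * indicator {-1<..<1} x \<partial>lborel)
          = (\<integral>\<^sup>+ c. F (a * x + (\<kappa> * circle_weight x) * c) \<partial>lborel)"
      proof (rule nn_integral_cong)
        fix c :: real
        have "\<bar>(\<kappa> * circle_weight x) * c\<bar> \<le> \<kappa> * t * circle_weight x \<longleftrightarrow> \<bar>c\<bar> \<le> t"
        proof -
          have "\<bar>(\<kappa> * circle_weight x) * c\<bar> = (\<kappa> * circle_weight x) * \<bar>c\<bar>" using k w by (simp add: abs_mult)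
          moreover have "\<kappa> * t * circle_weight x = (\<kappa> * circle_weight x) * t" by simp
          ultimately show ?thesis using k w by (simp only: mult_le_cancel_left_pos mult_pos_pos)
        qed
        then show "G (a * x + \<kappa> * c * circle_weight x) * indicator {-t..t} c * indicator {-1<..<1} x
            = F (a * x + (\<kappa> * circle_weight x) * c)"
          using True by (auto simp: F_def indicator_def mult_ac)
      qed
      also have "\<dots> = ennreal (1 / \<bar>\<kappa> * circle_weight x\<bar>) * (\<integral>\<^sup>+ z. F z \<partial>lborel)"
        by (rule nn_integral_affine[OF _ kw]) measurable
      also have "\<dots> = (\<integral>\<^sup>+ z. ennreal (1 / \<bar>\<kappa> * circle_weight x\<bar>) * F z \<partial>lborel)"
        by (rule nn_integral_cmult[symmetric]) measurable
      also have "\<dots> = (\<integral>\<^sup>+ z. G z * (ennreal (1 / (\<kappa> * circle_weight x))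
      * indicator {x. \<bar>z - a * x\<bar> \<le> \<kappa> * t * circle_weight x} x * indicator {-1<..<1} x) \<partial>lborel)"
        using True k w by (intro nn_integral_cong) (auto simp: F_def indicator_def abs_mult mult_ac)
      finally show ?thesis by simp
    qed simp
  qed
  also have "\<dots> = (\<integral>\<^sup>+ z. \<integral>\<^sup>+ x. G z * (ennreal (1 / (\<kappa> * circle_weight x))
      * indicator {x. \<bar>z - a * x\<bar> \<le> \<kappa> * t * circle_weight x} x * indicator {-1<..<1} x) \<partial>lborel \<partial>lborel)"
    by (rule nn_integral_swap) measurable
  also have "\<dots> = (\<integral>\<^sup>+ z. G z * (\<integral>\<^sup>+ x. ennreal (1 / (\<kappa> * circle_weight x))
      * indicator {x. \<bar>z - a * x\<bar> \<le> \<kappa> * t * circle_weight x} x * indicator {-1<..<1} x \<partial>lborel) \<partial>lborel)"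
    by (intro nn_integral_cong nn_integral_cmult) measurable
  also have "\<dots> \<le> (\<integral>\<^sup>+ z. G z * ennreal (8 * t) \<partial>lborel)"
    by (intro nn_integral_mono mult_left_mono angle_measure a k t) auto
  also have "\<dots> = ennreal (8 * t) * (\<integral>\<^sup>+ z. G z \<partial>lborel)"
    by (subst nn_integral_multc) (auto simp: mult.commute)
  finally show ?thesis .
qed

text \<open>The step \<open>\<sigma> = - \<delta> x + c \<phi>(x)\<close> combines an inward shift with a step along \<open>\<phi>\<close>. The shift
  keeps all nodes \<open>x + i \<sigma>\<close> inside \<open>[-1, 1]\<close>, and relative to the centre \<open>y\<close> of the stencil the
  step is at most of order \<open>t \<phi>(y)\<close>.\<close>

definition inward_step :: "real \<Rightarrow> real \<Rightarrow> real \<Rightarrow> real" where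
  "inward_step \<delta> c x = - \<delta> * x + c * circle_weight x"

section \<open>Position and weight of the shifted nodes\<close>

context
  fixes S :: nat and t \<delta> c x :: real
  assumes S: "0 < S" and t: "0 < t" "t * (4 * real S) \<le> 1"
    and d: "real S * t\<^sup>2 \<le> \<delta>" "\<delta> \<le> 2 * (real S * t\<^sup>2)" and c: "\<bar>c\<bar> \<le> t" and x: "\<bar>x\<bar> \<le> 1"
begin

lemma inward_step_small:
  shows inward_delta_pos: "0 < \<delta>"
    and inward_S_delta: "real S * \<delta> \<le> 1 / 8"
proof -
  have "0 < real S * t\<^sup>2" using S t by simp
  then show "0 < \<delta>" using d(1) by linarith
  have "(t * (4 * real S))\<^sup>2 \<le> 1\<^sup>2" using t S by (intro power_mono) auto
  then have "(real S * t)\<^sup>2 \<le> 1 / 16" by (simp add: power_mult_distrib field_simps)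
  then have "2 * (real S * (real S * t\<^sup>2)) \<le> 1 / 8" by (simp add: power2_eq_square mult_ac)
  moreover have "real S * \<delta> \<le> real S * (2 * (real S * t\<^sup>2))" using d(2) by (intro mult_left_mono) auto
  ultimately show "real S * \<delta> \<le> 1 / 8" by (simp add: mult_ac)
qed

text \<open>\<open>(x, \<phi>(x))\<close> is a unit vector, so this is Cauchy-Schwarz in the plane,
  obtained from Lagrange's identity.\<close>

lemma inward_convex: "(u * x + v * circle_weight x)\<^sup>2 \<le> u\<^sup>2 + v\<^sup>2"
proof -
  have "(u * x + v * circle_weight x)\<^sup>2 + (u * circle_weight x - v * x)\<^sup>2
      = (u\<^sup>2 + v\<^sup>2) * (x\<^sup>2 + (circle_weight x)\<^sup>2)"
    by (simp add: power2_eq_square algebra_simps)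
  also have "\<dots> = u\<^sup>2 + v\<^sup>2" by (simp add: circle_weight_sq[OF x])
  finally show ?thesis by (smt (verit) zero_le_power2)
qed

text \<open>The bound \<open>(1 - r \<delta>)^2 + (r c)^2\<close> shows the competition: the shift
  gains \<open>2 r \<delta>\<close>, the step along \<phi> loses at most \<open>r S t^2\<close>. The
  lower limit \<open>S t^2\<close> for \<delta> is chosen so that the gain wins; the second order
  term costs only one eighth of \<open>r \<delta>\<close>.\<close>

lemma inward_node:
  assumes "0 \<le> r" "r \<le> real S"
  shows "(x + r * inward_step \<delta> c x)\<^sup>2 \<le> 1 - r * \<delta> * (3 / 4)"
proof -
  have "x + r * inward_step \<delta> c x = (1 - r * \<delta>) * x + (r * c) * circle_weight x"
    by (simp add: inward_step_def algebra_simps)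
  then have "(x + r * inward_step \<delta> c x)\<^sup>2 \<le> (1 - r * \<delta>)\<^sup>2 + (r * c)\<^sup>2" using inward_convex by simp
  also have "\<dots> = 1 - 2 * (r * \<delta>) + r * \<delta> * (r * \<delta>) + r * (r * c\<^sup>2)"
    by (simp add: power2_eq_square algebra_simps)
  also have "r * \<delta> * (r * \<delta>) \<le> r * \<delta> * (1 / 8)"
  proof (intro mult_left_mono)
    have "r * \<delta> \<le> real S * \<delta>" using assms inward_delta_pos by (intro mult_right_mono) auto
    then show "r * \<delta> \<le> 1 / 8" using inward_S_delta by linarith
  qed (use assms inward_delta_pos in auto)
  also have "r * (r * c\<^sup>2) \<le> r * \<delta>"
  proof (intro mult_left_mono)
    have "c\<^sup>2 \<le> t\<^sup>2" using c t by (simp add: abs_le_square_iff[symmetric])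
    then have "r * c\<^sup>2 \<le> real S * t\<^sup>2" using assms by (intro mult_mono) auto
    then show "r * c\<^sup>2 \<le> \<delta>" using d(1) by linarith
  qed (use assms in auto)
  finally have "(x + r * inward_step \<delta> c x)\<^sup>2 \<le> 1 - 2 * (r * \<delta>) + r * \<delta> * (1 / 8) + r * \<delta>" by simp
  moreover have "1 - 2 * (r * \<delta>) + r * \<delta> * (1 / 8) + r * \<delta> = 1 - r * \<delta> * (7 / 8)" by simp
  moreover have "r * \<delta> * (3 / 4) \<le> r * \<delta> * (7 / 8)" using assms inward_delta_pos by (intro mult_left_mono) auto
  ultimately show ?thesis by linarith
qed

lemma inward_node_abs:
  assumes "0 \<le> r" "r \<le> real S"
  shows "\<bar>x + r * inward_step \<delta> c x\<bar> \<le> 1"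
proof -
  have "0 \<le> r * \<delta> * (3 / 4)" using assms inward_delta_pos by simp
  then have "(x + r * inward_step \<delta> c x)\<^sup>2 \<le> 1" using inward_node[OF assms] by linarith
  then show ?thesis by (simp add: abs_square_le_1)
qed


lemma centre_weight_ge_t: "t / 2 \<le> circle_weight (x + real S / 2 * inward_step \<delta> c x)"
proof (rule power2_le_imp_le)
  let ?y = "x + real S / 2 * inward_step \<delta> c x"
  have y: "\<bar>?y\<bar> \<le> 1" by (rule inward_node_abs) auto
  have "(t / 2)\<^sup>2 \<le> real S * real S * t\<^sup>2 * (3 / 8)"
  proof -
    have "1 * 1 \<le> real S * real S" using S by (intro mult_mono) auto
    then have "1 * (t\<^sup>2 * (3 / 8)) \<le> real S * real S * (t\<^sup>2 * (3 / 8))" by (intro mult_right_mono) auto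
    moreover have "(t / 2)\<^sup>2 \<le> t\<^sup>2 * (3 / 8)" by (simp add: power_divide)
    ultimately show ?thesis by (simp add: mult.assoc)
  qed
  also have "\<dots> \<le> real S / 2 * \<delta> * (3 / 4)"
    using mult_left_mono[OF d(1), of "real S"] by (simp add: mult_ac)
  also have "\<dots> \<le> 1 - ?y\<^sup>2" using inward_node[of "real S / 2"] by simp
  finally show "(t / 2)\<^sup>2 \<le> (circle_weight ?y)\<^sup>2" unfolding circle_weight_sq[OF y] .
  show "0 \<le> circle_weight ?y" by (rule circle_weight_nonneg[OF y])
qed

text \<open>The centre is the midpoint of the first node \<open>x\<close> and the last one, both in
  [-1, 1], so its distance to either end is at least half that of \<open>x\<close>.\<close>

lemma centre_weight_ge_half: "circle_weight x / 2 \<le> circle_weight (x + real S / 2 * inward_step \<delta> c x)"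
proof (rule power2_le_imp_le)
  let ?y = "x + real S / 2 * inward_step \<delta> c x"
  let ?z = "x + real S * inward_step \<delta> c x"
  have y: "\<bar>?y\<bar> \<le> 1" and z: "\<bar>?z\<bar> \<le> 1" by (rule inward_node_abs; auto)+
  have yz: "?y = (x + ?z) / 2" by (simp add: field_simps)
  have "(1 - x) / 2 * ((1 + x) / 2) \<le> (1 - ?y) * (1 + ?y)"
    using x z unfolding yz by (intro mult_mono) (auto simp: abs_le_iff field_simps)
  then have "(1 - x\<^sup>2) / 4 \<le> 1 - ?y\<^sup>2" by (simp add: power2_eq_square algebra_simps)
  then show "(circle_weight x / 2)\<^sup>2 \<le> (circle_weight ?y)\<^sup>2"
    unfolding circle_weight_sq[OF y] power_divide circle_weight_sq[OF x] by simp
  show "0 \<le> circle_weight ?y" by (rule circle_weight_nonneg[OF y])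
qed

lemma inward_step_le: "\<bar>inward_step \<delta> c x\<bar> \<le> 2 * (real S * t\<^sup>2) + t * circle_weight x"
proof -
  have "\<bar>inward_step \<delta> c x\<bar> \<le> \<delta> * \<bar>x\<bar> + \<bar>c\<bar> * circle_weight x"
    unfolding inward_step_def using inward_delta_pos circle_weight_nonneg[OF x]
    by (intro order_trans[OF abs_triangle_ineq]) (simp add: abs_mult)
  also have "\<delta> * \<bar>x\<bar> \<le> 2 * (real S * t\<^sup>2) * 1"
    using d x inward_delta_pos by (intro mult_mono) auto
  also have "\<bar>c\<bar> * circle_weight x \<le> t * circle_weight x"
    using c circle_weight_nonneg[OF x] by (intro mult_right_mono) auto
  finally show ?thesis by simp
qed

text \<open>Expresses the step as \<open>h \<phi>(y)\<close> at the centre \<open>y\<close> with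
  \<open>h\<close> at most \<open>6 S t\<close>, which is the form of step seen by the modulus. The
  shift is absorbed because the weight at the centre is at least \<open>t / 2\<close>.\<close>

lemma inward_step_le_centre:
  "\<bar>inward_step \<delta> c x\<bar> \<le> 6 * real S * t * circle_weight (x + real S / 2 * inward_step \<delta> c x)"
proof -
  let ?w = "circle_weight (x + real S / 2 * inward_step \<delta> c x)"
  have "2 * (real S * t\<^sup>2) = (4 * real S * t) * (t / 2)" by (simp add: power2_eq_square)
  also have "\<dots> \<le> (4 * real S * t) * ?w" using centre_weight_ge_t t by (intro mult_left_mono) auto
  finally have 1: "2 * (real S * t\<^sup>2) \<le> (4 * real S * t) * ?w" .
  have w: "0 \<le> ?w" using centre_weight_ge_t t by linarith
  have "t * circle_weight x \<le> t * (2 * ?w)" using centre_weight_ge_half t by (intro mult_left_mono) auto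
  also have "\<dots> \<le> real S * (t * (2 * ?w))"
    using S t w mult_right_mono[of 1 "real S" "t * (2 * ?w)"] by simp
  finally have 2: "t * circle_weight x \<le> (2 * real S * t) * ?w" by (simp add: mult_ac)
  show ?thesis using inward_step_le 1 2 by (simp add: algebra_simps)
qed

text \<open>The converse comparison, needed to undo the division by the weight at the centre in
  \<open>weighted_diff\<close>. The maximum with \<open>t\<close> reflects that the shift can lift a
  node off the boundary.\<close>

lemma centre_weight_le:
  "circle_weight (x + real S / 2 * inward_step \<delta> c x) \<le> 2 * real S * max t (circle_weight x)"
proof (rule power2_le_imp_le)
  let ?\<sigma> = "inward_step \<delta> c x"
  let ?y = "x + real S / 2 * ?\<sigma>"
  let ?M = "max t (circle_weight x)"
  have y: "\<bar>?y\<bar> \<le> 1" by (rule inward_node_abs) auto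
  have M: "0 < ?M" "t \<le> ?M" "circle_weight x \<le> ?M" using t by auto
  have S1: "1 \<le> real S" using S by simp
  have "1 - ?y\<^sup>2 = (1 - x\<^sup>2) - real S * (x * ?\<sigma>) - (real S / 2 * ?\<sigma>)\<^sup>2"
    by (simp add: power2_eq_square algebra_simps)
  also have "\<dots> \<le> (1 - x\<^sup>2) + real S * \<bar>?\<sigma>\<bar>"
  proof -
    have "\<bar>x * ?\<sigma>\<bar> \<le> 1 * \<bar>?\<sigma>\<bar>" unfolding abs_mult using x by (intro mult_right_mono) auto
    then have "real S * (- (x * ?\<sigma>)) \<le> real S * \<bar>?\<sigma>\<bar>" by (intro mult_left_mono) auto
    then show ?thesis by (smt (verit) zero_le_power2 mult_minus_right)
  qed
  also have "\<dots> \<le> ?M\<^sup>2 + real S * (3 * real S * ?M\<^sup>2)"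
  proof (intro add_mono mult_left_mono)
    show "1 - x\<^sup>2 \<le> ?M\<^sup>2" unfolding circle_weight_sq[OF x, symmetric]
      using circle_weight_nonneg[OF x] M by (intro power_mono) auto
    have "2 * (real S * t\<^sup>2) \<le> 2 * (real S * ?M\<^sup>2)" using t M by (intro mult_left_mono power_mono) auto
    moreover have "t * circle_weight x \<le> real S * ?M\<^sup>2"
    proof -
      have "t * circle_weight x \<le> ?M * ?M" using t M circle_weight_nonneg[OF x] by (intro mult_mono) auto
      also have "\<dots> \<le> real S * (?M * ?M)" using mult_right_mono[OF S1, of "?M * ?M"] M by simp
      finally show ?thesis by (simp add: power2_eq_square)
    qed
    ultimately show "\<bar>?\<sigma>\<bar> \<le> 3 * real S * ?M\<^sup>2" using inward_step_le by (simp add: mult.assoc)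
  qed auto
  also have "\<dots> = (1 + 3 * (real S)\<^sup>2) * ?M\<^sup>2" by (simp add: power2_eq_square algebra_simps)
  also have "\<dots> \<le> (4 * (real S)\<^sup>2) * ?M\<^sup>2"
  proof (intro mult_right_mono)
    have "1\<^sup>2 \<le> (real S)\<^sup>2" using S1 by (intro power_mono) auto
    then show "1 + 3 * (real S)\<^sup>2 \<le> 4 * (real S)\<^sup>2" by simp
  qed simp
  also have "\<dots> = (2 * real S * ?M)\<^sup>2" by (simp add: power_mult_distrib)
  finally show "(circle_weight ?y)\<^sup>2 \<le> (2 * real S * ?M)\<^sup>2" unfolding circle_weight_sq[OF y] .
  show "0 \<le> 2 * real S * ?M" using M by simp
qed

end

section \<open>Averages of squared differences against the modulus\<close>

lemma central_diff_minus: "central_diff n (- h) f x = (-1) ^ n * central_diff n h f x"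
proof -
  have "central_diff n (- h) f x = (\<Sum>i\<le>n. real (n choose (n - i)) * (-1) ^ (n - i) * f (x + (real (n - i) - real n / 2) * (- h)))"
    unfolding central_diff_def
    by (rule sum.reindex_bij_witness[of _ "\<lambda>i. n - i" "\<lambda>i. n - i"]) auto
  also have "\<dots> = (\<Sum>i\<le>n. (-1) ^ n * (real (n choose i) * (-1) ^ i * f (x + (real i - real n / 2) * h)))"
  proof (intro sum.cong refl)
    fix i assume i: "i \<in> {..n}"
    have sgn: "(-1) ^ (n - i) = ((-1) ^ n * (-1) ^ i :: real)"
      using i by (auto simp: minus_one_power_iff)
    have arg: "(real (n - i) - real n / 2) * (- h) = (real i - real n / 2) * h"
      using i by (simp add: of_nat_diff algebra_simps)
    have bin: "n choose (n - i) = n choose i" using i by (intro binomial_symmetric[symmetric]) auto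
    show "real (n choose (n - i)) * (-1) ^ (n - i) * f (x + (real (n - i) - real n / 2) * (- h))
        = (-1) ^ n * (real (n choose i) * (-1) ^ i * f (x + (real i - real n / 2) * h))"
      unfolding sgn arg bin by simp
  qed
  also have "\<dots> = (-1) ^ n * central_diff n h f x" by (simp add: central_diff_def sum_distrib_left)
  finally show ?thesis .
qed

lemma central_diff_sq_minus: "(central_diff n (- h) f x)\<^sup>2 = (central_diff n h f x)\<^sup>2"
  unfolding central_diff_minus power_mult_distrib by (simp flip: power_mult)

lemma central_diff_measurable [measurable]:
  assumes [measurable]: "f \<in> borel_measurable borel" "g \<in> borel_measurable M" "h \<in> borel_measurable M"
  shows "(\<lambda>p. central_diff n (h p) f (g p)) \<in> borel_measurable M"
  unfolding central_diff_def by measurable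

lemma inward_step_measurable [measurable]:
  assumes [measurable]: "d \<in> borel_measurable M" "c \<in> borel_measurable M" "x \<in> borel_measurable M"
  shows "(\<lambda>p. inward_step (d p) (c p) (x p)) \<in> borel_measurable M"
  unfolding inward_step_def by measurable

lemma nn_integral_indicator_const:
  "(\<integral>\<^sup>+ x. indicator {u..v} x * K \<partial>lborel) = ennreal (v - u) * K" if "u \<le> v" for u v :: real
  using that by (subst nn_integral_multc) auto

text \<open>The squared difference at centre \<open>y\<close> and step \<open>\<eta>\<close>, weighted by the density of
  \<open>\<eta> = h \<phi>(y)\<close> with respect to \<open>h\<close> and cut off outside the admissible region.\<close>

definition weighted_diff :: "nat \<Rightarrow> real \<Rightarrow> (real \<Rightarrow> real) \<Rightarrow> real \<Rightarrow> real \<Rightarrow> ennreal" where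
  "weighted_diff S t f y \<eta> = ennreal ((central_diff S \<eta> f y)\<^sup>2 / circle_weight y)
     * indicator {p. \<bar>snd p\<bar> \<le> 6 * real S * t * circle_weight (fst p) \<and> \<bar>fst p - real S / 2 * snd p\<bar> \<le> 1
         \<and> \<bar>fst p + real S / 2 * snd p\<bar> \<le> 1} (y, \<eta>)"

context
  fixes S :: nat and t M :: real and f :: "real \<Rightarrow> real"
  assumes S: "0 < S" and t: "0 < t" "t * (4 * real S) \<le> 1"
    and f [measurable]: "f \<in> borel_measurable borel" and M: "0 \<le> M"
    and modulus: "\<And>h. 0 < h \<Longrightarrow> h \<le> 6 * real S * t \<Longrightarrow>
      (\<integral>\<^sup>+ y. ennreal ((sym_difference (-1) 1 S (h * circle_weight y) f y)\<^sup>2) * indicator {-1..1} y \<partial>lborel) \<le> ennreal M"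
begin

lemma weighted_diff_measurable [measurable]:
  assumes [measurable]: "g \<in> borel_measurable N" "h \<in> borel_measurable N"
  shows "(\<lambda>p. weighted_diff S t f (g p) (h p)) \<in> borel_measurable N"
  unfolding weighted_diff_def indicator_def of_bool_def by simp measurable

text \<open>Two changes of variable: first from \<open>x\<close> to the centre \<open>y\<close>, a
  translation for fixed step, then from \<eta> to \<open>h = \<eta> / \<phi>(y)\<close>, whose
  Jacobian cancels the weight. For each \<open>h\<close> the inner integral is a squared modulus,
  and \<open>h\<close> ranges over an interval of length \<open>12 S t\<close>.\<close>

lemma weighted_diff_integral:
  "(\<integral>\<^sup>+ x. \<integral>\<^sup>+ \<eta>. weighted_diff S t f (x + real S / 2 * \<eta>) \<eta> * indicator {-1<..<1} (x + real S / 2 * \<eta>) \<partial>lborel \<partial>lborel)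
    \<le> ennreal (12 * real S * t * M)"
proof -
  define T where "T = 6 * real S * t"
  have T: "0 < T" using S t by (simp add: T_def)
  let ?W = "\<lambda>y \<eta>. weighted_diff S t f y \<eta> * indicator {-1<..<1} y"
  have "(\<integral>\<^sup>+ x. \<integral>\<^sup>+ \<eta>. ?W (x + real S / 2 * \<eta>) \<eta> \<partial>lborel \<partial>lborel)
      = (\<integral>\<^sup>+ \<eta>. \<integral>\<^sup>+ x. ?W (x + real S / 2 * \<eta>) \<eta> \<partial>lborel \<partial>lborel)"
    by (rule nn_integral_swap) measurable
  also have "\<dots> = (\<integral>\<^sup>+ \<eta>. \<integral>\<^sup>+ y. ?W y \<eta> \<partial>lborel \<partial>lborel)"
  proof (rule nn_integral_cong)
    fix \<eta> :: real
    show "(\<integral>\<^sup>+ x. ?W (x + real S / 2 * \<eta>) \<eta> \<partial>lborel) = (\<integral>\<^sup>+ y. ?W y \<eta> \<partial>lborel)"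
      using nn_integral_affine[of "\<lambda>y. ?W y \<eta>" 1 "real S / 2 * \<eta>"] by (simp add: add.commute)
  qed
  also have "\<dots> = (\<integral>\<^sup>+ y. \<integral>\<^sup>+ \<eta>. ?W y \<eta> \<partial>lborel \<partial>lborel)"
    by (rule nn_integral_swap) measurable
  also have "\<dots> \<le> (\<integral>\<^sup>+ y. \<integral>\<^sup>+ h. ennreal ((sym_difference (-1) 1 S (h * circle_weight y) f y)\<^sup>2) * indicator {-1..1} y
      * indicator {-T..T} h \<partial>lborel \<partial>lborel)"
  proof (rule nn_integral_mono)
    fix y :: real
    show "(\<integral>\<^sup>+ \<eta>. ?W y \<eta> \<partial>lborel) \<le> (\<integral>\<^sup>+ h. ennreal ((sym_difference (-1) 1 S (h * circle_weight y) f y)\<^sup>2) * indicator {-1..1} y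
      * indicator {-T..T} h \<partial>lborel)"
    proof (cases "y \<in> {-1<..<1}")
      case True
      define w where "w = circle_weight y"
      have w: "0 < w" using True by (simp add: w_def step_weight_def)
      have "(\<integral>\<^sup>+ \<eta>. ?W y \<eta> \<partial>lborel) = ennreal w * (\<integral>\<^sup>+ h. ?W y (0 + w * h) \<partial>lborel)"
        using nn_integral_real_affine[of "?W y" w 0] w by simp
      also have "\<dots> = (\<integral>\<^sup>+ h. ennreal w * ?W y (0 + w * h) \<partial>lborel)"
        by (rule nn_integral_cmult[symmetric]) measurable
      also have "\<dots> \<le> (\<integral>\<^sup>+ h. ennreal ((sym_difference (-1) 1 S (h * circle_weight y) f y)\<^sup>2) * indicator {-1..1} y
          * indicator {-T..T} h \<partial>lborel)"
      proof (rule nn_integral_mono)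
        fix h :: real
        show "ennreal w * ?W y (0 + w * h) \<le> ennreal ((sym_difference (-1) 1 S (h * circle_weight y) f y)\<^sup>2) * indicator {-1..1} y
          * indicator {-T..T} h"
        proof (cases "\<bar>w * h\<bar> \<le> T * w \<and> \<bar>y - real S / 2 * (w * h)\<bar> \<le> 1 \<and> \<bar>y + real S / 2 * (w * h)\<bar> \<le> 1")
          case R: True
          have "w * \<bar>h\<bar> \<le> w * T" using R w by (simp add: abs_mult mult_ac)
          then have hT: "\<bar>h\<bar> \<le> T" using w by simp
          have "ennreal w * ?W y (0 + w * h) = ennreal w * ennreal ((central_diff S (w * h) f y)\<^sup>2 / w)"
            using R True by (simp add: weighted_diff_def w_def[symmetric] T_def)
          also have "\<dots> = ennreal ((central_diff S (w * h) f y)\<^sup>2)"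
            using w by (subst ennreal_mult[symmetric]) auto
          also have "central_diff S (w * h) f y = sym_difference (-1) 1 S (h * circle_weight y) f y"
            using R by (auto simp: sym_difference_eq w_def[symmetric] mult.commute abs_le_iff)
          finally show ?thesis using True hT by (auto simp: indicator_def abs_le_iff)
        next
          case False
          then have "?W y (0 + w * h) = 0"
            by (auto simp: weighted_diff_def w_def[symmetric] T_def indicator_def)
          then show ?thesis by auto
        qed
      qed
      finally show ?thesis .
    qed simp
  qed
  also have "\<dots> = (\<integral>\<^sup>+ h. \<integral>\<^sup>+ y. ennreal ((sym_difference (-1) 1 S (h * circle_weight y) f y)\<^sup>2) * indicator {-1..1} y
      * indicator {-T..T} h \<partial>lborel \<partial>lborel)"
    unfolding sym_difference_eq by (rule nn_integral_swap) measurable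
  also have "\<dots> = (\<integral>\<^sup>+ h. (\<integral>\<^sup>+ y. ennreal ((sym_difference (-1) 1 S (h * circle_weight y) f y)\<^sup>2) * indicator {-1..1} y \<partial>lborel)
      * indicator {-T..T} h \<partial>lborel)"
    unfolding sym_difference_eq by (intro nn_integral_cong nn_integral_multc) measurable
  also have "\<dots> \<le> (\<integral>\<^sup>+ h. ennreal M * indicator {-T..T} h \<partial>lborel)"
  proof (rule nn_integral_mono_AE)
    \<comment> \<open>The modulus speaks of positive steps only; negative ones have the same square,
      and 0 is a null set.\<close>
    have "AE h in lborel. h \<noteq> (0::real)" by (rule AE_lborel_singleton)
    then show "AE h in lborel. (\<integral>\<^sup>+ y. ennreal ((sym_difference (-1) 1 S (h * circle_weight y) f y)\<^sup>2) * indicator {-1..1} y \<partial>lborel)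
      * indicator {-T..T} h \<le> ennreal M * indicator {-T..T} h"
    proof eventually_elim
      case (elim h)
      have even: "(sym_difference (-1) 1 S (h * circle_weight y) f y)\<^sup>2 = (sym_difference (-1) 1 S (\<bar>h\<bar> * circle_weight y) f y)\<^sup>2" for y
        using central_diff_sq_minus[of S "h * circle_weight y" f y]
        by (cases "h \<ge> 0") (auto simp: sym_difference_eq)
      show ?case
      proof (cases "h \<in> {-T..T}")
        case True
        then show ?thesis using modulus[of "\<bar>h\<bar>"] elim by (simp add: even[of _, symmetric] T_def[symmetric] abs_le_iff)
      qed simp
    qed
  qed
  also have "\<dots> = ennreal M * ennreal (2 * T)" using T by (simp add: nn_integral_cmult_indicator)
  also have "\<dots> = ennreal (12 * real S * t * M)"
    using M T by (subst ennreal_mult[symmetric]) (auto simp: T_def mult_ac)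
  finally show ?thesis .
qed

text \<open>Two parameters produce one step \<open>- \<delta> x + c \<phi>(x)\<close>, and either
  may be exchanged for the step itself. Away from the ends this is done with \<open>c\<close>, whose
  Jacobian is the weight at \<open>x\<close>; where the weight is below \<open>t\<close> it is done
  with \<delta>, whose Jacobian is \<open>\<bar>x\<bar>\<close>. The other parameter is integrated
  trivially, which contributes the factor \<delta>0 or \<open>t\<close>.\<close>

lemma averaged_difference_bound:
  defines "\<delta>0 \<equiv> real S * t\<^sup>2"
  shows "(\<integral>\<^sup>+ \<delta>. \<integral>\<^sup>+ c. \<integral>\<^sup>+ x. ennreal ((central_diff S (inward_step \<delta> c x) f (x + real S / 2 * inward_step \<delta> c x))\<^sup>2)
      * indicator {-1<..<1} x * indicator {-t..t} c * indicator {\<delta>0..2 * \<delta>0} \<delta> \<partial>lborel \<partial>lborel \<partial>lborel)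
    \<le> ennreal (120 * (real S)^3 * t^3 * M)"
proof -
  define J where "J = (\<integral>\<^sup>+ x. \<integral>\<^sup>+ \<eta>. weighted_diff S t f (x + real S / 2 * \<eta>) \<eta> * indicator {-1<..<1} (x + real S / 2 * \<eta>) \<partial>lborel \<partial>lborel)"
  define V where "V x = (\<integral>\<^sup>+ \<eta>. weighted_diff S t f (x + real S / 2 * \<eta>) \<eta> * indicator {-1<..<1} (x + real S / 2 * \<eta>) \<partial>lborel)" for x
  have [measurable]: "V \<in> borel_measurable borel" unfolding V_def by measurable
  have JV: "J = (\<integral>\<^sup>+ x. V x \<partial>lborel)" by (simp add: J_def V_def)
  have d0: "0 < \<delta>0" using S t by (simp add: \<delta>0_def)
  define D where "D \<delta> c x = ennreal ((central_diff S (inward_step \<delta> c x) f (x + real S / 2 * inward_step \<delta> c x))\<^sup>2)" for \<delta> c x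
  have [measurable]: "(\<lambda>p. D (d p) (c p) (x p)) \<in> borel_measurable N"
    if [measurable]: "d \<in> borel_measurable N" "c \<in> borel_measurable N" "x \<in> borel_measurable N" for d c x and N :: "'z measure"
    unfolding D_def by measurable
  define A where "A = {x. \<bar>x\<bar> < 1 \<and> t \<le> circle_weight x}"
  define B where "B = {x. \<bar>x\<bar> < 1 \<and> circle_weight x < t}"
  have [measurable]: "A \<in> sets borel" "B \<in> sets borel" unfolding A_def B_def by measurable
  have dom: "D \<delta> c x \<le> ennreal (2 * real S * max t (circle_weight x)) *
      (weighted_diff S t f (x + real S / 2 * inward_step \<delta> c x) (inward_step \<delta> c x)
        * indicator {-1<..<1} (x + real S / 2 * inward_step \<delta> c x))"
    if x: "\<bar>x\<bar> < 1" and c: "\<bar>c\<bar> \<le> t" and \<delta>: "\<delta> \<in> {\<delta>0..2 * \<delta>0}" for x c \<delta>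
  proof -
    have x': "\<bar>x\<bar> \<le> 1" using x by simp
    have dd: "real S * t\<^sup>2 \<le> \<delta>" "\<delta> \<le> 2 * (real S * t\<^sup>2)" using \<delta> by (auto simp: \<delta>0_def)
    note ctx = S t dd c x'
    define \<sigma> where "\<sigma> = inward_step \<delta> c x"
    define y where "y = x + real S / 2 * \<sigma>"
    have y1: "\<bar>y\<bar> \<le> 1" unfolding y_def \<sigma>_def by (rule inward_node_abs[OF ctx]) auto
    have w: "0 < circle_weight y"
      using centre_weight_ge_t[OF ctx] t unfolding y_def \<sigma>_def by linarith
    have "\<bar>y\<bar> \<noteq> 1" using w by (auto simp: circle_weight_eq abs_if split: if_splits)
    then have yin: "y \<in> {-1<..<1}" using y1 by auto
    have region: "\<bar>\<sigma>\<bar> \<le> 6 * real S * t * circle_weight y" "\<bar>y - real S / 2 * \<sigma>\<bar> \<le> 1" "\<bar>y + real S / 2 * \<sigma>\<bar> \<le> 1"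
    proof -
      show "\<bar>\<sigma>\<bar> \<le> 6 * real S * t * circle_weight y" unfolding y_def \<sigma>_def by (rule inward_step_le_centre[OF ctx])
      show "\<bar>y - real S / 2 * \<sigma>\<bar> \<le> 1" using x' by (simp add: y_def)
      have "y + real S / 2 * \<sigma> = x + real S * \<sigma>" by (simp add: y_def field_simps)
      then show "\<bar>y + real S / 2 * \<sigma>\<bar> \<le> 1" unfolding \<sigma>_def using inward_node_abs[OF ctx, of "real S"] by simp
    qed
    have "(central_diff S \<sigma> f y)\<^sup>2 = circle_weight y * ((central_diff S \<sigma> f y)\<^sup>2 / circle_weight y)" using w by simp
    also have "\<dots> \<le> 2 * real S * max t (circle_weight x) * ((central_diff S \<sigma> f y)\<^sup>2 / circle_weight y)"
      using centre_weight_le[OF ctx] w unfolding y_def \<sigma>_def by (intro mult_right_mono) auto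
    finally have "D \<delta> c x \<le> ennreal (2 * real S * max t (circle_weight x) * ((central_diff S \<sigma> f y)\<^sup>2 / circle_weight y))"
      unfolding D_def \<sigma>_def[symmetric] y_def[symmetric] by (rule ennreal_leI)
    also have "\<dots> = ennreal (2 * real S * max t (circle_weight x)) * ennreal ((central_diff S \<sigma> f y)\<^sup>2 / circle_weight y)"
      using w t by (intro ennreal_mult) (auto simp: max_def)
    also have "ennreal ((central_diff S \<sigma> f y)\<^sup>2 / circle_weight y) = weighted_diff S t f y \<sigma> * indicator {-1<..<1} y"
      using region yin by (simp add: weighted_diff_def)
    finally show ?thesis by (simp add: y_def \<sigma>_def)
  qed
  \<comment> \<open>The factor \<open>max t (circle_weight x)\<close> from \<open>dom\<close> is
    here the weight itself, and the Jacobian of \<open>c\<close> cancels it.\<close>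
  have partA: "(\<integral>\<^sup>+ c. D \<delta> c x * indicator A x * indicator {-t..t} c * indicator {\<delta>0..2 * \<delta>0} \<delta> \<partial>lborel)
      \<le> indicator {\<delta>0..2 * \<delta>0} \<delta> * (ennreal (2 * real S) * V x)" for x \<delta>
  proof (cases "x \<in> A \<and> \<delta> \<in> {\<delta>0..2 * \<delta>0}")
    case True
    define w where "w = circle_weight x"
    have w: "0 < w" "max t w = w" using True t by (auto simp: w_def A_def)
    define H where "H \<eta> = weighted_diff S t f (x + real S / 2 * \<eta>) \<eta> * indicator {-1<..<1} (x + real S / 2 * \<eta>)" for \<eta>
    have [measurable]: "H \<in> borel_measurable borel" unfolding H_def by measurable
    have "(\<integral>\<^sup>+ c. D \<delta> c x * indicator A x * indicator {-t..t} c * indicator {\<delta>0..2 * \<delta>0} \<delta> \<partial>lborel)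
        \<le> (\<integral>\<^sup>+ c. ennreal (2 * real S * w) * H (- \<delta> * x + w * c) \<partial>lborel)"
    proof (rule nn_integral_mono)
      fix c
      show "D \<delta> c x * indicator A x * indicator {-t..t} c * indicator {\<delta>0..2 * \<delta>0} \<delta>
          \<le> ennreal (2 * real S * w) * H (- \<delta> * x + w * c)"
        using dom[of x c \<delta>] True w(2)
        by (auto simp: indicator_def A_def H_def w_def[symmetric] inward_step_def mult.commute[of c] abs_le_iff)
    qed
    also have "\<dots> = ennreal (2 * real S * w) * (\<integral>\<^sup>+ c. H (- \<delta> * x + w * c) \<partial>lborel)"
      by (rule nn_integral_cmult) measurable
    also have "(\<integral>\<^sup>+ c. H (- \<delta> * x + w * c) \<partial>lborel) = ennreal (1 / \<bar>w\<bar>) * V x"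
      unfolding V_def H_def[symmetric] using w by (intro nn_integral_affine) auto
    also have "ennreal (2 * real S * w) * (ennreal (1 / \<bar>w\<bar>) * V x) = ennreal (2 * real S) * V x"
      unfolding mult.assoc[symmetric] using w by (subst ennreal_mult[symmetric]) auto
    finally show ?thesis using True by simp
  qed (auto simp: indicator_def)
  \<comment> \<open>Near the ends the Jacobian of \<delta> is at least 1/2: the weight is below
    \<open>t\<close>, and \<open>t\<close> is at most 1/4, which forces
    \<open>\<bar>x\<bar> \<ge> 1/2\<close>.\<close>
  have partB: "(\<integral>\<^sup>+ \<delta>. D \<delta> c x * indicator B x * indicator {-t..t} c * indicator {\<delta>0..2 * \<delta>0} \<delta> \<partial>lborel)
      \<le> indicator {-t..t} c * (ennreal (4 * real S * t) * V x)" for x c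
  proof (cases "x \<in> B \<and> c \<in> {-t..t}")
    case True
    define w where "w = circle_weight x"
    have w: "w < t" "max t w = t" using True t by (auto simp: w_def B_def)
    have x1: "\<bar>x\<bar> < 1" using True by (simp add: B_def)
    have t4: "t \<le> 1 / 4"
    proof -
      have "t * 4 * 1 \<le> t * 4 * real S" using S t by (intro mult_left_mono) auto
      then show ?thesis using t(2) by (simp add: mult_ac)
    qed
    have x2: "1 / 2 \<le> \<bar>x\<bar>"
    proof (rule power2_le_imp_le)
      have "w\<^sup>2 \<le> (1 / 4)\<^sup>2" using w t4 circle_weight_nonneg[of x] x1 by (intro power_mono) (auto simp: w_def)
      then have "1 - x\<^sup>2 \<le> 1 / 16" using circle_weight_sq[of x] x1 by (simp add: w_def power2_eq_square)
      then show "(1 / 2)\<^sup>2 \<le> \<bar>x\<bar>\<^sup>2" by (simp add: power2_eq_square)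
    qed simp
    define H where "H \<eta> = weighted_diff S t f (x + real S / 2 * \<eta>) \<eta> * indicator {-1<..<1} (x + real S / 2 * \<eta>)" for \<eta>
    have [measurable]: "H \<in> borel_measurable borel" unfolding H_def by measurable
    have "(\<integral>\<^sup>+ \<delta>. D \<delta> c x * indicator B x * indicator {-t..t} c * indicator {\<delta>0..2 * \<delta>0} \<delta> \<partial>lborel)
        \<le> (\<integral>\<^sup>+ \<delta>. ennreal (2 * real S * t) * H (c * w + (- x) * \<delta>) \<partial>lborel)"
    proof (rule nn_integral_mono)
      fix \<delta>
      show "D \<delta> c x * indicator B x * indicator {-t..t} c * indicator {\<delta>0..2 * \<delta>0} \<delta>
          \<le> ennreal (2 * real S * t) * H (c * w + (- x) * \<delta>)"
        using dom[of x c \<delta>] True w(2)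
        by (auto simp: indicator_def B_def H_def w_def[symmetric] inward_step_def mult.commute[of \<delta>] abs_le_iff add.commute)
    qed
    also have "\<dots> = ennreal (2 * real S * t) * (\<integral>\<^sup>+ \<delta>. H (c * w + (- x) * \<delta>) \<partial>lborel)"
      by (rule nn_integral_cmult) measurable
    also have "(\<integral>\<^sup>+ \<delta>. H (c * w + (- x) * \<delta>) \<partial>lborel) = ennreal (1 / \<bar>- x\<bar>) * V x"
      unfolding V_def H_def[symmetric] using x2 by (intro nn_integral_affine) auto
    also have "\<dots> \<le> ennreal 2 * V x"
    proof (intro mult_right_mono ennreal_leI)
      have "1 / \<bar>x\<bar> \<le> 1 / (1 / 2)" using x2 by (intro divide_left_mono) auto
      then show "1 / \<bar>- x\<bar> \<le> 2" by simp
    qed simp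
    also have "ennreal (2 * real S * t) * (ennreal 2 * V x) = ennreal (4 * real S * t) * V x"
      unfolding mult.assoc[symmetric] using t by (subst ennreal_mult[symmetric]) (auto simp: mult_ac)
    finally show ?thesis using True by (simp add: mult_left_mono)
  qed (auto simp: indicator_def)
  have "(\<integral>\<^sup>+ \<delta>. \<integral>\<^sup>+ c. \<integral>\<^sup>+ x. D \<delta> c x * indicator {-1<..<1} x * indicator {-t..t} c * indicator {\<delta>0..2 * \<delta>0} \<delta> \<partial>lborel \<partial>lborel \<partial>lborel)
      = (\<integral>\<^sup>+ \<delta>. \<integral>\<^sup>+ c. \<integral>\<^sup>+ x. D \<delta> c x * indicator A x * indicator {-t..t} c * indicator {\<delta>0..2 * \<delta>0} \<delta>
          + D \<delta> c x * indicator B x * indicator {-t..t} c * indicator {\<delta>0..2 * \<delta>0} \<delta> \<partial>lborel \<partial>lborel \<partial>lborel)"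
    by (intro nn_integral_cong) (auto simp: indicator_def A_def B_def)
  also have "\<dots> = (\<integral>\<^sup>+ \<delta>. \<integral>\<^sup>+ c. (\<integral>\<^sup>+ x. D \<delta> c x * indicator A x * indicator {-t..t} c * indicator {\<delta>0..2 * \<delta>0} \<delta> \<partial>lborel)
        + (\<integral>\<^sup>+ x. D \<delta> c x * indicator B x * indicator {-t..t} c * indicator {\<delta>0..2 * \<delta>0} \<delta> \<partial>lborel) \<partial>lborel \<partial>lborel)"
    by (intro nn_integral_cong nn_integral_add) measurable
  also have "\<dots> = (\<integral>\<^sup>+ \<delta>. (\<integral>\<^sup>+ c. \<integral>\<^sup>+ x. D \<delta> c x * indicator A x * indicator {-t..t} c * indicator {\<delta>0..2 * \<delta>0} \<delta> \<partial>lborel \<partial>lborel)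
        + (\<integral>\<^sup>+ c. \<integral>\<^sup>+ x. D \<delta> c x * indicator B x * indicator {-t..t} c * indicator {\<delta>0..2 * \<delta>0} \<delta> \<partial>lborel \<partial>lborel) \<partial>lborel)"
    by (intro nn_integral_cong nn_integral_add) measurable
  also have "\<dots> = (\<integral>\<^sup>+ \<delta>. \<integral>\<^sup>+ c. \<integral>\<^sup>+ x. D \<delta> c x * indicator A x * indicator {-t..t} c * indicator {\<delta>0..2 * \<delta>0} \<delta> \<partial>lborel \<partial>lborel \<partial>lborel)
        + (\<integral>\<^sup>+ \<delta>. \<integral>\<^sup>+ c. \<integral>\<^sup>+ x. D \<delta> c x * indicator B x * indicator {-t..t} c * indicator {\<delta>0..2 * \<delta>0} \<delta> \<partial>lborel \<partial>lborel \<partial>lborel)"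
    by (intro nn_integral_add) measurable
  also have "(\<integral>\<^sup>+ \<delta>. \<integral>\<^sup>+ c. \<integral>\<^sup>+ x. D \<delta> c x * indicator A x * indicator {-t..t} c * indicator {\<delta>0..2 * \<delta>0} \<delta> \<partial>lborel \<partial>lborel \<partial>lborel)
      = (\<integral>\<^sup>+ \<delta>. \<integral>\<^sup>+ x. \<integral>\<^sup>+ c. D \<delta> c x * indicator A x * indicator {-t..t} c * indicator {\<delta>0..2 * \<delta>0} \<delta> \<partial>lborel \<partial>lborel \<partial>lborel)"
    by (intro nn_integral_cong nn_integral_swap) measurable
  also have "\<dots> \<le> (\<integral>\<^sup>+ \<delta>. \<integral>\<^sup>+ x. indicator {\<delta>0..2 * \<delta>0} \<delta> * (ennreal (2 * real S) * V x) \<partial>lborel \<partial>lborel)"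
    by (intro nn_integral_mono partA)
  also have "\<dots> = (\<integral>\<^sup>+ \<delta>. indicator {\<delta>0..2 * \<delta>0} \<delta> * (ennreal (2 * real S) * J) \<partial>lborel)"
    unfolding JV by (intro nn_integral_cong) (simp add: nn_integral_cmult)
  also have "\<dots> = ennreal (2 * \<delta>0 - \<delta>0) * (ennreal (2 * real S) * J)"
    using d0 by (intro nn_integral_indicator_const) simp
  also have "(\<integral>\<^sup>+ \<delta>. \<integral>\<^sup>+ c. \<integral>\<^sup>+ x. D \<delta> c x * indicator B x * indicator {-t..t} c * indicator {\<delta>0..2 * \<delta>0} \<delta> \<partial>lborel \<partial>lborel \<partial>lborel)
      = (\<integral>\<^sup>+ c. \<integral>\<^sup>+ \<delta>. \<integral>\<^sup>+ x. D \<delta> c x * indicator B x * indicator {-t..t} c * indicator {\<delta>0..2 * \<delta>0} \<delta> \<partial>lborel \<partial>lborel \<partial>lborel)"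
    by (rule nn_integral_swap) measurable
  also have "\<dots> = (\<integral>\<^sup>+ c. \<integral>\<^sup>+ x. \<integral>\<^sup>+ \<delta>. D \<delta> c x * indicator B x * indicator {-t..t} c * indicator {\<delta>0..2 * \<delta>0} \<delta> \<partial>lborel \<partial>lborel \<partial>lborel)"
    by (intro nn_integral_cong nn_integral_swap) measurable
  also have "\<dots> \<le> (\<integral>\<^sup>+ c. \<integral>\<^sup>+ x. indicator {-t..t} c * (ennreal (4 * real S * t) * V x) \<partial>lborel \<partial>lborel)"
    by (intro nn_integral_mono partB)
  also have "\<dots> = (\<integral>\<^sup>+ c. indicator {-t..t} c * (ennreal (4 * real S * t) * J) \<partial>lborel)"
    unfolding JV by (intro nn_integral_cong) (simp add: nn_integral_cmult)
  also have "\<dots> = ennreal (t - - t) * (ennreal (4 * real S * t) * J)"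
    using t by (intro nn_integral_indicator_const) simp
  also have "ennreal (2 * \<delta>0 - \<delta>0) * (ennreal (2 * real S) * J) + ennreal (t - - t) * (ennreal (4 * real S * t) * J)
      = ennreal (2 * real S * \<delta>0 + 8 * real S * t\<^sup>2) * J"
  proof -
    have "ennreal (2 * \<delta>0 - \<delta>0) * (ennreal (2 * real S) * J) = ennreal (2 * real S * \<delta>0) * J"
      unfolding mult.assoc[symmetric] using d0 by (subst ennreal_mult[symmetric]) (auto simp: mult_ac)
    moreover have "ennreal (t - - t) * (ennreal (4 * real S * t) * J) = ennreal (8 * real S * t\<^sup>2) * J"
      unfolding mult.assoc[symmetric] using t by (subst ennreal_mult[symmetric]) (auto simp: mult_ac power2_eq_square)
    moreover have "ennreal (2 * real S * \<delta>0 + 8 * real S * t\<^sup>2) = ennreal (2 * real S * \<delta>0) + ennreal (8 * real S * t\<^sup>2)"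
      using d0 by (intro ennreal_plus) auto
    ultimately show ?thesis by (simp add: distrib_right)
  qed
  also have "\<dots> \<le> ennreal (10 * (real S)\<^sup>2 * t\<^sup>2) * ennreal (12 * real S * t * M)"
  proof (intro mult_mono ennreal_leI)
    have "real S * 1 \<le> real S * real S" using S by (intro mult_left_mono) auto
    then have "real S * t\<^sup>2 \<le> (real S)\<^sup>2 * t\<^sup>2" by (intro mult_right_mono) (auto simp: power2_eq_square)
    moreover have "2 * real S * \<delta>0 = 2 * ((real S)\<^sup>2 * t\<^sup>2)" by (simp add: \<delta>0_def power2_eq_square)
    ultimately show "2 * real S * \<delta>0 + 8 * real S * t\<^sup>2 \<le> 10 * (real S)\<^sup>2 * t\<^sup>2" by linarith
    show "J \<le> ennreal (12 * real S * t * M)" unfolding J_def by (rule weighted_diff_integral)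
  qed auto
  also have "\<dots> = ennreal (120 * (real S)^3 * t^3 * M)"
    using M t by (subst ennreal_mult[symmetric]) (auto simp: power2_eq_square power3_eq_cube mult_ac)
  finally show ?thesis unfolding D_def by (simp add: add_mono)
qed

end

section \<open>Averaging operators on polynomials\<close>

text \<open>Nonnegativity of the variance: the square of \<open>F\<close> minus its mean
  \<open>I / V\<close> is integrated.\<close>

lemma integral_square_le:
  fixes F :: "'a::euclidean_space \<Rightarrow> real"
  assumes F: "continuous_on (cbox u v) F" and V: "0 < measure lborel (cbox u v)"
  shows "(integral (cbox u v) F)\<^sup>2 \<le> measure lborel (cbox u v) * integral (cbox u v) (\<lambda>x. (F x)\<^sup>2)"
proof -
  define V where "V = measure lborel (cbox u v)"
  define I where "I = integral (cbox u v) F"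
  define Q where "Q = integral (cbox u v) (\<lambda>x. (F x)\<^sup>2)"
  have V0: "0 < V" using V by (simp add: V_def)
  have hI: "(F has_integral I) (cbox u v)"
    unfolding I_def by (intro integrable_integral integrable_continuous F)
  have hQ: "((\<lambda>x. (F x)\<^sup>2) has_integral Q) (cbox u v)"
    unfolding Q_def by (intro integrable_integral integrable_continuous continuous_intros F)
  have "((\<lambda>x. (F x)\<^sup>2 - 2 * (I / V) * F x + (I / V)\<^sup>2) has_integral (Q - 2 * (I / V) * I + V *\<^sub>R (I / V)\<^sup>2)) (cbox u v)"
    unfolding V_def by (intro has_integral_add has_integral_diff has_integral_mult_right hI hQ has_integral_const)
  then have "0 \<le> Q - 2 * (I / V) * I + V *\<^sub>R (I / V)\<^sup>2"
  proof (rule has_integral_nonneg)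
    fix x
    have "(F x)\<^sup>2 - 2 * (I / V) * F x + (I / V)\<^sup>2 = (F x - I / V)\<^sup>2" by (simp add: power2_diff)
    then show "0 \<le> (F x)\<^sup>2 - 2 * (I / V) * F x + (I / V)\<^sup>2" by simp
  qed
  then have "0 \<le> V * (Q - 2 * (I / V) * I + V *\<^sub>R (I / V)\<^sup>2)" using V0 by simp
  also have "\<dots> = V * Q - I\<^sup>2" using V0 by (simp add: power2_eq_square algebra_simps)
  finally show ?thesis by (simp add: V_def Q_def I_def)
qed

lemma nn_integral_cbox_prod:
  fixes F :: "real \<times> real \<Rightarrow> real"
  assumes F: "continuous_on UNIV F" and nn: "\<And>p. 0 \<le> F p"
  shows "ennreal (integral (cbox (d, c) (d', c')) F)
    = (\<integral>\<^sup>+ x. \<integral>\<^sup>+ y. ennreal (F (x, y)) * indicator {c..c'} y * indicator {d..d'} x \<partial>lborel \<partial>lborel)"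
proof -
  have Fm [measurable]: "F \<in> borel_measurable borel" by (rule borel_measurable_continuous_onI[OF F])
  have "ennreal (integral (cbox (d, c) (d', c')) F) = (\<integral>\<^sup>+ p. ennreal (F p) * indicator (cbox (d, c) (d', c')) p \<partial>lborel)"
    by (rule nn_integral_has_integral_lebesgue'[symmetric])
      (auto intro!: nn integrable_integral integrable_continuous continuous_on_subset[OF F])
  also have "\<dots> = (\<integral>\<^sup>+ p. ennreal (F p) * indicator (cbox (d, c) (d', c')) p \<partial>(lborel \<Otimes>\<^sub>M lborel))"
    by (simp only: lborel_prod)
  also have "\<dots> = (\<integral>\<^sup>+ x. \<integral>\<^sup>+ y. ennreal (F (x, y)) * indicator (cbox (d, c) (d', c')) (x, y) \<partial>lborel \<partial>lborel)"
  proof (rule lborel.nn_integral_fst[symmetric])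
    have "(\<lambda>p. ennreal (F p) * indicator (cbox (d, c) (d', c')) p) \<in> borel_measurable (borel :: (real \<times> real) measure)"
      by measurable
    then show "(\<lambda>p. ennreal (F p) * indicator (cbox (d, c) (d', c')) p) \<in> borel_measurable (lborel \<Otimes>\<^sub>M lborel)"
      by (simp add: lborel_prod)
  qed
  also have "\<dots> = (\<integral>\<^sup>+ x. \<integral>\<^sup>+ y. ennreal (F (x, y)) * indicator {c..c'} y * indicator {d..d'} x \<partial>lborel \<partial>lborel)"
    by (intro nn_integral_cong) (auto simp: indicator_def)
  finally show ?thesis .
qed

definition node :: "nat \<Rightarrow> real \<Rightarrow> real \<Rightarrow> real \<Rightarrow> real" where
  "node i \<delta> c x = (1 - real i * \<delta>) * x + real i * c * circle_weight x"

lemma node_eq: "node i \<delta> c x = x + real i * inward_step \<delta> c x"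
  by (simp add: node_def inward_step_def algebra_simps)

text \<open>The Epanechnikov kernel of width \<open>t\<close>, a probability density in
  \<open>c\<close>. It is even, so averages of polynomials remain polynomials, and it vanishes at
  both ends, so integration by parts in \<open>c\<close> leaves no boundary terms.\<close>

definition quadratic_kernel :: "real \<Rightarrow> real \<Rightarrow> real" where
  "quadratic_kernel t c = 3 / (4 * t) * (1 - (c / t)\<^sup>2)"

definition node_average :: "real \<Rightarrow> real \<Rightarrow> nat \<Rightarrow> (real \<Rightarrow> real) \<Rightarrow> real \<Rightarrow> real" where
  "node_average \<delta>0 t i g x =
     integral (cbox (\<delta>0, - t) (2 * \<delta>0, t)) (\<lambda>(\<delta>, c). quadratic_kernel t c * g (node i \<delta> c x)) / \<delta>0"

lemma quadratic_kernel_continuous [continuous_intros]: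
  "continuous_on A f \<Longrightarrow> continuous_on A (\<lambda>x. quadratic_kernel t (f x))" for f :: "'a::topological_space \<Rightarrow> real"
  unfolding quadratic_kernel_def divide_inverse by (intro continuous_intros)

lemma node_continuous [continuous_intros]:
  "continuous_on A f \<Longrightarrow> continuous_on A g \<Longrightarrow> continuous_on A (\<lambda>p. node i (f p) (g p) x)"
  for f :: "'a::topological_space \<Rightarrow> real"
  unfolding node_def by (intro continuous_intros)

lemma node_measurable [measurable]:
  assumes [measurable]: "d \<in> borel_measurable M" "c \<in> borel_measurable M" "x \<in> borel_measurable M"
  shows "(\<lambda>p. node i (d p) (c p) (x p)) \<in> borel_measurable M"
  unfolding node_def by measurable

lemma odd_integral_zero:
  fixes u :: "real \<Rightarrow> real"
  assumes "\<And>c. u (- c) = - u c"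
  shows "integral {-t..t} u = 0"
proof -
  have "integral {-t..t} u = integral {-t..t} (\<lambda>c. u (- c))"
    using Henstock_Kurzweil_Integration.integral_reflect_real[of t "-t" u] by simp
  also have "\<dots> = - integral {-t..t} u" by (simp add: assms)
  finally show ?thesis by simp
qed

section \<open>Averages over one node: energy, degree and derivative\<close>

context
  fixes S :: nat and t \<delta>0 :: real
  assumes S: "0 < S" and t: "0 < t" "t * (4 * real S) \<le> 1" and \<delta>0: "\<delta>0 = real S * t\<^sup>2"
begin

lemma delta_pos: "0 < \<delta>0" using S t by (simp add: \<delta>0)

lemma delta_ge: "t\<^sup>2 \<le> \<delta>0"
proof -
  have "1 * t\<^sup>2 \<le> real S * t\<^sup>2" using S by (intro mult_right_mono) auto
  then show ?thesis by (simp add: \<delta>0)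
qed

lemma node_coeff:
  assumes "i \<le> S" "\<delta> \<in> {\<delta>0..2 * \<delta>0}"
  shows "1 / 2 \<le> 1 - real i * \<delta>" "1 - real i * \<delta> \<le> 1"
proof -
  have d: "real S * t\<^sup>2 \<le> \<delta>" "\<delta> \<le> 2 * (real S * t\<^sup>2)" using assms(2) by (auto simp: \<delta>0)
  have "real S * \<delta> \<le> 1 / 8" by (rule inward_S_delta[OF S t d, of 0 0]) (use t in auto)
  moreover have "real i * \<delta> \<le> real S * \<delta>" using assms delta_pos by (intro mult_right_mono) auto
  ultimately show "1 / 2 \<le> 1 - real i * \<delta>" by linarith
  show "1 - real i * \<delta> \<le> 1" using assms(2) delta_pos by simp
qed

lemma node_in:
  assumes "i \<le> S" "\<delta> \<in> {\<delta>0..2 * \<delta>0}" "c \<in> {-t..t}" "\<bar>x\<bar> \<le> 1"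
  shows "\<bar>node i \<delta> c x\<bar> \<le> 1"
  unfolding node_eq using assms by (intro inward_node_abs[OF S t]) (auto simp: \<delta>0 abs_le_iff)

lemma node_energy_c:
  fixes G :: "real \<Rightarrow> ennreal"
  assumes [measurable]: "G \<in> borel_measurable borel" and i: "0 < i" "i \<le> S" and d: "\<delta> \<in> {\<delta>0..2 * \<delta>0}"
  shows "(\<integral>\<^sup>+ c. \<integral>\<^sup>+ x. G (node i \<delta> c x) * indicator {-1<..<1} x * indicator {-t..t} c \<partial>lborel \<partial>lborel)
    \<le> ennreal (8 * t) * (\<integral>\<^sup>+ z. G z \<partial>lborel)"
proof -
  have "(\<integral>\<^sup>+ c. \<integral>\<^sup>+ x. G (node i \<delta> c x) * indicator {-1<..<1} x * indicator {-t..t} c \<partial>lborel \<partial>lborel)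
      = (\<integral>\<^sup>+ c. (\<integral>\<^sup>+ x. G ((1 - real i * \<delta>) * x + real i * c * circle_weight x) * indicator {-1<..<1} x \<partial>lborel) * indicator {-t..t} c \<partial>lborel)"
    unfolding node_def by (intro nn_integral_cong nn_integral_multc) measurable
  also have "\<dots> \<le> ennreal (8 * t) * (\<integral>\<^sup>+ z. G z \<partial>lborel)"
    using i node_coeff[OF i(2) d] t by (intro composition_bound) auto
  finally show ?thesis .
qed

lemma node_energy:
  fixes G :: "real \<Rightarrow> ennreal"
  assumes G [measurable]: "G \<in> borel_measurable borel" and i: "i \<le> S"
  shows "(\<integral>\<^sup>+ \<delta>. \<integral>\<^sup>+ c. \<integral>\<^sup>+ x. G (node i \<delta> c x) * indicator {-1<..<1} x * indicator {-t..t} c * indicator {\<delta>0..2 * \<delta>0} \<delta> \<partial>lborel \<partial>lborel \<partial>lborel)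
    \<le> ennreal (8 * t * \<delta>0) * (\<integral>\<^sup>+ z. G z \<partial>lborel)"
proof -
  have inner: "(\<integral>\<^sup>+ c. \<integral>\<^sup>+ x. G (node i \<delta> c x) * indicator {-1<..<1} x * indicator {-t..t} c * indicator {\<delta>0..2 * \<delta>0} \<delta> \<partial>lborel \<partial>lborel)
      \<le> indicator {\<delta>0..2 * \<delta>0} \<delta> * (ennreal (8 * t) * (\<integral>\<^sup>+ z. G z \<partial>lborel))" for \<delta>
  proof (cases "\<delta> \<in> {\<delta>0..2 * \<delta>0}")
    case d: True
    have "(\<integral>\<^sup>+ c. \<integral>\<^sup>+ x. G (node i \<delta> c x) * indicator {-1<..<1} x * indicator {-t..t} c \<partial>lborel \<partial>lborel)
      \<le> ennreal (8 * t) * (\<integral>\<^sup>+ z. G z \<partial>lborel)"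
    proof (cases "i = 0")
      case True
      have "(\<integral>\<^sup>+ c. \<integral>\<^sup>+ x. G (node i \<delta> c x) * indicator {-1<..<1} x * indicator {-t..t} c \<partial>lborel \<partial>lborel)
          \<le> (\<integral>\<^sup>+ c. \<integral>\<^sup>+ x. G x * indicator {-t..t} c \<partial>lborel \<partial>lborel)"
        by (intro nn_integral_mono) (auto simp: True node_def indicator_def)
      also have "\<dots> = (\<integral>\<^sup>+ c. indicator {-t..t} c * (\<integral>\<^sup>+ x. G x \<partial>lborel) \<partial>lborel)"
        by (intro nn_integral_cong) (simp add: nn_integral_multc mult.commute)
      also have "\<dots> = ennreal (t - - t) * (\<integral>\<^sup>+ x. G x \<partial>lborel)"
        using t by (intro nn_integral_indicator_const) simp
      also have "\<dots> \<le> ennreal (8 * t) * (\<integral>\<^sup>+ x. G x \<partial>lborel)"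
        using t by (intro mult_right_mono ennreal_leI) auto
      finally show ?thesis .
    qed (use node_energy_c[OF G _ i d] in simp)
    then show ?thesis using d by simp
  qed simp
  have "(\<integral>\<^sup>+ \<delta>. \<integral>\<^sup>+ c. \<integral>\<^sup>+ x. G (node i \<delta> c x) * indicator {-1<..<1} x * indicator {-t..t} c * indicator {\<delta>0..2 * \<delta>0} \<delta> \<partial>lborel \<partial>lborel \<partial>lborel)
      \<le> (\<integral>\<^sup>+ \<delta>. indicator {\<delta>0..2 * \<delta>0} \<delta> * (ennreal (8 * t) * (\<integral>\<^sup>+ z. G z \<partial>lborel)) \<partial>lborel)"
    by (intro nn_integral_mono inner)
  also have "\<dots> = ennreal (2 * \<delta>0 - \<delta>0) * (ennreal (8 * t) * (\<integral>\<^sup>+ z. G z \<partial>lborel))"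
    using delta_pos by (intro nn_integral_indicator_const) simp
  also have "\<dots> = ennreal (8 * t * \<delta>0) * (\<integral>\<^sup>+ z. G z \<partial>lborel)"
    unfolding mult.assoc[symmetric] using delta_pos t by (subst ennreal_mult[symmetric]) (auto simp: mult_ac)
  finally show ?thesis .
qed

text \<open>Odd moments of the kernel vanish, and even powers of \<open>\<phi>\<close> are polynomials.\<close>

lemma node_average_monom:
  "\<exists>r. deg_less (Suc k) r \<and> (\<forall>x\<in>{-1..1}. node_average \<delta>0 t i (\<lambda>z. z ^ k) x = poly r x)"
proof -
  define Q where "Q = cbox (\<delta>0, - t) (2 * \<delta>0, t)"
  define I where "I j = integral Q (\<lambda>p. quadratic_kernel t (snd p) * ((1 - real i * fst p) ^ j * (real i * snd p) ^ (k - j)))" for j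
  have odd: "I j = 0" if "odd (k - j)" for j
  proof -
    have "I j = integral (cbox \<delta>0 (2 * \<delta>0)) (\<lambda>\<delta>. integral (cbox (- t) t)
        (\<lambda>c. quadratic_kernel t c * ((1 - real i * \<delta>) ^ j * (real i * c) ^ (k - j))))"
      unfolding I_def Q_def
      by (subst integral_prod_continuous) (auto intro!: continuous_intros)
    also have "\<dots> = integral (cbox \<delta>0 (2 * \<delta>0)) (\<lambda>\<delta>. 0)"
      unfolding cbox_interval using that
      by (intro Henstock_Kurzweil_Integration.integral_cong odd_integral_zero)
         (simp add: quadratic_kernel_def power_mult_distrib)
    finally show ?thesis by simp
  qed
  define r where "r = (\<Sum>j\<le>k. if odd (k - j) then 0 else
      smult (real (k choose j) * I j / \<delta>0) (monom 1 j * [:1, 0, -1:] ^ ((k - j) div 2)))"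
  have "deg_less (Suc k) r"
    unfolding r_def
  proof (intro deg_less_sum)
    fix j assume j: "j \<in> {..k}"
    show "deg_less (Suc k) (if odd (k - j) then 0 else
      smult (real (k choose j) * I j / \<delta>0) (monom 1 j * [:1, 0, -1:] ^ ((k - j) div 2)))"
    proof (cases "odd (k - j)")
      case False
      have "degree ([:1, 0, -1::real:] ^ ((k - j) div 2)) \<le> 2 * ((k - j) div 2)"
        using degree_power_le[of "[:1, 0, -1::real:]" "(k - j) div 2"] by simp
      then have "degree (monom 1 j * [:1, 0, -1::real:] ^ ((k - j) div 2)) \<le> j + 2 * ((k - j) div 2)"
        using degree_mult_le[of "monom (1::real) j" "[:1, 0, -1::real:] ^ ((k - j) div 2)"] degree_monom_le[of "1::real" j]
        by linarith
      also have "\<dots> \<le> k" using j by simp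
      finally have "deg_less (Suc k) (monom 1 j * [:1, 0, -1::real:] ^ ((k - j) div 2))" by (simp add: deg_less_def)
      then show ?thesis using False by (simp add: deg_less_smult)
    qed simp
  qed
  moreover have "node_average \<delta>0 t i (\<lambda>z. z ^ k) x = poly r x" if x: "x \<in> {-1..1}" for x
  proof -
    define w where "w = circle_weight x"
    have w2: "w\<^sup>2 = 1 - x\<^sup>2" unfolding w_def using x by (intro circle_weight_sq) auto
    have "integral Q (\<lambda>(\<delta>, c). quadratic_kernel t c * node i \<delta> c x ^ k)
        = integral Q (\<lambda>p. \<Sum>j\<le>k. (real (k choose j) * x ^ j * w ^ (k - j)) *
            (quadratic_kernel t (snd p) * ((1 - real i * fst p) ^ j * (real i * snd p) ^ (k - j))))"
      by (intro Henstock_Kurzweil_Integration.integral_cong)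
         (auto simp: node_def w_def[symmetric] binomial_ring power_mult_distrib sum_distrib_left mult_ac intro!: sum.cong)
    also have "\<dots> = (\<Sum>j\<le>k. integral Q (\<lambda>p. (real (k choose j) * x ^ j * w ^ (k - j)) *
            (quadratic_kernel t (snd p) * ((1 - real i * fst p) ^ j * (real i * snd p) ^ (k - j)))))"
      unfolding Q_def by (intro Henstock_Kurzweil_Integration.integral_sum integrable_continuous continuous_intros) auto
    also have "\<dots> = (\<Sum>j\<le>k. (real (k choose j) * x ^ j * w ^ (k - j)) * I j)"
      unfolding I_def by (intro sum.cong refl Henstock_Kurzweil_Integration.integral_mult_right)
    finally have "node_average \<delta>0 t i (\<lambda>z. z ^ k) x = (\<Sum>j\<le>k. (real (k choose j) * x ^ j * w ^ (k - j)) * I j / \<delta>0)"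
      unfolding node_average_def Q_def[symmetric] by (simp add: sum_divide_distrib)
    also have "\<dots> = poly r x"
      unfolding r_def poly_sum
    proof (intro sum.cong refl)
      fix j
      show "(real (k choose j) * x ^ j * w ^ (k - j)) * I j / \<delta>0 = poly (if odd (k - j) then 0 else
      smult (real (k choose j) * I j / \<delta>0) (monom 1 j * [:1, 0, -1:] ^ ((k - j) div 2))) x"
      proof (cases "odd (k - j)")
        case False
        then have "w ^ (k - j) = (w\<^sup>2) ^ ((k - j) div 2)" by (simp add: power_mult[symmetric])
        also have "\<dots> = poly ([:1, 0, -1:] ^ ((k - j) div 2)) x" unfolding w2 by (simp add: power2_eq_square)
        finally show ?thesis using False by (simp add: poly_monom mult_ac)
      qed (simp add: odd)
    qed
    finally show ?thesis .
  qed
  ultimately show ?thesis by blast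
qed

lemma kernel_node_integrable:
  "(\<lambda>(\<delta>, c). quadratic_kernel t c * poly g (node i \<delta> c x)) integrable_on cbox (\<delta>0, - t) (2 * \<delta>0, t)"
  unfolding case_prod_unfold by (intro integrable_continuous continuous_intros)

lemma node_average_poly:
  assumes "deg_less m g"
  shows "\<exists>r. deg_less m r \<and> (\<forall>x\<in>{-1..1}. node_average \<delta>0 t i (poly g) x = poly r x)"
proof -
  have "\<forall>k. \<exists>r. deg_less (Suc k) r \<and> (\<forall>x\<in>{-1..1}. node_average \<delta>0 t i (\<lambda>z. z ^ k) x = poly r x)"
    by (rule allI, rule node_average_monom)
  from choice[OF this] obtain R
    where R': "\<forall>k. deg_less (Suc k) (R k) \<and> (\<forall>x\<in>{-1..1}. node_average \<delta>0 t i (\<lambda>z. z ^ k) x = poly (R k) x)"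
    by (rule exE)
  have R: "deg_less (Suc k) (R k)"
    "x \<in> {-1..1} \<Longrightarrow> node_average \<delta>0 t i (\<lambda>z. z ^ k) x = poly (R k) x" for k x
    using R'[THEN spec, of k] by auto
  have "g = (\<Sum>k<m. monom (coeff g k) k)"
  proof (rule poly_eqI)
    fix i show "coeff g i = coeff (\<Sum>k<m. monom (coeff g k) k) i"
      using assms by (cases "i < m") (auto simp: coeff_sum deg_less_iff)
  qed
  then have geq: "poly g z = (\<Sum>k<m. coeff g k * z ^ k)" for z
    by (metis (no_types, lifting) poly_monom poly_sum sum.cong)
  define r where "r = (\<Sum>k<m. smult (coeff g k) (R k))"
  have "deg_less m r"
    unfolding r_def by (intro deg_less_sum deg_less_smult deg_less_mono[OF R(1)]) auto
  moreover have "node_average \<delta>0 t i (poly g) x = poly r x" if x: "x \<in> {-1..1}" for x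
  proof -
    define Q where "Q = cbox (\<delta>0, - t) (2 * \<delta>0, t)"
    have "integral Q (\<lambda>(\<delta>, c). quadratic_kernel t c * poly g (node i \<delta> c x))
        = integral Q (\<lambda>p. \<Sum>k<m. coeff g k * (quadratic_kernel t (snd p) * node i (fst p) (snd p) x ^ k))"
      by (intro Henstock_Kurzweil_Integration.integral_cong)
         (auto simp: geq sum_distrib_left mult_ac)
    also have "\<dots> = (\<Sum>k<m. coeff g k * integral Q (\<lambda>p. quadratic_kernel t (snd p) * node i (fst p) (snd p) x ^ k))"
      unfolding Q_def
      by (subst Henstock_Kurzweil_Integration.integral_sum) (auto intro!: integrable_continuous continuous_intros)
    finally have "node_average \<delta>0 t i (poly g) x = (\<Sum>k<m. coeff g k * node_average \<delta>0 t i (\<lambda>z. z ^ k) x)"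
      by (simp add: node_average_def Q_def[symmetric] sum_divide_distrib case_prod_unfold)
    then show ?thesis using R(2)[OF x] by (simp add: r_def poly_sum)
  qed
  ultimately show ?thesis by blast
qed

text \<open>The vector field \<open>\<phi> \<partial>\<^sub>x\<close> acts on \<open>g (node i \<delta> c x)\<close> as
  \<open>((1 - i \<delta>) / i) \<partial>\<^sub>c + c \<partial>\<^sub>\<delta>\<close>, so it can be moved onto the averaging kernel.\<close>

lemma node_average_deriv:
  assumes x: "x \<in> {-1<..<1}" and i: "0 < i"
  obtains D where "(node_average \<delta>0 t i (poly g) has_real_derivative D) (at x)"
    "circle_weight x * D * \<delta>0 =
       integral (cbox (\<delta>0, - t) (2 * \<delta>0, t)) (\<lambda>(\<delta>, c). (1 - real i * \<delta>) / real i * (3 / (2 * t^3) * c) * poly g (node i \<delta> c x))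
       + integral {-t..t} (\<lambda>c. quadratic_kernel t c * c * (poly g (node i (2 * \<delta>0) c x) - poly g (node i \<delta>0 c x)))"
proof -
  define Q where "Q = cbox (\<delta>0, - t) (2 * \<delta>0, t)"
  define F where "F x p = quadratic_kernel t (snd p) * poly g (node i (fst p) (snd p) x)" for x p
  define Fx where "Fx x p = quadratic_kernel t (snd p) * (poly (pderiv g) (node i (fst p) (snd p) x) *
      ((1 - real i * fst p) + real i * snd p * (- x / circle_weight x)))" for x p
  have wpos: "0 < circle_weight x" if "x \<in> {-1<..<1}" for x using that by (simp add: step_weight_def)
  have dw: "(circle_weight has_real_derivative - x / circle_weight x) (at x)" if x: "x \<in> {-1<..<1}" for x
  proof -
    have "0 < 1 - x\<^sup>2" using x by (simp add: abs_square_less_1 abs_less_iff)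
    then have "((\<lambda>x. sqrt (1 - x\<^sup>2)) has_real_derivative - x / sqrt (1 - x\<^sup>2)) (at x)"
      by (auto intro!: derivative_eq_intros simp: field_simps)
    then show ?thesis by (simp add: circle_weight_eq[abs_def])
  qed
  have dnode: "((\<lambda>x. node i \<delta> c x) has_real_derivative ((1 - real i * \<delta>) + real i * c * (- x / circle_weight x))) (at x)"
    if "x \<in> {-1<..<1}" for x \<delta> c
    unfolding node_def by (auto intro!: derivative_eq_intros dw[OF that])
  have cw: "continuous_on ({-1<..<1} \<times> Q) (\<lambda>p. circle_weight (fst p))"
    unfolding circle_weight_eq by (intro continuous_intros)
  have "((\<lambda>x. integral Q (F x)) has_field_derivative integral Q (Fx x)) (at x within {-1<..<1})"
    unfolding Q_def
  proof (rule leibniz_rule_field_derivative)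
    fix x p assume "x \<in> {-1<..<1::real}"
    then show "((\<lambda>x. F x p) has_field_derivative Fx x p) (at x within {-1<..<1})"
      unfolding F_def Fx_def
      by (intro DERIV_cmult DERIV_chain2[OF poly_DERIV] has_field_derivative_at_within[OF dnode])
  next
    fix x :: real
    show "F x integrable_on cbox (\<delta>0, - t) (2 * \<delta>0, t)"
      unfolding F_def by (intro integrable_continuous continuous_intros)
  next
    show "continuous_on ({-1<..<1} \<times> cbox (\<delta>0, - t) (2 * \<delta>0, t)) (\<lambda>(x, p). Fx x p)"
      unfolding Fx_def case_prod_unfold node_def Q_def[symmetric]
      using wpos by (intro continuous_intros cw) (auto simp: less_le)
  qed (use x in auto)
  then have der: "((\<lambda>x. integral Q (F x)) has_real_derivative integral Q (Fx x)) (at x)"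
    using x by (subst (asm) at_within_open) auto
  define D where "D = integral Q (Fx x) / \<delta>0"
  have nd: "(node_average \<delta>0 t i (poly g) has_real_derivative D) (at x)"
    unfolding node_average_def[abs_def] D_def Q_def[symmetric]
    using DERIV_cdivide[OF der, of \<delta>0] by (simp add: F_def[abs_def] case_prod_unfold)
  define w where "w = circle_weight x"
  have w: "0 < w" unfolding w_def by (rule wpos[OF x])
  define P where "P \<delta> c = poly g (node i \<delta> c x)" for \<delta> c
  define P' where "P' \<delta> c = poly (pderiv g) (node i \<delta> c x)" for \<delta> c
  have contP [continuous_intros]: "continuous_on A (\<lambda>p. P (f p) (h p))" "continuous_on A (\<lambda>p. P' (f p) (h p))"
    if "continuous_on A f" "continuous_on A h" for A :: "'z::topological_space set" and f h
    unfolding P_def P'_def by (intro continuous_intros that)+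
  have dPc: "((\<lambda>c. P \<delta> c) has_real_derivative P' \<delta> c * (real i * w)) (at c within A)" for \<delta> c A
    unfolding P_def P'_def
    by (rule DERIV_chain2[OF poly_DERIV]) (auto simp: node_def w_def intro!: derivative_eq_intros)
  have dPd: "((\<lambda>\<delta>. P \<delta> c) has_real_derivative P' \<delta> c * (- real i * x)) (at \<delta> within A)" for \<delta> c A
    unfolding P_def P'_def
    by (rule DERIV_chain2[OF poly_DERIV]) (auto simp: node_def intro!: derivative_eq_intros)
  have dk: "(quadratic_kernel t has_real_derivative - (3 / (2 * t^3) * c)) (at c within A)" for c A
    unfolding quadratic_kernel_def[abs_def] using t
    by (auto intro!: derivative_eq_intros simp: power2_eq_square power3_eq_cube field_simps)
  have k0: "quadratic_kernel t t = 0" "quadratic_kernel t (- t) = 0"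
    using t by (simp_all add: quadratic_kernel_def)
  \<comment> \<open>Integration by parts in \<open>c\<close>; the kernel has derivative
    \<open>- 3 c / (2 t^3)\<close> and is zero at the ends.\<close>
  have inner1: "integral {-t..t} (\<lambda>c. quadratic_kernel t c * (P' \<delta> c * (real i * w)))
      = integral {-t..t} (\<lambda>c. 3 / (2 * t^3) * c * P \<delta> c)" for \<delta>
  proof -
    have "((\<lambda>c. quadratic_kernel t c * P \<delta> c) has_real_derivative
        - (3 / (2 * t^3) * c) * P \<delta> c + P' \<delta> c * (real i * w) * quadratic_kernel t c) (at c within {-t..t})" for c
      by (rule DERIV_mult[OF dk dPc])
    then have "((\<lambda>c. - (3 / (2 * t^3) * c) * P \<delta> c + P' \<delta> c * (real i * w) * quadratic_kernel t c)
        has_integral (quadratic_kernel t t * P \<delta> t - quadratic_kernel t (- t) * P \<delta> (- t))) {-t..t}"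
      using t unfolding has_real_derivative_iff_has_vector_derivative
      by (intro fundamental_theorem_of_calculus) auto
    then have "integral {-t..t} (\<lambda>c. - (3 / (2 * t^3) * c) * P \<delta> c + P' \<delta> c * (real i * w) * quadratic_kernel t c) = 0"
      by (intro integral_unique) (simp add: k0)
    moreover have "integral {-t..t} (\<lambda>c. - (3 / (2 * t^3) * c) * P \<delta> c + P' \<delta> c * (real i * w) * quadratic_kernel t c)
        = integral {-t..t} (\<lambda>c. - (3 / (2 * t^3) * c) * P \<delta> c) + integral {-t..t} (\<lambda>c. P' \<delta> c * (real i * w) * quadratic_kernel t c)"
      by (intro Henstock_Kurzweil_Integration.integral_add integrable_continuous_real continuous_intros)
    moreover have "integral {-t..t} (\<lambda>c. - (3 / (2 * t^3) * c) * P \<delta> c) = - integral {-t..t} (\<lambda>c. 3 / (2 * t^3) * c * P \<delta> c)"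
      by (subst Henstock_Kurzweil_Integration.integral_neg[symmetric]) (simp add: mult_ac)
    ultimately show ?thesis by (simp add: mult_ac)
  qed
  \<comment> \<open>In \<delta> the weight is constant on its interval, so the integral of the
    derivative is the difference of the values at the two ends.\<close>
  have inner2: "integral {\<delta>0..2 * \<delta>0} (\<lambda>\<delta>. P' \<delta> c * (- real i * x)) = P (2 * \<delta>0) c - P \<delta>0 c" for c
    using delta_pos dPd unfolding has_real_derivative_iff_has_vector_derivative
    by (intro integral_unique fundamental_theorem_of_calculus) auto
  have "circle_weight x * D * \<delta>0 = w * integral Q (Fx x)" using delta_pos by (simp add: D_def w_def)
  also have "\<dots> = integral Q (\<lambda>p. w * Fx x p)" by (rule Henstock_Kurzweil_Integration.integral_mult_right[symmetric])
  \<comment> \<open>The node has derivative \<open>i w\<close> in \<open>c\<close> and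
    \<open>- i x\<close> in \<delta>; \<open>(1 - i \<delta>) / i\<close> times the first plus
    \<open>c\<close> times the second is \<open>w\<close> times its derivative in
    \<open>x\<close>.\<close>
  also have "\<dots> = integral Q (\<lambda>p. (1 - real i * fst p) / real i * (quadratic_kernel t (snd p) * (P' (fst p) (snd p) * (real i * w)))
      + quadratic_kernel t (snd p) * snd p * (P' (fst p) (snd p) * (- real i * x)))"
    using w i by (intro Henstock_Kurzweil_Integration.integral_cong)
      (simp add: Fx_def w_def[symmetric] P'_def[symmetric] field_simps)
  also have "\<dots> = integral Q (\<lambda>p. (1 - real i * fst p) / real i * (quadratic_kernel t (snd p) * (P' (fst p) (snd p) * (real i * w))))
      + integral Q (\<lambda>p. quadratic_kernel t (snd p) * snd p * (P' (fst p) (snd p) * (- real i * x)))"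
    unfolding Q_def by (intro Henstock_Kurzweil_Integration.integral_add integrable_continuous continuous_intros) (use i in auto)
  also have "integral Q (\<lambda>p. (1 - real i * fst p) / real i * (quadratic_kernel t (snd p) * (P' (fst p) (snd p) * (real i * w))))
      = integral (cbox \<delta>0 (2 * \<delta>0)) (\<lambda>\<delta>. integral (cbox (- t) t)
          (\<lambda>c. (1 - real i * \<delta>) / real i * (quadratic_kernel t c * (P' \<delta> c * (real i * w)))))"
    unfolding Q_def by (subst integral_prod_continuous) (auto intro!: continuous_intros simp: i less_imp_neq[symmetric] t(1))
  also have "\<dots> = integral (cbox \<delta>0 (2 * \<delta>0)) (\<lambda>\<delta>. integral (cbox (- t) t)
          (\<lambda>c. (1 - real i * \<delta>) / real i * (3 / (2 * t^3) * c * P \<delta> c)))"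
    using inner1 by (simp only: cbox_interval Henstock_Kurzweil_Integration.integral_mult_right)
  also have "\<dots> = integral Q (\<lambda>(\<delta>, c). (1 - real i * \<delta>) / real i * (3 / (2 * t^3) * c * P \<delta> c))"
    unfolding Q_def by (subst integral_prod_continuous) (auto intro!: continuous_intros simp: case_prod_unfold i less_imp_neq[symmetric] t(1))
  also have "integral Q (\<lambda>p. quadratic_kernel t (snd p) * snd p * (P' (fst p) (snd p) * (- real i * x)))
      = integral (cbox \<delta>0 (2 * \<delta>0)) (\<lambda>\<delta>. integral (cbox (- t) t) (\<lambda>c. quadratic_kernel t c * c * (P' \<delta> c * (- real i * x))))"
    unfolding Q_def by (subst integral_prod_continuous) (auto intro!: continuous_intros)
  also have "\<dots> = integral (cbox (- t) t) (\<lambda>c. integral (cbox \<delta>0 (2 * \<delta>0)) (\<lambda>\<delta>. quadratic_kernel t c * c * (P' \<delta> c * (- real i * x))))"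
    by (rule integral_swap_continuous) (auto intro!: continuous_intros simp: case_prod_unfold)
  also have "\<dots> = integral {-t..t} (\<lambda>c. quadratic_kernel t c * c * (P (2 * \<delta>0) c - P \<delta>0 c))"
    by (simp only: cbox_interval Henstock_Kurzweil_Integration.integral_mult_right inner2)
  finally show ?thesis using that[OF nd] by (simp add: Q_def P_def mult.assoc)
qed

end

section \<open>The weighted gradient of a node average\<close>

lemma l2n_sq_lborel:
  assumes "f \<in> L2 u v"
  shows "ennreal ((l2n u v f)\<^sup>2) = (\<integral>\<^sup>+ x. ennreal ((f x)\<^sup>2) * indicator {u..v} x \<partial>lborel)"
  unfolding nn_integral_L2[OF assms, symmetric] by (rule nn_integral_restrict_space) simp

lemma nn_integral_open_interval:
  "(\<integral>\<^sup>+ x. F x * indicator {u..v} x \<partial>lborel) = (\<integral>\<^sup>+ x. F x * indicator {u<..<v} x \<partial>lborel)" for u v :: real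
proof (rule nn_integral_cong_AE)
  have "AE x in lborel. x \<noteq> u \<and> x \<noteq> v" using AE_lborel_singleton[of u] AE_lborel_singleton[of v] by auto
  then show "AE x in lborel. F x * indicator {u..v} x = F x * indicator {u<..<v} x"
    by eventually_elim (auto simp: indicator_def)
qed

context
  fixes S :: nat and t \<delta>0 :: real
  assumes S: "0 < S" and t: "0 < t" "t * (4 * real S) \<le> 1" and \<delta>0: "\<delta>0 = real S * t\<^sup>2"
begin

lemma quadratic_kernel_bounds:
  assumes "\<bar>c\<bar> \<le> t"
  shows "0 \<le> quadratic_kernel t c" "quadratic_kernel t c \<le> 3 / (4 * t)"
proof -
  have "(c / t)\<^sup>2 \<le> 1" using assms t by (simp add: abs_square_le_1 abs_divide)
  then show "0 \<le> quadratic_kernel t c" "quadratic_kernel t c \<le> 3 / (4 * t)"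
    using t by (auto simp: quadratic_kernel_def divide_right_mono intro!: mult_nonneg_nonneg)
qed

lemma measure_parameter_box: "measure lborel (cbox (\<delta>0, - t) (2 * \<delta>0, t)) = 2 * t * \<delta>0"
proof -
  have "measure lborel (cbox (\<delta>0, - t) (2 * \<delta>0, t))
      = measure lborel (cbox \<delta>0 (2 * \<delta>0)) * measure lborel (cbox (- t) t)" by (rule content_Pair)
  also have "\<dots> = 2 * t * \<delta>0" using t delta_pos[OF S t \<delta>0] by simp
  finally show ?thesis .
qed

text \<open>Cauchy-Schwarz for both terms of \<open>node_average_deriv\<close>. On the domain the
  first coefficient is at most \<open>3 / (2 t^2)\<close> and the second at most 3/4, which explains
  the constants 9 and 9/2.\<close>

lemma node_average_deriv_sq:
  assumes i: "0 < i" "i \<le> S" and x: "x \<in> {-1<..<1}"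
    and r: "\<And>x. x \<in> {-1..1} \<Longrightarrow> node_average \<delta>0 t i (poly g) x = poly r x"
  shows "(1 - x\<^sup>2) * (poly (pderiv r) x)\<^sup>2 \<le>
    9 / (\<delta>0 * t^3) * integral (cbox (\<delta>0, - t) (2 * \<delta>0, t)) (\<lambda>p. (poly g (node i (fst p) (snd p) x))\<^sup>2)
    + 9 * t / (2 * \<delta>0\<^sup>2) * (integral {-t..t} (\<lambda>c. (poly g (node i (2 * \<delta>0) c x))\<^sup>2)
        + integral {-t..t} (\<lambda>c. (poly g (node i \<delta>0 c x))\<^sup>2))"
proof -
  note d0 = delta_pos[OF S t \<delta>0]
  define Q where "Q = cbox (\<delta>0, - t) (2 * \<delta>0, t)"
  define F where "F p = (1 - real i * fst p) / real i * (3 / (2 * t^3) * snd p) * poly g (node i (fst p) (snd p) x)" for p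
  define H where "H c = quadratic_kernel t c * c * (poly g (node i (2 * \<delta>0) c x) - poly g (node i \<delta>0 c x))" for c
  obtain D where D: "(node_average \<delta>0 t i (poly g) has_real_derivative D) (at x)"
    "circle_weight x * D * \<delta>0 = integral Q F + integral {-t..t} H"
  proof (rule node_average_deriv[OF S t \<delta>0 x i(1), of g], goal_cases)
    case (1 D)
    show ?thesis
      by (rule that[OF 1(2)]) (use 1(3) in \<open>simp only: Q_def F_def[abs_def] H_def[abs_def] case_prod_unfold\<close>)
  qed
  have "(poly r has_real_derivative D) (at x)"
  proof (rule DERIV_cong_ev[OF refl _ refl, THEN iffD1, OF _ D(1)])
    show "\<forall>\<^sub>F x in nhds x. node_average \<delta>0 t i (poly g) x = poly r x"
      using eventually_nhds_in_open[of "{-1<..<1}" x] x r by (auto elim!: eventually_mono)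
  qed
  then have Dr: "D = poly (pderiv r) x" by (rule DERIV_unique) (rule poly_DERIV)
  have Fc: "continuous_on A F" for A
    unfolding F_def by (intro continuous_intros) (use i t in auto)
  have Hc: "continuous_on A H" for A unfolding H_def by (intro continuous_intros)
  have FI: "(integral Q F)\<^sup>2 \<le> 9 * \<delta>0 / (2 * t^3) * integral Q (\<lambda>p. (poly g (node i (fst p) (snd p) x))\<^sup>2)"
  proof -
    have "(integral Q F)\<^sup>2 \<le> (2 * t * \<delta>0) * integral Q (\<lambda>p. (F p)\<^sup>2)"
      using integral_square_le[of "(\<delta>0, - t)" "(2 * \<delta>0, t)" F] t d0
      unfolding Q_def measure_parameter_box by (simp add: Fc)
    also have "\<dots> \<le> (2 * t * \<delta>0) * integral Q (\<lambda>p. (3 / (2 * t\<^sup>2))\<^sup>2 * (poly g (node i (fst p) (snd p) x))\<^sup>2)"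
    proof (intro mult_left_mono integral_le)
      show "(\<lambda>p. (F p)\<^sup>2) integrable_on Q" unfolding Q_def by (intro integrable_continuous continuous_intros Fc)
      show "(\<lambda>p. (3 / (2 * t\<^sup>2))\<^sup>2 * (poly g (node i (fst p) (snd p) x))\<^sup>2) integrable_on Q"
        unfolding Q_def by (intro integrable_continuous continuous_intros)
      fix p assume p: "p \<in> Q"
      obtain \<delta> c where pe: "p = (\<delta>, c)" by (cases p)
      have dc: "\<delta> \<in> {\<delta>0..2 * \<delta>0}" "\<bar>c\<bar> \<le> t" using p by (auto simp: pe Q_def abs_le_iff)
      have a: "1 / 2 \<le> 1 - real i * \<delta>" "1 - real i * \<delta> \<le> 1" by (rule node_coeff[OF S t \<delta>0 i(2) dc(1)])+
      have "\<bar>(1 - real i * \<delta>) / real i * (3 / (2 * t^3) * c)\<bar> = (1 - real i * \<delta>) / real i * (3 / (2 * t^3) * \<bar>c\<bar>)"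
        using a t by (simp add: abs_mult)
      also have "\<dots> \<le> 1 * (3 / (2 * t^3) * t)"
      proof (rule mult_mono)
        have "1 \<le> real i" using i by simp
        then have "1 - real i * \<delta> \<le> real i" using a by linarith
        then show "(1 - real i * \<delta>) / real i \<le> 1" using i by simp
        show "3 / (2 * t^3) * \<bar>c\<bar> \<le> 3 / (2 * t^3) * t" using dc t by (intro mult_left_mono) auto
      qed (use t in auto)
      also have "\<dots> = 3 / (2 * t\<^sup>2)" using t by (simp add: power2_eq_square power3_eq_cube)
      finally have "((1 - real i * \<delta>) / real i * (3 / (2 * t^3) * c))\<^sup>2 \<le> (3 / (2 * t\<^sup>2))\<^sup>2"
        by (simp add: abs_le_square_iff[symmetric])
      then show "(F p)\<^sup>2 \<le> (3 / (2 * t\<^sup>2))\<^sup>2 * (poly g (node i (fst p) (snd p) x))\<^sup>2"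
        unfolding F_def pe power_mult_distrib[of _ "poly g _"] by (intro mult_right_mono) auto
    qed (use t d0 in auto)
    also have "\<dots> = 9 * \<delta>0 / (2 * t^3) * integral Q (\<lambda>p. (poly g (node i (fst p) (snd p) x))\<^sup>2)"
      unfolding Henstock_Kurzweil_Integration.integral_mult_right using t by (simp add: power2_eq_square power3_eq_cube)
    finally show ?thesis .
  qed
  define P where "P d c = poly g (node i d c x)" for d c
  have Pc: "continuous_on A (P d)" for A d unfolding P_def by (intro continuous_intros)
  have HI: "(integral {-t..t} H)\<^sup>2 \<le> 9 * t / 4 * (integral {-t..t} (\<lambda>c. (P (2 * \<delta>0) c)\<^sup>2) + integral {-t..t} (\<lambda>c. (P \<delta>0 c)\<^sup>2))"
  proof -
    have "(integral {-t..t} H)\<^sup>2 \<le> (2 * t) * integral {-t..t} (\<lambda>c. (H c)\<^sup>2)"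
      using integral_square_le[of "- t" t H] t by (simp add: Hc)
    also have "\<dots> \<le> (2 * t) * integral {-t..t} (\<lambda>c. 9 / 8 * ((P (2 * \<delta>0) c)\<^sup>2 + (P \<delta>0 c)\<^sup>2))"
    proof (intro mult_left_mono integral_le)
      show "(\<lambda>c. (H c)\<^sup>2) integrable_on {-t..t}" by (intro integrable_continuous_real continuous_intros Hc)
      show "(\<lambda>c. 9 / 8 * ((P (2 * \<delta>0) c)\<^sup>2 + (P \<delta>0 c)\<^sup>2)) integrable_on {-t..t}"
        by (intro integrable_continuous_real continuous_intros Pc)
      fix c assume "c \<in> {-t..t}"
      then have c: "\<bar>c\<bar> \<le> t" by (simp add: abs_le_iff)
      have "\<bar>quadratic_kernel t c * c\<bar> = quadratic_kernel t c * \<bar>c\<bar>"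
        using quadratic_kernel_bounds[OF c] by (simp add: abs_mult)
      also have "\<dots> \<le> 3 / (4 * t) * t" using quadratic_kernel_bounds[OF c] c t by (intro mult_mono) auto
      also have "\<dots> = 3 / 4" using t by simp
      finally have "(quadratic_kernel t c * c)\<^sup>2 \<le> (3 / 4)\<^sup>2" by (simp add: abs_le_square_iff[symmetric])
      then have "(H c)\<^sup>2 \<le> (3 / 4)\<^sup>2 * (P (2 * \<delta>0) c - P \<delta>0 c)\<^sup>2"
        unfolding H_def P_def power_mult_distrib[of _ "_ - _"] by (intro mult_right_mono) auto
      also have "(P (2 * \<delta>0) c - P \<delta>0 c)\<^sup>2 \<le> 2 * ((P (2 * \<delta>0) c)\<^sup>2 + (P \<delta>0 c)\<^sup>2)"
        using sum_squares_bound[of "P (2 * \<delta>0) c" "- P \<delta>0 c"] by (simp add: power2_diff)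
      finally show "(H c)\<^sup>2 \<le> 9 / 8 * ((P (2 * \<delta>0) c)\<^sup>2 + (P \<delta>0 c)\<^sup>2)" by (simp add: power2_eq_square)
    qed (use t in auto)
    also have "\<dots> = 9 * t / 4 * integral {-t..t} (\<lambda>c. (P (2 * \<delta>0) c)\<^sup>2 + (P \<delta>0 c)\<^sup>2)"
      unfolding Henstock_Kurzweil_Integration.integral_mult_right by simp
    also have "integral {-t..t} (\<lambda>c. (P (2 * \<delta>0) c)\<^sup>2 + (P \<delta>0 c)\<^sup>2)
        = integral {-t..t} (\<lambda>c. (P (2 * \<delta>0) c)\<^sup>2) + integral {-t..t} (\<lambda>c. (P \<delta>0 c)\<^sup>2)"
      by (intro Henstock_Kurzweil_Integration.integral_add integrable_continuous_real continuous_intros Pc)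
    finally show ?thesis .
  qed
  have "(1 - x\<^sup>2) * (poly (pderiv r) x)\<^sup>2 = (circle_weight x * D * \<delta>0)\<^sup>2 / \<delta>0\<^sup>2"
  proof -
    have "\<bar>x\<bar> \<le> 1" using x by (simp add: abs_le_iff)
    then show ?thesis using circle_weight_sq[of x] d0 by (simp add: Dr power_mult_distrib)
  qed
  also have "\<dots> \<le> 2 * ((integral Q F)\<^sup>2 + (integral {-t..t} H)\<^sup>2) / \<delta>0\<^sup>2"
    unfolding D(2) using sum_squares_bound[of "integral Q F" "integral {-t..t} H"]
    by (intro divide_right_mono) (auto simp: power2_sum)
  also have "\<dots> \<le> 2 * (9 * \<delta>0 / (2 * t^3) * integral Q (\<lambda>p. (poly g (node i (fst p) (snd p) x))\<^sup>2)
      + 9 * t / 4 * (integral {-t..t} (\<lambda>c. (P (2 * \<delta>0) c)\<^sup>2) + integral {-t..t} (\<lambda>c. (P \<delta>0 c)\<^sup>2))) / \<delta>0\<^sup>2"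
    using FI HI by (intro divide_right_mono mult_left_mono add_mono) auto
  also have "\<dots> = 9 / (\<delta>0 * t^3) * integral Q (\<lambda>p. (poly g (node i (fst p) (snd p) x))\<^sup>2)
    + 9 * t / (2 * \<delta>0\<^sup>2) * (integral {-t..t} (\<lambda>c. (P (2 * \<delta>0) c)\<^sup>2) + integral {-t..t} (\<lambda>c. (P \<delta>0 c)\<^sup>2))"
    using d0 t by (simp add: field_simps power2_eq_square)
  finally show ?thesis by (simp add: Q_def P_def)
qed

lemma poly_sq_integral: "(\<integral>\<^sup>+ z. ennreal ((poly g z)\<^sup>2) * indicator {-1..1} z \<partial>lborel) = ennreal ((l2n (-1) 1 (poly g))\<^sup>2)"
  by (rule l2n_sq_lborel[symmetric]) simp

text \<open>A Bernstein inequality whose constant \<open>12 / t\<close> does not depend on the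
  degree of \<open>g\<close>. The double integral is averaged over both parameters, the boundary
  terms only over \<open>c\<close> at fixed \<delta>; that is enough, because the composition bound
  averages over \<open>c\<close> alone.\<close>

lemma node_average_gradient:
  assumes i: "0 < i" "i \<le> S"
    and r: "\<And>x. x \<in> {-1..1} \<Longrightarrow> node_average \<delta>0 t i (poly g) x = poly r x"
  shows "integral {-1..1} (\<lambda>x. (1 - x\<^sup>2) * (poly (pderiv r) x)\<^sup>2) \<le> 144 / t\<^sup>2 * (l2n (-1) 1 (poly g))\<^sup>2"
proof -
  note d0 = delta_pos[OF S t \<delta>0]
  define N where "N = (l2n (-1) 1 (poly g))\<^sup>2"
  define G where "G z = ennreal ((poly g z)\<^sup>2) * indicator {-1..1} z" for z
  have [measurable]: "poly g \<in> borel_measurable borel"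
    by (intro borel_measurable_continuous_onI continuous_intros)
  have Gm [measurable]: "G \<in> borel_measurable borel" unfolding G_def by measurable
  have GN: "(\<integral>\<^sup>+ z. G z \<partial>lborel) = ennreal N" unfolding G_def N_def by (rule poly_sq_integral)
  have Geq: "ennreal ((poly g (node i \<delta> c x))\<^sup>2) = G (node i \<delta> c x)"
    if "\<delta> \<in> {\<delta>0..2 * \<delta>0}" "c \<in> {-t..t}" "x \<in> {-1<..<1}" for \<delta> c x
    using node_in[OF S t \<delta>0 i(2) that(1,2), of x] that(3) by (auto simp: G_def abs_le_iff)
  define k1 where "k1 = 9 / (\<delta>0 * t^3)"
  define k2 where "k2 = 9 * t / (2 * \<delta>0\<^sup>2)"
  have k: "0 \<le> k1" "0 \<le> k2" using d0 t by (auto simp: k1_def k2_def)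
  define Q where "Q = cbox (\<delta>0, - t) (2 * \<delta>0, t)"
  define U where "U x = integral Q (\<lambda>p. (poly g (node i (fst p) (snd p) x))\<^sup>2)" for x
  define W where "W \<delta> x = integral {-t..t} (\<lambda>c. (poly g (node i \<delta> c x))\<^sup>2)" for \<delta> x
  have U0: "0 \<le> U x" and W0: "0 \<le> W \<delta> x" for x \<delta>
    unfolding U_def W_def Q_def
    by (intro integral_nonneg integrable_continuous integrable_continuous_real continuous_intros; simp)+
  have UE: "ennreal (U x) * indicator {-1<..<1} x
      = (\<integral>\<^sup>+ \<delta>. \<integral>\<^sup>+ c. G (node i \<delta> c x) * indicator {-1<..<1} x * indicator {-t..t} c * indicator {\<delta>0..2 * \<delta>0} \<delta> \<partial>lborel \<partial>lborel)" for x
  proof (cases "x \<in> {-1<..<1}")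
    case True
    have "ennreal (U x) = (\<integral>\<^sup>+ \<delta>. \<integral>\<^sup>+ c. ennreal ((poly g (node i \<delta> c x))\<^sup>2) * indicator {-t..t} c * indicator {\<delta>0..2 * \<delta>0} \<delta> \<partial>lborel \<partial>lborel)"
      unfolding U_def Q_def by (subst nn_integral_cbox_prod) (auto intro!: continuous_intros)
    also have "\<dots> = (\<integral>\<^sup>+ \<delta>. \<integral>\<^sup>+ c. G (node i \<delta> c x) * indicator {-1<..<1} x * indicator {-t..t} c * indicator {\<delta>0..2 * \<delta>0} \<delta> \<partial>lborel \<partial>lborel)"
      using Geq True by (intro nn_integral_cong) (auto simp: indicator_def)
    finally show ?thesis using True by simp
  qed simp
  have WE: "ennreal (W \<delta> x) * indicator {-1<..<1} x
      = (\<integral>\<^sup>+ c. G (node i \<delta> c x) * indicator {-1<..<1} x * indicator {-t..t} c \<partial>lborel)"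
    if d: "\<delta> \<in> {\<delta>0..2 * \<delta>0}" for x \<delta>
  proof (cases "x \<in> {-1<..<1}")
    case True
    have "ennreal (W \<delta> x) = (\<integral>\<^sup>+ c. ennreal ((poly g (node i \<delta> c x))\<^sup>2) * indicator {-t..t} c \<partial>lborel)"
      unfolding W_def
      by (rule nn_integral_has_integral_lebesgue'[symmetric])
         (auto intro!: integrable_integral integrable_continuous_real continuous_intros)
    also have "\<dots> = (\<integral>\<^sup>+ c. G (node i \<delta> c x) * indicator {-1<..<1} x * indicator {-t..t} c \<partial>lborel)"
      using Geq d True by (intro nn_integral_cong) (auto simp: indicator_def)
    finally show ?thesis using True by simp
  qed simp
  have Uint: "(\<integral>\<^sup>+ x. ennreal (U x) * indicator {-1<..<1} x \<partial>lborel) \<le> ennreal (8 * t * \<delta>0 * N)"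
  proof -
    have "(\<integral>\<^sup>+ x. ennreal (U x) * indicator {-1<..<1} x \<partial>lborel)
        = (\<integral>\<^sup>+ \<delta>. \<integral>\<^sup>+ x. \<integral>\<^sup>+ c. G (node i \<delta> c x) * indicator {-1<..<1} x * indicator {-t..t} c * indicator {\<delta>0..2 * \<delta>0} \<delta> \<partial>lborel \<partial>lborel \<partial>lborel)"
      unfolding UE by (rule nn_integral_swap) measurable
    also have "\<dots> = (\<integral>\<^sup>+ \<delta>. \<integral>\<^sup>+ c. \<integral>\<^sup>+ x. G (node i \<delta> c x) * indicator {-1<..<1} x * indicator {-t..t} c * indicator {\<delta>0..2 * \<delta>0} \<delta> \<partial>lborel \<partial>lborel \<partial>lborel)"
      by (intro nn_integral_cong nn_integral_swap) measurable
    also have "\<dots> \<le> ennreal (8 * t * \<delta>0) * (\<integral>\<^sup>+ z. G z \<partial>lborel)"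
      by (rule node_energy[OF S t \<delta>0 Gm i(2)])
    also have "\<dots> = ennreal (8 * t * \<delta>0 * N)"
      unfolding GN using t d0 by (intro ennreal_mult[symmetric]) (auto simp: N_def)
    finally show ?thesis .
  qed
  have Wint: "(\<integral>\<^sup>+ x. ennreal (W \<delta> x) * indicator {-1<..<1} x \<partial>lborel) \<le> ennreal (8 * t * N)"
    if d: "\<delta> \<in> {\<delta>0..2 * \<delta>0}" for \<delta>
  proof -
    have "(\<integral>\<^sup>+ x. ennreal (W \<delta> x) * indicator {-1<..<1} x \<partial>lborel)
        = (\<integral>\<^sup>+ c. \<integral>\<^sup>+ x. G (node i \<delta> c x) * indicator {-1<..<1} x * indicator {-t..t} c \<partial>lborel \<partial>lborel)"
      unfolding WE[OF d] by (rule nn_integral_swap) measurable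
    also have "\<dots> \<le> ennreal (8 * t) * (\<integral>\<^sup>+ z. G z \<partial>lborel)"
      by (rule node_energy_c[OF S t \<delta>0 Gm i d])
    also have "\<dots> = ennreal (8 * t * N)"
      unfolding GN using t by (intro ennreal_mult[symmetric]) (auto simp: N_def)
    finally show ?thesis .
  qed
  have mU: "(\<lambda>x. ennreal (U x) * indicator {-1<..<1} x) \<in> borel_measurable borel"
    unfolding UE by measurable
  have mW: "(\<lambda>x. ennreal (W \<delta> x) * indicator {-1<..<1} x) \<in> borel_measurable borel" if "\<delta> \<in> {\<delta>0..2 * \<delta>0}" for \<delta>
    unfolding WE[OF that] by measurable
  have dd: "\<delta>0 \<in> {\<delta>0..2 * \<delta>0}" "2 * \<delta>0 \<in> {\<delta>0..2 * \<delta>0}" using d0 by auto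
  have "ennreal (integral {-1..1} (\<lambda>x. (1 - x\<^sup>2) * (poly (pderiv r) x)\<^sup>2))
      = (\<integral>\<^sup>+ x. ennreal ((1 - x\<^sup>2) * (poly (pderiv r) x)\<^sup>2) * indicator {-1..1} x \<partial>lborel)"
    by (rule nn_integral_has_integral_lebesgue'[symmetric])
       (auto intro!: integrable_integral integrable_continuous_real continuous_intros mult_nonneg_nonneg simp: abs_square_le_1 abs_le_iff)
  also have "\<dots> = (\<integral>\<^sup>+ x. ennreal ((1 - x\<^sup>2) * (poly (pderiv r) x)\<^sup>2) * indicator {-1<..<1} x \<partial>lborel)"
    by (rule nn_integral_open_interval)
  also have "\<dots> \<le> (\<integral>\<^sup>+ x. ennreal k1 * (ennreal (U x) * indicator {-1<..<1} x)
      + ennreal k2 * (ennreal (W (2 * \<delta>0) x) * indicator {-1<..<1} x + ennreal (W \<delta>0 x) * indicator {-1<..<1} x) \<partial>lborel)"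
  proof (rule nn_integral_mono)
    fix x
    show "ennreal ((1 - x\<^sup>2) * (poly (pderiv r) x)\<^sup>2) * indicator {-1<..<1} x \<le> ennreal k1 * (ennreal (U x) * indicator {-1<..<1} x)
      + ennreal k2 * (ennreal (W (2 * \<delta>0) x) * indicator {-1<..<1} x + ennreal (W \<delta>0 x) * indicator {-1<..<1} x)"
    proof (cases "x \<in> {-1<..<1}")
      case True
      have "ennreal ((1 - x\<^sup>2) * (poly (pderiv r) x)\<^sup>2) \<le> ennreal (k1 * U x + k2 * (W (2 * \<delta>0) x + W \<delta>0 x))"
        using node_average_deriv_sq[OF i True r]
        by (intro ennreal_leI) (simp add: k1_def k2_def U_def W_def Q_def)
      also have "\<dots> = ennreal k1 * ennreal (U x) + ennreal k2 * (ennreal (W (2 * \<delta>0) x) + ennreal (W \<delta>0 x))"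
        using k U0 W0 by (simp add: ennreal_mult)
      finally show ?thesis using True by simp
    qed simp
  qed
  also have "\<dots> = ennreal k1 * (\<integral>\<^sup>+ x. ennreal (U x) * indicator {-1<..<1} x \<partial>lborel)
      + ennreal k2 * ((\<integral>\<^sup>+ x. ennreal (W (2 * \<delta>0) x) * indicator {-1<..<1} x \<partial>lborel)
        + (\<integral>\<^sup>+ x. ennreal (W \<delta>0 x) * indicator {-1<..<1} x \<partial>lborel))"
    using mU mW[OF dd(1)] mW[OF dd(2)] by (simp add: nn_integral_add nn_integral_cmult)
  also have "\<dots> \<le> ennreal k1 * ennreal (8 * t * \<delta>0 * N) + ennreal k2 * (ennreal (8 * t * N) + ennreal (8 * t * N))"
    by (intro add_mono mult_left_mono Uint Wint dd) auto
  also have "\<dots> = ennreal (k1 * (8 * t * \<delta>0 * N) + k2 * (16 * t * N))"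
  proof -
    have "ennreal (8 * t * N) + ennreal (8 * t * N) = ennreal (16 * t * N)"
      using t by (subst ennreal_plus[symmetric]) (auto simp: N_def)
    moreover have "ennreal k1 * ennreal (8 * t * \<delta>0 * N) = ennreal (k1 * (8 * t * \<delta>0 * N))"
      using k t d0 by (intro ennreal_mult[symmetric]) (auto simp: N_def)
    moreover have "ennreal k2 * ennreal (16 * t * N) = ennreal (k2 * (16 * t * N))"
      using k t by (intro ennreal_mult[symmetric]) (auto simp: N_def)
    ultimately show ?thesis using k t d0 by (subst ennreal_plus) (auto simp: N_def)
  qed
  also have "\<dots> \<le> ennreal (144 / t\<^sup>2 * N)"
  proof (rule ennreal_leI)
    have 1: "k1 * (8 * t * \<delta>0 * N) = 72 / t\<^sup>2 * N"
      using t d0 by (simp add: k1_def power2_eq_square power3_eq_cube)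
    have "k2 * (16 * t * N) = 72 * (t / \<delta>0)\<^sup>2 * N" by (simp add: k2_def power2_eq_square)
    also have "\<dots> \<le> 72 * (1 / t)\<^sup>2 * N"
    proof (intro mult_right_mono mult_left_mono power_mono)
      \<comment> \<open>The boundary terms are of order \<open>t / \<delta>0\<close>; the size
        \<open>S t^2\<close> of \<delta>0 brings them down to \<open>1 / t\<close>, the order of the
        other term.\<close>
      have "t * t \<le> \<delta>0" using delta_ge[OF S t \<delta>0] by (simp add: power2_eq_square)
      then show "t / \<delta>0 \<le> 1 / t" using t d0 by (simp add: field_simps)
    qed (use t d0 in \<open>auto simp: N_def\<close>)
    finally have 2: "k2 * (16 * t * N) \<le> 72 / t\<^sup>2 * N" by (simp add: power_divide)
    have "144 / t\<^sup>2 * N = 72 / t\<^sup>2 * N + 72 / t\<^sup>2 * N" by simp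
    then show "k1 * (8 * t * \<delta>0 * N) + k2 * (16 * t * N) \<le> 144 / t\<^sup>2 * N" unfolding 1 using 2 by linarith
  qed
  finally show ?thesis unfolding N_def by (subst (asm) ennreal_le_iff) auto
qed

end

text \<open>The signs make the identity minus this operator the average of S-th differences along
  the nodes: the missing term \<open>i = 0\<close> of the alternating sum is the function
  itself.\<close>

definition smoothing :: "nat \<Rightarrow> real \<Rightarrow> real \<Rightarrow> real poly \<Rightarrow> real \<Rightarrow> real" where
  "smoothing S \<delta>0 t q x =
     (\<Sum>i=1..S. (-1) ^ (i + 1) * real (S choose i) * node_average \<delta>0 t i (poly q) x)"

text \<open>Transport of \<open>legendre_projection\<close> to [-1, 1]; minimality follows from
  orthogonality by Pythagoras.\<close>

lemma best_approximation:
  "\<exists>p. deg_less m p \<and> (\<forall>r. deg_less m r \<longrightarrow> l2n (-1) 1 (poly (q - p)) \<le> l2n (-1) 1 (poly (q - r))) \<and>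
     (real m)\<^sup>2 * (l2n (-1) 1 (poly (q - p)))\<^sup>2 \<le> integral {-1..1} (\<lambda>x. (1 - x\<^sup>2) * (poly (pderiv q) x)\<^sup>2)"
proof -
  define A :: "real poly" where "A = [:-1, 2:]"
  define B :: "real poly" where "B = [:1/2, 1/2:]"
  have AB: "s \<circ>\<^sub>p B \<circ>\<^sub>p A = s" for s
    by (simp add: pcompose_assoc[symmetric] A_def B_def pcompose_pCons)
  have sq: "pint ((s \<circ>\<^sub>p A) * (s \<circ>\<^sub>p A)) = (l2n (-1) 1 (poly s))\<^sup>2 / 2" for s
    using pint_sq_compose[of "-1" 1 s] by (simp add: A_def)
  obtain P where P: "deg_less m P" "\<And>r. deg_less m r \<Longrightarrow> pint ((q \<circ>\<^sub>p A - P) * r) = 0"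
    "(real m)\<^sup>2 * pint ((q \<circ>\<^sub>p A - P) * (q \<circ>\<^sub>p A - P)) \<le> pint ([:0, 1, -1:] * pderiv (q \<circ>\<^sub>p A) * pderiv (q \<circ>\<^sub>p A))"
    using legendre_projection[of m "q \<circ>\<^sub>p A"] by blast
  define p where "p = P \<circ>\<^sub>p B"
  have pA: "p \<circ>\<^sub>p A = P" unfolding p_def by (rule AB)
  have "deg_less m p" unfolding p_def B_def by (rule deg_less_pcompose_linear[OF P(1)])
  moreover have "l2n (-1) 1 (poly (q - p)) \<le> l2n (-1) 1 (poly (q - r))" if r: "deg_less m r" for r
  proof -
    define R where "R = r \<circ>\<^sub>p A"
    have R: "deg_less m R" unfolding R_def A_def by (rule deg_less_pcompose_linear[OF r])
    define X where "X = q \<circ>\<^sub>p A - P"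
    define Y where "Y = P - R"
    have XY: "(q - p) \<circ>\<^sub>p A = X" "(q - r) \<circ>\<^sub>p A = X + Y"
      by (simp_all add: X_def Y_def R_def pcompose_diff pA)
    have "pint (X * Y) = 0" unfolding X_def Y_def by (intro P(2) deg_less_diff P(1) R)
    moreover have "(X + Y) * (X + Y) = X * X + smult 2 (X * Y) + Y * Y"
      using smult_add_left[of 1 1 "X * Y"] by (simp add: algebra_simps)
    ultimately have "pint ((X + Y) * (X + Y)) = pint (X * X) + pint (Y * Y)"
      by (simp only: pint_add pint_smult)
    moreover have "0 \<le> pint (Y * Y)" unfolding pint_def by (intro integral_nonneg) auto
    ultimately have "(l2n (-1) 1 (poly (q - p)))\<^sup>2 / 2 \<le> (l2n (-1) 1 (poly (q - r)))\<^sup>2 / 2"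
      unfolding sq[symmetric] XY by simp
    then have "(l2n (-1) 1 (poly (q - p)))\<^sup>2 \<le> (l2n (-1) 1 (poly (q - r)))\<^sup>2" by simp
    then show ?thesis by (rule power2_le_imp_le) simp
  qed
  moreover have "(real m)\<^sup>2 * (l2n (-1) 1 (poly (q - p)))\<^sup>2 \<le> integral {-1..1} (\<lambda>x. (1 - x\<^sup>2) * (poly (pderiv q) x)\<^sup>2)"
  proof -
    \<comment> \<open>Under \<open>x = 2 y - 1\<close> the weight \<open>y (1 - y)\<close> is
      \<open>(1 - x^2) / 4\<close>, and the two inner derivatives contribute a compensating factor
      4.\<close>
    have "[:0, 1, -1:] * pderiv (q \<circ>\<^sub>p A) * pderiv (q \<circ>\<^sub>p A) = ([:1, 0, -1:] * pderiv q * pderiv q) \<circ>\<^sub>p A"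
    proof (intro poly_eq_poly_eq_iff[THEN iffD1] ext)
      fix y
      show "poly ([:0, 1, -1:] * pderiv (q \<circ>\<^sub>p A) * pderiv (q \<circ>\<^sub>p A)) y = poly (([:1, 0, -1:] * pderiv q * pderiv q) \<circ>\<^sub>p A) y"
        by (simp add: pderiv_pcompose poly_pcompose A_def pderiv_pCons algebra_simps)
    qed
    then have "pint ([:0, 1, -1:] * pderiv (q \<circ>\<^sub>p A) * pderiv (q \<circ>\<^sub>p A))
        = integral {-1..1} (poly ([:1, 0, -1:] * pderiv q * pderiv q)) / 2"
      using integral_poly_affine[of 2 "[:1, 0, -1:] * pderiv q * pderiv q" "-1"] by (simp add: A_def min_def max_def)
    also have "integral {-1..1} (poly ([:1, 0, -1:] * pderiv q * pderiv q))
        = integral {-1..1} (\<lambda>x. (1 - x\<^sup>2) * (poly (pderiv q) x)\<^sup>2)"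
      by (intro Henstock_Kurzweil_Integration.integral_cong) (simp add: power2_eq_square algebra_simps)
    finally have "(real m)\<^sup>2 * pint ((q \<circ>\<^sub>p A - P) * (q \<circ>\<^sub>p A - P)) \<le> integral {-1..1} (\<lambda>x. (1 - x\<^sup>2) * (poly (pderiv q) x)\<^sup>2) / 2"
      using P(3) by simp
    moreover have "q \<circ>\<^sub>p A - P = (q - p) \<circ>\<^sub>p A" by (simp add: pcompose_diff pA)
    ultimately show ?thesis by (simp add: sq)
  qed
  ultimately show ?thesis by blast
qed

section \<open>The smoothing operator: gradient and error\<close>

context
  fixes S :: nat and t \<delta>0 :: real
  assumes S: "0 < S" and t: "0 < t" "t * (4 * real S) \<le> 1" and \<delta>0: "\<delta>0 = real S * t\<^sup>2"
begin

lemma node_average_add: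
  "node_average \<delta>0 t i (poly (p + g)) x = node_average \<delta>0 t i (poly p) x + node_average \<delta>0 t i (poly g) x"
proof -
  have "integral (cbox (\<delta>0, - t) (2 * \<delta>0, t)) (\<lambda>(\<delta>, c). quadratic_kernel t c * poly (p + g) (node i \<delta> c x))
      = integral (cbox (\<delta>0, - t) (2 * \<delta>0, t)) (\<lambda>z. (case z of (\<delta>, c) \<Rightarrow> quadratic_kernel t c * poly p (node i \<delta> c x))
          + (case z of (\<delta>, c) \<Rightarrow> quadratic_kernel t c * poly g (node i \<delta> c x)))"
    by (intro Henstock_Kurzweil_Integration.integral_cong) (auto simp: algebra_simps)
  also have "\<dots> = integral (cbox (\<delta>0, - t) (2 * \<delta>0, t)) (\<lambda>(\<delta>, c). quadratic_kernel t c * poly p (node i \<delta> c x))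
      + integral (cbox (\<delta>0, - t) (2 * \<delta>0, t)) (\<lambda>(\<delta>, c). quadratic_kernel t c * poly g (node i \<delta> c x))"
    by (intro Henstock_Kurzweil_Integration.integral_add kernel_node_integrable[OF S t \<delta>0])
  finally show ?thesis by (simp add: node_average_def add_divide_distrib)
qed

lemma smoothing_add: "smoothing S \<delta>0 t (p + g) x = smoothing S \<delta>0 t p x + smoothing S \<delta>0 t g x"
  unfolding smoothing_def node_average_add distrib_left sum.distrib ..

text \<open>In the constant, \<open>12 / t\<close> is the gradient of one node average,
  \<open>2^S\<close> bounds the root of the sum of squared binomials, and \<open>S\<close> bounds
  the root of the number of terms.\<close>

lemma smoothing_poly:
  assumes "deg_less m q"
  shows "\<exists>r. deg_less m r \<and> (\<forall>x\<in>{-1..1}. smoothing S \<delta>0 t q x = poly r x) \<and>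
    integral {-1..1} (\<lambda>x. (1 - x\<^sup>2) * (poly (pderiv r) x)\<^sup>2) \<le> (12 * real S * 2 ^ S / t)\<^sup>2 * (l2n (-1) 1 (poly q))\<^sup>2"
proof -
  have "\<forall>i. \<exists>r. deg_less m r \<and> (\<forall>x\<in>{-1..1}. node_average \<delta>0 t i (poly q) x = poly r x)"
    by (rule allI, rule node_average_poly[OF S t \<delta>0 assms])
  from choice[OF this] obtain R
    where R': "\<forall>i. deg_less m (R i) \<and> (\<forall>x\<in>{-1..1}. node_average \<delta>0 t i (poly q) x = poly (R i) x)"
    by (rule exE)
  have R: "deg_less m (R i)" "x \<in> {-1..1} \<Longrightarrow> node_average \<delta>0 t i (poly q) x = poly (R i) x" for i x
    using R'[THEN spec, of i] by auto
  define a where "a i = (-1) ^ (i + 1) * real (S choose i)" for i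
  define r where "r = (\<Sum>i=1..S. smult (a i) (R i))"
  have "deg_less m r" unfolding r_def by (intro deg_less_sum deg_less_smult R)
  moreover have "smoothing S \<delta>0 t q x = poly r x" if "x \<in> {-1..1}" for x
    unfolding smoothing_def r_def using R(2)[OF that] by (simp add: poly_sum a_def)
  moreover have "integral {-1..1} (\<lambda>x. (1 - x\<^sup>2) * (poly (pderiv r) x)\<^sup>2) \<le> (12 * real S * 2 ^ S / t)\<^sup>2 * (l2n (-1) 1 (poly q))\<^sup>2"
  proof -
    define u where "u i x = (1 - x\<^sup>2) * (poly (pderiv (R i)) x)\<^sup>2" for i x
    have ui: "u i integrable_on {-1..1}" for i
      unfolding u_def by (intro integrable_continuous_real continuous_intros)
    have a2: "(\<Sum>i=1..S. (a i)\<^sup>2) \<le> (2 ^ S)\<^sup>2"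
    proof -
      have "(\<Sum>i=1..S. (a i)\<^sup>2) = (\<Sum>i=1..S. (real (S choose i))\<^sup>2)"
        by (intro sum.cong) (auto simp: a_def power_mult_distrib simp flip: power_mult)
      also have "\<dots> \<le> (\<Sum>i\<le>S. (real (S choose i))\<^sup>2)" by (intro sum_mono2) auto
      also have "\<dots> \<le> (\<Sum>i\<le>S. real (S choose i) * 2 ^ S)"
      proof (intro sum_mono)
        fix i
        have "real (S choose i) \<le> 2 ^ S"
          using binomial_le_pow2[of S i] by (metis of_nat_le_iff of_nat_numeral of_nat_power)
        then show "(real (S choose i))\<^sup>2 \<le> real (S choose i) * 2 ^ S"
          unfolding power2_eq_square by (intro mult_left_mono) auto
      qed
      also have "\<dots> = real (\<Sum>i\<le>S. S choose i) * 2 ^ S" by (simp add: sum_distrib_right)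
      also have "\<dots> = (2 ^ S)\<^sup>2" unfolding choose_row_sum by (simp add: power2_eq_square)
      finally show ?thesis .
    qed
    have "integral {-1..1} (\<lambda>x. (1 - x\<^sup>2) * (poly (pderiv r) x)\<^sup>2) \<le> integral {-1..1} (\<lambda>x. (2 ^ S)\<^sup>2 * (\<Sum>i=1..S. u i x))"
    proof (intro integral_le)
      show "(\<lambda>x. (1 - x\<^sup>2) * (poly (pderiv r) x)\<^sup>2) integrable_on {-1..1}"
        by (intro integrable_continuous_real continuous_intros)
      show "(\<lambda>x. (2 ^ S)\<^sup>2 * (\<Sum>i=1..S. u i x)) integrable_on {-1..1}"
        by (intro integrable_on_mult_right integrable_sum ui) auto
      fix x :: real assume "x \<in> {-1..1}"
      then have x: "0 \<le> 1 - x\<^sup>2" by (simp add: abs_square_le_1 abs_le_iff)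
      have "(poly (pderiv r) x)\<^sup>2 = (\<Sum>i=1..S. a i * poly (pderiv (R i)) x)\<^sup>2"
        by (simp add: r_def higher_pderiv_sum[of 1, simplified] pderiv_smult poly_sum)
      also have "\<dots> \<le> (\<Sum>i=1..S. (a i)\<^sup>2) * (\<Sum>i=1..S. (poly (pderiv (R i)) x)\<^sup>2)" by (rule Cauchy_Schwarz_ineq_sum)
      also have "\<dots> \<le> (2 ^ S)\<^sup>2 * (\<Sum>i=1..S. (poly (pderiv (R i)) x)\<^sup>2)"
        by (intro mult_right_mono a2 sum_nonneg) auto
      finally have "(1 - x\<^sup>2) * (poly (pderiv r) x)\<^sup>2 \<le> (1 - x\<^sup>2) * ((2 ^ S)\<^sup>2 * (\<Sum>i=1..S. (poly (pderiv (R i)) x)\<^sup>2))"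
        using x by (intro mult_left_mono) auto
      then show "(1 - x\<^sup>2) * (poly (pderiv r) x)\<^sup>2 \<le> (2 ^ S)\<^sup>2 * (\<Sum>i=1..S. u i x)"
        by (simp add: u_def sum_distrib_left mult_ac)
    qed
    also have "\<dots> = (2 ^ S)\<^sup>2 * (\<Sum>i=1..S. integral {-1..1} (u i))"
      by (simp add: Henstock_Kurzweil_Integration.integral_sum ui)
    also have "\<dots> \<le> (2 ^ S)\<^sup>2 * (\<Sum>i=1..S. 144 / t\<^sup>2 * (l2n (-1) 1 (poly q))\<^sup>2)"
      unfolding u_def
    proof (intro mult_left_mono sum_mono)
      fix i assume "i \<in> {1..S}"
      then have i: "0 < i" "i \<le> S" by auto
      show "integral {-1..1} (\<lambda>x. (1 - x\<^sup>2) * (poly (pderiv (R i)) x)\<^sup>2) \<le> 144 / t\<^sup>2 * (l2n (-1) 1 (poly q))\<^sup>2"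
        by (rule node_average_gradient[OF S t \<delta>0 i R(2)])
    qed simp
    also have "\<dots> = real S * ((12 * 2 ^ S / t)\<^sup>2 * (l2n (-1) 1 (poly q))\<^sup>2)"
      by (simp add: power_divide power_mult_distrib)
    also have "\<dots> \<le> (real S)\<^sup>2 * ((12 * 2 ^ S / t)\<^sup>2 * (l2n (-1) 1 (poly q))\<^sup>2)"
      using S by (intro mult_right_mono) (auto simp: power2_eq_square)
    finally show ?thesis by (simp add: power_divide power_mult_distrib mult_ac)
  qed
  ultimately show ?thesis by blast
qed

lemma quadratic_kernel_integral: "integral {-t..t} (quadratic_kernel t) = 1"
proof (rule integral_unique)
  have "((\<lambda>c. 3 / (4 * t) * (c - c^3 / (3 * t\<^sup>2))) has_real_derivative quadratic_kernel t c) (at c within {-t..t})" for c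
    using t by (auto intro!: derivative_eq_intros simp: quadratic_kernel_def power2_eq_square field_simps)
  then have "(quadratic_kernel t has_integral (3 / (4 * t) * (t - t^3 / (3 * t\<^sup>2)) - 3 / (4 * t) * (- t - (- t)^3 / (3 * t\<^sup>2)))) {-t..t}"
    using t unfolding has_real_derivative_iff_has_vector_derivative by (intro fundamental_theorem_of_calculus) auto
  moreover have "3 / (4 * t) * (t - t^3 / (3 * t\<^sup>2)) - 3 / (4 * t) * (- t - (- t)^3 / (3 * t\<^sup>2)) = 1"
    using t by (simp add: power2_eq_square power3_eq_cube field_simps)
  ultimately show "(quadratic_kernel t has_integral 1) {-t..t}" by simp
qed

lemma node_average_0: "node_average \<delta>0 t 0 (poly q) x = poly q x"
proof -
  note d0 = delta_pos[OF S t \<delta>0]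
  have "integral (cbox (\<delta>0, - t) (2 * \<delta>0, t)) (\<lambda>(\<delta>, c). quadratic_kernel t c * poly q (node 0 \<delta> c x))
      = integral (cbox \<delta>0 (2 * \<delta>0)) (\<lambda>\<delta>. integral (cbox (- t) t) (\<lambda>c. quadratic_kernel t c * poly q x))"
    by (subst integral_prod_continuous) (auto simp: case_prod_unfold node_def intro!: continuous_intros)
  also have "\<dots> = \<delta>0 * poly q x"
    using d0 quadratic_kernel_integral by (simp add: cbox_interval)
  finally show ?thesis using d0 by (simp add: node_average_def)
qed

lemma node_difference:
  "(\<Sum>i\<le>S. (-1) ^ i * real (S choose i) * h (node i \<delta> c x))
     = central_diff S (inward_step \<delta> c x) h (x + real S / 2 * inward_step \<delta> c x)"
  unfolding central_diff_def node_eq by (intro sum.cong refl) (simp add: algebra_simps)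

text \<open>The error is a kernel average of S-th differences along the nodes. Cauchy-Schwarz on a
  box of area \<open>2 t \<delta>0\<close>, with the kernel at most \<open>3 / (4 t)\<close> and the
  normalisation \<open>1 / \<delta>0\<close>, produces the factor in front.\<close>

lemma smoothing_error:
  "(poly q x - smoothing S \<delta>0 t q x)\<^sup>2 \<le> 9 / (8 * t * \<delta>0) * integral (cbox (\<delta>0, - t) (2 * \<delta>0, t))
     (\<lambda>p. (central_diff S (inward_step (fst p) (snd p) x) (poly q) (x + real S / 2 * inward_step (fst p) (snd p) x))\<^sup>2)"
proof -
  note d0 = delta_pos[OF S t \<delta>0]
  define Q where "Q = cbox (\<delta>0, - t) (2 * \<delta>0, t)"
  define C where "C p = central_diff S (inward_step (fst p) (snd p) x) (poly q) (x + real S / 2 * inward_step (fst p) (snd p) x)" for p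
  have Ceq: "C p = (\<Sum>i\<le>S. (-1) ^ i * real (S choose i) * poly q (node i (fst p) (snd p) x))" for p
    unfolding C_def by (rule node_difference[symmetric])
  have Cc: "continuous_on A C" for A unfolding Ceq by (intro continuous_intros)
  have "poly q x - smoothing S \<delta>0 t q x = (\<Sum>i\<le>S. (-1) ^ i * real (S choose i) * node_average \<delta>0 t i (poly q) x)"
  proof -
    have "{..S} = insert 0 {1..S}" by auto
    then have "(\<Sum>i\<le>S. (-1) ^ i * real (S choose i) * node_average \<delta>0 t i (poly q) x)
        = poly q x + (\<Sum>i=1..S. (-1) ^ i * real (S choose i) * node_average \<delta>0 t i (poly q) x)"
      by (simp add: node_average_0)
    then show ?thesis by (simp add: smoothing_def sum_negf)
  qed
  also have "\<dots> = integral Q (\<lambda>p. quadratic_kernel t (snd p) * C p) / \<delta>0"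
  proof -
    have "integral Q (\<lambda>p. quadratic_kernel t (snd p) * C p)
        = integral Q (\<lambda>p. \<Sum>i\<le>S. (-1) ^ i * real (S choose i) * (case p of (\<delta>, c) \<Rightarrow> quadratic_kernel t c * poly q (node i \<delta> c x)))"
      by (intro Henstock_Kurzweil_Integration.integral_cong) (auto simp: Ceq sum_distrib_left mult_ac)
    also have "\<dots> = (\<Sum>i\<le>S. (-1) ^ i * real (S choose i) * integral Q (\<lambda>(\<delta>, c). quadratic_kernel t c * poly q (node i \<delta> c x)))"
      unfolding Q_def using kernel_node_integrable[OF S t \<delta>0]
      by (subst Henstock_Kurzweil_Integration.integral_sum) (auto intro: integrable_on_mult_right)
    finally show ?thesis by (simp add: node_average_def Q_def[symmetric] sum_divide_distrib)
  qed
  finally have "(poly q x - smoothing S \<delta>0 t q x)\<^sup>2 = (integral Q (\<lambda>p. quadratic_kernel t (snd p) * C p))\<^sup>2 / \<delta>0\<^sup>2"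
    by (simp add: power_divide)
  also have "\<dots> \<le> (2 * t * \<delta>0 * integral Q (\<lambda>p. (quadratic_kernel t (snd p) * C p)\<^sup>2)) / \<delta>0\<^sup>2"
  proof (rule divide_right_mono)
    show "(integral Q (\<lambda>p. quadratic_kernel t (snd p) * C p))\<^sup>2 \<le> 2 * t * \<delta>0 * integral Q (\<lambda>p. (quadratic_kernel t (snd p) * C p)\<^sup>2)"
      using integral_square_le[of "(\<delta>0, - t)" "(2 * \<delta>0, t)" "\<lambda>p. quadratic_kernel t (snd p) * C p"] t d0
      unfolding Q_def measure_parameter_box[OF S t \<delta>0] by (simp add: continuous_intros Cc)
  qed simp
  also have "\<dots> \<le> (2 * t * \<delta>0 * integral Q (\<lambda>p. (3 / (4 * t))\<^sup>2 * (C p)\<^sup>2)) / \<delta>0\<^sup>2"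
  proof (intro divide_right_mono mult_left_mono integral_le)
    show "(\<lambda>p. (quadratic_kernel t (snd p) * C p)\<^sup>2) integrable_on Q" "(\<lambda>p. (3 / (4 * t))\<^sup>2 * (C p)\<^sup>2) integrable_on Q"
      unfolding Q_def by (intro integrable_continuous continuous_intros Cc)+
    fix p assume p: "p \<in> Q"
    obtain \<delta> c where pe: "p = (\<delta>, c)" by (cases p)
    have c: "\<bar>c\<bar> \<le> t" using p by (auto simp: pe Q_def abs_le_iff)
    have "(quadratic_kernel t c)\<^sup>2 \<le> (3 / (4 * t))\<^sup>2"
      using quadratic_kernel_bounds[OF S t \<delta>0 c] by (intro power_mono) auto
    then show "(quadratic_kernel t (snd p) * C p)\<^sup>2 \<le> (3 / (4 * t))\<^sup>2 * (C p)\<^sup>2"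
      unfolding power_mult_distrib pe by (intro mult_right_mono) auto
  qed (use t d0 in auto)
  also have "\<dots> = 9 / (8 * t * \<delta>0) * integral Q (\<lambda>p. (C p)\<^sup>2)"
    unfolding Henstock_Kurzweil_Integration.integral_mult_right using t d0 by (simp add: power2_eq_square)
  finally show ?thesis by (simp add: Q_def C_def)
qed

text \<open>The modulus is known for \<open>f\<close>, while the operator acts on polynomials. The
  difference of \<open>q\<close> is split into that of \<open>f\<close>, bounded by the modulus, and
  that of \<open>q - f\<close>, bounded node by node through \<open>node_energy\<close>.\<close>

lemma smoothing_error_norm:
  assumes f [measurable]: "f \<in> borel_measurable borel" and fL: "f \<in> L2 (-1) 1" and M: "0 \<le> M"
    and modulus: "\<And>h. 0 < h \<Longrightarrow> h \<le> 6 * real S * t \<Longrightarrow>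
      (\<integral>\<^sup>+ y. ennreal ((sym_difference (-1) 1 S (h * circle_weight y) f y)\<^sup>2) * indicator {-1..1} y \<partial>lborel) \<le> ennreal M"
    and r: "\<And>x. x \<in> {-1..1} \<Longrightarrow> smoothing S \<delta>0 t q x = poly r x"
  shows "(l2n (-1) 1 (poly (q - r)))\<^sup>2
    \<le> 270 * (real S)\<^sup>2 * M + 18 * (real S + 1)\<^sup>2 * 4 ^ S * (l2n (-1) 1 (\<lambda>x. poly q x - f x))\<^sup>2"
proof -
  note d0 = delta_pos[OF S t \<delta>0]
  \<comment> \<open>Cut off to the interval, so that its total energy is the squared norm. The cut
    is invisible to the differences, because all nodes stay in [-1, 1].\<close>
  define e where "e z = (poly q z - f z) * indicator {-1..1} z" for z
  define E where "E = (l2n (-1) 1 (\<lambda>x. poly q x - f x))\<^sup>2"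
  have [measurable]: "poly q \<in> borel_measurable borel"
    by (intro borel_measurable_continuous_onI continuous_intros)
  have em [measurable]: "e \<in> borel_measurable borel" unfolding e_def by measurable
  define cd where "cd h \<delta> c x = central_diff S (inward_step \<delta> c x) h (x + real S / 2 * inward_step \<delta> c x)" for h \<delta> c x
  have cdm [measurable]: "(\<lambda>p. cd h (d p) (c p) (x p)) \<in> borel_measurable N"
    if [measurable]: "h \<in> borel_measurable borel" "d \<in> borel_measurable N" "c \<in> borel_measurable N" "x \<in> borel_measurable N"
    for h d c x and N :: "'z measure"
    unfolding cd_def by measurable
  define R where "R \<delta> c x = (indicator {-1<..<1} x * indicator {-t..t} c * indicator {\<delta>0..2 * \<delta>0} \<delta> :: ennreal)" for \<delta> c x :: real
  have Rm [measurable]: "(\<lambda>p. R (d p) (c p) (x p)) \<in> borel_measurable N"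
    if [measurable]: "d \<in> borel_measurable N" "c \<in> borel_measurable N" "x \<in> borel_measurable N" for d c x and N :: "'z measure"
    unfolding R_def by measurable
  define T where "T h = (\<integral>\<^sup>+ \<delta>. \<integral>\<^sup>+ c. \<integral>\<^sup>+ x. ennreal ((cd h \<delta> c x)\<^sup>2) * R \<delta> c x \<partial>lborel \<partial>lborel \<partial>lborel)" for h
  have Tf: "T f \<le> ennreal (120 * (real S)^3 * t^3 * M)"
    unfolding T_def cd_def R_def mult.assoc[symmetric]
    by (rule averaged_difference_bound[OF S t f M modulus, folded \<delta>0]) auto
  have enode: "(\<integral>\<^sup>+ z. ennreal ((e z)\<^sup>2) \<partial>lborel) = ennreal E"
  proof -
    have "(\<integral>\<^sup>+ z. ennreal ((e z)\<^sup>2) \<partial>lborel) = (\<integral>\<^sup>+ z. ennreal ((poly q z - f z)\<^sup>2) * indicator {-1..1} z \<partial>lborel)"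
      by (intro nn_integral_cong) (auto simp: e_def indicator_def)
    also have "\<dots> = ennreal E"
      unfolding E_def by (rule l2n_sq_lborel[symmetric]) (intro L2_diff fL poly_L2)
    finally show ?thesis .
  qed
  have Te: "T e \<le> ennreal ((real S + 1)\<^sup>2 * 4 ^ S * (8 * t * \<delta>0) * E)"
  proof -
    have point: "ennreal ((cd e \<delta> c x)\<^sup>2) * R \<delta> c x \<le> (\<Sum>i\<le>S. ennreal ((real S + 1) * 4 ^ S) * (ennreal ((e (node i \<delta> c x))\<^sup>2) * R \<delta> c x))" for \<delta> c x
    proof -
      have "(cd e \<delta> c x)\<^sup>2 \<le> real (S + 1) * 4 ^ S * (\<Sum>i\<le>S. (e (x + real S / 2 * inward_step \<delta> c x + (real i - real S / 2) * inward_step \<delta> c x))\<^sup>2)"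
        unfolding cd_def by (rule central_diff_sq_le)
      also have "(\<Sum>i\<le>S. (e (x + real S / 2 * inward_step \<delta> c x + (real i - real S / 2) * inward_step \<delta> c x))\<^sup>2)
          = (\<Sum>i\<le>S. (e (node i \<delta> c x))\<^sup>2)"
        by (intro sum.cong refl) (simp add: node_eq algebra_simps)
      finally have "ennreal ((cd e \<delta> c x)\<^sup>2) \<le> ennreal (\<Sum>i\<le>S. (real S + 1) * 4 ^ S * (e (node i \<delta> c x))\<^sup>2)"
        by (intro ennreal_leI) (simp add: sum_distrib_left add.commute)
      also have "\<dots> = (\<Sum>i\<le>S. ennreal ((real S + 1) * 4 ^ S * (e (node i \<delta> c x))\<^sup>2))"
        by (intro sum_ennreal[symmetric]) auto
      also have "\<dots> = (\<Sum>i\<le>S. ennreal ((real S + 1) * 4 ^ S) * ennreal ((e (node i \<delta> c x))\<^sup>2))"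
        by (intro sum.cong refl ennreal_mult) auto
      finally have "ennreal ((cd e \<delta> c x)\<^sup>2) * R \<delta> c x \<le> (\<Sum>i\<le>S. ennreal ((real S + 1) * 4 ^ S) * ennreal ((e (node i \<delta> c x))\<^sup>2)) * R \<delta> c x"
        by (intro mult_right_mono) auto
      then show ?thesis by (simp add: sum_distrib_right mult.assoc)
    qed
    have "T e \<le> (\<integral>\<^sup>+ \<delta>. \<integral>\<^sup>+ c. \<integral>\<^sup>+ x. (\<Sum>i\<le>S. ennreal ((real S + 1) * 4 ^ S) * (ennreal ((e (node i \<delta> c x))\<^sup>2) * R \<delta> c x)) \<partial>lborel \<partial>lborel \<partial>lborel)"
      unfolding T_def by (intro nn_integral_mono point)
    also have "\<dots> = (\<integral>\<^sup>+ \<delta>. \<integral>\<^sup>+ c. (\<Sum>i\<le>S. ennreal ((real S + 1) * 4 ^ S) * (\<integral>\<^sup>+ x. ennreal ((e (node i \<delta> c x))\<^sup>2) * R \<delta> c x \<partial>lborel)) \<partial>lborel \<partial>lborel)"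
      by (intro nn_integral_cong, subst nn_integral_sum) (auto intro!: sum.cong nn_integral_cmult)
    also have "\<dots> = (\<integral>\<^sup>+ \<delta>. (\<Sum>i\<le>S. ennreal ((real S + 1) * 4 ^ S) * (\<integral>\<^sup>+ c. \<integral>\<^sup>+ x. ennreal ((e (node i \<delta> c x))\<^sup>2) * R \<delta> c x \<partial>lborel \<partial>lborel)) \<partial>lborel)"
      by (intro nn_integral_cong, subst nn_integral_sum) (auto intro!: sum.cong nn_integral_cmult)
    also have "\<dots> = (\<Sum>i\<le>S. ennreal ((real S + 1) * 4 ^ S) * (\<integral>\<^sup>+ \<delta>. \<integral>\<^sup>+ c. \<integral>\<^sup>+ x. ennreal ((e (node i \<delta> c x))\<^sup>2) * R \<delta> c x \<partial>lborel \<partial>lborel \<partial>lborel))"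
      by (subst nn_integral_sum) (auto intro!: sum.cong nn_integral_cmult)
    also have "\<dots> \<le> (\<Sum>i\<le>S. ennreal ((real S + 1) * 4 ^ S) * ennreal (8 * t * \<delta>0 * E))"
    proof (intro sum_mono mult_left_mono)
      fix i assume "i \<in> {..S}"
      then have "(\<integral>\<^sup>+ \<delta>. \<integral>\<^sup>+ c. \<integral>\<^sup>+ x. ennreal ((e (node i \<delta> c x))\<^sup>2) * R \<delta> c x \<partial>lborel \<partial>lborel \<partial>lborel)
          \<le> ennreal (8 * t * \<delta>0) * (\<integral>\<^sup>+ z. ennreal ((e z)\<^sup>2) \<partial>lborel)"
        unfolding R_def mult.assoc[symmetric] by (intro node_energy[OF S t \<delta>0]) auto
      also have "\<dots> = ennreal (8 * t * \<delta>0 * E)"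
        unfolding enode using t d0 by (intro ennreal_mult[symmetric]) (auto simp: E_def)
      finally show "(\<integral>\<^sup>+ \<delta>. \<integral>\<^sup>+ c. \<integral>\<^sup>+ x. ennreal ((e (node i \<delta> c x))\<^sup>2) * R \<delta> c x \<partial>lborel \<partial>lborel \<partial>lborel) \<le> ennreal (8 * t * \<delta>0 * E)" .
    qed simp
    also have "\<dots> = (\<Sum>i\<le>S. ennreal ((real S + 1) * 4 ^ S * (8 * t * \<delta>0 * E)))"
      using t d0 by (intro sum.cong refl ennreal_mult[symmetric]) (auto simp: E_def)
    also have "\<dots> = ennreal (\<Sum>i\<le>S. (real S + 1) * 4 ^ S * (8 * t * \<delta>0 * E))"
      using t d0 by (intro sum_ennreal) (auto simp: E_def)
    also have "(\<Sum>i\<le>S. (real S + 1) * 4 ^ S * (8 * t * \<delta>0 * E)) = (real S + 1)\<^sup>2 * 4 ^ S * (8 * t * \<delta>0) * E"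
      by (simp add: power2_eq_square algebra_simps)
    finally show ?thesis .
  qed
  have Tq: "T (poly q) \<le> ennreal 2 * T f + ennreal 2 * T e"
  proof -
    have point: "ennreal ((cd (poly q) \<delta> c x)\<^sup>2) * R \<delta> c x
        \<le> ennreal 2 * (ennreal ((cd f \<delta> c x)\<^sup>2) * R \<delta> c x) + ennreal 2 * (ennreal ((cd e \<delta> c x)\<^sup>2) * R \<delta> c x)" for \<delta> c x
    proof (cases "x \<in> {-1<..<1} \<and> c \<in> {-t..t} \<and> \<delta> \<in> {\<delta>0..2 * \<delta>0}")
      case True
      have "poly q (node i \<delta> c x) = f (node i \<delta> c x) + e (node i \<delta> c x)" if "i \<le> S" for i
        using node_in[OF S t \<delta>0 that, of \<delta> c x] True by (auto simp: e_def indicator_def abs_le_iff)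
      then have "cd (poly q) \<delta> c x = cd f \<delta> c x + cd e \<delta> c x"
        unfolding cd_def node_difference[symmetric] by (simp add: distrib_left sum.distrib)
      then have "(cd (poly q) \<delta> c x)\<^sup>2 \<le> 2 * (cd f \<delta> c x)\<^sup>2 + 2 * (cd e \<delta> c x)\<^sup>2"
        using sum_squares_bound[of "cd f \<delta> c x" "cd e \<delta> c x"] by (simp add: power2_sum)
      then have "ennreal ((cd (poly q) \<delta> c x)\<^sup>2) \<le> ennreal (2 * (cd f \<delta> c x)\<^sup>2 + 2 * (cd e \<delta> c x)\<^sup>2)" by (rule ennreal_leI)
      also have "\<dots> = ennreal 2 * ennreal ((cd f \<delta> c x)\<^sup>2) + ennreal 2 * ennreal ((cd e \<delta> c x)\<^sup>2)"
        by (simp add: ennreal_mult)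
      finally show ?thesis using True by (simp add: R_def)
    qed (auto simp: R_def)
    have "T (poly q) \<le> (\<integral>\<^sup>+ \<delta>. \<integral>\<^sup>+ c. \<integral>\<^sup>+ x. ennreal 2 * (ennreal ((cd f \<delta> c x)\<^sup>2) * R \<delta> c x)
        + ennreal 2 * (ennreal ((cd e \<delta> c x)\<^sup>2) * R \<delta> c x) \<partial>lborel \<partial>lborel \<partial>lborel)"
      unfolding T_def by (intro nn_integral_mono point)
    also have "\<dots> = (\<integral>\<^sup>+ \<delta>. \<integral>\<^sup>+ c. ennreal 2 * (\<integral>\<^sup>+ x. ennreal ((cd f \<delta> c x)\<^sup>2) * R \<delta> c x \<partial>lborel)
        + ennreal 2 * (\<integral>\<^sup>+ x. ennreal ((cd e \<delta> c x)\<^sup>2) * R \<delta> c x \<partial>lborel) \<partial>lborel \<partial>lborel)"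
      by (intro nn_integral_cong, subst nn_integral_add) (auto intro!: arg_cong2[where f=plus] nn_integral_cmult)
    also have "\<dots> = (\<integral>\<^sup>+ \<delta>. ennreal 2 * (\<integral>\<^sup>+ c. \<integral>\<^sup>+ x. ennreal ((cd f \<delta> c x)\<^sup>2) * R \<delta> c x \<partial>lborel \<partial>lborel)
        + ennreal 2 * (\<integral>\<^sup>+ c. \<integral>\<^sup>+ x. ennreal ((cd e \<delta> c x)\<^sup>2) * R \<delta> c x \<partial>lborel \<partial>lborel) \<partial>lborel)"
      by (intro nn_integral_cong, subst nn_integral_add) (auto intro!: arg_cong2[where f=plus] nn_integral_cmult)
    also have "\<dots> = ennreal 2 * T f + ennreal 2 * T e"
      unfolding T_def by (subst nn_integral_add) (auto intro!: arg_cong2[where f=plus] nn_integral_cmult)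
    finally show ?thesis .
  qed
  define Q where "Q = cbox (\<delta>0, - t) (2 * \<delta>0, t)"
  define k where "k = 9 / (8 * t * \<delta>0)"
  have k: "0 \<le> k" using t d0 by (simp add: k_def)
  have "ennreal ((l2n (-1) 1 (poly (q - r)))\<^sup>2) = (\<integral>\<^sup>+ x. ennreal ((poly (q - r) x)\<^sup>2) * indicator {-1..1} x \<partial>lborel)"
    by (rule l2n_sq_lborel) simp
  also have "\<dots> = (\<integral>\<^sup>+ x. ennreal ((poly (q - r) x)\<^sup>2) * indicator {-1<..<1} x \<partial>lborel)"
    by (rule nn_integral_open_interval)
  also have "\<dots> \<le> (\<integral>\<^sup>+ x. ennreal k * (\<integral>\<^sup>+ \<delta>. \<integral>\<^sup>+ c. ennreal ((cd (poly q) \<delta> c x)\<^sup>2) * R \<delta> c x \<partial>lborel \<partial>lborel) \<partial>lborel)"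
  proof (rule nn_integral_mono)
    fix x
    show "ennreal ((poly (q - r) x)\<^sup>2) * indicator {-1<..<1} x
        \<le> ennreal k * (\<integral>\<^sup>+ \<delta>. \<integral>\<^sup>+ c. ennreal ((cd (poly q) \<delta> c x)\<^sup>2) * R \<delta> c x \<partial>lborel \<partial>lborel)"
    proof (cases "x \<in> {-1<..<1}")
      case True
      have "ennreal ((poly (q - r) x)\<^sup>2) = ennreal ((poly q x - smoothing S \<delta>0 t q x)\<^sup>2)"
        using r[of x] True by simp
      also have "\<dots> \<le> ennreal (k * integral Q (\<lambda>p. (cd (poly q) (fst p) (snd p) x)\<^sup>2))"
        unfolding k_def Q_def cd_def by (rule ennreal_leI[OF smoothing_error])
      also have "\<dots> = ennreal k * ennreal (integral Q (\<lambda>p. (cd (poly q) (fst p) (snd p) x)\<^sup>2))"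
        using k by (rule ennreal_mult')
      also have "ennreal (integral Q (\<lambda>p. (cd (poly q) (fst p) (snd p) x)\<^sup>2))
          = (\<integral>\<^sup>+ \<delta>. \<integral>\<^sup>+ c. ennreal ((cd (poly q) \<delta> c x)\<^sup>2) * indicator {-t..t} c * indicator {\<delta>0..2 * \<delta>0} \<delta> \<partial>lborel \<partial>lborel)"
        unfolding Q_def cd_def node_difference[symmetric]
        by (subst nn_integral_cbox_prod) (auto intro!: continuous_intros)
      also have "\<dots> = (\<integral>\<^sup>+ \<delta>. \<integral>\<^sup>+ c. ennreal ((cd (poly q) \<delta> c x)\<^sup>2) * R \<delta> c x \<partial>lborel \<partial>lborel)"
        using True by (simp add: R_def mult.assoc)
      finally show ?thesis using True by simp
    qed simp
  qed
  also have "\<dots> = ennreal k * (\<integral>\<^sup>+ x. \<integral>\<^sup>+ \<delta>. \<integral>\<^sup>+ c. ennreal ((cd (poly q) \<delta> c x)\<^sup>2) * R \<delta> c x \<partial>lborel \<partial>lborel \<partial>lborel)"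
    by (rule nn_integral_cmult) measurable
  also have "(\<integral>\<^sup>+ x. \<integral>\<^sup>+ \<delta>. \<integral>\<^sup>+ c. ennreal ((cd (poly q) \<delta> c x)\<^sup>2) * R \<delta> c x \<partial>lborel \<partial>lborel \<partial>lborel)
      = (\<integral>\<^sup>+ \<delta>. \<integral>\<^sup>+ x. \<integral>\<^sup>+ c. ennreal ((cd (poly q) \<delta> c x)\<^sup>2) * R \<delta> c x \<partial>lborel \<partial>lborel \<partial>lborel)"
    by (rule nn_integral_swap) measurable
  also have "\<dots> = T (poly q)"
    unfolding T_def by (intro nn_integral_cong nn_integral_swap) measurable
  also have "ennreal k * T (poly q) \<le> ennreal k * (ennreal 2 * ennreal (120 * (real S)^3 * t^3 * M)
      + ennreal 2 * ennreal ((real S + 1)\<^sup>2 * 4 ^ S * (8 * t * \<delta>0) * E))"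
    using order_trans[OF Tq add_mono[OF mult_left_mono[OF Tf] mult_left_mono[OF Te]]]
    by (intro mult_left_mono) auto
  also have "\<dots> = ennreal (k * (2 * (120 * (real S)^3 * t^3 * M) + 2 * ((real S + 1)\<^sup>2 * 4 ^ S * (8 * t * \<delta>0) * E)))"
  proof -
    have 1: "0 \<le> 120 * (real S)^3 * t^3 * M" using t M by simp
    have 2: "0 \<le> (real S + 1)\<^sup>2 * 4 ^ S * (8 * t * \<delta>0) * E" using t d0 by (simp add: E_def)
    show ?thesis using k 1 2 by (simp only: ennreal_mult[symmetric] ennreal_plus[symmetric] mult_nonneg_nonneg add_nonneg_nonneg zero_le_numeral)
  qed
  \<comment> \<open>Since \<open>t \<delta>0 = S t^3\<close>, all powers of \<open>t\<close> cancel;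
    270 is \<open>(9 / 8) * 2 * 120\<close> and 18 is \<open>(9 / 8) * 2 * 8\<close>.\<close>
  also have "k * (2 * (120 * (real S)^3 * t^3 * M) + 2 * ((real S + 1)\<^sup>2 * 4 ^ S * (8 * t * \<delta>0) * E))
      = 270 * (real S)\<^sup>2 * M + 18 * (real S + 1)\<^sup>2 * 4 ^ S * E"
  proof -
    have "k * (2 * (120 * (real S)^3 * t^3 * M)) = 270 * (real S)\<^sup>2 * M"
      using S t by (simp add: k_def \<delta>0 power2_eq_square power3_eq_cube)
    moreover have "k * (2 * ((real S + 1)\<^sup>2 * 4 ^ S * (8 * t * \<delta>0) * E)) = 18 * (real S + 1)\<^sup>2 * 4 ^ S * E"
      using t d0 by (simp add: k_def)
    ultimately show ?thesis unfolding distrib_left by (rule arg_cong2[where f = "(+)"])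
  qed
  finally show ?thesis using M unfolding E_def by (subst (asm) ennreal_le_iff) auto
qed

end

section \<open>Jackson's inequality\<close>

lemma l2n_dominated_tendsto:
  assumes u: "\<And>n. u n \<in> borel_measurable (interval_measure a b)"
    and lim: "AE x in interval_measure a b. (\<lambda>n. u n x) \<longlonglongrightarrow> 0"
    and bound: "\<And>n x. x \<in> {a..b} \<Longrightarrow> \<bar>u n x\<bar> \<le> w x" and w: "w \<in> L2 a b"
  shows "(\<lambda>n. l2n a b (u n)) \<longlonglongrightarrow> 0"
proof -
  have "(\<lambda>n. L2inner a b (u n) (u n)) \<longlonglongrightarrow> (\<integral>x. 0 \<partial>interval_measure a b)"
    unfolding L2inner_def
  proof (rule integral_dominated_convergence[where w = "\<lambda>x. (w x)\<^sup>2"])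
    show "integrable (interval_measure a b) (\<lambda>x. (w x)\<^sup>2)" using w by (simp add: L2_iff)
    show "AE x in interval_measure a b. (\<lambda>n. u n x * u n x) \<longlonglongrightarrow> 0"
      using lim by eventually_elim (auto intro: tendsto_mult_zero)
    show "AE x in interval_measure a b. norm (u n x * u n x) \<le> (w x)\<^sup>2" for n
    proof (rule AE_I2)
      fix x assume "x \<in> space (interval_measure a b)"
      then have "\<bar>u n x\<bar> \<le> w x" using bound by (simp add: space_restrict_space)
      then have "(u n x)\<^sup>2 \<le> (w x)\<^sup>2" by (simp add: abs_le_square_iff[symmetric])
      then show "norm (u n x * u n x) \<le> (w x)\<^sup>2" by (simp add: power2_eq_square)
    qed
    show "(\<lambda>x. u n x * u n x) \<in> borel_measurable (interval_measure a b)" for n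
      by (intro borel_measurable_times u)
  qed simp
  then have "(\<lambda>n. sqrt (L2inner a b (u n) (u n))) \<longlonglongrightarrow> sqrt 0"
    by (intro tendsto_real_sqrt) simp
  then show ?thesis by (simp add: l2n_def)
qed

text \<open>Three approximations with error \<epsilon>/3 each: truncate, approximate the truncated
  function by continuous ones, and apply the Weierstrass theorem. Truncating the continuous
  functions as well provides the domination for the second step.\<close>

lemma polynomials_dense:
  assumes f: "f \<in> L2 a b" and \<epsilon>: "0 < \<epsilon>"
  shows "\<exists>q. l2n a b (\<lambda>x. poly q x - f x) < \<epsilon>"
proof -
  define clamp :: "nat \<Rightarrow> real \<Rightarrow> real" where "clamp k y = max (- real k) (min (real k) y)" for k y
  note fm [measurable] = L2_measurable[OF f]
  have clampm [measurable]: "clamp k \<in> borel_measurable borel" for k unfolding clamp_def by measurable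
  have clamp_le: "\<bar>clamp k y\<bar> \<le> real k" for k y by (auto simp: clamp_def)
  have "(\<lambda>k. l2n a b (\<lambda>x. clamp k (f x) - f x)) \<longlonglongrightarrow> 0"
  proof (rule l2n_dominated_tendsto[where w = "\<lambda>x. \<bar>f x\<bar>"])
    show "AE x in interval_measure a b. (\<lambda>k. clamp k (f x) - f x) \<longlonglongrightarrow> 0"
    proof (rule AE_I2)
      fix x
      have "\<forall>\<^sub>F k in sequentially. clamp k (f x) - f x = 0"
        using eventually_ge_at_top[of "nat \<lceil>\<bar>f x\<bar>\<rceil>"]
      proof eventually_elim
        case (elim k)
        then have "\<bar>f x\<bar> \<le> real k" by linarith
        then show ?case by (auto simp: clamp_def)
      qed
      then show "(\<lambda>k. clamp k (f x) - f x) \<longlonglongrightarrow> 0" by (rule tendsto_eventually)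
    qed
    show "\<bar>clamp k (f x) - f x\<bar> \<le> \<bar>f x\<bar>" for k x by (auto simp: clamp_def)
    show "(\<lambda>x. \<bar>f x\<bar>) \<in> L2 a b" using f by (simp add: L2_iff)
  qed measurable
  then have "\<forall>\<^sub>F k in sequentially. l2n a b (\<lambda>x. clamp k (f x) - f x) < \<epsilon> / 3"
    by (rule order_tendstoD) (use \<epsilon> in simp)
  then obtain k where k: "l2n a b (\<lambda>x. clamp k (f x) - f x) < \<epsilon> / 3"
    using eventually_happens'[OF sequentially_bot] by blast
  define F where "F x = indicator {a..b} x *\<^sub>R clamp k (f x)" for x
  have kf: "(\<lambda>x. clamp k (f x)) \<in> borel_measurable (interval_measure a b)"
    by (rule measurable_compose[OF fm clampm])
  then have "F \<in> borel_measurable lborel"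
    unfolding F_def by (subst (asm) borel_measurable_restrict_space_iff) auto
  then have "F \<in> borel_measurable lebesgue" by (rule measurable_completion)
  \<comment> \<open>This notion of measurability provides continuous functions converging outside a
    negligible set.\<close>
  then have "F measurable_on UNIV" by (rule lebesgue_measurable_imp_measurable_on) simp
  then obtain N g where N: "negligible N" and g: "\<And>n. continuous_on UNIV (g n)"
    and lim: "\<And>x. x \<notin> N \<Longrightarrow> (\<lambda>n. g n x) \<longlonglongrightarrow> F x"
    unfolding measurable_on_def by auto
  have gm [measurable]: "g n \<in> borel_measurable borel" for n
    by (rule borel_measurable_continuous_onI[OF g])
  have "AE x in lborel. x \<notin> N"
    using AE_not_in[of N lebesgue] N by (simp add: negligible_iff_null_sets AE_completion_iff)
  then have AN: "AE x in interval_measure a b. x \<notin> N"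
    by (subst AE_restrict_space_iff) auto
  have "(\<lambda>n. l2n a b (\<lambda>x. clamp k (g n x) - clamp k (f x))) \<longlonglongrightarrow> 0"
  proof (rule l2n_dominated_tendsto[where w = "\<lambda>x. 2 * real k"])
    have "AE x in interval_measure a b. x \<in> {a..b}" by (rule AE_I2) (simp add: space_restrict_space)
    with AN show "AE x in interval_measure a b. (\<lambda>n. clamp k (g n x) - clamp k (f x)) \<longlonglongrightarrow> 0"
    proof eventually_elim
      case (elim x)
      have "(\<lambda>n. clamp k (g n x)) \<longlonglongrightarrow> clamp k (F x)"
        unfolding clamp_def by (intro tendsto_intros lim elim)
      moreover have "clamp k (F x) = clamp k (f x)" using elim by (auto simp: F_def clamp_def)
      ultimately show ?case by (simp add: LIM_zero)
    qed
    show "\<bar>clamp k (g n x) - clamp k (f x)\<bar> \<le> 2 * real k" for n x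
      using clamp_le[of k "g n x"] clamp_le[of k "f x"] by linarith
    show "(\<lambda>x. clamp k (g n x) - clamp k (f x)) \<in> borel_measurable (interval_measure a b)" for n
      by (intro borel_measurable_diff kf measurable_restrict_space1) measurable
  qed (auto intro: L2_continuous)
  then have "\<forall>\<^sub>F n in sequentially. l2n a b (\<lambda>x. clamp k (g n x) - clamp k (f x)) < \<epsilon> / 3"
    by (rule order_tendstoD) (use \<epsilon> in simp)
  then obtain n where n: "l2n a b (\<lambda>x. clamp k (g n x) - clamp k (f x)) < \<epsilon> / 3"
    using eventually_happens'[OF sequentially_bot] by blast
  define c where "c x = clamp k (g n x)" for x
  have c: "continuous_on {a..b} c"
    unfolding c_def clamp_def by (intro continuous_intros continuous_on_subset[OF g]) auto
  define L where "L = l2n a b (\<lambda>_. 1)"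
  define e where "e = \<epsilon> / (3 * (1 + L))"
  have L: "0 \<le> L" by (simp add: L_def)
  have e: "0 < e" "e * L < \<epsilon> / 3" using \<epsilon> L by (auto simp: e_def field_simps)
  obtain h where h: "real_polynomial_function h" "\<And>x. x \<in> {a..b} \<Longrightarrow> \<bar>c x - h x\<bar> < e"
    using Stone_Weierstrass_real_polynomial_function[OF compact_Icc c e(1)] by blast
  obtain co d where hc: "h = (\<lambda>x. \<Sum>i\<le>d. co i * x ^ i)"
    using h(1) unfolding real_polynomial_function_iff_sum by blast
  define q where "q = (\<Sum>i\<le>d. monom (co i) i)"
  have q: "poly q x = h x" for x by (simp add: q_def hc poly_sum poly_monom)
  have cL: "c \<in> L2 a b" by (rule L2_continuous[OF c])
  have kL: "(\<lambda>x. clamp k (f x)) \<in> L2 a b" by (rule L2_bounded[OF kf clamp_le])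
  have "l2n a b (\<lambda>x. poly q x - c x) \<le> l2n a b (\<lambda>_. e * 1)"
  proof (rule l2n_mono)
    fix x assume "x \<in> {a..b}"
    then show "\<bar>poly q x - c x\<bar> \<le> \<bar>e * 1\<bar>" using h(2)[of x] e by (simp add: q abs_minus_commute)
  qed (auto intro!: L2_diff cL poly_L2 L2_continuous[OF continuous_on_const])
  also have "\<dots> = e * L" unfolding l2n_cmult L_def using e by simp
  finally have 1: "l2n a b (\<lambda>x. poly q x - c x) < \<epsilon> / 3" using e by linarith
  have "l2n a b (\<lambda>x. poly q x - f x) \<le> l2n a b (\<lambda>x. poly q x - c x) + l2n a b (\<lambda>x. c x - f x)"
    by (intro l2n_triangle_diff poly_L2 cL f)
  also have "l2n a b (\<lambda>x. c x - f x) \<le> l2n a b (\<lambda>x. c x - clamp k (f x)) + l2n a b (\<lambda>x. clamp k (f x) - f x)"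
    by (intro l2n_triangle_diff kL cL f)
  finally have "l2n a b (\<lambda>x. poly q x - f x) < \<epsilon>" using 1 k n unfolding c_def by linarith
  then show ?thesis by blast
qed

text \<open>Let \<open>d\<close> be the distance of a nearby polynomial \<open>q\<close>, of any
  degree, to degree below \<open>m\<close>, attained at \<open>p\<close>. Smoothing \<open>q\<close>
  is smoothing \<open>p\<close>, which keeps the degree below \<open>m\<close>, plus smoothing
  \<open>q - p\<close>, whose weighted gradient is at most \<open>(m / 2) d\<close> and which is
  therefore within \<open>d / 2\<close> of such polynomials. Hence \<open>d\<close> is at most the
  smoothing error plus \<open>d / 2\<close>.\<close>

lemma jackson:
  assumes F [measurable]: "F \<in> borel_measurable borel" and FL: "F \<in> L2 (-1) 1"
    and A: "0 < A" and \<alpha>: "0 \<le> \<alpha>" and S: "0 < S" and m: "96 * (real S)\<^sup>2 * 2 ^ S \<le> real m"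
    and modulus: "\<And>h. 0 < h \<Longrightarrow>
      (\<integral>\<^sup>+ y. ennreal ((sym_difference (-1) 1 S (h * circle_weight y) F y)\<^sup>2) * indicator {-1..1} y \<partial>lborel)
        \<le> ennreal ((A * h powr \<alpha>)\<^sup>2)"
  defines "c \<equiv> sqrt (270 * (real S)\<^sup>2 * ((6 * real S) powr \<alpha>)\<^sup>2 + 18 * (real S + 1)\<^sup>2 * 4 ^ S)"
  shows "\<exists>p. deg_less m p \<and> l2n (-1) 1 (\<lambda>x. F x - poly p x)
    \<le> (1 + 2 * c) * (24 * real S * 2 ^ S) powr \<alpha> * A * real m powr - \<alpha>"
proof -
  have "0 < 96 * (real S)\<^sup>2 * 2 ^ S" using S by simp
  then have m0: "0 < real m" using m by linarith
  \<comment> \<open>Twice the constant \<open>12 S 2^S\<close> of the gradient bound, so that the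
    bound becomes \<open>m / 2\<close>. The requirement on \<open>m\<close> is
    \<open>4 S t \<le> 1\<close>.\<close>
  define t where "t = 24 * real S * 2 ^ S / real m"
  define \<delta>0 where "\<delta>0 = real S * t\<^sup>2"
  have t: "0 < t" using S m0 by (simp add: t_def)
  have t4: "t * (4 * real S) \<le> 1" using m m0 by (simp add: t_def power2_eq_square field_simps)
  define \<eta> where "\<eta> = A * t powr \<alpha>"
  have \<eta>: "0 < \<eta>" using A t by (simp add: \<eta>_def)
  obtain q where q: "l2n (-1) 1 (\<lambda>x. poly q x - F x) < \<eta>"
    using polynomials_dense[OF FL \<eta>] by blast
  obtain p where p: "deg_less m p" "\<And>r. deg_less m r \<Longrightarrow> l2n (-1) 1 (poly (q - p)) \<le> l2n (-1) 1 (poly (q - r))"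
    using best_approximation[of m q] by blast
  define d where "d = l2n (-1) 1 (poly (q - p))"
  obtain rp where rp: "deg_less m rp" "\<And>x. x \<in> {-1..1} \<Longrightarrow> smoothing S \<delta>0 t p x = poly rp x"
    using smoothing_poly[OF S t t4 \<delta>0_def p(1)] by blast
  have "deg_less (Suc (degree (q - p))) (q - p)" by (simp add: deg_less_def)
  from smoothing_poly[OF S t t4 \<delta>0_def this] obtain rg
    where rg: "\<And>x. x \<in> {-1..1} \<Longrightarrow> smoothing S \<delta>0 t (q - p) x = poly rg x"
      "integral {-1..1} (\<lambda>x. (1 - x\<^sup>2) * (poly (pderiv rg) x)\<^sup>2) \<le> (12 * real S * 2 ^ S / t)\<^sup>2 * d\<^sup>2"
    unfolding d_def by blast
  obtain p' where p': "deg_less m p'"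
    "(real m)\<^sup>2 * (l2n (-1) 1 (poly (rg - p')))\<^sup>2 \<le> integral {-1..1} (\<lambda>x. (1 - x\<^sup>2) * (poly (pderiv rg) x)\<^sup>2)"
    using best_approximation[of m rg] by blast
  \<comment> \<open>The Legendre operator gains a factor \<open>1 / m\<close> over the weighted
    gradient, which is at most \<open>(m / 2) d\<close>.\<close>
  have "l2n (-1) 1 (poly (rg - p')) \<le> d / 2"
  proof -
    have "12 * real S * 2 ^ S / t = real m / 2" using S m0 by (simp add: t_def)
    then have "(real m)\<^sup>2 * (l2n (-1) 1 (poly (rg - p')))\<^sup>2 \<le> (real m / 2)\<^sup>2 * d\<^sup>2"
      using order_trans[OF p'(2) rg(2)] by (simp only:)
    then have "(real m)\<^sup>2 * (l2n (-1) 1 (poly (rg - p')))\<^sup>2 \<le> (real m)\<^sup>2 * (d / 2)\<^sup>2"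
      by (simp add: power_divide)
    then have "(l2n (-1) 1 (poly (rg - p')))\<^sup>2 \<le> (d / 2)\<^sup>2"
      using m0 by (simp only: mult_le_cancel_left_pos zero_less_power)
    then show ?thesis by (rule power2_le_imp_le) (simp add: d_def)
  qed
  moreover have "l2n (-1) 1 (poly (q - (rp + rg))) \<le> c * \<eta>"
  proof -
    define M where "M = (A * (6 * real S * t) powr \<alpha>)\<^sup>2"
    have "(l2n (-1) 1 (poly (q - (rp + rg))))\<^sup>2
        \<le> 270 * (real S)\<^sup>2 * M + 18 * (real S + 1)\<^sup>2 * 4 ^ S * (l2n (-1) 1 (\<lambda>x. poly q x - F x))\<^sup>2"
    proof (rule smoothing_error_norm[OF S t t4 \<delta>0_def F FL])
      show "0 \<le> M" by (simp add: M_def)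
      fix h :: real assume h: "0 < h" "h \<le> 6 * real S * t"
      have "(A * h powr \<alpha>)\<^sup>2 \<le> M"
        unfolding M_def using A h \<alpha> by (intro power_mono mult_left_mono powr_mono2) auto
      then show "(\<integral>\<^sup>+ y. ennreal ((sym_difference (-1) 1 S (h * circle_weight y) F y)\<^sup>2) * indicator {-1..1} y \<partial>lborel) \<le> ennreal M"
        using modulus[OF h(1)] by (meson ennreal_leI order_trans)
    next
      fix x :: real assume x: "x \<in> {-1..1}"
      have "smoothing S \<delta>0 t (p + (q - p)) x = poly (rp + rg) x"
        by (simp only: smoothing_add[OF S t t4 \<delta>0_def] rp(2)[OF x] rg(1)[OF x] poly_add)
      then show "smoothing S \<delta>0 t q x = poly (rp + rg) x" by simp
    qed
    also have "\<dots> \<le> 270 * (real S)\<^sup>2 * M + 18 * (real S + 1)\<^sup>2 * 4 ^ S * \<eta>\<^sup>2"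
      using q by (intro add_left_mono mult_left_mono power_mono) auto
    also have "M = ((6 * real S) powr \<alpha>)\<^sup>2 * \<eta>\<^sup>2"
      using t by (simp add: M_def \<eta>_def powr_mult power_mult_distrib)
    also have "270 * (real S)\<^sup>2 * (((6 * real S) powr \<alpha>)\<^sup>2 * \<eta>\<^sup>2) + 18 * (real S + 1)\<^sup>2 * 4 ^ S * \<eta>\<^sup>2 = (c * \<eta>)\<^sup>2"
      by (simp add: c_def power_mult_distrib algebra_simps)
    finally show ?thesis by (rule power2_le_imp_le) (use \<eta> in \<open>simp add: c_def\<close>)
  qed
  moreover have "d \<le> l2n (-1) 1 (poly (q - (rp + rg))) + l2n (-1) 1 (poly (rg - p'))"
  proof -
    have "d \<le> l2n (-1) 1 (poly (q - (rp + p')))" unfolding d_def by (intro p(2) deg_less_add rp p'(1))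
    also have "poly (q - (rp + p')) = (\<lambda>x. poly (q - (rp + rg)) x + poly (rg - p') x)" by auto
    also have "l2n (-1) 1 \<dots> \<le> l2n (-1) 1 (poly (q - (rp + rg))) + l2n (-1) 1 (poly (rg - p'))"
      by (intro l2n_triangle poly_L2)
    finally show ?thesis .
  qed
  \<comment> \<open>The term \<open>d / 2\<close> is absorbed into the left side.\<close>
  ultimately have d: "d \<le> 2 * (c * \<eta>)" by linarith
  have "l2n (-1) 1 (\<lambda>x. F x - poly p x) \<le> l2n (-1) 1 (\<lambda>x. F x - poly q x) + l2n (-1) 1 (\<lambda>x. poly q x - poly p x)"
    by (intro l2n_triangle_diff FL poly_L2)
  also have "\<dots> \<le> \<eta> + 2 * (c * \<eta>)"
    using q d by (simp add: d_def poly_diff[abs_def] l2n_minus_commute[of _ _ F])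
  also have "\<dots> = (1 + 2 * c) * (24 * real S * 2 ^ S) powr \<alpha> * A * real m powr - \<alpha>"
    using m0 by (simp add: \<eta>_def t_def powr_divide powr_minus_divide algebra_simps)
  finally show ?thesis using p(1) by blast
qed

section \<open>Approximation of smooth functions by Poisson masses\<close>

lemma L2norm_leD:
  assumes "L2norm a b g \<le> ennreal R" "0 \<le> R"
  shows "(\<integral>\<^sup>+ x. ennreal ((g x)\<^sup>2) \<partial>interval_measure a b) \<le> ennreal (R\<^sup>2)"
proof -
  define I where "I = (\<integral>\<^sup>+ x. ennreal ((g x)\<^sup>2) \<partial>interval_measure a b)"
  have I: "I \<noteq> \<infinity>"
  proof
    assume "I = \<infinity>"
    then have "L2norm a b g = \<infinity>" by (simp add: L2norm_def Let_def I_def)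
    then show False using assms(1) by (simp add: top_unique)
  qed
  then have "ennreal (sqrt (enn2real I)) \<le> ennreal R"
    using assms(1) by (simp only: L2norm_def Let_def I_def[symmetric] if_False)
  then have "sqrt (enn2real I) \<le> R" using assms(2) by (simp add: ennreal_le_iff)
  then have "(sqrt (enn2real I))\<^sup>2 \<le> R\<^sup>2" by (intro power_mono) auto
  then have "enn2real I \<le> R\<^sup>2" by simp
  then have "ennreal (enn2real I) \<le> ennreal (R\<^sup>2)" by (rule ennreal_leI)
  then show ?thesis using I by (simp add: I_def ennreal_enn2real_if)
qed

lemma nn_integral_affine_interval:
  fixes G :: "real \<Rightarrow> ennreal"
  assumes "G \<in> borel_measurable borel" "a < b"
  shows "(\<integral>\<^sup>+ x. G x * indicator {a..b} x \<partial>lborel)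
    = ennreal ((b - a) / 2) * (\<integral>\<^sup>+ y. G ((a + b) / 2 + (b - a) / 2 * y) * indicator {-1..1} y \<partial>lborel)"
proof -
  note [measurable] = assms(1)
  have ind: "indicator {a..b} ((a + b) / 2 + (b - a) / 2 * y) = (indicator {-1..1} y :: ennreal)" for y
  proof -
    have "a \<le> (a + b) / 2 + (b - a) / 2 * y \<longleftrightarrow> (b - a) * (-1) \<le> (b - a) * y"
      "(a + b) / 2 + (b - a) / 2 * y \<le> b \<longleftrightarrow> (b - a) * y \<le> (b - a) * 1"
      by (auto simp: field_simps)
    then show ?thesis using assms(2) by (simp only: mult_le_cancel_left_pos diff_gt_0_iff_gt indicator_def atLeastAtMost_iff)
  qed
  have "(\<integral>\<^sup>+ x. G x * indicator {a..b} x \<partial>lborel) = ennreal \<bar>(b - a) / 2\<bar> *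
      (\<integral>\<^sup>+ y. G ((a + b) / 2 + (b - a) / 2 * y) * indicator {a..b} ((a + b) / 2 + (b - a) / 2 * y) \<partial>lborel)"
    using assms(2) by (intro nn_integral_real_affine) auto
  then show ?thesis using assms(2) unfolding ind by simp
qed

lemma l2n_affine:
  assumes u [measurable]: "u \<in> borel_measurable borel" and ab: "a < b" and uL: "u \<in> L2 a b"
  shows "(\<lambda>y. u ((a + b) / 2 + (b - a) / 2 * y)) \<in> L2 (-1) 1"
    and "l2n a b u = sqrt ((b - a) / 2) * l2n (-1) 1 (\<lambda>y. u ((a + b) / 2 + (b - a) / 2 * y))"
proof -
  define v where "v y = u ((a + b) / 2 + (b - a) / 2 * y)" for y
  have [measurable]: "v \<in> borel_measurable borel" unfolding v_def by measurable
  have eq: "ennreal ((l2n a b u)\<^sup>2) = ennreal ((b - a) / 2) * (\<integral>\<^sup>+ y. ennreal ((v y)\<^sup>2) * indicator {-1..1} y \<partial>lborel)"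
    unfolding l2n_sq_lborel[OF uL] v_def by (rule nn_integral_affine_interval) (use ab in auto)
  then have "(\<integral>\<^sup>+ y. ennreal ((v y)\<^sup>2) * indicator {-1..1} y \<partial>lborel) < \<infinity>"
    using ab by (metis ennreal_mult_eq_top_iff ennreal_neq_top ennreal_eq_0_iff diff_gt_0_iff_gt half_gt_zero
        infinity_ennreal_def not_le top.not_eq_extremum)
  then have "v \<in> L2 (-1) 1"
    by (simp add: L2_iff integrable_iff_bounded nn_integral_restrict_space measurable_restrict_space1)
  then show "(\<lambda>y. u ((a + b) / 2 + (b - a) / 2 * y)) \<in> L2 (-1) 1" unfolding v_def .
  have "ennreal ((l2n a b u)\<^sup>2) = ennreal ((b - a) / 2 * (l2n (-1) 1 v)\<^sup>2)"
    unfolding eq l2n_sq_lborel[OF \<open>v \<in> L2 (-1) 1\<close>, symmetric] using ab by (intro ennreal_mult[symmetric]) auto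
  then have "(l2n a b u)\<^sup>2 = (sqrt ((b - a) / 2) * l2n (-1) 1 v)\<^sup>2"
    using ab by (simp add: power_mult_distrib)
  then show "l2n a b u = sqrt ((b - a) / 2) * l2n (-1) 1 (\<lambda>y. u ((a + b) / 2 + (b - a) / 2 * y))"
    unfolding v_def[symmetric] using ab by (simp add: power2_eq_iff_nonneg)
qed

lemma sym_difference_cong:
  assumes "\<And>z. z \<in> {a..b} \<Longrightarrow> f z = g z"
  shows "sym_difference a b s h f x = sym_difference a b s h g x"
proof (cases "x - real s / 2 * h \<in> {a..b} \<and> x + real s / 2 * h \<in> {a..b}")
  case True
  have "f (x + (real i - real s / 2) * h) = g (x + (real i - real s / 2) * h)" if "i \<le> s" for i
  proof (rule assms)
    have "real i \<le> real s" using that by simp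
    then have "\<bar>real i - real s / 2\<bar> \<le> real s / 2" by linarith
    then have "\<bar>(real i - real s / 2) * h\<bar> \<le> real s / 2 * \<bar>h\<bar>"
      unfolding abs_mult by (rule mult_right_mono) simp
    moreover have "real s / 2 * \<bar>h\<bar> = \<bar>real s / 2 * h\<bar>" by (simp add: abs_mult)
    ultimately show "x + (real i - real s / 2) * h \<in> {a..b}" using True
      by (smt (verit) atLeastAtMost_iff)
  qed
  then show ?thesis by (simp add: sym_difference_def)
qed (simp only: sym_difference_def if_False)

text \<open>The weight \<phi> scales like the variable, so a step \<open>h \<phi>\<close> keeps its
  \<open>h\<close> under affine maps and the modulus changes only by the Jacobian.\<close>

lemma sym_difference_affine:
  assumes "a < b"
  defines "c \<equiv> (a + b) / 2" and "\<rho> \<equiv> (b - a) / 2"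
  shows "sym_difference a b s (h * step_weight a b (c + \<rho> * y)) f (c + \<rho> * y)
    = sym_difference (-1) 1 s (h * circle_weight y) (\<lambda>y. f (c + \<rho> * y)) y"
proof -
  have \<rho>: "0 < \<rho>" using assms by simp
  have w: "step_weight a b (c + \<rho> * y) = \<rho> * circle_weight y"
  proof -
    have "(c + \<rho> * y - a) * (b - (c + \<rho> * y)) = \<rho>\<^sup>2 * ((y - (-1)) * (1 - y))"
      by (simp add: c_def \<rho>_def power2_eq_square field_simps)
    then show ?thesis using \<rho> by (simp only: step_weight_def real_sqrt_mult real_sqrt_abs abs_of_pos)
  qed
  have iff: "c + \<rho> * z \<in> {a..b} \<longleftrightarrow> z \<in> {-1..1}" for z
  proof -
    have "a \<le> c + \<rho> * z \<longleftrightarrow> \<rho> * (-1) \<le> \<rho> * z" "c + \<rho> * z \<le> b \<longleftrightarrow> \<rho> * z \<le> \<rho> * 1"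
      by (auto simp: c_def \<rho>_def field_simps)
    then show ?thesis using \<rho> by (simp only: mult_le_cancel_left_pos atLeastAtMost_iff)
  qed
  have node: "c + \<rho> * y + k * (h * (\<rho> * circle_weight y)) = c + \<rho> * (y + k * (h * circle_weight y))" for k
    by (simp add: algebra_simps)
  have node': "c + \<rho> * y - k * (h * (\<rho> * circle_weight y)) = c + \<rho> * (y - k * (h * circle_weight y))" for k
    by (simp add: algebra_simps)
  show ?thesis unfolding sym_difference_def w node node' iff ..
qed

text \<open>The Jacobian \<open>\<rho>\<close> appears as \<open>1 / sqrt \<rho>\<close> in the
  modulus on [-1, 1] and as \<open>sqrt \<rho>\<close> when the norm is transported back, so it
  cancels.\<close>

lemma jackson_interval:
  assumes ab: "a < b" and \<alpha>: "0 \<le> \<alpha>"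
  shows "\<exists>K N. 0 \<le> K \<and> (\<forall>f\<in>smooth_class a b \<alpha> C. 0 < C \<longrightarrow>
    (\<forall>m\<ge>N. \<exists>p. deg_less m p \<and> l2n a b (\<lambda>x. f x - poly p x) \<le> K * C * real m powr - \<alpha>))"
proof -
  define S where "S = nat \<lfloor>\<alpha>\<rfloor> + 1"
  define c where "c = sqrt (270 * (real S)\<^sup>2 * ((6 * real S) powr \<alpha>)\<^sup>2 + 18 * (real S + 1)\<^sup>2 * 4 ^ S)"
  define K where "K = (1 + 2 * c) * (24 * real S * 2 ^ S) powr \<alpha>"
  define N where "N = nat \<lceil>96 * (real S)\<^sup>2 * 2 ^ S\<rceil>"
  define x0 where "x0 = (a + b) / 2"
  define \<rho> where "\<rho> = (b - a) / 2"
  have \<rho>: "0 < \<rho>" using ab by (simp add: \<rho>_def)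
  have S: "0 < S" by (simp add: S_def)
  have K: "0 \<le> K" by (simp add: K_def c_def)
  have "\<exists>p. deg_less m p \<and> l2n a b (\<lambda>x. f x - poly p x) \<le> K * C * real m powr - \<alpha>"
    if f: "f \<in> smooth_class a b \<alpha> C" and C: "0 < C" and m: "N \<le> m" for f m
  proof -
    have fL: "f \<in> L2 a b" using f by (simp add: smooth_class_def)
    \<comment> \<open>A representative that is Borel on the whole line, as the changes of variable
      require; the differences see only values inside [a, b].\<close>
    define g where "g x = indicator {a..b} x *\<^sub>R f x" for x
    have [measurable]: "g \<in> borel_measurable borel"
      using L2_measurable[OF fL] unfolding g_def by (subst (asm) borel_measurable_restrict_space_iff) auto
    have g: "g x = f x" if "x \<in> {a..b}" for x using that by (simp add: g_def)
    have gL: "g \<in> L2 a b"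
    proof -
      have "g \<in> borel_measurable (interval_measure a b)" by (rule measurable_restrict_space1) measurable
      moreover have "L2norm a b g = L2norm a b f"
        unfolding L2norm_def by (intro arg_cong[where f = "\<lambda>I. let I = I in _ I"] nn_integral_cong)
          (simp add: space_restrict_space g)
      ultimately show ?thesis using fL by (simp add: L2_def)
    qed
    define F where "F y = g (x0 + \<rho> * y)" for y
    have Fm [measurable]: "F \<in> borel_measurable borel" unfolding F_def by measurable
    have FL: "F \<in> L2 (-1) 1"
      unfolding F_def x0_def \<rho>_def by (rule l2n_affine(1)[OF _ ab gL]) measurable
    have "\<exists>p. deg_less m p \<and> l2n (-1) 1 (\<lambda>x. F x - poly p x) \<le> K * (C / sqrt \<rho>) * real m powr - \<alpha>"
      unfolding K_def c_def
    proof (rule jackson[OF Fm FL _ \<alpha> S])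
      show "0 < C / sqrt \<rho>" using C \<rho> by simp
      show "96 * (real S)\<^sup>2 * 2 ^ S \<le> real m" using m unfolding N_def by linarith
      fix h :: real assume h: "0 < h"
      define D where "D x = sym_difference a b S (h * step_weight a b x) g x" for x
      have [measurable]: "D \<in> borel_measurable borel"
        unfolding D_def[abs_def] sym_difference_def step_weight_def by measurable
      have "L2norm a b (\<lambda>x. sym_difference a b S (h * step_weight a b x) f x) \<le> modulus a b S f h"
        unfolding modulus_def using h by (intro SUP_upper2[where i = h]) auto
      also have "\<dots> \<le> ennreal (C * h powr \<alpha>)"
        using f h by (simp add: smooth_class_def S_def)
      also have "(\<lambda>x. sym_difference a b S (h * step_weight a b x) f x) = D"
        unfolding D_def by (intro ext sym_difference_cong) (simp add: g)
      finally have "(\<integral>\<^sup>+ x. ennreal ((D x)\<^sup>2) \<partial>interval_measure a b) \<le> ennreal ((C * h powr \<alpha>)\<^sup>2)"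
        by (rule L2norm_leD) (use C in simp)
      also have "(\<integral>\<^sup>+ x. ennreal ((D x)\<^sup>2) \<partial>interval_measure a b) = (\<integral>\<^sup>+ x. ennreal ((D x)\<^sup>2) * indicator {a..b} x \<partial>lborel)"
        by (rule nn_integral_restrict_space) simp
      also have "\<dots> = ennreal \<rho> * (\<integral>\<^sup>+ y. ennreal ((D (x0 + \<rho> * y))\<^sup>2) * indicator {-1..1} y \<partial>lborel)"
        unfolding x0_def \<rho>_def by (rule nn_integral_affine_interval[OF _ ab]) measurable
      also have "(\<lambda>y. D (x0 + \<rho> * y)) = (\<lambda>y. sym_difference (-1) 1 S (h * circle_weight y) F y)"
        unfolding D_def F_def x0_def \<rho>_def sym_difference_affine[OF ab] ..
      finally have le: "ennreal \<rho> * (\<integral>\<^sup>+ y. ennreal ((sym_difference (-1) 1 S (h * circle_weight y) F y)\<^sup>2) * indicator {-1..1} y \<partial>lborel)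
        \<le> ennreal ((C * h powr \<alpha>)\<^sup>2)" (is "ennreal \<rho> * ?J \<le> _") .
      have "?J = ennreal (1 / \<rho>) * (ennreal \<rho> * ?J)"
        using \<rho> by (simp add: mult.assoc[symmetric] flip: ennreal_mult)
      also have "\<dots> \<le> ennreal (1 / \<rho>) * ennreal ((C * h powr \<alpha>)\<^sup>2)" by (intro mult_left_mono le) simp
      also have "\<dots> = ennreal (1 / \<rho> * (C * h powr \<alpha>)\<^sup>2)" using \<rho> by (intro ennreal_mult[symmetric]) auto
      also have "1 / \<rho> * (C * h powr \<alpha>)\<^sup>2 = (C / sqrt \<rho> * h powr \<alpha>)\<^sup>2"
        using \<rho> by (simp add: power_mult_distrib power_divide)
      finally show "?J \<le> ennreal ((C / sqrt \<rho> * h powr \<alpha>)\<^sup>2)" .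
    qed
    then obtain p where p: "deg_less m p" "l2n (-1) 1 (\<lambda>x. F x - poly p x) \<le> K * (C / sqrt \<rho>) * real m powr - \<alpha>"
      by blast
    define q where "q = p \<circ>\<^sub>p [:- x0 / \<rho>, 1 / \<rho>:]"
    have q: "poly q (x0 + \<rho> * y) = poly p y" for y
      using \<rho> by (simp add: q_def poly_pcompose field_simps)
    have "l2n a b (\<lambda>x. f x - poly q x) \<le> l2n a b (\<lambda>x. g x - poly q x)"
      by (intro l2n_mono L2_diff fL gL poly_L2) (simp add: g)
    also have "\<dots> = sqrt \<rho> * l2n (-1) 1 (\<lambda>y. g (x0 + \<rho> * y) - poly q (x0 + \<rho> * y))"
      unfolding x0_def \<rho>_def
    proof (rule l2n_affine(2)[OF _ ab])
      have "poly q \<in> borel_measurable borel" by (intro borel_measurable_continuous_onI continuous_intros)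
      then show "(\<lambda>x. g x - poly q x) \<in> borel_measurable borel" by measurable
    qed (intro L2_diff gL poly_L2)
    also have "\<dots> = sqrt \<rho> * l2n (-1) 1 (\<lambda>y. F y - poly p y)" by (simp add: q F_def)
    also have "\<dots> \<le> sqrt \<rho> * (K * (C / sqrt \<rho>) * real m powr - \<alpha>)" using \<rho> by (intro mult_left_mono p) auto
    also have "\<dots> = K * C * real m powr - \<alpha>" using \<rho> by simp
    finally show ?thesis using deg_less_pcompose_linear[OF p(1)] by (auto simp: q_def)
  qed
  then show ?thesis using K by blast
qed

text \<open>A factor \<open>exp (- j)\<close> is split off to tame the power, and its inverse is
  absorbed into the base of the exponential series.\<close>

lemma powr_fact_bounded:
  fixes b \<alpha> :: real
  assumes "0 \<le> b"
  shows "\<exists>B\<ge>0. \<forall>j::nat. (2 * real j) powr \<alpha> * (b ^ j / fact j) \<le> B"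
proof -
  have "((\<lambda>x::real. (2 * x) powr \<alpha> * exp (- x)) \<longlongrightarrow> 0) at_top" by real_asymp
  from filterlim_compose[OF this filterlim_real_sequentially]
  have "(\<lambda>j. (2 * real j) powr \<alpha> * exp (- real j)) \<longlonglongrightarrow> 0" .
  moreover have "(\<lambda>j. (b * exp 1) ^ j / fact j) \<longlonglongrightarrow> 0"
    using summable_LIMSEQ_zero[OF summable_exp[of "b * exp 1"]] by (simp add: divide_inverse mult.commute)
  ultimately have "(\<lambda>j. ((2 * real j) powr \<alpha> * exp (- real j)) * ((b * exp 1) ^ j / fact j)) \<longlonglongrightarrow> 0"
    by (rule tendsto_mult_zero)
  moreover have "((2 * real j) powr \<alpha> * exp (- real j)) * ((b * exp 1) ^ j / fact j) = (2 * real j) powr \<alpha> * (b ^ j / fact j)" for j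
    by (simp add: power_mult_distrib exp_of_nat_mult[symmetric] exp_minus)
  ultimately have "(\<lambda>j. (2 * real j) powr \<alpha> * (b ^ j / fact j)) \<longlonglongrightarrow> 0" by (simp only:)
  then have "convergent (\<lambda>j. (2 * real j) powr \<alpha> * (b ^ j / fact j))" by (rule convergentI)
  then have "Bseq (\<lambda>j. (2 * real j) powr \<alpha> * (b ^ j / fact j))" by (rule convergent_imp_Bseq)
  then obtain B where "0 < B" "\<And>j. norm ((2 * real j) powr \<alpha> * (b ^ j / fact j)) \<le> B"
    by (auto simp: Bseq_def)
  then show ?thesis unfolding real_norm_def abs_le_iff by (intro exI[of _ B]) (auto intro: less_imp_le)
qed

text \<open>The degree is shared between Jackson's polynomial \<open>p\<close> and the Taylor
  polynomial \<open>E\<close> of the exponential. The factor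
  \<open>1 - exp (- \<theta>) E(\<theta>)\<close> is a Poisson tail, of size
  \<open>b^j / j!\<close>, negligible against every power of \<open>m\<close>.\<close>

lemma smooth_class_approximation:
  assumes a: "0 \<le> a" "a < b" and \<alpha>: "0 \<le> \<alpha>" and C: "0 < C"
  shows "\<exists>K N. 0 \<le> K \<and> (\<forall>f\<in>smooth_class a b \<alpha> C. \<forall>m\<ge>N.
    l2n a b (\<lambda>\<theta>. f \<theta> - span_projection a b m f \<theta>) \<le> K * real m powr - \<alpha>)"
proof -
  obtain K N where K: "0 \<le> K" and approx: "\<And>f m. f \<in> smooth_class a b \<alpha> C \<Longrightarrow> N \<le> m \<Longrightarrow>
      \<exists>p. deg_less m p \<and> l2n a b (\<lambda>x. f x - poly p x) \<le> K * C * real m powr - \<alpha>"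
    using jackson_interval[OF a(2) \<alpha>, of C] C by blast
  have b: "0 \<le> b" using a by simp
  obtain B where B: "0 \<le> B" "\<And>j::nat. (2 * real j) powr \<alpha> * (b ^ j / fact j) \<le> B"
    using powr_fact_bounded[OF b, of \<alpha>] by blast
  have "l2n a b (\<lambda>\<theta>. f \<theta> - span_projection a b m f \<theta>) \<le> (K * C * 3 powr \<alpha> + B * (C + K * C)) * real m powr - \<alpha>"
    if f: "f \<in> smooth_class a b \<alpha> C" and m: "2 * N + 2 \<le> m" for f m
  proof -
    have fL: "f \<in> L2 a b" using f by (simp add: smooth_class_def)
    have fC: "l2n a b f \<le> C" using f C L2norm_eq[OF fL] by (simp add: smooth_class_def)
    \<comment> \<open>Both shares are proportional to \<open>m\<close>: \<open>k \<ge> m / 3\<close>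
      costs the factor \<open>3 powr \<alpha>\<close>, and \<open>2 j \<ge> m\<close> makes the tail
      factorially small.\<close>
    define k where "k = m div 2"
    define j where "j = m - k"
    have "m \<le> 3 * k" using m unfolding k_def by presburger
    then have k: "N \<le> k" "real m / 3 \<le> real k" "1 \<le> k" using m by (auto simp: k_def)
    have j: "j + k = m" "real m \<le> 2 * real j" using m by (auto simp: j_def k_def)
    have m0: "0 < real m" using m by simp
    obtain p where p: "deg_less k p" "l2n a b (\<lambda>x. f x - poly p x) \<le> K * C * real k powr - \<alpha>"
      using approx[OF f k(1)] by blast
    define E where "E = (\<Sum>i<j. monom (1 / fact i :: real) i)"
    have E: "deg_less j E" by (auto simp: E_def deg_less_iff coeff_sum)
    define T where "T \<theta> = exp (- \<theta>) * poly E \<theta>" for \<theta>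
    have T: "T \<theta> = (\<Sum>i<j. poisson_mass i \<theta>)" for \<theta>
      by (simp add: T_def E_def poly_sum poly_monom sum_distrib_left poisson_mass_def)
    define g where "g \<theta> = exp (- \<theta>) * poly (E * p) \<theta>" for \<theta>
    have g: "g \<in> poisson_span m"
      unfolding poisson_span_iff_poly g_def using deg_less_mult[OF E p(1)] j(1) by auto
    note gL = poisson_span_L2[OF g, of a b]
    have T1: "\<bar>1 - T \<theta>\<bar> \<le> b ^ j / fact j" if \<theta>: "\<theta> \<in> {a..b}" for \<theta>
    proof -
      have "T \<theta> \<le> 1"
      proof -
        have "poly E \<theta> = (\<Sum>i<j. \<theta> ^ i /\<^sub>R fact i)"
          by (simp add: E_def poly_sum poly_monom divide_inverse mult.commute)
        also have "\<dots> \<le> exp \<theta>"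
          unfolding exp_def using \<theta> a by (intro sum_le_suminf summable_exp_generic) auto
        finally show ?thesis by (simp add: T_def exp_minus field_simps)
      qed
      moreover have "1 - \<theta> ^ j / fact j \<le> T \<theta>" unfolding T using \<theta> a by (intro poisson_partial_sum_ge) auto
      moreover have "\<theta> ^ j / fact j \<le> b ^ j / fact j" using \<theta> a by (intro divide_right_mono power_mono) auto
      ultimately show ?thesis by linarith
    qed
    define \<epsilon> where "\<epsilon> = b ^ j / fact j"
    have \<epsilon>: "0 \<le> \<epsilon>" using b by (simp add: \<epsilon>_def)
    have "\<epsilon> \<le> B * real m powr - \<alpha>"
    proof -
      have "real m powr \<alpha> * \<epsilon> \<le> (2 * real j) powr \<alpha> * \<epsilon>"
        using j \<alpha> m0 \<epsilon> by (intro mult_right_mono powr_mono2) auto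
      also have "\<dots> \<le> B" unfolding \<epsilon>_def by (rule B)
      finally show ?thesis using m0 by (simp add: powr_minus field_simps)
    qed
    have kp: "real k powr - \<alpha> \<le> 3 powr \<alpha> * real m powr - \<alpha>"
    proof -
      have "real k powr - \<alpha> \<le> (real m / 3) powr - \<alpha>" using k m0 \<alpha> by (intro powr_mono2') auto
      also have "\<dots> = 3 powr \<alpha> * real m powr - \<alpha>" using m0 by (simp add: powr_divide powr_minus field_simps)
      finally show ?thesis .
    qed
    have "l2n a b (poly p) \<le> C + K * C"
    proof -
      have "l2n a b (\<lambda>x. f x + (poly p x - f x)) \<le> l2n a b f + l2n a b (\<lambda>x. poly p x - f x)"
        by (intro l2n_triangle L2_diff fL poly_L2)
      also have "l2n a b (\<lambda>x. poly p x - f x) \<le> K * C * real k powr - \<alpha>" using p(2) by (simp add: l2n_minus_commute)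
      also have "\<dots> \<le> K * C * 1"
        using K C k \<alpha> by (intro mult_left_mono) (auto simp: powr_minus_divide ge_one_powr_ge_zero)
      finally show ?thesis using fC by simp
    qed
    then have "\<epsilon> * l2n a b (poly p) \<le> B * real m powr - \<alpha> * (C + K * C)"
      using \<open>\<epsilon> \<le> _\<close> \<epsilon> B K C by (intro mult_mono) auto
    moreover have "l2n a b (\<lambda>x. poly p x - g x) \<le> \<epsilon> * l2n a b (poly p)"
    proof -
      have "l2n a b (\<lambda>x. poly p x - g x) \<le> l2n a b (\<lambda>x. \<epsilon> * poly p x)"
      proof (intro l2n_mono L2_diff L2_cmult poly_L2 gL)
        fix x assume "x \<in> {a..b}"
        have "poly p x - g x = (1 - T x) * poly p x" by (simp add: g_def T_def algebra_simps)
        then have "\<bar>poly p x - g x\<bar> = \<bar>1 - T x\<bar> * \<bar>poly p x\<bar>" by (simp add: abs_mult)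
        also have "\<dots> \<le> \<epsilon> * \<bar>poly p x\<bar>" unfolding \<epsilon>_def by (intro mult_right_mono T1 abs_ge_zero \<open>x \<in> {a..b}\<close>)
        finally show "\<bar>poly p x - g x\<bar> \<le> \<bar>\<epsilon> * poly p x\<bar>" using \<epsilon> by (simp add: abs_mult)
      qed
      then show ?thesis using \<epsilon> by (simp add: l2n_cmult)
    qed
    moreover have "l2n a b (\<lambda>\<theta>. f \<theta> - span_projection a b m f \<theta>) \<le> l2n a b (\<lambda>x. f x - g x)"
      by (rule span_projection_best[OF a(2) fL g])
    moreover have "l2n a b (\<lambda>x. f x - g x) \<le> l2n a b (\<lambda>x. f x - poly p x) + l2n a b (\<lambda>x. poly p x - g x)"
      by (intro l2n_triangle_diff fL poly_L2 gL)
    moreover have "l2n a b (\<lambda>x. f x - poly p x) \<le> K * C * (3 powr \<alpha> * real m powr - \<alpha>)"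
      using p(2) mult_left_mono[OF kp, of "K * C"] K C by auto
    ultimately show ?thesis by (simp add: algebra_simps)
  qed
  moreover have "0 \<le> K * C * 3 powr \<alpha> + B * (C + K * C)" using K B C by simp
  ultimately show ?thesis by blast
qed

section \<open>Rates of convergence\<close>

text \<open>The variance is smaller than any power of \<open>log_ratio n\<close>, so the bias
  \<open>m^(- \<alpha>)\<close> alone sets the rate. A smaller \<tau> only changes the
  constant.\<close>

lemma smooth_class_upper:
  assumes a: "0 \<le> a" "a < b" and \<alpha>: "0 \<le> \<alpha>" and C: "0 < C" and \<tau>: "0 < \<tau>" "\<tau> \<le> 1"
  shows "achieves_MISE_rate a b (smooth_class a b \<alpha> C \<inter> L2_densities a b)
    (\<lambda>n. log_ratio n powr (- 2 * \<alpha>)) (\<lambda>n. projection_estimator a b (cutoff \<tau> n) n)"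
proof -
  obtain K where K: "K \<ge> 1" and risk: "\<And>m n f. f \<in> L2_densities a b \<Longrightarrow> 0 < n \<Longrightarrow>
       MISE a b n (projection_estimator a b m n) f
         \<le> ennreal (2 * (l2n a b (\<lambda>\<theta>. f \<theta> - span_projection a b m f \<theta>))\<^sup>2 + 2 * (K ^ m * fact m / real n))"
    using projection_risk[OF a] by metis
  obtain Q N where Q: "0 \<le> Q" and bias: "\<And>f m. f \<in> smooth_class a b \<alpha> C \<Longrightarrow> N \<le> m \<Longrightarrow>
      l2n a b (\<lambda>\<theta>. f \<theta> - span_projection a b m f \<theta>) \<le> Q * real m powr - \<alpha>"
    using smooth_class_approximation[OF a \<alpha> C] by blast
  define W where "W = 2 * Q\<^sup>2 * (\<tau> / 2) powr (- 2 * \<alpha>) + 2"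
  have "\<forall>\<^sub>F n in sequentially. (real N + 2) / \<tau> \<le> log_ratio n"
    using log_ratio_at_top unfolding filterlim_at_top by blast
  moreover have "\<forall>\<^sub>F n in sequentially. log_ratio n powr (2 * \<alpha>) * (K ^ cutoff \<tau> n * fact (cutoff \<tau> n) / real n) < 1"
    by (rule order_tendstoD(2)[OF cutoff_variance_vanishes[OF K \<tau>]]) simp
  ultimately have "\<forall>\<^sub>F n in sequentially. ennreal (inverse (log_ratio n powr (- 2 * \<alpha>))) *
      (SUP f\<in>smooth_class a b \<alpha> C \<inter> L2_densities a b. MISE a b n (projection_estimator a b (cutoff \<tau> n) n) f) \<le> ennreal W"
    using eventually_gt_at_top[of 0]
  proof eventually_elim
    case (elim n)
    define x where "x = log_ratio n"
    define m where "m = cutoff \<tau> n"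
    define V where "V = K ^ m * fact m / real n"
    have "real N + 2 \<le> \<tau> * x" using elim(1) \<tau> by (simp add: x_def field_simps)
    moreover have "\<tau> * x \<le> 1 + real m" unfolding x_def m_def by (rule cutoff_ge)
    \<comment> \<open>The 2 in the threshold pays for rounding twice: \<open>\<tau> x - 1\<close> is
      at least \<open>N\<close>, and also at least \<open>\<tau> x / 2\<close>.\<close>
    ultimately have m: "N \<le> m" "\<tau> * x / 2 \<le> real m" and tx: "0 < \<tau> * x" by linarith+
    have x: "0 < x" using tx \<tau> by (simp add: zero_less_mult_iff)
    have V: "0 \<le> V" "x powr (2 * \<alpha>) * V < 1" using K elim(2) by (simp_all add: V_def x_def m_def)
    have inv: "inverse (x powr (- 2 * \<alpha>)) = x powr (2 * \<alpha>)" by (simp add: powr_minus)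
    have *: "MISE a b n (projection_estimator a b m n) f \<le> ennreal (2 * Q\<^sup>2 * (\<tau> * x / 2) powr (- 2 * \<alpha>) + 2 * V)"
      if f: "f \<in> smooth_class a b \<alpha> C \<inter> L2_densities a b" for f
    proof -
      have "l2n a b (\<lambda>\<theta>. f \<theta> - span_projection a b m f \<theta>) \<le> Q * real m powr - \<alpha>" using f by (intro bias m) auto
      also have "\<dots> \<le> Q * (\<tau> * x / 2) powr - \<alpha>" using m tx \<alpha> Q by (intro mult_left_mono powr_mono2') auto
      finally have "(l2n a b (\<lambda>\<theta>. f \<theta> - span_projection a b m f \<theta>))\<^sup>2 \<le> (Q * (\<tau> * x / 2) powr - \<alpha>)\<^sup>2"
        by (intro power_mono) auto
      also have "\<dots> = Q\<^sup>2 * (\<tau> * x / 2) powr (- 2 * \<alpha>)"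
        by (simp add: power_mult_distrib power2_eq_square[of "_ powr _"] powr_add[symmetric])
      finally have "2 * (l2n a b (\<lambda>\<theta>. f \<theta> - span_projection a b m f \<theta>))\<^sup>2 + 2 * V
          \<le> 2 * Q\<^sup>2 * (\<tau> * x / 2) powr (- 2 * \<alpha>) + 2 * V" by simp
      from order_trans[OF risk ennreal_leI[OF this[unfolded V_def]]] show ?thesis
        using f elim(3) by (simp add: V_def)
    qed
    have "ennreal (x powr (2 * \<alpha>)) * (SUP f\<in>smooth_class a b \<alpha> C \<inter> L2_densities a b. MISE a b n (projection_estimator a b m n) f)
        \<le> ennreal (x powr (2 * \<alpha>)) * ennreal (2 * Q\<^sup>2 * (\<tau> * x / 2) powr (- 2 * \<alpha>) + 2 * V)"
      by (intro mult_left_mono SUP_least *) auto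
    also have "\<dots> = ennreal (x powr (2 * \<alpha>) * (2 * Q\<^sup>2 * (\<tau> * x / 2) powr (- 2 * \<alpha>) + 2 * V))"
      using V by (intro ennreal_mult[symmetric]) auto
    also have "\<dots> \<le> ennreal W"
    proof (rule ennreal_leI)
      have "(\<tau> * x / 2) powr (- 2 * \<alpha>) = (\<tau> / 2) powr (- 2 * \<alpha>) * x powr (- 2 * \<alpha>)"
        using x \<tau> powr_mult[of "\<tau> / 2" x "- 2 * \<alpha>"] by simp
      moreover have "x powr (2 * \<alpha>) * x powr (- 2 * \<alpha>) = 1" using x by (simp flip: powr_add)
      ultimately have "x powr (2 * \<alpha>) * (\<tau> * x / 2) powr (- 2 * \<alpha>) = (\<tau> / 2) powr (- 2 * \<alpha>)" by simp
      then have "x powr (2 * \<alpha>) * (2 * Q\<^sup>2 * (\<tau> * x / 2) powr (- 2 * \<alpha>) + 2 * V)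
          = 2 * Q\<^sup>2 * (\<tau> / 2) powr (- 2 * \<alpha>) + 2 * (x powr (2 * \<alpha>) * V)"
        by (simp only: distrib_left mult.left_commute[of "x powr (2 * \<alpha>)"])
      then show "x powr (2 * \<alpha>) * (2 * Q\<^sup>2 * (\<tau> * x / 2) powr (- 2 * \<alpha>) + 2 * V) \<le> W" using V by (simp add: W_def)
    qed
    finally show ?case unfolding x_def[symmetric] m_def[symmetric] inv .
  qed
  then have "limsup (\<lambda>n. ennreal (inverse (log_ratio n powr (- 2 * \<alpha>))) *
      (SUP f\<in>smooth_class a b \<alpha> C \<inter> L2_densities a b. MISE a b n (projection_estimator a b (cutoff \<tau> n) n) f)) \<le> ennreal W"
    by (rule Limsup_bounded)
  then show ?thesis unfolding achieves_MISE_rate_def by (rule le_less_trans) simp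
qed

lemma smooth_class_rate:
  assumes a: "0 \<le> a" "a < b" and \<alpha>: "1 \<le> \<alpha>" and C: "1 / sqrt (b - a) < C"
  shows "is_minimax_MISE_rate a b (smooth_class a b \<alpha> C \<inter> L2_densities a b) (\<lambda>n. log_ratio n powr (- 2 * \<alpha>))"
  unfolding is_minimax_MISE_rate_def
proof
  show "0 < liminf (\<lambda>n. ennreal (inverse (log_ratio n powr (- 2 * \<alpha>))) *
      (INF g\<in>estimators a b n. SUP f\<in>smooth_class a b \<alpha> C \<inter> L2_densities a b. MISE a b n g f))"
    by (rule smooth_class_lower[OF a \<alpha> C])
  have "0 < 1 / sqrt (b - a)" using a by simp
  then have C0: "0 < C" using C by linarith
  have "limsup (\<lambda>n. ennreal (inverse (log_ratio n powr (- 2 * \<alpha>))) *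
      (INF g\<in>estimators a b n. SUP f\<in>smooth_class a b \<alpha> C \<inter> L2_densities a b. MISE a b n g f))
    \<le> limsup (\<lambda>n. ennreal (inverse (log_ratio n powr (- 2 * \<alpha>))) *
      (SUP f\<in>smooth_class a b \<alpha> C \<inter> L2_densities a b. MISE a b n (projection_estimator a b (cutoff 1 n) n) f))"
    by (intro Limsup_mono always_eventually allI mult_left_mono INF_lower projection_estimator_estimator a) auto
  also have "\<dots> < \<infinity>"
    using smooth_class_upper[OF a _ C0, of \<alpha> 1] \<alpha> by (simp add: achieves_MISE_rate_def)
  finally show "limsup (\<lambda>n. ennreal (inverse (log_ratio n powr (- 2 * \<alpha>))) *
      (INF g\<in>estimators a b n. SUP f\<in>smooth_class a b \<alpha> C \<inter> L2_densities a b. MISE a b n g f)) < \<infinity>" .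
qed

theorem corollary2:
  fixes a b \<alpha> :: real
  assumes "0 \<le> a" and "a < b" and "1 \<le> \<alpha>"
  shows
    "(\<forall>C > 1 / sqrt (b - a).
        is_minimax_MISE_rate a b (smooth_class a b \<alpha> C \<inter> L2_densities a b)
          (\<lambda>n. log_ratio n powr (- 2 * \<alpha>))
      \<and> (\<forall>\<tau>::real. 0 < \<tau> \<and> \<tau> \<le> 1 \<longrightarrow>
           achieves_MISE_rate a b (smooth_class a b \<alpha> C \<inter> L2_densities a b)
             (\<lambda>n. log_ratio n powr (- 2 * \<alpha>))
             (\<lambda>n. projection_estimator a b (cutoff \<tau> n) n)))
   \<and> (1 < \<alpha> \<longrightarrow>
        (\<forall>C > 0. \<forall>r::nat. 0 < r \<longrightarrow>
           limsup (\<lambda>n. ennreal (log_ratio n powr \<alpha>) *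
             (SUP f \<in> approx_class a b (power_seq \<alpha>) C r \<inter> L2_densities a b.
                mean_error a b n (projection_estimator a b (cutoff 1 n) n) f)) = ennreal C
         \<and> liminf (\<lambda>n. ennreal (log_ratio n powr \<alpha>) *
             (INF g \<in> estimators a b n.
                SUP f \<in> approx_class a b (power_seq \<alpha>) C r \<inter> L2_densities a b.
                  mean_error a b n g f)) = ennreal C))"
proof (intro conjI allI impI)
  fix C :: real assume C: "C > 1 / sqrt (b - a)"
  show "is_minimax_MISE_rate a b (smooth_class a b \<alpha> C \<inter> L2_densities a b) (\<lambda>n. log_ratio n powr (- 2 * \<alpha>))"
    by (rule smooth_class_rate[OF assms C])
  have "0 < 1 / sqrt (b - a)" using assms by simp
  then have C0: "0 < C" using C by linarith
  fix \<tau> :: real assume "0 < \<tau> \<and> \<tau> \<le> 1"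
  then show "achieves_MISE_rate a b (smooth_class a b \<alpha> C \<inter> L2_densities a b)
      (\<lambda>n. log_ratio n powr (- 2 * \<alpha>)) (\<lambda>n. projection_estimator a b (cutoff \<tau> n) n)"
    using assms by (intro smooth_class_upper C0) auto
qed (rule approx_class_efficient[OF assms(1,2)], assumption+)+

end
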